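(* Let $T$ be a theory in a (possibly many-sorted) first-order language $L$. Assume that $T$ admits elimination of imaginaries, and that every sort of $L$ has an element which is $0$-definable in $T$. Then the theory $T_{atomless}$ admits weak elimination of imaginaries.
   Context: Conventions: by adding sorts one assumes every finite product of sorts of $L$ is in $0$-definable bijection with a sort. $L^{boole}$ is the language with the sorts of $L$ together with a new sort $B$ carrying the Boolean algebra operations and equality, and for every $L$-formula $\phi(x_1,\dots,x_n)$ a function symbol $[\phi]$ from the corresponding product of sorts into $B$. $T^{boole}$ is the $L^{boole}$-theory with axioms: (1) $B$ is a Boolean algebra; (2) if $T\models\forall x\,\phi(x)$ then $[\phi](a)=1$ for all $a$; (3) for each tuple $a$, $\phi\mapsto[\phi](a)$ is a Boolean homomorphism, and $[\cdot]$ respects dummy variables; (4) whenever $T\vdash\forall y(\psi_i(y)\to\exists x\,\phi_i(x,y))$ for $i=1,\dots,n$, then for all pairwise disjoint $b_1,\dots,b_n\in B$ and all $y$ with $[\psi_i](y)\ge b_i$ for all $i$, there is $x$ with $[\phi_i](x,y)\ge b_i$ for all $i$. $T_{atomless}$ is $T^{boole}$ together with the axiom that $B$ is atomless. EI: every imaginary is interdefinable with a real tuple. Weak EI: for every imaginary $e$ of any model there are real tuples $e_1,\dots,e_k\in\mathrm{acl}(e)$ with $e\in\mathrm{dcl}(e_1,\dots,e_k)$. *)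

theory Defs
  imports Main
begin

section \<open>Many-sorted first-order logic\<close>

text \<open>A variable carries its sort, so formulas are sorted without reference to a context.\<close>

type_synonym 's var = "'s \<times> nat"

datatype ('s, 'f) tm = Var "'s var" | Fn 'f "('s, 'f) tm list"

datatype ('s, 'f, 'r) fm =
    Bot
  | Eq "('s, 'f) tm" "('s, 'f) tm"
  | Rel 'r "('s, 'f) tm list"
  | Neg "('s, 'f, 'r) fm"
  | Conj "('s, 'f, 'r) fm" "('s, 'f, 'r) fm"
  | Exists "'s var" "('s, 'f, 'r) fm"

definition "Imp \<phi> \<psi> = Neg (Conj \<phi> (Neg \<psi>))"
definition "Iff \<phi> \<psi> = Conj (Imp \<phi> \<psi>) (Imp \<psi> \<phi>)"
definition "Forall x \<phi> = Neg (Exists x (Neg \<phi>))"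
definition "Exs xs \<phi> = foldr Exists xs \<phi>"
definition "Alls xs \<phi> = foldr Forall xs \<phi>"
definition "Conjs \<phi>s = foldr Conj \<phi>s (Neg Bot)"

record ('s, 'f, 'r) lang =
  sorts :: "'s set"
  funs :: "'f set"
  rels :: "'r set"
  fargs :: "'f \<Rightarrow> 's list"
  fres :: "'f \<Rightarrow> 's"
  rargs :: "'r \<Rightarrow> 's list"

definition wf_lang :: "('s, 'f, 'r) lang \<Rightarrow> bool" where
  "wf_lang L \<longleftrightarrow>
     (\<forall>f \<in> funs L. set (fargs L f) \<subseteq> sorts L \<and> fres L f \<in> sorts L) \<and>
     (\<forall>r \<in> rels L. set (rargs L r) \<subseteq> sorts L)"

fun has_sort :: "('s, 'f, 'r) lang \<Rightarrow> ('s, 'f) tm \<Rightarrow> 's \<Rightarrow> bool" where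
  "has_sort L (Var x) s \<longleftrightarrow> fst x = s \<and> s \<in> sorts L"
| "has_sort L (Fn f ts) s \<longleftrightarrow> f \<in> funs L \<and> fres L f = s \<and> list_all2 (has_sort L) ts (fargs L f)"

primrec wf_fm :: "('s, 'f, 'r) lang \<Rightarrow> ('s, 'f, 'r) fm \<Rightarrow> bool" where
  "wf_fm L Bot \<longleftrightarrow> True"
| "wf_fm L (Eq t u) \<longleftrightarrow> (\<exists>s. has_sort L t s \<and> has_sort L u s)"
| "wf_fm L (Rel r ts) \<longleftrightarrow> r \<in> rels L \<and> list_all2 (has_sort L) ts (rargs L r)"
| "wf_fm L (Neg \<phi>) \<longleftrightarrow> wf_fm L \<phi>"
| "wf_fm L (Conj \<phi> \<psi>) \<longleftrightarrow> wf_fm L \<phi> \<and> wf_fm L \<psi>"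
| "wf_fm L (Exists x \<phi>) \<longleftrightarrow> fst x \<in> sorts L \<and> wf_fm L \<phi>"

primrec fv_tm :: "('s, 'f) tm \<Rightarrow> 's var set" where
  "fv_tm (Var x) = {x}"
| "fv_tm (Fn f ts) = \<Union> (set (map fv_tm ts))"

primrec fv :: "('s, 'f, 'r) fm \<Rightarrow> 's var set" where
  "fv Bot = {}"
| "fv (Eq t u) = fv_tm t \<union> fv_tm u"
| "fv (Rel r ts) = \<Union> (set (map fv_tm ts))"
| "fv (Neg \<phi>) = fv \<phi>"
| "fv (Conj \<phi> \<psi>) = fv \<phi> \<union> fv \<psi>"
| "fv (Exists x \<phi>) = fv \<phi> - {x}"

text \<open>\<open>fm_in L xs \<phi>\<close> is the usual convention of writing an \<open>L\<close>-formula as \<open>\<phi>(x\<^sub>1,\<dots>,x\<^sub>n)\<close>: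
  the tuple may contain dummy variables.\<close>

definition fm_in :: "('s, 'f, 'r) lang \<Rightarrow> 's var list \<Rightarrow> ('s, 'f, 'r) fm \<Rightarrow> bool" where
  "fm_in L xs \<phi> \<longleftrightarrow> wf_fm L \<phi> \<and> distinct xs \<and> fst ` set xs \<subseteq> sorts L \<and> fv \<phi> \<subseteq> set xs"

definition theory_in :: "('s, 'f, 'r) lang \<Rightarrow> ('s, 'f, 'r) fm set \<Rightarrow> bool" where
  "theory_in L T \<longleftrightarrow> (\<forall>\<phi> \<in> T. fm_in L [] \<phi>)"

text \<open>The carriers of distinct sorts may overlap. This is harmless, since variables, equations
  and elements (see \<open>elems\<close>) are always tagged with their sort.\<close>

record ('s, 'f, 'r, 'm) struct =
  univ :: "'s \<Rightarrow> 'm set"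
  fint :: "'f \<Rightarrow> 'm list \<Rightarrow> 'm"
  rint :: "'r \<Rightarrow> 'm list \<Rightarrow> bool"

definition tuples :: "('s, 'f, 'r, 'm) struct \<Rightarrow> 's list \<Rightarrow> 'm list set" where
  "tuples M ss = listset (map (univ M) ss)"

definition is_struct :: "('s, 'f, 'r) lang \<Rightarrow> ('s, 'f, 'r, 'm) struct \<Rightarrow> bool" where
  "is_struct L M \<longleftrightarrow>
     (\<forall>s \<in> sorts L. univ M s \<noteq> {}) \<and>
     (\<forall>f \<in> funs L. \<forall>as \<in> tuples M (fargs L f). fint M f as \<in> univ M (fres L f))"

primrec eval_tm :: "('s, 'f, 'r, 'm) struct \<Rightarrow> ('s var \<Rightarrow> 'm) \<Rightarrow> ('s, 'f) tm \<Rightarrow> 'm" where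
  "eval_tm M v (Var x) = v x"
| "eval_tm M v (Fn f ts) = fint M f (map (eval_tm M v) ts)"

primrec sat :: "('s, 'f, 'r, 'm) struct \<Rightarrow> ('s var \<Rightarrow> 'm) \<Rightarrow> ('s, 'f, 'r) fm \<Rightarrow> bool" where
  "sat M v Bot \<longleftrightarrow> False"
| "sat M v (Eq t u) \<longleftrightarrow> eval_tm M v t = eval_tm M v u"
| "sat M v (Rel r ts) \<longleftrightarrow> rint M r (map (eval_tm M v) ts)"
| "sat M v (Neg \<phi>) \<longleftrightarrow> \<not> sat M v \<phi>"
| "sat M v (Conj \<phi> \<psi>) \<longleftrightarrow> sat M v \<phi> \<and> sat M v \<psi>"
| "sat M v (Exists x \<phi>) \<longleftrightarrow> (\<exists>a \<in> univ M (fst x). sat M (v(x := a)) \<phi>)"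

text \<open>\<open>holds M xs \<phi> as\<close> means \<open>M \<Turnstile> \<phi>(as)\<close>, for \<open>\<phi> = \<phi>(xs)\<close>.\<close>

definition holds ::
  "('s, 'f, 'r, 'm) struct \<Rightarrow> 's var list \<Rightarrow> ('s, 'f, 'r) fm \<Rightarrow> 'm list \<Rightarrow> bool" where
  "holds M xs \<phi> as \<longleftrightarrow> sat M (\<lambda>x. the (map_of (zip xs as) x)) \<phi>"

definition is_model ::
  "('s, 'f, 'r) lang \<Rightarrow> ('s, 'f, 'r) fm set \<Rightarrow> ('s, 'f, 'r, 'm) struct \<Rightarrow> bool" where
  "is_model L T M \<longleftrightarrow> is_struct L M \<and> (\<forall>\<phi> \<in> T. holds M [] \<phi> [])"

text \<open>HOL cannot quantify over types inside a formula, so the notions that refer to all models of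
  a theory take the type of the elements of these models as a parameter. By the downward
  Loewenheim-Skolem theorem they do not depend on it, as long as the type is at least as large as
  the set of formulas.\<close>

definition entails ::
  "'u itself \<Rightarrow> ('s, 'f, 'r) lang \<Rightarrow> ('s, 'f, 'r) fm set \<Rightarrow> ('s, 'f, 'r) fm \<Rightarrow> bool" where
  "entails _ L T \<phi> \<longleftrightarrow> (\<forall>M :: ('s, 'f, 'r, 'u) struct. is_model L T M \<longrightarrow> holds M [] \<phi> [])"

definition sort_has_definable_element ::
  "'u itself \<Rightarrow> ('s, 'f, 'r) lang \<Rightarrow> ('s, 'f, 'r) fm set \<Rightarrow> 's \<Rightarrow> bool" where
  "sort_has_definable_element _ L T s \<longleftrightarrow>
     (\<exists>x \<phi>. fst x = s \<and> fm_in L [x] \<phi> \<and>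
        (\<forall>M :: ('s, 'f, 'r, 'u) struct. is_model L T M \<longrightarrow>
           (\<exists>!a. a \<in> univ M s \<and> holds M [x] \<phi> [a])))"

section \<open>Definable and algebraic closure\<close>

definition elems :: "('s, 'f, 'r) lang \<Rightarrow> ('s, 'f, 'r, 'm) struct \<Rightarrow> ('s \<times> 'm) set" where
  "elems L M = {(s, a). s \<in> sorts L \<and> a \<in> univ M s}"

text \<open>The subsets of the sort \<open>s\<close> that are definable over the set \<open>A\<close> of elements.\<close>

definition definable_over ::
  "('s, 'f, 'r) lang \<Rightarrow> ('s, 'f, 'r, 'm) struct \<Rightarrow> ('s \<times> 'm) set \<Rightarrow> 's \<Rightarrow> 'm set \<Rightarrow> bool" where
  "definable_over L M A s D \<longleftrightarrow>
     (\<exists>x ys \<phi> bs. fst x = s \<and> fm_in L (x # ys) \<phi> \<and>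
        length bs = length ys \<and> set (zip (map fst ys) bs) \<subseteq> A \<and>
        D = {a \<in> univ M s. holds M (x # ys) \<phi> (a # bs)})"

definition dcl ::
  "('s, 'f, 'r) lang \<Rightarrow> ('s, 'f, 'r, 'm) struct \<Rightarrow> ('s \<times> 'm) set \<Rightarrow> ('s \<times> 'm) set" where
  "dcl L M A = {(s, a) \<in> elems L M. definable_over L M A s {a}}"

definition acl ::
  "('s, 'f, 'r) lang \<Rightarrow> ('s, 'f, 'r, 'm) struct \<Rightarrow> ('s \<times> 'm) set \<Rightarrow> ('s \<times> 'm) set" where
  "acl L M A = {(s, a) \<in> elems L M. \<exists>D. definable_over L M A s D \<and> finite D \<and> a \<in> D}"

section \<open>Imaginaries\<close>

text \<open>\<open>Imag xs ys E\<close> is the sort of the classes of the equivalence relation defined by \<open>E(xs, ys)\<close>,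
  where \<open>xs\<close> and \<open>ys\<close> are disjoint tuples of variables of the same sorts. \<open>Proj xs ys E\<close> is the
  projection to that sort. These sorts are formed for each model separately. Compared with the
  formulas that define an equivalence relation in all models of a theory this gives no new
  imaginaries: replace \<open>E(x, y)\<close> by "\<open>E\<close> is an equivalence relation and \<open>E(x, y)\<close>, or it is not and
  \<open>x = y\<close>".\<close>

datatype ('s, 'f, 'r) eq_sort = Real 's | Imag "'s var list" "'s var list" "('s, 'f, 'r) fm"

datatype ('s, 'f, 'r) eq_fun = RealF 'f | Proj "'s var list" "'s var list" "('s, 'f, 'r) fm"

definition eqrel ::
  "('s, 'f, 'r, 'm) struct \<Rightarrow> 's var list \<Rightarrow> 's var list \<Rightarrow> ('s, 'f, 'r) fm \<Rightarrow> 'm list rel" where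
  "eqrel M xs ys E = {(as, bs). as \<in> tuples M (map fst xs) \<and> bs \<in> tuples M (map fst ys) \<and>
                                holds M (xs @ ys) E (as @ bs)}"

definition defines_equiv ::
  "('s, 'f, 'r) lang \<Rightarrow> ('s, 'f, 'r, 'm) struct \<Rightarrow>
     's var list \<Rightarrow> 's var list \<Rightarrow> ('s, 'f, 'r) fm \<Rightarrow> bool" where
  "defines_equiv L M xs ys E \<longleftrightarrow>
     map fst xs = map fst ys \<and> fm_in L (xs @ ys) E \<and>
     equiv (tuples M (map fst xs)) (eqrel M xs ys E)"

fun eq_fargs :: "('s, 'f, 'r) lang \<Rightarrow> ('s, 'f, 'r) eq_fun \<Rightarrow> ('s, 'f, 'r) eq_sort list" where
  "eq_fargs L (RealF f) = map Real (fargs L f)"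
| "eq_fargs L (Proj xs ys E) = map (\<lambda>x. Real (fst x)) xs"

fun eq_fres :: "('s, 'f, 'r) lang \<Rightarrow> ('s, 'f, 'r) eq_fun \<Rightarrow> ('s, 'f, 'r) eq_sort" where
  "eq_fres L (RealF f) = Real (fres L f)"
| "eq_fres L (Proj xs ys E) = Imag xs ys E"

definition eq_lang ::
  "('s, 'f, 'r) lang \<Rightarrow> ('s, 'f, 'r, 'm) struct \<Rightarrow>
     (('s, 'f, 'r) eq_sort, ('s, 'f, 'r) eq_fun, 'r) lang" where
  "eq_lang L M = \<lparr>
     sorts = Real ` sorts L \<union> {Imag xs ys E | xs ys E. defines_equiv L M xs ys E},
     funs = RealF ` funs L \<union> {Proj xs ys E | xs ys E. defines_equiv L M xs ys E},
     rels = rels L,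
     fargs = eq_fargs L,
     fres = eq_fres L,
     rargs = (\<lambda>r. map Real (rargs L r))\<rparr>"

fun eq_univ :: "('s, 'f, 'r, 'm) struct \<Rightarrow> ('s, 'f, 'r) eq_sort \<Rightarrow> ('m + 'm list set) set" where
  "eq_univ M (Real s) = Inl ` univ M s"
| "eq_univ M (Imag xs ys E) = Inr ` (tuples M (map fst xs) // eqrel M xs ys E)"

fun eq_fint ::
  "('s, 'f, 'r, 'm) struct \<Rightarrow> ('s, 'f, 'r) eq_fun \<Rightarrow> ('m + 'm list set) list \<Rightarrow> 'm + 'm list set"
where
  "eq_fint M (RealF f) as = Inl (fint M f (map projl as))"
| "eq_fint M (Proj xs ys E) as = Inr (eqrel M xs ys E `` {map projl as})"

text \<open>\<open>eq_lang L M\<close> and \<open>eq_struct M\<close> are \<open>L\<^sup>e\<^sup>q\<close> and \<open>M\<^sup>e\<^sup>q\<close>.\<close>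

definition eq_struct ::
  "('s, 'f, 'r, 'm) struct \<Rightarrow>
     (('s, 'f, 'r) eq_sort, ('s, 'f, 'r) eq_fun, 'r, 'm + 'm list set) struct" where
  "eq_struct M = \<lparr>
     univ = eq_univ M,
     fint = eq_fint M,
     rint = (\<lambda>r as. rint M r (map projl as))\<rparr>"

definition imaginaries ::
  "('s, 'f, 'r) lang \<Rightarrow> ('s, 'f, 'r, 'm) struct \<Rightarrow>
     (('s, 'f, 'r) eq_sort \<times> ('m + 'm list set)) set" where
  "imaginaries L M = elems (eq_lang L M) (eq_struct M)"

definition reals ::
  "('s, 'f, 'r) lang \<Rightarrow> ('s, 'f, 'r, 'm) struct \<Rightarrow>
     (('s, 'f, 'r) eq_sort \<times> ('m + 'm list set)) set" where
  "reals L M = {(Real s, Inl a) | s a. (s, a) \<in> elems L M}"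

abbreviation dcl_eq where "dcl_eq L M \<equiv> dcl (eq_lang L M) (eq_struct M)"
abbreviation acl_eq where "acl_eq L M \<equiv> acl (eq_lang L M) (eq_struct M)"

definition elim_imaginaries ::
  "'u itself \<Rightarrow> ('s, 'f, 'r) lang \<Rightarrow> ('s, 'f, 'r) fm set \<Rightarrow> bool" where
  "elim_imaginaries _ L T \<longleftrightarrow>
     (\<forall>M :: ('s, 'f, 'r, 'u) struct. is_model L T M \<longrightarrow>
        (\<forall>e \<in> imaginaries L M. \<exists>d. set d \<subseteq> reals L M \<and>
           e \<in> dcl_eq L M (set d) \<and> set d \<subseteq> dcl_eq L M {e}))"

text \<open>A tuple lies in the algebraic closure iff all its entries do.\<close>

definition weak_elim_imaginaries ::
  "'u itself \<Rightarrow> ('s, 'f, 'r) lang \<Rightarrow> ('s, 'f, 'r) fm set \<Rightarrow> bool" where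
  "weak_elim_imaginaries _ L T \<longleftrightarrow>
     (\<forall>M :: ('s, 'f, 'r, 'u) struct. is_model L T M \<longrightarrow>
        (\<forall>e \<in> imaginaries L M. \<exists>ds.
           (\<forall>d \<in> set ds. set d \<subseteq> reals L M \<and> set d \<subseteq> acl_eq L M {e}) \<and>
           e \<in> dcl_eq L M (\<Union>d \<in> set ds. set d)))"

section \<open>The Boolean-valued theory\<close>

datatype 's bsort = LSort 's | BSort

text \<open>\<open>Val xs \<phi>\<close> is the function symbol \<open>[\<phi>]\<close> for the formula \<open>\<phi>(xs)\<close>.\<close>

datatype ('s, 'f, 'r) bfun =
    Zero | One | Meet | Join | Compl | Val "'s var list" "('s, 'f, 'r) fm"

type_synonym ('s, 'f, 'r) btm = "('s bsort, ('s, 'f, 'r) bfun) tm"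
type_synonym ('s, 'f, 'r) bfm = "('s bsort, ('s, 'f, 'r) bfun, unit) fm"

fun boole_fargs :: "('s, 'f, 'r) bfun \<Rightarrow> 's bsort list" where
  "boole_fargs Zero = []"
| "boole_fargs One = []"
| "boole_fargs Meet = [BSort, BSort]"
| "boole_fargs Join = [BSort, BSort]"
| "boole_fargs Compl = [BSort]"
| "boole_fargs (Val xs \<phi>) = map (\<lambda>x. LSort (fst x)) xs"

definition boole_lang ::
  "('s, 'f, 'r) lang \<Rightarrow> ('s bsort, ('s, 'f, 'r) bfun, unit) lang" where
  "boole_lang L = \<lparr>
     sorts = insert BSort (LSort ` sorts L),
     funs = {Zero, One, Meet, Join, Compl} \<union> {Val xs \<phi> | xs \<phi>. fm_in L xs \<phi>},
     rels = {},
     fargs = boole_fargs,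
     fres = (\<lambda>_. BSort),
     rargs = (\<lambda>_. [])\<rparr>"

definition lvar :: "'s var \<Rightarrow> 's bsort var" where "lvar x = (LSort (fst x), snd x)"
definition bvar :: "nat \<Rightarrow> 's bsort var" where "bvar i = (BSort, i)"

definition bv :: "nat \<Rightarrow> ('s, 'f, 'r) btm" where "bv i = Var (bvar i)"

definition bzero :: "('s, 'f, 'r) btm" where "bzero = Fn Zero []"
definition bone :: "('s, 'f, 'r) btm" where "bone = Fn One []"
definition bmeet :: "('s, 'f, 'r) btm \<Rightarrow> ('s, 'f, 'r) btm \<Rightarrow> ('s, 'f, 'r) btm" where
  "bmeet t u = Fn Meet [t, u]"
definition bjoin :: "('s, 'f, 'r) btm \<Rightarrow> ('s, 'f, 'r) btm \<Rightarrow> ('s, 'f, 'r) btm" where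
  "bjoin t u = Fn Join [t, u]"
definition bcompl :: "('s, 'f, 'r) btm \<Rightarrow> ('s, 'f, 'r) btm" where
  "bcompl t = Fn Compl [t]"
definition ble :: "('s, 'f, 'r) btm \<Rightarrow> ('s, 'f, 'r) btm \<Rightarrow> ('s, 'f, 'r) bfm" where
  "ble t u = Eq (bmeet t u) t"

text \<open>The term \<open>[\<phi>](xs)\<close>.\<close>

definition bval :: "'s var list \<Rightarrow> ('s, 'f, 'r) fm \<Rightarrow> ('s, 'f, 'r) btm" where
  "bval xs \<phi> = Fn (Val xs \<phi>) (map (\<lambda>x. Var (lvar x)) xs)"

abbreviation LAlls :: "'s var list \<Rightarrow> ('s, 'f, 'r) bfm \<Rightarrow> ('s, 'f, 'r) bfm" where
  "LAlls xs \<equiv> Alls (map lvar xs)"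
abbreviation LExs :: "'s var list \<Rightarrow> ('s, 'f, 'r) bfm \<Rightarrow> ('s, 'f, 'r) bfm" where
  "LExs xs \<equiv> Exs (map lvar xs)"
abbreviation BAlls :: "nat list \<Rightarrow> ('s, 'f, 'r) bfm \<Rightarrow> ('s, 'f, 'r) bfm" where
  "BAlls is \<equiv> Alls (map bvar is)"

definition boolean_algebra_axioms :: "('s, 'f, 'r) bfm set" where
  "boolean_algebra_axioms = {
     BAlls [0,1,2] (Eq (bmeet (bmeet (bv 0) (bv 1)) (bv 2)) (bmeet (bv 0) (bmeet (bv 1) (bv 2)))),
     BAlls [0,1,2] (Eq (bjoin (bjoin (bv 0) (bv 1)) (bv 2)) (bjoin (bv 0) (bjoin (bv 1) (bv 2)))),
     BAlls [0,1] (Eq (bmeet (bv 0) (bv 1)) (bmeet (bv 1) (bv 0))),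
     BAlls [0,1] (Eq (bjoin (bv 0) (bv 1)) (bjoin (bv 1) (bv 0))),
     BAlls [0,1,2] (Eq (bmeet (bv 0) (bjoin (bv 1) (bv 2)))
                       (bjoin (bmeet (bv 0) (bv 1)) (bmeet (bv 0) (bv 2)))),
     BAlls [0,1,2] (Eq (bjoin (bv 0) (bmeet (bv 1) (bv 2)))
                       (bmeet (bjoin (bv 0) (bv 1)) (bjoin (bv 0) (bv 2)))),
     BAlls [0] (Eq (bmeet (bv 0) bone) (bv 0)),
     BAlls [0] (Eq (bjoin (bv 0) bzero) (bv 0)),
     BAlls [0] (Eq (bmeet (bv 0) (bcompl (bv 0))) bzero),
     BAlls [0] (Eq (bjoin (bv 0) (bcompl (bv 0))) bone)}"

definition validity_axioms ::
  "'u itself \<Rightarrow> ('s, 'f, 'r) lang \<Rightarrow> ('s, 'f, 'r) fm set \<Rightarrow> ('s, 'f, 'r) bfm set" where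
  "validity_axioms U L T =
     {LAlls xs (Eq (bval xs \<phi>) bone) | xs \<phi>. fm_in L xs \<phi> \<and> entails U L T (Alls xs \<phi>)}"

text \<open>The last family says that \<open>[\<phi>]\<close> only depends on the values of the variables free in \<open>\<phi>\<close>, and
  not on the tuple \<open>xs\<close> of which \<open>\<phi>\<close> is regarded as a formula.\<close>

definition homomorphism_axioms :: "('s, 'f, 'r) lang \<Rightarrow> ('s, 'f, 'r) bfm set" where
  "homomorphism_axioms L =
     {LAlls xs (Eq (bval xs Bot) bzero) | xs. fm_in L xs Bot} \<union>
     {LAlls xs (Eq (bval xs (Neg \<phi>)) (bcompl (bval xs \<phi>))) | xs \<phi>. fm_in L xs \<phi>} \<union>
     {LAlls xs (Eq (bval xs (Conj \<phi> \<psi>)) (bmeet (bval xs \<phi>) (bval xs \<psi>)))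
        | xs \<phi> \<psi>. fm_in L xs \<phi> \<and> fm_in L xs \<psi>} \<union>
     {LAlls (xs @ ys) (Eq (bval xs \<phi>) (bval ys \<phi>)) | xs ys \<phi>. fm_in L xs \<phi> \<and> fm_in L ys \<phi>}"

text \<open>Among the sorts of the Boolean-valued language only \<open>B\<close> carries a primitive equality; equality
  on an \<open>L\<close>-sort is by convention \<open>[x = y] = 1\<close>. Since equality is a logical symbol on all sorts
  here, this convention is an axiom.\<close>

definition equality_axioms :: "('s, 'f, 'r) lang \<Rightarrow> ('s, 'f, 'r) bfm set" where
  "equality_axioms L =
     {LAlls [x, y] (Iff (Eq (Var (lvar x)) (Var (lvar y)))
                        (Eq (bval [x, y] (Eq (Var x) (Var y))) bone))
        | x y. x \<noteq> y \<and> fst x = fst y \<and> fst x \<in> sorts L}"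

text \<open>The pairs in \<open>ps\<close> are the \<open>(\<psi>\<^sub>i(ys), \<phi>\<^sub>i(xs, ys))\<close>.\<close>

definition gluing_axiom ::
  "'s var list \<Rightarrow> 's var list \<Rightarrow> (('s, 'f, 'r) fm \<times> ('s, 'f, 'r) fm) list \<Rightarrow>
     ('s, 'f, 'r) bfm" where
  "gluing_axiom xs ys ps =
     (let n = length ps in
      BAlls [0..<n] (LAlls ys
        (Imp (Conj (Conjs [Eq (bmeet (bv i) (bv j)) bzero. i \<leftarrow> [0..<n], j \<leftarrow> [0..<i]])
                   (Conjs [ble (bv i) (bval ys (fst (ps ! i))). i \<leftarrow> [0..<n]]))
             (LExs xs (Conjs [ble (bv i) (bval (xs @ ys) (snd (ps ! i))). i \<leftarrow> [0..<n]])))))"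

definition gluing_axioms ::
  "'u itself \<Rightarrow> ('s, 'f, 'r) lang \<Rightarrow> ('s, 'f, 'r) fm set \<Rightarrow> ('s, 'f, 'r) bfm set" where
  "gluing_axioms U L T =
     {gluing_axiom xs ys ps | xs ys ps. ps \<noteq> [] \<and>
        (\<forall>(\<psi>, \<phi>) \<in> set ps. fm_in L ys \<psi> \<and> fm_in L (xs @ ys) \<phi> \<and>
           entails U L T (Alls ys (Imp \<psi> (Exs xs \<phi>))))}"

definition boole_theory ::
  "'u itself \<Rightarrow> ('s, 'f, 'r) lang \<Rightarrow> ('s, 'f, 'r) fm set \<Rightarrow> ('s, 'f, 'r) bfm set" where
  "boole_theory U L T =
     boolean_algebra_axioms \<union> validity_axioms U L T \<union> homomorphism_axioms L \<union>
     equality_axioms L \<union> gluing_axioms U L T"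

text \<open>As usual, atomless Boolean algebras are nontrivial.\<close>

definition atomless_axioms :: "('s, 'f, 'r) bfm set" where
  "atomless_axioms = {
     Neg (Eq bzero bone),
     BAlls [0] (Imp (Neg (Eq (bv 0) bzero))
       (Exists (bvar 1) (Conjs [ble (bv 1) (bv 0), Neg (Eq (bv 1) bzero), Neg (Eq (bv 1) (bv 0))])))}"

definition atomless_theory ::
  "'u itself \<Rightarrow> ('s, 'f, 'r) lang \<Rightarrow> ('s, 'f, 'r) fm set \<Rightarrow> ('s, 'f, 'r) bfm set" where
  "atomless_theory U L T = boole_theory U L T \<union> atomless_axioms"

end

(*
  Let M be a model of T_atomless and Omega the Stone space of its Boolean algebra. At every point p
  the relation "[phi](v) is in p" is the theory of a stalk. Gluing and compactness turn statements
  that hold at each point, with witnesses that may depend on the point, into statements with global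
  witnesses, and since no point is isolated any finite set of types can be spread over Omega. Hence
  a formula E(x, y) only depends on the set im(x, y) of the colours taken on Omega by some finite
  clopen colouring c(x, y).

  For an imaginary a/E let s be a maximal set of colours that makes E(a, y) true and is of the form
  im(a, y). Let P(x) be the map that sends p to {y. c(x, y) at p is in s}. Let x and x' range over
  the tuples for which s is realised and maximal. Then P(x) = P(x') implies E(x, x'), and within the
  class of a the family P(x) is determined by the set of the colours c(a, y) with y in P(x), so that
  there are only finitely many P(x). It remains to code P(a) by a real tuple. At each point it is a
  class of an equivalence relation definable in the stalk, which has a code since T eliminates
  imaginaries. By compactness finitely many formulas suffice; off the region where such a formula
  works, the code takes the values of 0-definable elements, and the region is part of the code.
*)

theory Submission
  imports Defs "HOL-Library.Nat_Bijection"
begin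

section \<open>Many-sorted logic\<close>

text \<open>Two obstacles shape the proof. Elimination of imaginaries speaks of models with elements
  in \<open>'u\<close>, whereas a stalk is a quotient of carriers in \<open>'m\<close>. Truth at a
  point is therefore handled as a satisfaction relation in which equality is only a congruence, and
  where a genuine model is required, a Skolem hull is given names in \<open>'u\<close> that come
  from the injection of formulas. Moreover \<open>M\<close> interprets the formulas of
  \<open>L\<close> but not its function symbols, so that terms have no values in \<open>M\<close>.

  Maximality of \<open>s\<close> makes two candidates comparable. Suppose their fibres show the same
  colours relative to \<open>a\<close>, and an element of one fibre is missing from the other. Its
  colours can be added to a section in such a way that nothing changes relative to \<open>a\<close>,
  so the section remains \<open>E\<close>-related to the class, yet relative to the candidate it has
  a colour set larger than \<open>s\<close>. Hence such fibres coincide. Nothing singles out one of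
  the finitely many fibres in a class, however; this is why the code is only algebraic over the
  imaginary.\<close>

declare split_paired_All [simp del] split_paired_Ex [simp del]

text \<open>Assignments are total, so they also have values at variables of sorts outside the
  language; nothing is required there. The family \<open>U\<close> is arbitrary because
  \<open>gd\<close> serves structures, the \<open>L\<close>-part of a Boolean-valued model and
  Skolem hulls alike.\<close>

definition gd :: "('s, 'f, 'r) lang \<Rightarrow> ('s \<Rightarrow> 'a set) \<Rightarrow> ('s var \<Rightarrow> 'a) \<Rightarrow> bool" where
  "gd L U v \<longleftrightarrow> (\<forall>x. fst x \<in> sorts L \<longrightarrow> v x \<in> U (fst x))"

lemma gd_in: "gd L U v \<Longrightarrow> fst x = s \<Longrightarrow> s \<in> sorts L \<Longrightarrow> v x \<in> U s"
  by (auto simp: gd_def)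

definition off :: "'x set \<Rightarrow> ('x \<Rightarrow> 'a) \<Rightarrow> ('x \<Rightarrow> 'a) \<Rightarrow> bool" where
  "off X v w \<longleftrightarrow> (\<forall>x. x \<notin> X \<longrightarrow> w x = v x)"

lemma off_refl [simp]: "off X v v" by (simp add: off_def)
lemma off_trans: "off X u v \<Longrightarrow> off Y v w \<Longrightarrow> off (X \<union> Y) u w" by (simp add: off_def)
lemma off_apply: "off X v w \<Longrightarrow> x \<notin> X \<Longrightarrow> w x = v x" by (simp add: off_def)
lemma off_empty [simp]: "off {} v w \<longleftrightarrow> w = v" by (auto simp: off_def)

lemma gd_upd: "gd L U v \<Longrightarrow> (fst x \<in> sorts L \<Longrightarrow> a \<in> U (fst x)) \<Longrightarrow> gd L U (v(x := a))"
  by (auto simp: gd_def)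

lemma gd_override: "gd L U v \<Longrightarrow> gd L U w \<Longrightarrow> gd L U (override_on v w X)"
  by (auto simp: gd_def override_on_def)

lemma off_override: "off X v (override_on v w X)"
  by (auto simp: off_def override_on_def)

lemma gd_ex: "(\<And>s. s \<in> sorts L \<Longrightarrow> U s \<noteq> {}) \<Longrightarrow> \<exists>v. gd L U v"
  by (rule exI[of _ "\<lambda>x. SOME a. a \<in> U (fst x)"]) (auto simp: gd_def some_in_eq)

lemma finite_fv_tm [simp]: "finite (fv_tm t)" by (induction t) auto
lemma finite_fv [simp]: "finite (fv \<phi>)" by (induction \<phi>) auto

lemma eval_tm_cong: "(\<And>x. x \<in> fv_tm t \<Longrightarrow> v x = w x) \<Longrightarrow> eval_tm M v t = eval_tm M w t"
proof (induction t)
  case (Fn f ts)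
  have "map (eval_tm M v) ts = map (eval_tm M w) ts"
    by (intro map_cong refl Fn.IH Fn.prems) auto
  then show ?case by (simp only: eval_tm.simps)
qed simp

lemma sat_cong: "(\<And>x. x \<in> fv \<phi> \<Longrightarrow> v x = w x) \<Longrightarrow> sat M v \<phi> = sat M w \<phi>"
proof (induction \<phi> arbitrary: v w)
  case (Eq t u)
  have "eval_tm M v t = eval_tm M w t" "eval_tm M v u = eval_tm M w u"
    by (rule eval_tm_cong, rule Eq, simp)+
  then show ?case by simp
next
  case (Rel r ts)
  have "map (eval_tm M v) ts = map (eval_tm M w) ts"
    by (intro map_cong refl eval_tm_cong Rel) auto
  then show ?case by (simp only: sat.simps)
next
  case (Neg \<phi>)
  have "sat M v \<phi> = sat M w \<phi>" by (rule Neg.IH, rule Neg.prems, simp)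
  then show ?case by simp
next
  case (Conj \<phi> \<psi>)
  have "sat M v \<phi> = sat M w \<phi>" by (rule Conj.IH(1), rule Conj.prems, simp)
  moreover have "sat M v \<psi> = sat M w \<psi>" by (rule Conj.IH(2), rule Conj.prems, simp)
  ultimately show ?case by simp
next
  case (Exists x \<phi>)
  have "sat M (v(x := a)) \<phi> = sat M (w(x := a)) \<phi>" for a
    by (rule Exists.IH) (use Exists.prems in simp)
  then show ?case by simp
qed simp

lemma tuples_iff: "as \<in> tuples M ss \<longleftrightarrow> list_all2 (\<lambda>a s. a \<in> univ M s) as ss"
  unfolding tuples_def
  by (induction ss arbitrary: as) (auto simp: set_Cons_def list_all2_Cons2)

lemma eval_tm_sort:
  assumes "is_struct L M" "gd L (univ M) v"
  shows "has_sort L t s \<Longrightarrow> eval_tm M v t \<in> univ M s"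
proof (induction t arbitrary: s)
  case (Var x)
  then show ?case using assms(2) by (auto simp: gd_def)
next
  case (Fn f ts)
  have "list_all2 (has_sort L) ts (fargs L f)" using Fn.prems by simp
  then have "list_all2 (\<lambda>t s. eval_tm M v t \<in> univ M s) ts (fargs L f)"
    using Fn.IH by (auto simp: list_all2_conv_all_nth)
  then have "map (eval_tm M v) ts \<in> tuples M (fargs L f)"
    by (simp add: tuples_iff list_all2_map1)
  then show ?case using assms(1) Fn.prems by (auto simp: is_struct_def)
qed

lemma holds_map:
  assumes "fv \<phi> \<subseteq> set xs"
  shows "holds M xs \<phi> (map v xs) \<longleftrightarrow> sat M v \<phi>"
  unfolding holds_def using assms
  by (intro sat_cong) (auto simp: map_of_zip_map)

lemma fresh_vars:
  fixes V :: "'s var set"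
  assumes "finite V"
  shows "\<exists>zs. map fst zs = ss \<and> distinct zs \<and> set zs \<inter> V = {}"
proof -
  obtain n where n: "\<forall>x\<in>V. snd x < n"
    using assms by (metis finite_imageI finite_nat_set_iff_bounded imageI)
  let ?zs = "zip ss [n..<n + length ss]"
  have "map fst ?zs = ss" by simp
  moreover have "distinct ?zs" by (simp add: distinct_zipI2)
  moreover have "set ?zs \<inter> V = {}"
    using n by (auto dest!: set_zip_rightD) 
  ultimately show ?thesis by blast
qed

lemma fresh_var:
  fixes V :: "'s var set"
  assumes "finite V"
  obtains z where "fst z = s" "z \<notin> V"
proof -
  obtain zs where zs: "map fst zs = [s] \<and> distinct zs \<and> set zs \<inter> V = {}"
    using fresh_vars[OF assms, of "[s]"] by (rule exE)
  then have "fst (hd zs) = s" "hd zs \<notin> V" by (cases zs; simp)+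
  then show thesis by (rule that)
qed

lemma val_of_list:
  fixes v :: "'s var \<Rightarrow> 'a"
  assumes "gd L U v" "distinct xs" "list_all2 (\<lambda>a x. a \<in> U (fst x)) as xs"
  obtains w where "gd L U w" "off (set xs) v w" "map w xs = as"
proof -
  have len: "length as = length xs" using assms(3) by (rule list_all2_lengthD)
  let ?w = "\<lambda>x. case map_of (zip xs as) x of Some a \<Rightarrow> a | None \<Rightarrow> v x"
  have "map ?w xs = as"
    using assms(2) len by (intro nth_equalityI) (auto simp: map_of_zip_nth)
  moreover have "off (set xs) v ?w" using len by (auto simp: off_def split: option.split dest!: map_of_SomeD set_zip_leftD)
  moreover have "gd L U ?w"
    unfolding gd_def
  proof (intro allI impI)
    fix x :: "'s var" assume x: "fst x \<in> sorts L"
    show "?w x \<in> U (fst x)"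
    proof (cases "x \<in> set xs")
      case True
      then obtain i where "i < length xs" "x = xs ! i" by (metis in_set_conv_nth)
      then show ?thesis using assms(2,3) len by (simp add: map_of_zip_nth list_all2_conv_all_nth)
    next
      case False
      then have "?w x = v x" using \<open>off (set xs) v ?w\<close> by (simp add: off_def)
      then show ?thesis using assms(1) x by (simp add: gd_def)
    qed
  qed
  ultimately show thesis using that by blast
qed

lemma tuples_map: "gd L (univ M) v \<Longrightarrow> fst ` set xs \<subseteq> sorts L \<Longrightarrow> map v xs \<in> tuples M (map fst xs)"
  by (auto simp: tuples_iff list_all2_conv_all_nth gd_def dest: nth_mem)

lemma zip_sorts:
  assumes "map fst xs = map fst zs" "(x, z) \<in> set (zip xs zs)"
  shows "x \<in> set xs \<and> z \<in> set zs \<and> fst x = fst z"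
proof -
  have "length xs = length zs" using assms(1) by (metis length_map)
  moreover obtain i where "i < length xs" "i < length zs" "x = xs ! i" "z = zs ! i"
    using assms(2) by (auto simp: in_set_zip)
  ultimately show ?thesis using assms(1) by (metis nth_map nth_mem)
qed

lemma sat_Conjs: "sat N v (Conjs \<phi>s) \<longleftrightarrow> (\<forall>\<phi>\<in>set \<phi>s. sat N v \<phi>)"
  by (induction \<phi>s) (auto simp: Conjs_def)

lemma fv_Conjs: "fv (Conjs \<phi>s) = (\<Union>\<phi>\<in>set \<phi>s. fv \<phi>)"
  by (induction \<phi>s) (auto simp: Conjs_def)
lemma wf_Conjs [simp]: "wf_fm L (Conjs \<phi>s) \<longleftrightarrow> (\<forall>\<phi>\<in>set \<phi>s. wf_fm L \<phi>)"
  by (induction \<phi>s) (auto simp: Conjs_def)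
lemma fv_Exs [simp]: "fv (Exs xs \<phi>) = fv \<phi> - set xs"
  by (induction xs) (auto simp: Exs_def)
lemma wf_Exs [simp]: "wf_fm L (Exs xs \<phi>) \<longleftrightarrow> fst ` set xs \<subseteq> sorts L \<and> wf_fm L \<phi>"
  by (induction xs) (auto simp: Exs_def)
lemma fv_Alls [simp]: "fv (Alls xs \<phi>) = fv \<phi> - set xs"
  by (induction xs) (auto simp: Alls_def Forall_def)
lemma wf_Alls [simp]: "wf_fm L (Alls xs \<phi>) \<longleftrightarrow> fst ` set xs \<subseteq> sorts L \<and> wf_fm L \<phi>"
  by (induction xs) (auto simp: Alls_def Forall_def)
lemma fv_Imp [simp]: "fv (Imp \<phi> \<psi>) = fv \<phi> \<union> fv \<psi>" by (simp add: Imp_def)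
lemma wf_Imp [simp]: "wf_fm L (Imp \<phi> \<psi>) \<longleftrightarrow> wf_fm L \<phi> \<and> wf_fm L \<psi>" by (simp add: Imp_def)
lemma fv_Iff [simp]: "fv (Iff \<phi> \<psi>) = fv \<phi> \<union> fv \<psi>" by (auto simp: Iff_def)
lemma wf_Iff [simp]: "wf_fm L (Iff \<phi> \<psi>) \<longleftrightarrow> wf_fm L \<phi> \<and> wf_fm L \<psi>" by (auto simp: Iff_def)

definition eqs :: "'s var list \<Rightarrow> 's var list \<Rightarrow> ('s, 'f, 'r) fm" where
  "eqs xs zs = Conjs (map2 (\<lambda>x z. Eq (Var x) (Var z)) xs zs)"

text \<open>Substitution of \<open>zs\<close> for \<open>xs\<close> by a quantifier: \<exists>xs. xs
  = zs \<and> \<phi>. It is correct for disjoint tuples only, since a variable of \<open>zs\<close>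
  that also occurs in \<open>xs\<close> would be captured.\<close>

definition ren :: "'s var list \<Rightarrow> 's var list \<Rightarrow> ('s, 'f, 'r) fm \<Rightarrow> ('s, 'f, 'r) fm" where
  "ren xs zs \<phi> = Exs xs (Conj (eqs xs zs) \<phi>)"

lemma wf_eqs:
  assumes "map fst xs = map fst zs" "fst ` set xs \<subseteq> sorts L"
  shows "wf_fm L (eqs xs zs)"
proof -
  have "fst x = fst z \<and> fst x \<in> sorts L" if "(x, z) \<in> set (zip xs zs)" for x z
    using zip_sorts[OF assms(1) that] assms(2) by auto
  then show ?thesis by (fastforce simp: eqs_def)
qed

lemma wf_ren:
  assumes "map fst xs = map fst zs" "fst ` set xs \<subseteq> sorts L" "wf_fm L \<phi>"
  shows "wf_fm L (ren xs zs \<phi>)"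
  using assms wf_eqs[OF assms(1,2)] by (simp add: ren_def)

lemma fv_eqs: "fv (eqs xs zs) \<subseteq> set xs \<union> set zs"
  by (auto simp: eqs_def fv_Conjs dest: set_zip_leftD set_zip_rightD)

lemma fv_ren: "fv (ren xs zs \<phi>) \<subseteq> (fv \<phi> - set xs) \<union> set zs"
  using fv_eqs[of xs zs] by (auto simp: ren_def)

text \<open>The relation \<open>eqv\<close> is a congruence for \<open>S\<close> and need not be
  equality. The two instances are satisfaction in a structure, and truth at a point of the Stone
  space, where elements stand for their classes in the stalk. Atomic formulas other than equations
  between variables are left uninterpreted, since in the second instance terms have no
  values.\<close>

locale tarski =
  fixes L :: "('s, 'f, 'r) lang" and U :: "'s \<Rightarrow> 'a set"
    and S :: "('s var \<Rightarrow> 'a) \<Rightarrow> ('s, 'f, 'r) fm \<Rightarrow> bool"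
    and eqv :: "'s \<Rightarrow> 'a \<Rightarrow> 'a \<Rightarrow> bool"
  assumes nonempty: "s \<in> sorts L \<Longrightarrow> U s \<noteq> {}"
    and S_Bot: "gd L U v \<Longrightarrow> \<not> S v Bot"
    and S_Neg: "gd L U v \<Longrightarrow> wf_fm L \<phi> \<Longrightarrow> S v (Neg \<phi>) \<longleftrightarrow> \<not> S v \<phi>"
    and S_Conj: "gd L U v \<Longrightarrow> wf_fm L \<phi> \<Longrightarrow> wf_fm L \<psi> \<Longrightarrow> S v (Conj \<phi> \<psi>) \<longleftrightarrow> S v \<phi> \<and> S v \<psi>"
    and S_Exists: "gd L U v \<Longrightarrow> wf_fm L \<phi> \<Longrightarrow> fst x \<in> sorts L \<Longrightarrow>
      S v (Exists x \<phi>) \<longleftrightarrow> (\<exists>a \<in> U (fst x). S (v(x := a)) \<phi>)"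
    and S_fv: "gd L U v \<Longrightarrow> gd L U w \<Longrightarrow> wf_fm L \<phi> \<Longrightarrow> (\<And>x. x \<in> fv \<phi> \<Longrightarrow> v x = w x) \<Longrightarrow> S v \<phi> = S w \<phi>"
    and S_Eq: "gd L U v \<Longrightarrow> fst x = fst y \<Longrightarrow> fst x \<in> sorts L \<Longrightarrow>
      S v (Eq (Var x) (Var y)) \<longleftrightarrow> eqv (fst x) (v x) (v y)"
    and eqv_refl: "s \<in> sorts L \<Longrightarrow> a \<in> U s \<Longrightarrow> eqv s a a"
    and S_eqv: "gd L U v \<Longrightarrow> wf_fm L \<phi> \<Longrightarrow> fst x \<in> sorts L \<Longrightarrow> a \<in> U (fst x) \<Longrightarrow>
      eqv (fst x) (v x) a \<Longrightarrow> S v \<phi> = S (v(x := a)) \<phi>"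
begin

lemma S_Imp: "gd L U v \<Longrightarrow> wf_fm L \<phi> \<Longrightarrow> wf_fm L \<psi> \<Longrightarrow> S v (Imp \<phi> \<psi>) \<longleftrightarrow> (S v \<phi> \<longrightarrow> S v \<psi>)"
  by (simp add: Imp_def S_Neg S_Conj)

lemma S_Iff: "gd L U v \<Longrightarrow> wf_fm L \<phi> \<Longrightarrow> wf_fm L \<psi> \<Longrightarrow> S v (Iff \<phi> \<psi>) \<longleftrightarrow> (S v \<phi> \<longleftrightarrow> S v \<psi>)"
  by (auto simp: Iff_def S_Conj S_Imp)

lemma S_Conjs: "gd L U v \<Longrightarrow> (\<forall>\<phi>\<in>set \<phi>s. wf_fm L \<phi>) \<Longrightarrow> S v (Conjs \<phi>s) \<longleftrightarrow> (\<forall>\<phi>\<in>set \<phi>s. S v \<phi>)"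
proof (induction \<phi>s)
  case Nil
  then show ?case by (simp add: Conjs_def S_Neg S_Bot)
next
  case (Cons \<phi> \<phi>s)
  have "Conjs (\<phi> # \<phi>s) = Conj \<phi> (Conjs \<phi>s)" by (simp add: Conjs_def)
  then show ?case using Cons by (simp add: S_Conj)
qed

lemma S_Exs:
  assumes "wf_fm L \<phi>" "fst ` set xs \<subseteq> sorts L"
  shows "gd L U v \<Longrightarrow> S v (Exs xs \<phi>) \<longleftrightarrow> (\<exists>w. gd L U w \<and> off (set xs) v w \<and> S w \<phi>)"
  using assms(2)
proof (induction xs arbitrary: v)
  case Nil
  then show ?case by (auto simp: Exs_def)
next
  case (Cons x xs)
  have "S v (Exs (x # xs) \<phi>) \<longleftrightarrow> (\<exists>a\<in>U (fst x). S (v(x := a)) (Exs xs \<phi>))"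
    using Cons.prems assms(1) S_Exists[of v "Exs xs \<phi>" x] wf_Exs[of L xs \<phi>] by (simp add: Exs_def)
  also have "\<dots> \<longleftrightarrow> (\<exists>a\<in>U (fst x). \<exists>w. gd L U w \<and> off (set xs) (v(x := a)) w \<and> S w \<phi>)"
  proof (intro bex_cong refl)
    fix a assume "a \<in> U (fst x)"
    then have "gd L U (v(x := a))" using Cons.prems by (simp add: gd_upd)
    then show "S (v(x := a)) (Exs xs \<phi>) \<longleftrightarrow> (\<exists>w. gd L U w \<and> off (set xs) (v(x := a)) w \<and> S w \<phi>)"
      using Cons by simp
  qed
  also have "\<dots> \<longleftrightarrow> (\<exists>w. gd L U w \<and> off (set (x # xs)) v w \<and> S w \<phi>)" (is "?l \<longleftrightarrow> ?r")
  proof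
    assume ?l then show ?r by (fastforce simp: off_def)
  next
    assume ?r
    then obtain w where w: "gd L U w" "off (set (x # xs)) v w" "S w \<phi>" by blast
    show ?l
    \<comment> \<open>The list may repeat \<open>x\<close>. In that case the outer quantifier is
      vacuous and the old value \<open>v x\<close> serves as witness.\<close>
    proof (cases "x \<in> set xs")
      case True
      then have "off (set xs) (v(x := v x)) w" using w by (auto simp: off_def)
      moreover have "v x \<in> U (fst x)" using Cons.prems by (auto simp: gd_def)
      ultimately show ?thesis using w by blast
    next
      case False
      then have "off (set xs) (v(x := w x)) w" using w by (auto simp: off_def)
      moreover have "w x \<in> U (fst x)" using Cons.prems w by (auto simp: gd_def)
      ultimately show ?thesis using w by blast
    qed
  qed
  finally show ?case .
qed

lemma S_Forall: "gd L U v \<Longrightarrow> wf_fm L \<phi> \<Longrightarrow> fst x \<in> sorts L \<Longrightarrow>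
      S v (Forall x \<phi>) \<longleftrightarrow> (\<forall>a \<in> U (fst x). S (v(x := a)) \<phi>)"
  by (simp add: Forall_def S_Neg S_Exists gd_upd)

lemma S_Alls:
  assumes "wf_fm L \<phi>" "fst ` set xs \<subseteq> sorts L" "gd L U v"
  shows "S v (Alls xs \<phi>) \<longleftrightarrow> (\<forall>w. gd L U w \<longrightarrow> off (set xs) v w \<longrightarrow> S w \<phi>)"
proof -
  have "S v (Alls xs \<phi>) \<longleftrightarrow> \<not> S v (Exs xs (Neg \<phi>))" if "gd L U v" for v
    using that assms(2)
  proof (induction xs arbitrary: v)
    case Nil
    then show ?case using assms(1) by (simp add: Alls_def Exs_def S_Neg)
  next
    case (Cons x xs)
    have *: "Alls (x # xs) \<phi> = Forall x (Alls xs \<phi>)" "Exs (x # xs) (Neg \<phi>) = Exists x (Exs xs (Neg \<phi>))"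
      by (simp_all add: Alls_def Exs_def)
    show ?case unfolding * using Cons assms(1) by (simp add: S_Forall S_Exists) (metis gd_upd)
  qed
  then show ?thesis using assms by (auto simp: S_Exs S_Neg)
qed

text \<open>Symmetry and transitivity are not assumed in the locale. Both arise by replacing one
  side of a true equation between two variables by means of \<open>S_eqv\<close>.\<close>

lemma eqv_sym:
  assumes "s \<in> sorts L" "a \<in> U s" "b \<in> U s" "eqv s a b"
  shows "eqv s b a"
proof -
  obtain v where v: "gd L U v" using gd_ex nonempty by metis
  let ?x = "(s, 0)" and ?y = "(s, Suc 0)"
  let ?v = "v(?x := a, ?y := a)"
  have g: "gd L U ?v" using v assms by (simp add: gd_upd)
  have "S ?v (Eq (Var ?x) (Var ?y))" using S_Eq[OF g, of ?x ?y] assms by (simp add: eqv_refl)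
  then have "S (?v(?x := b)) (Eq (Var ?x) (Var ?y))" using S_eqv[OF g, of _ ?x b] assms by auto
  moreover have "gd L U (?v(?x := b))" by (rule gd_upd[OF g]) (use assms in simp)
  ultimately show ?thesis using S_Eq[of "?v(?x := b)" ?x ?y] assms by simp
qed

lemma eqv_trans:
  assumes "s \<in> sorts L" "a \<in> U s" "b \<in> U s" "c \<in> U s" "eqv s a b" "eqv s b c"
  shows "eqv s a c"
proof -
  obtain v where v: "gd L U v" using gd_ex nonempty by metis
  let ?x = "(s, 0)" and ?y = "(s, Suc 0)"
  let ?v = "v(?x := a, ?y := b)"
  have g: "gd L U ?v" using v assms by (simp add: gd_upd)
  have "S ?v (Eq (Var ?x) (Var ?y))" using S_Eq[OF g, of ?x ?y] assms by simp
  then have "S (?v(?y := c)) (Eq (Var ?x) (Var ?y))" using S_eqv[OF g, of _ ?y c] assms by auto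
  moreover have "gd L U (?v(?y := c))" by (rule gd_upd[OF g]) (use assms in simp)
  ultimately show ?thesis using S_Eq[of "?v(?y := c)" ?x ?y] assms by simp
qed

lemma fv_sorts_tm: "has_sort L t s \<Longrightarrow> x \<in> fv_tm t \<Longrightarrow> fst x \<in> sorts L"
  by (induction t arbitrary: s) (fastforce simp: list_all2_conv_all_nth in_set_conv_nth)+

lemma fv_sorts: "wf_fm L \<phi> \<Longrightarrow> x \<in> fv \<phi> \<Longrightarrow> fst x \<in> sorts L"
proof (induction \<phi>)
  case (Rel r ts)
  then show ?case by (fastforce simp: list_all2_conv_all_nth in_set_conv_nth dest: fv_sorts_tm)
qed (auto dest: fv_sorts_tm)

text \<open>\<open>S_eqv\<close> changes one variable at a time; the finitely many free variables
  are replaced one after the other, and the remaining ones do not matter.\<close>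

lemma S_eqvs:
  assumes "gd L U v" "gd L U w" "wf_fm L \<phi>" "\<And>x. x \<in> fv \<phi> \<Longrightarrow> eqv (fst x) (v x) (w x)"
  shows "S v \<phi> = S w \<phi>"
proof -
  have "S v \<phi> = S (override_on v w F) \<phi>" if "finite F" "F \<subseteq> fv \<phi>" for F
    using that
  proof (induction F)
    case empty
    then show ?case by (simp add: override_on_def)
  next
    case (insert x F)
    let ?u = "override_on v w F"
    have x: "fst x \<in> sorts L" using insert assms(3) fv_sorts by blast
    have "S ?u \<phi> = S (?u(x := w x)) \<phi>"
      using x insert.hyps insert.prems assms(4)[of x] assms(2)
      by (intro S_eqv gd_override assms) (auto simp: override_on_def gd_def)
    moreover have "?u(x := w x) = override_on v w (insert x F)" by (auto simp: override_on_def)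
    ultimately show ?case using insert by simp
  qed
  from this[of "fv \<phi>"] have "S v \<phi> = S (override_on v w (fv \<phi>)) \<phi>" by simp
  also have "\<dots> = S w \<phi>" using assms by (intro S_fv gd_override) (auto simp: override_on_def)
  finally show ?thesis .
qed

lemma S_eqs:
  assumes "gd L U v" "map fst xs = map fst zs" "fst ` set xs \<subseteq> sorts L"
  shows "S v (eqs xs zs) \<longleftrightarrow> (\<forall>i<length xs. eqv (fst (xs ! i)) (v (xs ! i)) (v (zs ! i)))"
proof -
  have len: "length xs = length zs" using assms(2) by (metis length_map)
  have *: "fst (xs ! i) = fst (zs ! i)" "fst (xs ! i) \<in> sorts L" if "i < length xs" for i
    using assms that len by (metis nth_map, auto)
  have eqs: "set (map2 (\<lambda>x z. Eq (Var x) (Var z)) xs zs) = (\<lambda>i. Eq (Var (xs ! i)) (Var (zs ! i))) ` {..<length xs}"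
    using len by (force simp: set_zip)
  have "S v (eqs xs zs) \<longleftrightarrow> (\<forall>i<length xs. S v (Eq (Var (xs ! i)) (Var (zs ! i))))"
    using wf_eqs[OF assms(2,3)] unfolding eqs_def wf_Conjs
    by (subst S_Conjs[OF assms(1)]) (auto simp only: eqs ball_simps lessThan_iff Ball_def)
  then show ?thesis using S_Eq[OF assms(1)] * by auto
qed

text \<open>The equations in \<open>ren\<close> fix the values of \<open>xs\<close> only up to
  \<open>eqv\<close>, so \<open>v'\<close> is one witness among several. By \<open>S_eqvs\<close>
  all of them give the same truth value.\<close>

lemma S_ren:
  assumes g: "gd L U v" "gd L U v'" and "map fst xs = map fst zs" "fst ` set xs \<subseteq> sorts L"
    and "set xs \<inter> set zs = {}" "off (set xs) v v'" "map v' xs = map v zs" "wf_fm L \<phi>"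
  shows "S v (ren xs zs \<phi>) \<longleftrightarrow> S v' \<phi>"
proof -
  have len: "length xs = length zs" using assms(3) by (metis length_map)
  have v': "v' (xs ! i) = v (zs ! i)" if "i < length xs" for i
    using that len assms(7) by (metis nth_map)
  have zs: "w (zs ! i) = v (zs ! i)" if "off (set xs) v w" "i < length xs" for w i
    using that assms(5) len off_apply[OF that(1)] nth_mem by (metis disjoint_iff)
  have *: "S v (ren xs zs \<phi>) \<longleftrightarrow>
    (\<exists>w. gd L U w \<and> off (set xs) v w \<and> (\<forall>i<length xs. eqv (fst (xs ! i)) (w (xs ! i)) (w (zs ! i))) \<and> S w \<phi>)"
    unfolding ren_def using assms wf_eqs[OF assms(3,4)]
    by (auto simp: S_Exs S_Conj S_eqs)
  show ?thesis
  proof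
    assume "S v (ren xs zs \<phi>)"
    then obtain w where w: "gd L U w" "off (set xs) v w"
      "\<forall>i<length xs. eqv (fst (xs ! i)) (w (xs ! i)) (w (zs ! i))" "S w \<phi>"
      unfolding * by blast
    have "S w \<phi> = S v' \<phi>"
    proof (rule S_eqvs)
      fix x assume x: "x \<in> fv \<phi>"
      show "eqv (fst x) (w x) (v' x)"
      proof (cases "x \<in> set xs")
        case True
        then obtain i where "i < length xs" "x = xs ! i" by (metis in_set_conv_nth)
        then show ?thesis using w zs v' by metis
      next
        case False
        then have "w x = v' x" using w assms(6) by (simp add: off_def)
        moreover have "fst x \<in> sorts L" using x assms(8) fv_sorts by blast
        ultimately show ?thesis using g by (simp add: eqv_refl gd_def)
      qed
    qed (use w g assms(8) in auto)
    then show "S v' \<phi>" using w by simp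
  next
    assume "S v' \<phi>"
    moreover have "eqv (fst (xs ! i)) (v' (xs ! i)) (v' (zs ! i))" if "i < length xs" for i
    proof -
      have "v' (zs ! i) = v' (xs ! i)" "fst (xs ! i) \<in> sorts L"
        using that v' zs[OF assms(6)] assms(4) by auto
      then show ?thesis using g(2) by (simp add: eqv_refl gd_def)
    qed
    ultimately show "S v (ren xs zs \<phi>)" unfolding * using g(2) assms(6) by blast
  qed
qed

end

lemma tarski_sat:
  assumes "is_struct L M"
  shows "tarski L (univ M) (sat M) (\<lambda>_. (=))"
proof (unfold_locales, goal_cases)
  case 1
  then show ?case using assms by (simp add: is_struct_def)
next
  case (6 v w \<phi>)
  then show ?case by (intro sat_cong)
next
  case (9 v \<phi> x a)
  have "v(x := a) = v" using 9 by auto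
  then show ?case by simp
qed simp_all

section \<open>Ultrafilters\<close>

text \<open>The algebra is one sort of a structure, a set inside a type, so every law is relativised
  to the carrier \<open>B\<close>.\<close>

locale carrier_ba =
  fixes B :: "'a set" and meet join :: "'a \<Rightarrow> 'a \<Rightarrow> 'a" and compl :: "'a \<Rightarrow> 'a" and zero one :: 'a
  assumes zero_in: "zero \<in> B" and one_in: "one \<in> B"
    and meet_in: "x \<in> B \<Longrightarrow> y \<in> B \<Longrightarrow> meet x y \<in> B"
    and join_in: "x \<in> B \<Longrightarrow> y \<in> B \<Longrightarrow> join x y \<in> B"
    and compl_in: "x \<in> B \<Longrightarrow> compl x \<in> B"
    and meet_assoc: "x \<in> B \<Longrightarrow> y \<in> B \<Longrightarrow> z \<in> B \<Longrightarrow> meet (meet x y) z = meet x (meet y z)"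
    and meet_comm: "x \<in> B \<Longrightarrow> y \<in> B \<Longrightarrow> meet x y = meet y x"
    and join_comm: "x \<in> B \<Longrightarrow> y \<in> B \<Longrightarrow> join x y = join y x"
    and meet_join: "x \<in> B \<Longrightarrow> y \<in> B \<Longrightarrow> z \<in> B \<Longrightarrow> meet x (join y z) = join (meet x y) (meet x z)"
    and join_meet: "x \<in> B \<Longrightarrow> y \<in> B \<Longrightarrow> z \<in> B \<Longrightarrow> join x (meet y z) = meet (join x y) (join x z)"
    and meet_one: "x \<in> B \<Longrightarrow> meet x one = x"
    and join_zero: "x \<in> B \<Longrightarrow> join x zero = x"
    and meet_compl: "x \<in> B \<Longrightarrow> meet x (compl x) = zero"
    and join_compl: "x \<in> B \<Longrightarrow> join x (compl x) = one"
begin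

lemma meet_idem: assumes "x \<in> B" shows "meet x x = x"
proof -
  have "meet x x = join (meet x x) zero" using assms by (simp add: meet_in join_zero)
  also have "\<dots> = join (meet x x) (meet x (compl x))" using assms by (simp add: meet_compl)
  also have "\<dots> = meet x (join x (compl x))" using assms by (simp add: meet_join compl_in)
  finally show ?thesis using assms by (simp add: join_compl meet_one)
qed

lemma meet_zero: assumes "x \<in> B" shows "meet x zero = zero"
proof -
  have "meet x zero = meet x (meet x (compl x))" using assms by (simp add: meet_compl)
  also have "\<dots> = meet (meet x x) (compl x)" using assms by (simp add: meet_assoc compl_in)
  finally show ?thesis using assms by (simp add: meet_idem meet_compl)
qed

lemma meet_absorb: assumes "x \<in> B" "y \<in> B" shows "meet x (join x y) = x"
proof -
  have "meet x (join x y) = meet (join x zero) (join x y)" using assms by (simp add: join_zero)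
  also have "\<dots> = join x (meet zero y)" using assms by (simp add: join_meet zero_in)
  also have "meet zero y = zero" using assms by (metis meet_comm meet_zero zero_in)
  finally show ?thesis using assms by (simp add: join_zero)
qed

lemma meet_split: assumes "x \<in> B" "y \<in> B" shows "x = join (meet x y) (meet x (compl y))"
  using meet_join[of x y "compl y"] assms by (simp add: compl_in join_compl meet_one)

lemma meet_left_comm: "x \<in> B \<Longrightarrow> y \<in> B \<Longrightarrow> z \<in> B \<Longrightarrow> meet x (meet y z) = meet y (meet x z)"
  by (metis meet_assoc meet_comm)

definition pfilter :: "'a set \<Rightarrow> bool" where
  "pfilter F \<longleftrightarrow> F \<subseteq> B \<and> one \<in> F \<and> zero \<notin> F \<and> (\<forall>x\<in>F. \<forall>y\<in>F. meet x y \<in> F) \<and>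
     (\<forall>x\<in>F. \<forall>y\<in>B. meet x y = x \<longrightarrow> y \<in> F)"

definition ultra :: "'a set \<Rightarrow> bool" where
  "ultra F \<longleftrightarrow> pfilter F \<and> (\<forall>x\<in>B. compl x \<in> F \<longleftrightarrow> x \<notin> F)"

lemma ultra_sub: "ultra p \<Longrightarrow> p \<subseteq> B"
  and ultra_one: "ultra p \<Longrightarrow> one \<in> p"
  and ultra_zero: "ultra p \<Longrightarrow> zero \<notin> p"
  and ultra_compl: "ultra p \<Longrightarrow> x \<in> B \<Longrightarrow> compl x \<in> p \<longleftrightarrow> x \<notin> p"
  by (auto simp: ultra_def pfilter_def)

lemma ultra_meet:
  assumes "ultra p" "x \<in> B" "y \<in> B"
  shows "meet x y \<in> p \<longleftrightarrow> x \<in> p \<and> y \<in> p"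
proof
  assume m: "meet x y \<in> p"
  have "meet (meet x y) x = meet x y"
    using assms by (metis meet_assoc meet_comm meet_idem)
  moreover have "meet (meet x y) y = meet x y" using assms by (simp add: meet_assoc meet_idem)
  ultimately show "x \<in> p \<and> y \<in> p" using m assms by (auto simp: ultra_def pfilter_def)
qed (use assms in \<open>auto simp: ultra_def pfilter_def\<close>)

lemma ultra_join:
  assumes "ultra p" "x \<in> B" "y \<in> B"
  shows "join x y \<in> p \<longleftrightarrow> x \<in> p \<or> y \<in> p"
proof
  assume j: "join x y \<in> p"
  show "x \<in> p \<or> y \<in> p"
  proof (rule ccontr)
    assume "\<not> (x \<in> p \<or> y \<in> p)"
    then have c: "compl x \<in> p" "compl y \<in> p" using assms by (auto simp: ultra_compl)
    have "meet (compl y) (meet (compl x) (join x y)) = meet (compl y) (join zero (meet (compl x) y))"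
      using assms by (simp add: meet_join compl_in meet_comm[of "compl x" x] meet_compl)
    also have "join zero (meet (compl x) y) = meet (compl x) y"
      using assms by (metis join_comm join_zero meet_in compl_in zero_in)
    also have "meet (compl y) (meet (compl x) y) = meet (compl x) (meet y (compl y))"
      using assms by (metis meet_left_comm meet_comm compl_in)
    also have "\<dots> = zero" using assms by (simp add: meet_compl meet_zero compl_in)
    finally show False
      using ultra_zero[OF assms(1)] c j assms by (metis ultra_meet compl_in join_in meet_in)
  qed
next
  assume "x \<in> p \<or> y \<in> p"
  moreover have "meet x (join x y) = x" "meet y (join x y) = y"
    using assms meet_absorb join_comm by metis+
  ultimately show "join x y \<in> p" using assms by (auto simp: ultra_def pfilter_def join_in)
qed

text \<open>Zorn's lemma gives a maximal proper filter \<open>M\<close>. If \<open>M\<close> omits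
  \<open>x\<close>, the filter generated by \<open>M\<close> and \<open>x\<close> must be improper,
  so some \<open>f\<close> in \<open>M\<close> is disjoint from \<open>x\<close> and therefore lies
  below \<open>compl x\<close>, which puts \<open>compl x\<close> into \<open>M\<close>.\<close>

lemma pfilter_extends:
  assumes "pfilter F"
  shows "\<exists>p. ultra p \<and> F \<subseteq> p"
proof -
  let ?A = "{G. pfilter G \<and> F \<subseteq> G}"
  have "\<exists>M\<in>?A. \<forall>X\<in>?A. M \<subseteq> X \<longrightarrow> X = M"
  proof (rule subset_Zorn_nonempty)
    show "?A \<noteq> {}" using assms by auto
    fix \<C> assume C: "\<C> \<noteq> {}" "subset.chain ?A \<C>"
    then have mem: "pfilter G" "F \<subseteq> G" if "G \<in> \<C>" for G
      using that by (auto simp: subset.chain_def)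
    have "meet x y \<in> \<Union> \<C>" if xy: "x \<in> \<Union> \<C>" "y \<in> \<Union> \<C>" for x y
    proof -
      obtain G H where GH: "G \<in> \<C>" "H \<in> \<C>" "x \<in> G" "y \<in> H" using xy by blast
      then have "G \<subseteq> H \<or> H \<subseteq> G" using C(2) unfolding subset.chain_def by blast
      then obtain K where "K \<in> \<C>" "x \<in> K" "y \<in> K" using GH by blast
      then show ?thesis using mem(1)[of K] by (auto simp: pfilter_def)
    qed
    moreover have "one \<in> \<Union> \<C>" using C(1) mem(1) by (auto simp: pfilter_def)
    ultimately have "pfilter (\<Union> \<C>)" using mem(1) unfolding pfilter_def by blast
    moreover have "F \<subseteq> \<Union> \<C>" using C(1) mem(2) by blast
    ultimately show "\<Union> \<C> \<in> ?A" by simp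
  qed
  then obtain M where M: "pfilter M" "F \<subseteq> M" and max: "\<And>X. pfilter X \<Longrightarrow> M \<subseteq> X \<Longrightarrow> X = M"
    by (metis (mono_tags, lifting) mem_Collect_eq subset_trans)
  have MB: "M \<subseteq> B" using M by (simp add: pfilter_def)
  have "compl x \<in> M \<longleftrightarrow> x \<notin> M" if x: "x \<in> B" for x
  proof
    assume "compl x \<in> M"
    then show "x \<notin> M" using M meet_compl[OF x] by (auto simp: pfilter_def)
  next
    assume nx: "x \<notin> M"
    let ?X = "{y\<in>B. \<exists>f\<in>M. meet (meet f x) y = meet f x}"
    have "M \<subseteq> ?X"
    proof
      fix f assume f: "f \<in> M"
      then have fB: "f \<in> B" using MB by auto
      have "meet (meet f x) f = meet f x" using fB x by (metis meet_assoc meet_comm meet_idem)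
      then show "f \<in> ?X" using f fB by blast
    qed
    moreover have "x \<in> ?X"
    proof -
      have "one \<in> M" using M by (simp add: pfilter_def)
      moreover have "meet (meet one x) x = meet one x"
        using x by (metis meet_comm meet_one meet_idem one_in)
      ultimately show ?thesis using x by blast
    qed
    ultimately have "\<not> pfilter ?X" using max nx by blast
    have "zero \<in> ?X"
    proof (rule ccontr)
      assume z: "zero \<notin> ?X"
      have "pfilter ?X" unfolding pfilter_def
      proof (intro conjI ballI impI)
        show "one \<in> ?X" using \<open>M \<subseteq> ?X\<close> M by (auto simp: pfilter_def)
      next
        fix a b assume "a \<in> ?X" "b \<in> ?X"
        then obtain f g where fg: "f \<in> M" "g \<in> M" "meet (meet f x) a = meet f x" "meet (meet g x) b = meet g x"
          and ab: "a \<in> B" "b \<in> B" by blast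
        have fgB: "f \<in> B" "g \<in> B" using fg MB by auto
        have "meet f g \<in> M" using fg M by (auto simp: pfilter_def)
        have 1: "meet (meet f g) x = meet (meet f x) (meet g x)"
          using fgB x by (metis meet_assoc meet_comm meet_idem meet_in)
        have "meet (meet (meet f x) (meet g x)) (meet a b) = meet (meet (meet f x) a) (meet (meet g x) b)"
          using fgB x ab by (metis meet_assoc meet_comm meet_in)
        then have "meet (meet (meet f g) x) (meet a b) = meet (meet f g) x" unfolding 1 fg .
        then show "meet a b \<in> ?X" using \<open>meet f g \<in> M\<close> ab by (auto simp: meet_in)
      next
        fix a b assume "a \<in> ?X" "b \<in> B" "meet a b = a"
        then obtain f where f: "f \<in> M" "meet (meet f x) a = meet f x" "a \<in> B" by blast
        have "meet (meet f x) b = meet f x"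
          using f \<open>b \<in> B\<close> \<open>meet a b = a\<close> x MB by (metis meet_assoc meet_in subsetD)
        then show "b \<in> ?X" using \<open>b \<in> B\<close> f by blast
      qed (use z in auto)
      then show False using \<open>\<not> pfilter ?X\<close> by blast
    qed
    then obtain f where f: "f \<in> M" "meet (meet f x) zero = meet f x" by blast
    have fB: "f \<in> B" using f MB by auto
    have "meet f x = zero" using f fB x by (simp add: meet_zero meet_in)
    then have "f = join zero (meet f (compl x))" using meet_split[OF fB x] by simp
    then have "meet f (compl x) = f" using fB x by (metis join_comm join_zero zero_in meet_in compl_in)
    then show "compl x \<in> M" using M f x by (auto simp: pfilter_def compl_in)
  qed
  then show ?thesis using M by (auto simp: ultra_def)
qed

text \<open>If \<open>x\<close> minus \<open>y\<close> is not zero, its principal filter is proper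
  and extends to an ultrafilter that contains \<open>x\<close> but not \<open>y\<close>. From here
  on identities in the algebra are proved point by point.\<close>

lemma ultra_separates:
  assumes "x \<in> B" "y \<in> B" "\<And>p. ultra p \<Longrightarrow> x \<in> p \<longleftrightarrow> y \<in> p"
  shows "x = y"
proof -
  have *: "meet a (compl b) = zero" if ab: "a \<in> B" "b \<in> B" "\<And>p. ultra p \<Longrightarrow> a \<in> p \<Longrightarrow> b \<in> p" for a b
  proof (rule ccontr)
    assume nz: "meet a (compl b) \<noteq> zero"
    let ?c = "meet a (compl b)"
    have c: "?c \<in> B" using ab by (simp add: meet_in compl_in)
    have "pfilter {y\<in>B. meet ?c y = ?c}" unfolding pfilter_def
    proof (intro conjI ballI impI)
      fix u v assume "u \<in> {y\<in>B. meet ?c y = ?c}" "v \<in> {y\<in>B. meet ?c y = ?c}"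
      then have "u \<in> B" "v \<in> B" "meet ?c u = ?c" "meet ?c v = ?c" by auto
      then have "meet ?c (meet u v) = ?c" using c by (metis meet_assoc)
      then show "meet u v \<in> {y\<in>B. meet ?c y = ?c}" using \<open>u \<in> B\<close> \<open>v \<in> B\<close> by (simp add: meet_in)
    next
      fix u v assume "u \<in> {y\<in>B. meet ?c y = ?c}" "v \<in> B" "meet u v = u"
      then have "u \<in> B" "meet ?c u = ?c" by auto
      then have "meet ?c v = ?c" using c \<open>v \<in> B\<close> \<open>meet u v = u\<close> by (metis meet_assoc)
      then show "v \<in> {y\<in>B. meet ?c y = ?c}" using \<open>v \<in> B\<close> by simp
    qed (use nz c in \<open>auto simp: one_in meet_one meet_zero\<close>)
    then obtain p where p: "ultra p" "{y\<in>B. meet ?c y = ?c} \<subseteq> p" using pfilter_extends by blast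
    have "?c \<in> p" using p(2) c meet_idem[OF c] by auto
    then have "a \<in> p" "compl b \<in> p" using p ab by (auto simp: ultra_meet compl_in)
    then show False using ab p by (auto simp: ultra_compl)
  qed
  have 1: "meet x y = x" if "meet x (compl y) = zero" "x \<in> B" "y \<in> B" for x y
    using meet_split[OF that(2,3)] that by (metis join_zero meet_in)
  have "meet x (compl y) = zero" "meet y (compl x) = zero" using assms by (auto intro!: *)
  then have "meet x y = x" "meet y x = y" using 1 assms(1,2) by blast+
  then show ?thesis using assms meet_comm by metis
qed

text \<open>Compactness of the Stone space in terms of ideals. If the ideal \<open>K\<close> omits
  \<open>one\<close>, the complements of its members form a proper filter; an ultrafilter above it
  avoids all of \<open>K\<close> and is not covered. The order in the hypothesis on downward closure
  is expressed through points, which is the same by separation.\<close>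

lemma ultra_compact:
  assumes KB: "K \<subseteq> B" and join: "\<And>x y. x \<in> K \<Longrightarrow> y \<in> K \<Longrightarrow> join x y \<in> K"
    and down: "\<And>x y. x \<in> K \<Longrightarrow> y \<in> B \<Longrightarrow> (\<And>p. ultra p \<Longrightarrow> y \<in> p \<Longrightarrow> x \<in> p) \<Longrightarrow> y \<in> K"
    and zero: "zero \<in> K" and cover: "\<And>p. ultra p \<Longrightarrow> \<exists>u\<in>K. u \<in> p"
  shows "one \<in> K"
proof (rule ccontr)
  assume n1: "one \<notin> K"
  have cc: "compl (compl x) = x" if "x \<in> B" for x
    by (rule ultra_separates) (use that in \<open>auto simp: compl_in ultra_compl\<close>)
  let ?F = "{x\<in>B. compl x \<in> K}"
  have "pfilter ?F" unfolding pfilter_def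
  proof (intro conjI ballI impI)
    show "one \<in> ?F"
      using zero down[OF zero, of "compl one"] by (auto simp: one_in compl_in ultra_compl ultra_one)
    show "zero \<notin> ?F"
      using n1 down[of "compl zero" one] by (auto simp: one_in zero_in ultra_compl ultra_zero)
  next
    fix x y assume "x \<in> ?F" "y \<in> ?F"
    then have xy: "x \<in> B" "y \<in> B" "join (compl x) (compl y) \<in> K" using join by auto
    have "compl (meet x y) \<in> K"
      using xy by (intro down[OF xy(3)]) (auto simp: compl_in meet_in ultra_join ultra_meet ultra_compl)
    then show "meet x y \<in> ?F" using xy by (simp add: meet_in)
  next
    fix x y assume "x \<in> ?F" "y \<in> B" "meet x y = x"
    then have xy: "x \<in> B" "y \<in> B" "compl x \<in> K" by auto
    have "compl y \<in> K"
      using xy \<open>meet x y = x\<close> ultra_meet[of _ x y] by (intro down[OF xy(3)]) (auto simp: compl_in ultra_compl)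
    then show "y \<in> ?F" using xy by simp
  qed auto
  then obtain p where p: "ultra p" "?F \<subseteq> p" using pfilter_extends by blast
  obtain u where u: "u \<in> K" "u \<in> p" using cover[OF p(1)] by blast
  then have "compl u \<in> ?F" using KB cc by (auto simp: compl_in)
  then show False using p u KB ultra_compl[OF p(1), of u] by blast
qed

end

section \<open>Truth at a point\<close>

lemma sat_AllsD:
  "sat M v (Alls xs \<phi>) \<Longrightarrow> off (set xs) v w \<Longrightarrow> (\<And>x. x \<in> set xs \<Longrightarrow> w x \<in> univ M (fst x)) \<Longrightarrow> sat M w \<phi>"
proof (induction xs arbitrary: v)
  case Nil
  then show ?case by (simp add: Alls_def)
next
  case (Cons x xs)
  have *: "Alls (x # xs) \<phi> = Forall x (Alls xs \<phi>)" by (simp add: Alls_def)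
  have "sat M (v(x := w x)) (Alls xs \<phi>)"
    using Cons.prems(1) Cons.prems(3)[of x] unfolding * by (simp add: Forall_def)
  moreover have "off (set xs) (v(x := w x)) w" using Cons.prems(2) by (auto simp: off_def)
  ultimately show ?case using Cons.IH Cons.prems(3) by simp
qed

text \<open>The symbol \<open>[\<phi>]\<close> belongs to a formula together with a tuple of
  variables; this fixes one tuple for each formula.\<close>

definition fvl :: "('s, 'f, 'r) fm \<Rightarrow> 's var list" where
  "fvl \<phi> = (SOME xs. set xs = fv \<phi> \<and> distinct xs)"

lemma fvl: "set (fvl \<phi>) = fv \<phi>" "distinct (fvl \<phi>)"
proof -
  have "\<exists>xs. set xs = fv \<phi> \<and> distinct xs" using finite_distinct_list by (metis finite_fv)
  then have "set (fvl \<phi>) = fv \<phi> \<and> distinct (fvl \<phi>)" unfolding fvl_def by (rule someI_ex)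
  then show "set (fvl \<phi>) = fv \<phi>" "distinct (fvl \<phi>)" by auto
qed

lemma wf_fv_sorts: "wf_fm L \<phi> \<Longrightarrow> fst ` fv \<phi> \<subseteq> sorts L"
proof -
  have tm: "has_sort L t s \<Longrightarrow> fst ` fv_tm t \<subseteq> sorts L" for t :: "('a, 'b) tm" and s
    by (induction t arbitrary: s) (fastforce simp: list_all2_conv_all_nth in_set_conv_nth)+
  show "wf_fm L \<phi> \<Longrightarrow> fst ` fv \<phi> \<subseteq> sorts L"
  proof (induction \<phi>)
    case (Eq t u)
    then show ?case using tm by fastforce
  next
    case (Rel r ts)
    then show ?case using tm by (fastforce simp: list_all2_conv_all_nth in_set_conv_nth)
  qed auto
qed

lemma fm_in_fvl: "wf_fm L \<phi> \<Longrightarrow> fm_in L (fvl \<phi>) \<phi>"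
  using wf_fv_sorts[of L \<phi>] by (simp add: fm_in_def fvl)

lemma lvar_inj [simp]: "lvar x = lvar y \<longleftrightarrow> x = y"
  by (auto simp: lvar_def prod_eq_iff)
lemma lvar_bvar [simp]: "lvar x \<noteq> bvar i" "bvar i \<noteq> lvar x"
  by (auto simp: lvar_def bvar_def)
lemma bvar_inj [simp]: "bvar i = bvar j \<longleftrightarrow> i = j"
  by (auto simp: bvar_def)
lemma lvar_mem [simp]: "lvar x \<in> lvar ` A \<longleftrightarrow> x \<in> A" by (auto simp: image_iff)
lemma bvar_mem [simp]: "bvar i \<notin> lvar ` A" by auto
lemma fst_lvar [simp]: "fst (lvar x) = LSort (fst x)" by (simp add: lvar_def)
lemma fst_bvar [simp]: "fst (bvar i) = BSort" by (simp add: bvar_def)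

definition mkv :: "('s var \<Rightarrow> 'm) \<Rightarrow> (nat \<Rightarrow> 'm) \<Rightarrow> 's bsort var \<Rightarrow> 'm" where
  "mkv v \<beta> x = (case fst x of LSort s \<Rightarrow> v (s, snd x) | BSort \<Rightarrow> \<beta> (snd x))"

lemma mkv_simps [simp]: "mkv v \<beta> (lvar x) = v x" "mkv v \<beta> (bvar i) = \<beta> i"
  by (auto simp: mkv_def lvar_def bvar_def)

lemma mkv_comp [simp]: "mkv v \<beta> \<circ> lvar = v" by auto

text \<open>\<open>ty\<close> fixes the type of the models of \<open>T\<close> in which entailment
  is tested, while \<open>M\<close> has elements of a type \<open>'m\<close> unrelated to it. The
  hypotheses on \<open>T\<close> thus say nothing directly about structures made from elements of
  \<open>M\<close>.\<close>

locale bvmodel =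
  fixes ty :: "'u itself" and L :: "('s, 'f, 'r) lang" and T :: "('s, 'f, 'r) fm set"
    and M :: "('s bsort, ('s, 'f, 'r) bfun, unit, 'm) struct"
  assumes wfL: "wf_lang L" and TL: "theory_in L T"
    and M: "is_model (boole_lang L) (atomless_theory ty L T) M"
begin

abbreviation "BL \<equiv> boole_lang L"
abbreviation "Th \<equiv> atomless_theory ty L T"
abbreviation "U \<equiv> \<lambda>s. univ M (LSort s)"
abbreviation "BB \<equiv> univ M BSort"
abbreviation "bmt x y \<equiv> fint M Meet [x, y]"
abbreviation "bjn x y \<equiv> fint M Join [x, y]"
abbreviation "bcm x \<equiv> fint M Compl [x]"
abbreviation "b0 \<equiv> fint M Zero []"
abbreviation "b1 \<equiv> fint M One []"

lemma is_struct_M: "is_struct BL M" using M by (simp add: is_model_def)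

lemma BL_sorts [simp]: "BSort \<in> sorts BL" "LSort s \<in> sorts BL \<longleftrightarrow> s \<in> sorts L"
  by (auto simp: boole_lang_def)

lemma univ_ne: "s \<in> sorts BL \<Longrightarrow> univ M s \<noteq> {}" using is_struct_M by (simp add: is_struct_def)

lemma fint_in: "f \<in> funs BL \<Longrightarrow> list_all2 (\<lambda>a s. a \<in> univ M s) as (boole_fargs f) \<Longrightarrow> fint M f as \<in> BB"
  using is_struct_M by (auto simp: is_struct_def boole_lang_def tuples_iff)

lemma axiomD:
  assumes "Alls xs \<psi> \<in> Th" "fv \<psi> \<subseteq> set xs" "\<And>x. x \<in> set xs \<Longrightarrow> w x \<in> univ M (fst x)"
  shows "sat M w \<psi>"
proof -
  have "holds M [] (Alls xs \<psi>) []" using M assms(1) by (simp add: is_model_def)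
  then have "sat M w (Alls xs \<psi>)"
    unfolding holds_def using assms(2) by (subst sat_cong[of _ w]) auto
  then show ?thesis by (rule sat_AllsD) (auto intro: assms(3))
qed

lemma ba_axiomD:
  assumes "BAlls is \<psi> \<in> boolean_algebra_axioms \<union> atomless_axioms" "fv \<psi> \<subseteq> bvar ` set is"
    "\<And>i. i \<in> set is \<Longrightarrow> \<beta> i \<in> BB"
  shows "sat M (mkv v \<beta>) \<psi>"
  using assms by (intro axiomD[of "map bvar is"]) (auto simp: atomless_theory_def boole_theory_def)

lemma ba: "carrier_ba BB (\<lambda>x y. bmt x y) (\<lambda>x y. bjn x y) (\<lambda>x. bcm x) b0 b1"
proof -
  define \<beta> where "\<beta> x y z i = (if i = 0 then x else if i = Suc 0 then y else z)" for x y z :: 'm and i :: nat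
  have \<beta>: "\<beta> x y z i \<in> BB" if "x \<in> BB" "y \<in> BB" "z \<in> BB" for x y z i
    using that by (simp add: \<beta>_def)
  have \<beta>s [simp]: "\<beta> x y z 0 = x" "\<beta> x y z (Suc 0) = y" "\<beta> x y z 2 = z" for x y z
    by (simp_all add: \<beta>_def)
  note defs = bv_def bmeet_def bjoin_def bcompl_def bone_def bzero_def
  have ax: "sat M (mkv v (\<beta> x y z)) \<psi>"
    if "BAlls is \<psi> \<in> boolean_algebra_axioms" "fv \<psi> \<subseteq> bvar ` set is" "x \<in> BB" "y \<in> BB" "z \<in> BB"
    for x y z "is" \<psi> v
    using that by (intro ba_axiomD[of "is"] \<beta>) auto
  show ?thesis
  proof (unfold_locales, goal_cases)
    case (6 x y z)
    then show ?case using ax[of "[0,1,2]" "Eq (bmeet (bmeet (bv 0) (bv 1)) (bv 2)) (bmeet (bv 0) (bmeet (bv 1) (bv 2)))" x y z]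
      by (simp add: boolean_algebra_axioms_def defs)
  next
    case (7 x y)
    then show ?case using ax[of "[0,1]" "Eq (bmeet (bv 0) (bv 1)) (bmeet (bv 1) (bv 0))" x y x]
      by (simp add: boolean_algebra_axioms_def defs)
  next
    case (8 x y)
    then show ?case using ax[of "[0,1]" "Eq (bjoin (bv 0) (bv 1)) (bjoin (bv 1) (bv 0))" x y x]
      by (simp add: boolean_algebra_axioms_def defs)
  next
    case (9 x y z)
    then show ?case using ax[of "[0,1,2]" "Eq (bmeet (bv 0) (bjoin (bv 1) (bv 2)))
                       (bjoin (bmeet (bv 0) (bv 1)) (bmeet (bv 0) (bv 2)))" x y z]
      by (simp add: boolean_algebra_axioms_def defs)
  next
    case (10 x y z)
    then show ?case using ax[of "[0,1,2]" "Eq (bjoin (bv 0) (bmeet (bv 1) (bv 2)))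
                       (bmeet (bjoin (bv 0) (bv 1)) (bjoin (bv 0) (bv 2)))" x y z]
      by (simp add: boolean_algebra_axioms_def defs)
  next
    case (11 x)
    then show ?case using ax[of "[0]" "Eq (bmeet (bv 0) bone) (bv 0)" x x x]
      by (simp add: boolean_algebra_axioms_def defs)
  next
    case (12 x)
    then show ?case using ax[of "[0]" "Eq (bjoin (bv 0) bzero) (bv 0)" x x x]
      by (simp add: boolean_algebra_axioms_def defs)
  next
    case (13 x)
    then show ?case using ax[of "[0]" "Eq (bmeet (bv 0) (bcompl (bv 0))) bzero" x x x]
      by (simp add: boolean_algebra_axioms_def defs)
  next
    case (14 x)
    then show ?case using ax[of "[0]" "Eq (bjoin (bv 0) (bcompl (bv 0))) bone" x x x]
      by (simp add: boolean_algebra_axioms_def defs)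
  qed (auto intro!: fint_in simp: boole_lang_def)
qed

sublocale ba: carrier_ba BB "\<lambda>x y. bmt x y" "\<lambda>x y. bjn x y" "\<lambda>x. bcm x" b0 b1 by (rule ba)

definition "\<Omega> = {p. ba.ultra p}"

lemma zero_one: "b0 \<noteq> b1"
proof -
  have "Alls [] (Neg (Eq bzero bone)) \<in> Th"
    by (simp add: Alls_def atomless_theory_def atomless_axioms_def)
  from axiomD[OF this, of "\<lambda>_. undefined"] show ?thesis by (simp add: bzero_def bone_def)
qed

lemma point_mem [simp]:
  assumes "p \<in> \<Omega>"
  shows "b1 \<in> p" "b0 \<notin> p" "x \<in> BB \<Longrightarrow> bcm x \<in> p \<longleftrightarrow> x \<notin> p"
    "x \<in> BB \<Longrightarrow> y \<in> BB \<Longrightarrow> bmt x y \<in> p \<longleftrightarrow> x \<in> p \<and> y \<in> p"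
    "x \<in> BB \<Longrightarrow> y \<in> BB \<Longrightarrow> bjn x y \<in> p \<longleftrightarrow> x \<in> p \<or> y \<in> p"
  using assms ba.ultra_meet ba.ultra_join ba.ultra_compl ba.ultra_one ba.ultra_zero by (auto simp: \<Omega>_def)

lemma B_eqI: "x \<in> BB \<Longrightarrow> y \<in> BB \<Longrightarrow> (\<And>p. p \<in> \<Omega> \<Longrightarrow> x \<in> p \<longleftrightarrow> y \<in> p) \<Longrightarrow> x = y"
  by (rule ba.ultra_separates) (auto simp: \<Omega>_def)

lemma B_nonzero: assumes "x \<in> BB" "x \<noteq> b0" shows "\<exists>p\<in>\<Omega>. x \<in> p"
  using assms B_eqI[of x b0] ba.zero_in by auto

text \<open>A nonzero \<open>w\<close> has a part \<open>z\<close> such that both \<open>z\<close>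
  and its complement in \<open>w\<close> are nonzero. A point \<open>r0\<close> lies in at most one
  of the two, and the other one is kept; this removes the points of \<open>F\<close> one by one. The
  splitting axiom of atomless algebras is used here and nowhere else.\<close>

lemma no_isolated:
  assumes "p \<in> \<Omega>" "u \<in> BB" "u \<in> p" "finite F" "F \<subseteq> \<Omega>"
  shows "\<exists>q\<in>\<Omega>. \<exists>w\<in>BB. w \<in> q \<and> (\<forall>r\<in>\<Omega>. w \<in> r \<longrightarrow> u \<in> r) \<and> (\<forall>r\<in>F. w \<notin> r)"
proof -
  have half: "\<exists>w\<in>BB. w \<noteq> b0 \<and> bmt w u = w \<and> w \<noteq> u" if u: "u \<in> BB" "u \<noteq> b0" for u
  proof -
    let ?\<psi> = "Imp (Neg (Eq (bv 0) bzero))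
       (Exists (bvar 1) (Conjs [ble (bv 1) (bv 0), Neg (Eq (bv 1) bzero), Neg (Eq (bv 1) (bv 0))]))"
    have "sat M (mkv (\<lambda>_. undefined) (\<lambda>_. u)) ?\<psi>"
      using u by (intro ba_axiomD[of "[0]"]) (auto simp: atomless_axioms_def bv_def bzero_def Conjs_def ble_def bmeet_def)
    then show ?thesis using u
      by (auto simp: Imp_def bv_def bzero_def Conjs_def ble_def bmeet_def)
  qed
  have "\<exists>w\<in>BB. w \<noteq> b0 \<and> (\<forall>r\<in>\<Omega>. w \<in> r \<longrightarrow> u \<in> r) \<and> (\<forall>r\<in>F. w \<notin> r)"
    using assms(4,5)
  proof (induction F)
    case empty
    then show ?case using assms by (intro bexI[of _ u]) auto
  next
    case (insert r0 F)
    then obtain w where w: "w \<in> BB" "w \<noteq> b0" "\<forall>r\<in>\<Omega>. w \<in> r \<longrightarrow> u \<in> r" "\<forall>r\<in>F. w \<notin> r" by auto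
    obtain z where z: "z \<in> BB" "z \<noteq> b0" "bmt z w = z" "z \<noteq> w" using half[OF w(1,2)] by blast
    have zw: "w \<in> r" if "r \<in> \<Omega>" "z \<in> r" for r using z w that by (metis point_mem(4))
    let ?y = "bmt w (bcm z)"
    have y: "?y \<in> BB" using w z by (simp add: ba.meet_in ba.compl_in)
    have "?y \<noteq> b0"
    proof
      assume y0: "?y = b0"
      have "z \<in> r" if "r \<in> \<Omega>" "w \<in> r" for r
      proof (rule ccontr)
        assume "z \<notin> r"
        then have "?y \<in> r" using that w z by (simp add: ba.compl_in)
        then show False using y0 that by simp
      qed
      then show False using B_eqI[of z w] zw w z by blast
    qed
    show ?case
    proof (cases "z \<in> r0")
      case False
      then show ?thesis using w z zw insert.prems by (intro bexI[of _ z]) auto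
    next
      case True
      have "\<forall>r\<in>insert r0 F. ?y \<notin> r" using True w z insert.prems by (auto simp: ba.compl_in)
      moreover have "\<forall>r\<in>\<Omega>. ?y \<in> r \<longrightarrow> u \<in> r" using w z by (auto simp: ba.compl_in)
      ultimately show ?thesis using y \<open>?y \<noteq> b0\<close> by blast
    qed
  qed
  then show ?thesis using B_nonzero by metis
qed

end

section \<open>Boolean values of formulas and the semantic reading of the axioms\<close>

context bvmodel begin

abbreviation "val v xs \<phi> \<equiv> fint M (Val xs \<phi>) (map v xs)"
abbreviation "gdL \<equiv> gd L U"
abbreviation "gdB \<equiv> gd BL (univ M)"

lemma fm_in_sort: "fm_in L' xs \<phi> \<Longrightarrow> x \<in> set xs \<Longrightarrow> fst x \<in> sorts L'"
  by (auto simp: fm_in_def)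

lemma mkv_lvar_in:
  assumes "gdL v" "fst ` A \<subseteq> sorts L" "x \<in> lvar ` A"
  shows "mkv v \<beta> x \<in> univ M (fst x)"
proof -
  obtain y where y: "x = lvar y" "y \<in> A" using assms(3) by (rule imageE)
  then have "fst y \<in> sorts L" using assms(2) by (metis image_subset_iff)
  then show ?thesis using y assms(1) by (simp add: gd_def)
qed

lemma val_in: "fm_in L xs \<phi> \<Longrightarrow> gdL v \<Longrightarrow> val v xs \<phi> \<in> BB"
  by (rule fint_in)
    (auto simp: boole_lang_def list_all2_conv_all_nth intro!: gd_in[of L U v] dest: fm_in_sort nth_mem)

lemma eval_bval [simp]: "eval_tm M w (bval xs \<phi>) = val (w \<circ> lvar) xs \<phi>"
  by (simp add: bval_def comp_def)

lemma fv_bval [simp]: "fv_tm (bval xs \<phi>) = lvar ` set xs"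
  by (auto simp: bval_def)

lemma val_axD:
  assumes "LAlls xs (Eq t u) \<in> Th" "gdL v" "fst ` set xs \<subseteq> sorts L" "fv_tm t \<union> fv_tm u \<subseteq> lvar ` set xs"
  shows "eval_tm M (mkv v \<beta>) t = eval_tm M (mkv v \<beta>) u"
proof -
  have "sat M (mkv v \<beta>) (Eq t u)"
    using assms(3,4) mkv_lvar_in[OF assms(2,3)] by (intro axiomD[OF assms(1)]) simp_all
  then show ?thesis by simp
qed

lemma Th_valid: "fm_in L xs \<phi> \<Longrightarrow> entails ty L T (Alls xs \<phi>) \<Longrightarrow> LAlls xs (Eq (bval xs \<phi>) bone) \<in> Th"
  by (auto simp: atomless_theory_def boole_theory_def validity_axioms_def)

lemma Th_hom: "\<psi> \<in> homomorphism_axioms L \<Longrightarrow> \<psi> \<in> Th"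
  by (auto simp: atomless_theory_def boole_theory_def)

lemma val_valid:
  assumes "fm_in L xs \<phi>" "entails ty L T (Alls xs \<phi>)" "gdL v"
  shows "val v xs \<phi> = b1"
  using val_axD[OF Th_valid[OF assms(1,2)] assms(3)] assms(1)
  by (auto simp: fm_in_def bone_def)

lemma val_Bot: assumes "fm_in L xs Bot" "gdL v" shows "val v xs Bot = b0"
proof -
  have "LAlls xs (Eq (bval xs Bot) bzero) \<in> Th"
    using assms by (intro Th_hom) (auto simp: homomorphism_axioms_def)
  from val_axD[OF this assms(2)] show ?thesis using assms(1) by (auto simp: fm_in_def bzero_def)
qed

lemma val_Neg: assumes "fm_in L xs \<phi>" "gdL v" shows "val v xs (Neg \<phi>) = bcm (val v xs \<phi>)"
proof -
  have "LAlls xs (Eq (bval xs (Neg \<phi>)) (bcompl (bval xs \<phi>))) \<in> Th"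
    using assms by (intro Th_hom) (auto simp: homomorphism_axioms_def)
  from val_axD[OF this assms(2)] show ?thesis using assms(1) by (auto simp: fm_in_def bcompl_def)
qed

lemma val_Conj:
  assumes "fm_in L xs \<phi>" "fm_in L xs \<psi>" "gdL v"
  shows "val v xs (Conj \<phi> \<psi>) = bmt (val v xs \<phi>) (val v xs \<psi>)"
proof -
  have "LAlls xs (Eq (bval xs (Conj \<phi> \<psi>)) (bmeet (bval xs \<phi>) (bval xs \<psi>))) \<in> Th"
    using assms by (intro Th_hom) (auto simp: homomorphism_axioms_def)
  from val_axD[OF this assms(3)] show ?thesis using assms(1) by (auto simp: fm_in_def bmeet_def)
qed

lemma val_dummy:
  assumes "fm_in L xs \<phi>" "fm_in L ys \<phi>" "gdL v"
  shows "val v xs \<phi> = val v ys \<phi>"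
proof -
  have "LAlls (xs @ ys) (Eq (bval xs \<phi>) (bval ys \<phi>)) \<in> Th"
    using assms by (intro Th_hom) (auto simp: homomorphism_axioms_def)
  moreover have "fst ` set (xs @ ys) \<subseteq> sorts L" using assms(1,2) by (auto simp: fm_in_def)
  ultimately have "eval_tm M (mkv v (\<lambda>_. b0)) (bval xs \<phi>) = eval_tm M (mkv v (\<lambda>_. b0)) (bval ys \<phi>)"
    by (rule val_axD[OF _ assms(3)]) auto
  then show ?thesis by simp
qed

lemma val_Eq:
  assumes "x \<noteq> y" "fst x = fst y" "fst x \<in> sorts L" "gdL v"
  shows "v x = v y \<longleftrightarrow> val v [x, y] (Eq (Var x) (Var y)) = b1"
proof -
  let ?\<psi> = "Iff (Eq (Var (lvar x)) (Var (lvar y))) (Eq (bval [x, y] (Eq (Var x) (Var y))) bone)"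
  have "LAlls [x, y] ?\<psi> \<in> Th"
  proof -
    have "LAlls [x, y] ?\<psi> \<in> equality_axioms L"
      unfolding equality_axioms_def using assms(1-3) by blast
    then show ?thesis by (simp add: atomless_theory_def boole_theory_def)
  qed
  then have "sat M (mkv v (\<lambda>_. undefined)) ?\<psi>"
    by (rule axiomD) (use assms(1-3) in \<open>auto simp: bone_def intro!: gd_in[OF assms(4)]\<close>)
  then show ?thesis by (auto simp: Iff_def Imp_def bone_def)
qed

lemma glue_axiom:
  assumes ps: "ps \<noteq> []"
    "\<And>\<psi> \<phi>. (\<psi>, \<phi>) \<in> set ps \<Longrightarrow> fm_in L ys \<psi> \<and> fm_in L (xs @ ys) \<phi> \<and> entails ty L T (Alls ys (Imp \<psi> (Exs xs \<phi>)))"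
    and v: "gdL v" and \<beta>: "\<And>i. i < length ps \<Longrightarrow> \<beta> i \<in> BB"
    and disj: "\<And>i j. i < length ps \<Longrightarrow> j < i \<Longrightarrow> bmt (\<beta> i) (\<beta> j) = b0"
    and le: "\<And>i. i < length ps \<Longrightarrow> bmt (\<beta> i) (val v ys (fst (ps ! i))) = \<beta> i"
  shows "\<exists>w. gdL w \<and> off (set xs) v w \<and> (\<forall>i<length ps. bmt (\<beta> i) (val w (xs @ ys) (snd (ps ! i))) = \<beta> i)"
proof -
  let ?n = "length ps"
  let ?C1 = "Conjs [Eq (bmeet (bv i) (bv j)) bzero. i \<leftarrow> [0..<?n], j \<leftarrow> [0..<i]] :: ('s, 'f, 'r) bfm"
  let ?C2 = "Conjs [ble (bv i) (bval ys (fst (ps ! i))). i \<leftarrow> [0..<?n]]"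
  let ?C3 = "Conjs [ble (bv i) (bval (xs @ ys) (snd (ps ! i))). i \<leftarrow> [0..<?n]]"
  let ?\<psi> = "Imp (Conj ?C1 ?C2) (LExs xs ?C3)"
  have "gluing_axiom xs ys ps \<in> Th"
    using ps unfolding atomless_theory_def boole_theory_def gluing_axioms_def by fastforce
  moreover have "gluing_axiom xs ys ps = Alls (map bvar [0..<?n] @ map lvar ys) ?\<psi>"
    by (simp add: gluing_axiom_def Alls_def Let_def)
  ultimately have ax: "Alls (map bvar [0..<?n] @ map lvar ys) ?\<psi> \<in> Th" by simp
  obtain \<psi>0 \<phi>0 where p0: "(\<psi>0, \<phi>0) \<in> set ps" using ps(1) by (metis list.set_intros(1) neq_Nil_conv surj_pair)
  then have xys: "fst ` set (xs @ ys) \<subseteq> sorts L" "distinct (xs @ ys)" using ps(2) by (auto simp: fm_in_def)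
  let ?w = "mkv v \<beta>"
  have "sat M ?w ?\<psi>"
  proof (rule axiomD[OF ax])
    show "fv ?\<psi> \<subseteq> set (map bvar [0..<?n] @ map lvar ys)"
      by (auto simp: fv_Conjs ble_def bmeet_def bv_def bzero_def)
    show "?w x \<in> univ M (fst x)" if "x \<in> set (map bvar [0..<?n] @ map lvar ys)" for x
    proof (cases "x \<in> lvar ` set ys")
      case True
      then show ?thesis using xys(1) by (intro mkv_lvar_in[OF v, of "set ys"]) auto
    next
      case False
      then show ?thesis using that \<beta> by auto
    qed
  qed
  moreover have "sat M ?w ?C1" using disj by (auto simp: sat_Conjs bmeet_def bv_def bzero_def)
  moreover have "sat M ?w ?C2" using le by (auto simp: sat_Conjs ble_def bmeet_def bv_def)
  ultimately have ex: "sat M ?w (LExs xs ?C3)" by (auto simp: Imp_def)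
  \<comment> \<open>The values \<open>\<beta> i\<close> lie in the algebra only for \<open>i\<close>
    below \<open>length ps\<close>, so the assignment need not be good at all
    \<open>B\<close>-variables. The quantifier block is therefore unfolded by hand, with control of
    the \<open>L\<close>-part alone.\<close>
  have *: "sat M z (LExs xs \<chi>) \<Longrightarrow> gd L U (z \<circ> lvar) \<Longrightarrow> fst ` set xs \<subseteq> sorts L \<Longrightarrow>
      \<exists>z'. gd L U (z' \<circ> lvar) \<and> off (lvar ` set xs) z z' \<and> sat M z' \<chi>" for z \<chi> and xs :: "'s var list"
  proof (induction xs arbitrary: z)
    case Nil
    then show ?case by (auto simp: Exs_def)
  next
    case (Cons x xs)
    then obtain a where a: "a \<in> U (fst x)" "sat M (z(lvar x := a)) (LExs xs \<chi>)" by (auto simp: Exs_def)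
    have "z(lvar x := a) \<circ> lvar = (z \<circ> lvar)(x := a)" by auto
    then have "gd L U (z(lvar x := a) \<circ> lvar)" using Cons.prems(2) a(1) gd_upd by metis
    then obtain z' where "gd L U (z' \<circ> lvar)" "off (lvar ` set xs) (z(lvar x := a)) z'" "sat M z' \<chi>"
      using Cons.IH[OF a(2)] Cons.prems(3) by (metis image_subset_iff list.set_intros(2))
    then show ?case by (intro exI[of _ z'] conjI) (assumption | simp add: off_def)+
  qed
  obtain z where z: "gd L U (z \<circ> lvar)" "off (lvar ` set xs) ?w z" "sat M z ?C3"
    using *[OF ex] v xys by auto
  have "bmt (\<beta> i) (val (z \<circ> lvar) (xs @ ys) (snd (ps ! i))) = \<beta> i" if "i < ?n" for i
  proof -
    have "bvar i \<notin> lvar ` set xs" by auto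
    then have "z (bvar i) = \<beta> i" using off_apply[OF z(2), of "bvar i"] by simp
    moreover have "sat M z (ble (bv i) (bval (xs @ ys) (snd (ps ! i))))"
      using z(3) that unfolding sat_Conjs by auto
    ultimately show ?thesis by (simp add: ble_def bmeet_def bv_def del: map_append)
  qed
  moreover have "off (set xs) v (z \<circ> lvar)" using z(2) by (auto simp: off_def)
  ultimately show ?thesis using z(1) by blast
qed

text \<open>The source of all logical facts about a point: a formula is checked in ordinary models
  of \<open>T\<close> over \<open>'u\<close>, and the validity axioms then make its Boolean value
  equal to one. This replaces derivations in a calculus.\<close>

definition valid :: "('s, 'f, 'r) fm \<Rightarrow> bool" where
  "valid \<phi> \<longleftrightarrow> wf_fm L \<phi> \<and>
     (\<forall>N :: ('s, 'f, 'r, 'u) struct. is_model L T N \<longrightarrow> (\<forall>v. gd L (univ N) v \<longrightarrow> sat N v \<phi>))"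

lemma validI:
  assumes "wf_fm L \<phi>"
    "\<And>(N :: ('s, 'f, 'r, 'u) struct) v. is_struct L N \<Longrightarrow> is_model L T N \<Longrightarrow> gd L (univ N) v \<Longrightarrow> sat N v \<phi>"
  shows "valid \<phi>"
  using assms by (auto simp: valid_def is_model_def)

lemma valid_entails:
  assumes "valid \<phi>" "fm_in L xs \<phi>"
  shows "entails ty L T (Alls xs \<phi>)"
  unfolding entails_def
proof (intro allI impI)
  fix N :: "('s, 'f, 'r, 'u) struct" assume N: "is_model L T N"
  interpret N: tarski L "univ N" "sat N" "\<lambda>_. (=)" using N by (intro tarski_sat) (simp add: is_model_def)
  obtain v where v: "gd L (univ N) v" using gd_ex N.nonempty by metis
  have "sat N v (Alls xs \<phi>)" using assms N v by (subst N.S_Alls) (auto simp: valid_def fm_in_def)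
  then show "holds N [] (Alls xs \<phi>) []"
    unfolding holds_def using assms(2) by (subst sat_cong[of _ _ v]) (auto simp: fm_in_def)
qed

section \<open>Truth at a point satisfies Tarski's conditions\<close>

definition tr :: "'m set \<Rightarrow> ('s var \<Rightarrow> 'm) \<Rightarrow> ('s, 'f, 'r) fm \<Rightarrow> bool" where
  "tr p v \<phi> \<longleftrightarrow> val v (fvl \<phi>) \<phi> \<in> p"

lemma tr_iff: "fm_in L xs \<phi> \<Longrightarrow> gdL v \<Longrightarrow> tr p v \<phi> \<longleftrightarrow> val v xs \<phi> \<in> p"
  unfolding tr_def by (metis fm_in_fvl fm_in_def val_dummy)

lemma tr_valid: "valid \<phi> \<Longrightarrow> gdL v \<Longrightarrow> p \<in> \<Omega> \<Longrightarrow> tr p v \<phi>"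
  by (simp add: tr_def val_valid valid_entails fm_in_fvl valid_def)

lemma tr_fv: "(\<And>x. x \<in> fv \<phi> \<Longrightarrow> v x = w x) \<Longrightarrow> tr p v \<phi> = tr p w \<phi>"
proof -
  assume "\<And>x. x \<in> fv \<phi> \<Longrightarrow> v x = w x"
  then have "map v (fvl \<phi>) = map w (fvl \<phi>)" by (simp add: fvl)
  then show ?thesis by (simp only: tr_def)
qed

lemma tr_Bot: "gdL v \<Longrightarrow> p \<in> \<Omega> \<Longrightarrow> \<not> tr p v Bot"
  by (simp add: tr_def val_Bot fm_in_fvl)

lemma tr_Neg: "gdL v \<Longrightarrow> p \<in> \<Omega> \<Longrightarrow> wf_fm L \<phi> \<Longrightarrow> tr p v (Neg \<phi>) \<longleftrightarrow> \<not> tr p v \<phi>"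
  using fm_in_fvl[of L \<phi>]
  by (subst (1 2) tr_iff[of "fvl \<phi>"]) (auto simp: val_Neg val_in fm_in_def)

lemma tr_Conj:
  assumes "gdL v" "p \<in> \<Omega>" "wf_fm L \<phi>" "wf_fm L \<psi>"
  shows "tr p v (Conj \<phi> \<psi>) \<longleftrightarrow> tr p v \<phi> \<and> tr p v \<psi>"
proof -
  let ?xs = "fvl (Conj \<phi> \<psi>)"
  have "fm_in L ?xs (Conj \<phi> \<psi>)" using assms by (intro fm_in_fvl) simp
  then have "fm_in L ?xs \<phi>" "fm_in L ?xs \<psi>" by (auto simp: fm_in_def)
  then show ?thesis using assms \<open>fm_in L ?xs (Conj \<phi> \<psi>)\<close> by (simp add: tr_iff[of ?xs] val_Conj val_in)
qed

lemma tr_Imp: "gdL v \<Longrightarrow> p \<in> \<Omega> \<Longrightarrow> wf_fm L \<phi> \<Longrightarrow> wf_fm L \<psi> \<Longrightarrow> tr p v (Imp \<phi> \<psi>) \<longleftrightarrow> (tr p v \<phi> \<longrightarrow> tr p v \<psi>)"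
  by (simp add: Imp_def tr_Neg tr_Conj)

lemma tr_Iff: "gdL v \<Longrightarrow> p \<in> \<Omega> \<Longrightarrow> wf_fm L \<phi> \<Longrightarrow> wf_fm L \<psi> \<Longrightarrow> tr p v (Iff \<phi> \<psi>) \<longleftrightarrow> (tr p v \<phi> \<longleftrightarrow> tr p v \<psi>)"
  by (auto simp: Iff_def tr_Imp tr_Conj)

text \<open>The gluing axiom for the single pair of \<exists>x. \<phi> and \<phi>, with the value of
  \<exists>x. \<phi> as the Boolean element, yields one witness that works at all points of that
  value at once. The converse is the transfer of the valid formula \<phi> \<longrightarrow>
  (\<exists>x. \<phi>).\<close>

lemma tr_Exists:
  assumes "gdL v" "wf_fm L \<phi>" "fst x \<in> sorts L" "p \<in> \<Omega>"
  shows "tr p v (Exists x \<phi>) \<longleftrightarrow> (\<exists>a\<in>U (fst x). tr p (v(x := a)) \<phi>)"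
proof
  assume t: "tr p v (Exists x \<phi>)"
  let ?ys = "fvl (Exists x \<phi>)"
  have ys: "fm_in L ?ys (Exists x \<phi>)" using assms by (intro fm_in_fvl) simp
  have xys: "fm_in L ([x] @ ?ys) \<phi>" using ys assms(3) by (auto simp: fm_in_def fvl)
  let ?\<beta> = "val v ?ys (Exists x \<phi>)"
  have ent: "entails ty L T (Alls ?ys (Imp (Exists x \<phi>) (Exs [x] \<phi>)))"
    using ys by (intro valid_entails validI) (auto simp: fm_in_def Imp_def Exs_def)
  have "\<exists>w. gdL w \<and> off (set [x]) v w \<and>
      (\<forall>i<length [(Exists x \<phi>, \<phi>)]. bmt ?\<beta> (val w ([x] @ ?ys) (snd ([(Exists x \<phi>, \<phi>)] ! i))) = ?\<beta>)"
    using ys xys ent val_in[OF ys assms(1)] by (intro glue_axiom[OF _ _ assms(1)]) (auto simp: assms ba.meet_idem)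
  then obtain w where w: "gdL w" "off {x} v w" "bmt ?\<beta> (val w ([x] @ ?ys) \<phi>) = ?\<beta>"
    by (auto simp del: map_append)
  have "?\<beta> \<in> p" using t tr_iff[OF ys assms(1)] by simp
  then have "val w ([x] @ ?ys) \<phi> \<in> p"
    using w(3) val_in[OF ys assms(1)] val_in[OF xys w(1)] assms(4) by (metis point_mem(4))
  then have "tr p w \<phi>" using tr_iff[OF xys w(1)] by simp
  moreover have "w = v(x := w x)" using w(2) by (auto simp: off_def)
  moreover have "w x \<in> U (fst x)" using w(1) assms(3) by (simp add: gd_def)
  ultimately show "\<exists>a\<in>U (fst x). tr p (v(x := a)) \<phi>" by metis
next
  assume "\<exists>a\<in>U (fst x). tr p (v(x := a)) \<phi>"
  then obtain a where a: "a \<in> U (fst x)" "tr p (v(x := a)) \<phi>" by blast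
  have g: "gdL (v(x := a))" using assms(1) a(1) by (simp add: gd_upd)
  have "valid (Imp \<phi> (Exists x \<phi>))"
  proof (rule validI)
    fix N :: "('s, 'f, 'r, 'u) struct" and v assume "gd L (univ N) v"
    then have "v x \<in> univ N (fst x)" using assms(3) by (simp add: gd_def)
    then have "sat N (v(x := v x)) \<phi> \<longrightarrow> sat N v (Exists x \<phi>)" unfolding sat.simps by blast
    then show "sat N v (Imp \<phi> (Exists x \<phi>))" by (simp add: Imp_def)
  qed (use assms in simp)
  then have "tr p (v(x := a)) (Imp \<phi> (Exists x \<phi>))" by (rule tr_valid[OF _ g assms(4)])
  then have "tr p (v(x := a)) (Exists x \<phi>)" using tr_Imp[OF g assms(4,2), of "Exists x \<phi>"] assms(2,3) a(2) by simp
  then show "tr p v (Exists x \<phi>)" by (subst tr_fv[of _ _ "v(x := a)"]) auto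
qed

text \<open>Equality in the stalk, as a relation between elements. The variables
  \<open>(s, 0)\<close> and \<open>(s, 1)\<close> are arbitrary representatives;
  \<open>tr_Eq\<close> shows that any others give the same relation.\<close>

definition eqv :: "'m set \<Rightarrow> 's \<Rightarrow> 'm \<Rightarrow> 'm \<Rightarrow> bool" where
  "eqv p s a b \<longleftrightarrow> fint M (Val [(s, 0), (s, 1)] (Eq (Var (s, 0)) (Var (s, 1)))) [a, b] \<in> p"

lemma fm_in_Eq: "x \<noteq> y \<Longrightarrow> fst x = fst y \<Longrightarrow> fst x \<in> sorts L \<Longrightarrow> fm_in L [x, y] (Eq (Var x) (Var y))"
  by (auto simp: fm_in_def)

lemma wf_Eq_var [simp]: "wf_fm L (Eq (Var x) (Var y)) \<longleftrightarrow> fst x = fst y \<and> fst x \<in> sorts L"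
  by auto

lemma tr_Eq_refl:
  assumes "x \<noteq> y" "fst x = fst y" "fst x \<in> sorts L" "gdL v" "v x = v y" "p \<in> \<Omega>"
  shows "tr p v (Eq (Var x) (Var y))"
  using tr_iff[OF fm_in_Eq[OF assms(1-3)] assms(4)] val_Eq[OF assms(1-4)] assms(5,6) by simp

lemma tr_Eq_move:
  assumes "gdL v" "p \<in> \<Omega>" "fst x \<in> sorts L" "fst y = fst x" "fst x' = fst x" "fst y' = fst x"
    "{x, y} \<inter> {x', y'} = {}" "v x = v x'" "v y = v y'"
  shows "tr p v (Eq (Var x) (Var y)) = tr p v (Eq (Var x') (Var y'))"
proof -
  have "valid (Imp (Conj (Eq (Var x) (Var x')) (Eq (Var y) (Var y'))) (Iff (Eq (Var x) (Var y)) (Eq (Var x') (Var y'))))"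
    using assms by (intro validI) (auto simp: Imp_def Iff_def)
  from tr_valid[OF this assms(1,2)]
  have "tr p v (Eq (Var x) (Var x')) \<and> tr p v (Eq (Var y) (Var y')) \<longrightarrow> tr p v (Iff (Eq (Var x) (Var y)) (Eq (Var x') (Var y')))"
    using assms by (simp add: tr_Imp tr_Conj)
  moreover have "tr p v (Eq (Var x) (Var x'))" "tr p v (Eq (Var y) (Var y'))"
    using assms by (auto intro!: tr_Eq_refl)
  ultimately show ?thesis using assms by (simp add: tr_Iff)
qed

text \<open>The variables \<open>x\<close> and \<open>y\<close> may coincide or overlap with the
  standard pair, and \<open>tr_Eq_move\<close> works between disjoint pairs only. Hence two moves,
  with the fresh pair \<open>x2\<close>, \<open>y2\<close> in between.\<close>

lemma tr_Eq:
  assumes "gdL v" "p \<in> \<Omega>" "fst x = fst y" "fst x \<in> sorts L"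
  shows "tr p v (Eq (Var x) (Var y)) \<longleftrightarrow> eqv p (fst x) (v x) (v y)"
proof -
  let ?s = "fst x" let ?x0 = "(?s, 0)" and ?y0 = "(?s, 1)"
  obtain x2 where x2: "fst x2 = ?s" "x2 \<notin> {x, y, ?x0, ?y0}" by (rule fresh_var[of "{x, y, ?x0, ?y0}"]) auto
  obtain y2 where y2: "fst y2 = ?s" "y2 \<notin> {x, y, ?x0, ?y0, x2}" by (rule fresh_var[of "{x, y, ?x0, ?y0, x2}"]) auto
  have vU: "v x \<in> U ?s" "v y \<in> U ?s" using assms by (auto intro!: gd_in[OF assms(1)])
  define v1 where "v1 = v(x2 := v x, y2 := v y)"
  have g1: "gdL v1" unfolding v1_def using assms x2 y2 vU by (intro gd_upd) auto
  define v2 where "v2 = v1(?x0 := v x, ?y0 := v y)"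
  have g2: "gdL v2" unfolding v2_def using g1 assms vU by (intro gd_upd) auto
  have "tr p v (Eq (Var x) (Var y)) = tr p v1 (Eq (Var x) (Var y))"
    by (rule tr_fv) (use x2 y2 in \<open>auto simp: v1_def\<close>)
  also have "\<dots> = tr p v1 (Eq (Var x2) (Var y2))"
    by (rule tr_Eq_move[OF g1 assms(2)]) (use x2 y2 assms in \<open>auto simp: v1_def\<close>)
  also have "\<dots> = tr p v2 (Eq (Var x2) (Var y2))"
    by (rule tr_fv) (use x2 y2 in \<open>auto simp: v2_def\<close>)
  also have "\<dots> = tr p v2 (Eq (Var ?x0) (Var ?y0))"
    by (rule tr_Eq_move[OF g2 assms(2)]) (use x2 y2 assms in \<open>auto simp: v2_def v1_def\<close>)
  also have "\<dots> \<longleftrightarrow> eqv p ?s (v x) (v y)"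
    using tr_iff[OF fm_in_Eq[of ?x0 ?y0] g2] assms by (simp add: eqv_def v2_def)
  finally show ?thesis .
qed

lemma eqv_refl': assumes "s \<in> sorts L" "a \<in> U s" "p \<in> \<Omega>" shows "eqv p s a a"
proof -
  obtain v where v: "gdL v" using gd_ex[of L U] univ_ne by auto
  let ?x = "(s, 0)" and ?y = "(s, Suc 0)"
  have g: "gdL (v(?x := a, ?y := a))" using v assms by (intro gd_upd) auto
  have "tr p (v(?x := a, ?y := a)) (Eq (Var ?x) (Var ?y))"
    by (rule tr_Eq_refl[OF _ _ _ g]) (use assms in auto)
  then show ?thesis using tr_Eq[OF g assms(3), of ?x ?y] assms by simp
qed

text \<open>Equality at every point means that \<open>[x = y]\<close> is one, and the equality axiom
  turns this into equality of the elements.\<close>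

lemma eqv_all:
  assumes "s \<in> sorts L" "a \<in> U s" "b \<in> U s" "\<And>p. p \<in> \<Omega> \<Longrightarrow> eqv p s a b"
  shows "a = b"
proof -
  obtain v where v: "gdL v" using gd_ex[of L U] univ_ne by auto
  let ?x = "(s, 0)" and ?y = "(s, Suc 0)" let ?v = "v(?x := a, ?y := b)"
  have g: "gdL ?v" using v assms by (intro gd_upd) auto
  have i: "fm_in L [?x, ?y] (Eq (Var ?x) (Var ?y))" by (rule fm_in_Eq) (use assms in auto)
  have "val ?v [?x, ?y] (Eq (Var ?x) (Var ?y)) = b1"
    using assms(4) val_in[OF i g] by (intro B_eqI) (auto simp: eqv_def ba.one_in)
  then show ?thesis using val_Eq[of ?x ?y ?v] g assms by simp
qed

text \<open>Leibniz's law for arbitrary \<phi> without induction on \<phi>. Let \<open>y\<close> be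
  a fresh variable with value \<open>a\<close>. Under the hypothesis x = y the formula \<phi> is
  equivalent to \<exists>x. x = y \<and> \<phi>, by validity. The hypothesis is true at
  \<open>p\<close> both for the old value of \<open>x\<close> and for \<open>a\<close>, and the
  second formula does not depend on the value of \<open>x\<close>.\<close>

lemma tr_eqv:
  assumes "gdL v" "wf_fm L \<phi>" "fst x \<in> sorts L" "a \<in> U (fst x)" "p \<in> \<Omega>" "eqv p (fst x) (v x) a"
  shows "tr p v \<phi> = tr p (v(x := a)) \<phi>"
proof -
  obtain y where y: "fst y = fst x" "y \<notin> insert x (fv \<phi>)" by (rule fresh_var[of "insert x (fv \<phi>)"]) auto
  let ?E = "Eq (Var x) (Var y)" let ?\<theta> = "Exists x (Conj ?E \<phi>)"
  define u where "u = v(y := a)"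
  have gu: "gdL u" unfolding u_def using assms y by (intro gd_upd) auto
  have gu': "gdL (u(x := a))" using gu assms by (intro gd_upd) auto
  have hv: "valid (Imp ?E (Iff \<phi> ?\<theta>))"
  proof (rule validI)
    fix N :: "('s, 'f, 'r, 'u) struct" and v assume g: "gd L (univ N) v"
    show "sat N v (Imp ?E (Iff \<phi> ?\<theta>))"
    proof (cases "v x = v y")
      case True
      have "v y \<in> univ N (fst x)" using y assms by (intro gd_in[OF g])
      then have "sat N v ?\<theta> \<longleftrightarrow> sat N (v(x := v y)) \<phi>" using y by auto
      also have "v(x := v y) = v" using True by auto
      finally show ?thesis by (simp add: Imp_def Iff_def)
    qed (simp add: Imp_def)
  qed (use assms y in auto)
  have *: "tr p w \<phi> = tr p w ?\<theta>" if "gdL w" "tr p w ?E" for w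
  proof -
    have wf: "wf_fm L ?E" "wf_fm L ?\<theta>" using assms y by auto
    have "tr p w (Imp ?E (Iff \<phi> ?\<theta>))" by (rule tr_valid[OF hv that(1) assms(5)])
    then show ?thesis using tr_Imp[OF that(1) assms(5) wf(1), of "Iff \<phi> ?\<theta>"] tr_Iff[OF that(1) assms(5,2) wf(2)]
      that(2) assms(2) wf by simp
  qed
  have xy: "x \<noteq> y" using y(2) by blast
  then have ux: "u x = v x" "u y = a" by (simp_all add: u_def)
  have "tr p u ?E"
    unfolding tr_Eq[OF gu assms(5) y(1)[symmetric] assms(3)] ux by (rule assms(6))
  moreover have "tr p (u(x := a)) ?E"
  proof (rule tr_Eq_refl[OF _ _ _ gu' _ assms(5)])
    show "x \<noteq> y" by (rule xy)
    then show "(u(x := a)) x = (u(x := a)) y" by (simp add: u_def)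
  qed (use y assms(3) in simp_all)
  moreover have "tr p u ?\<theta> = tr p (u(x := a)) ?\<theta>" by (rule tr_fv) auto
  moreover have "tr p u \<phi> = tr p v \<phi>" by (rule tr_fv) (use y in \<open>auto simp: u_def\<close>)
  moreover have "tr p (u(x := a)) \<phi> = tr p (v(x := a)) \<phi>" by (rule tr_fv) (use y in \<open>auto simp: u_def\<close>)
  ultimately show ?thesis using * gu gu' by metis
qed

lemma tarski_tr: "p \<in> \<Omega> \<Longrightarrow> tarski L U (tr p) (eqv p)"
proof (unfold_locales, goal_cases)
  case (6 v w \<phi>)
  then show ?case by (intro tr_fv)
next
  case (9 v \<phi> x a)
  then show ?case by (intro tr_eqv)
qed (use univ_ne in \<open>simp_all add: tr_Bot tr_Neg tr_Conj tr_Exists tr_Eq eqv_refl'\<close>)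

end

section \<open>Gluing\<close>

text \<open>Renaming in two stages through a fresh tuple \<open>zs\<close>. In this way
  \<open>vs\<close> may overlap with \<open>xs\<close> and may repeat variables, both of which a
  single application of \<open>ren\<close> does not permit.\<close>

definition sub :: "'s var list \<Rightarrow> 's var list \<Rightarrow> ('s, 'f, 'r) fm \<Rightarrow> ('s, 'f, 'r) fm" where
  "sub xs vs \<phi> = (let zs = (SOME zs. map fst zs = map fst xs \<and> distinct zs \<and> set zs \<inter> (set xs \<union> set vs) = {})
     in ren zs vs (ren xs zs \<phi>))"

lemma sub_fresh:
  obtains zs where "map fst zs = map fst xs" "distinct zs" "set zs \<inter> (set xs \<union> set vs) = {}"
    "\<And>\<phi>. sub xs vs \<phi> = ren zs vs (ren xs zs \<phi>)"
proof -
  let ?P = "\<lambda>zs. map fst zs = map fst xs \<and> distinct zs \<and> set zs \<inter> (set xs \<union> set vs) = {}"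
  have "?P (SOME zs. ?P zs)" by (rule someI_ex) (rule fresh_vars, simp)
  then show thesis by (intro that[of "SOME zs. ?P zs"]) (auto simp: sub_def Let_def)
qed

lemma wf_sub:
  assumes "map fst xs = map fst vs" "fst ` set xs \<subseteq> sorts L" "wf_fm L \<phi>"
  shows "wf_fm L (sub xs vs \<phi>)"
proof -
  obtain zs where zs: "map fst zs = map fst xs" "sub xs vs \<phi> = ren zs vs (ren xs zs \<phi>)"
    by (rule sub_fresh) blast
  have "fst ` set zs \<subseteq> sorts L" using zs(1) assms(2) by (metis set_map)
  then show ?thesis using zs assms by (simp add: wf_ren)
qed

lemma fv_sub:
  assumes "fv \<phi> \<subseteq> set xs"
  shows "fv (sub xs vs \<phi>) \<subseteq> set vs"
proof -
  obtain zs where zs: "sub xs vs \<phi> = ren zs vs (ren xs zs \<phi>)"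
    by (rule sub_fresh) blast
  show ?thesis using fv_ren[of zs vs "ren xs zs \<phi>"] fv_ren[of xs zs \<phi>] assms unfolding zs by blast
qed

lemma (in tarski) S_sub:
  assumes g: "gd L U v" "gd L U v'" and xs: "map fst xs = map fst vs" "fst ` set xs \<subseteq> sorts L" "distinct xs"
    and \<phi>: "wf_fm L \<phi>" "fv \<phi> \<subseteq> set xs" and v': "map v' xs = map v vs"
  shows "S v (sub xs vs \<phi>) \<longleftrightarrow> S v' \<phi>"
proof -
  obtain zs where zs: "map fst zs = map fst xs" "distinct zs" "set zs \<inter> (set xs \<union> set vs) = {}"
    and sub: "sub xs vs \<phi> = ren zs vs (ren xs zs \<phi>)"
    by (rule sub_fresh) blast
  have sorts: "fst ` set zs \<subseteq> sorts L" "fst ` set vs \<subseteq> sorts L" using zs(1) xs(1,2) by (metis set_map)+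
  have len: "length xs = length vs" "length zs = length xs" using zs(1) xs(1) by (metis length_map)+
  have "list_all2 (\<lambda>a x. a \<in> U (fst x)) (map v vs) zs"
  proof -
    have "fst (vs ! i) = fst (zs ! i)" "fst (vs ! i) \<in> sorts L" if "i < length zs" for i
      using that len zs(1) xs(1) sorts by (metis nth_map, metis image_subset_iff nth_mem)
    then show ?thesis using len by (auto simp: list_all2_conv_all_nth intro!: gd_in[OF g(1)])
  qed
  then obtain v1 where v1: "gd L U v1" "off (set zs) v v1" "map v1 zs = map v vs"
    using val_of_list[OF g(1) zs(2)] by blast
  have "list_all2 (\<lambda>a x. a \<in> U (fst x)) (map v' xs) xs"
    using g(2) xs(2) by (auto simp: list_all2_conv_all_nth gd_def dest: nth_mem)
  then obtain v2 where v2: "gd L U v2" "off (set xs) v1 v2" "map v2 xs = map v' xs"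
    using val_of_list[OF v1(1) xs(3)] by blast
  have wr: "wf_fm L (ren xs zs \<phi>)" using zs xs \<phi> by (intro wf_ren) auto
  have "S v (sub xs vs \<phi>) \<longleftrightarrow> S v1 (ren xs zs \<phi>)"
    unfolding sub using zs xs v1 by (intro S_ren[OF g(1) v1(1) _ sorts(1)] wr) auto
  also have "\<dots> \<longleftrightarrow> S v2 \<phi>"
    using zs xs v1 v2 v' \<phi>(1) by (intro S_ren[OF v1(1) v2(1) _ xs(2)]) auto
  also have "\<dots> \<longleftrightarrow> S v' \<phi>"
    using v2(3) \<phi>(2) by (intro S_fv[OF v2(1) g(2) \<phi>(1)]) (auto simp: map_eq_conv)
  finally show ?thesis .
qed

section \<open>From witnesses at each point to global witnesses\<close>

context bvmodel begin

lemma \<Omega>_ne: "\<Omega> \<noteq> {}"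
  using B_nonzero[OF ba.one_in] zero_one by force

text \<open>The clopen sets on which a single \<open>w\<close> satisfies \<open>R\<close> form an
  ideal: smaller sets are allowed trivially, and for joins two witnesses are glued. The ideal covers
  \<Omega>, since \<open>R\<close> is clopen for each fixed \<open>w\<close>, and so contains
  \<open>b1\<close> by compactness.\<close>

lemma local_global_abs:
  assumes cl: "\<And>w. w \<in> W \<Longrightarrow> \<exists>u\<in>BB. \<forall>p\<in>\<Omega>. R p w \<longleftrightarrow> u \<in> p"
    and glue: "\<And>w w' u. w \<in> W \<Longrightarrow> w' \<in> W \<Longrightarrow> u \<in> BB \<Longrightarrow>
      \<exists>z\<in>W. \<forall>p\<in>\<Omega>. (if u \<in> p then R p w' else R p w) \<longrightarrow> R p z"
    and ex: "\<And>p. p \<in> \<Omega> \<Longrightarrow> \<exists>w\<in>W. R p w"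
  shows "\<exists>w\<in>W. \<forall>p\<in>\<Omega>. R p w"
proof -
  let ?K = "{u\<in>BB. \<exists>w\<in>W. \<forall>p\<in>\<Omega>. u \<in> p \<longrightarrow> R p w}"
  have "b1 \<in> ?K"
  proof (rule ba.ultra_compact)
    fix x y assume "x \<in> ?K" "y \<in> ?K"
    then obtain w w' where xy: "x \<in> BB" "y \<in> BB" "w \<in> W" "w' \<in> W"
      "\<forall>p\<in>\<Omega>. x \<in> p \<longrightarrow> R p w" "\<forall>p\<in>\<Omega>. y \<in> p \<longrightarrow> R p w'" by blast
    obtain z where "z \<in> W" "\<forall>p\<in>\<Omega>. (if x \<in> p then R p w else R p w') \<longrightarrow> R p z"
      using glue[OF xy(4,3,1)] by blast
    moreover have "bjn x y \<in> BB" using xy by (simp add: ba.join_in)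
    ultimately show "bjn x y \<in> ?K" using xy by (auto intro!: bexI[of _ z])
  next
    fix x y assume "x \<in> ?K" "y \<in> BB" "\<And>p. ba.ultra p \<Longrightarrow> y \<in> p \<Longrightarrow> x \<in> p"
    then show "y \<in> ?K" by (auto simp: \<Omega>_def)
  next
    show "b0 \<in> ?K" using \<Omega>_ne ex ba.zero_in by (auto dest!: ex)
  next
    fix p assume "ba.ultra p"
    then have "p \<in> \<Omega>" by (simp add: \<Omega>_def)
    then obtain w where w: "w \<in> W" "R p w" using ex by blast
    then obtain u where "u \<in> BB" "\<forall>p\<in>\<Omega>. R p w \<longleftrightarrow> u \<in> p" using cl by blast
    then show "\<exists>u\<in>?K. u \<in> p" using w \<open>p \<in> \<Omega>\<close> by blast
  qed auto
  then show ?thesis by auto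
qed

text \<open>No point of \<open>\<Omega>\<close> is isolated, so prescribed values can be attained one after the other on ever
  smaller clopen sets that leave the points used so far untouched.\<close>

lemma realize_colours:
  assumes cl: "\<And>w i. w \<in> W \<Longrightarrow> \<exists>u\<in>BB. \<forall>p\<in>\<Omega>. k p w = i \<longleftrightarrow> u \<in> p"
    and glue: "\<And>w w' u. w \<in> W \<Longrightarrow> w' \<in> W \<Longrightarrow> u \<in> BB \<Longrightarrow>
      \<exists>z\<in>W. \<forall>p\<in>\<Omega>. k p z = (if u \<in> p then k p w' else k p w)"
    and fin: "finite s"
    and ex: "\<And>p. p \<in> \<Omega> \<Longrightarrow> \<exists>w\<in>W. k p w \<in> s"
    and real: "\<And>i. i \<in> s \<Longrightarrow> \<exists>p\<in>\<Omega>. \<exists>w\<in>W. k p w = i"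
  shows "\<exists>w\<in>W. (\<lambda>p. k p w) ` \<Omega> = s"
proof -
  have cls: "\<exists>u\<in>BB. \<forall>p\<in>\<Omega>. k p w \<in> s' \<longleftrightarrow> u \<in> p" if "w \<in> W" "finite s'" for s' w
    using that(2)
  proof (induction s')
    case empty
    then show ?case using ba.zero_in by (intro bexI[of _ b0]) auto
  next
    case (insert i s')
    obtain u u' where u: "u \<in> BB" "\<forall>p\<in>\<Omega>. k p w = i \<longleftrightarrow> u \<in> p" and u': "u' \<in> BB" "\<forall>p\<in>\<Omega>. k p w \<in> s' \<longleftrightarrow> u' \<in> p"
      using insert.IH cl[OF \<open>w \<in> W\<close>, of i] by blast
    have "\<forall>p\<in>\<Omega>. k p w \<in> insert i s' \<longleftrightarrow> bjn u u' \<in> p" using u u' by auto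
    then show ?case using ba.join_in[OF u(1) u'(1)] by blast
  qed
  have "\<exists>w\<in>W. \<forall>p\<in>\<Omega>. k p w \<in> s"
  proof (rule local_global_abs)
    fix w w' u assume "w \<in> W" "w' \<in> W" "u \<in> BB"
    then obtain z where "z \<in> W" "\<forall>p\<in>\<Omega>. k p z = (if u \<in> p then k p w' else k p w)" using glue by blast
    then show "\<exists>z\<in>W. \<forall>p\<in>\<Omega>. (if u \<in> p then k p w' \<in> s else k p w \<in> s) \<longrightarrow> k p z \<in> s" by (auto intro!: bexI[of _ z])
  qed (use cls fin ex in auto)
  then obtain w0 where w0: "w0 \<in> W" "\<forall>p\<in>\<Omega>. k p w0 \<in> s" by blast
  have "\<exists>w\<in>W. (\<forall>p\<in>\<Omega>. k p w \<in> s) \<and> s' \<subseteq> (\<lambda>p. k p w) ` \<Omega>" if "finite s'" "s' \<subseteq> s" for s'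
    using that
  proof (induction s')
    case empty
    then show ?case using w0 by auto
  next
    case (insert i s')
    then obtain w where w: "w \<in> W" "\<forall>p\<in>\<Omega>. k p w \<in> s" "s' \<subseteq> (\<lambda>p. k p w) ` \<Omega>" by blast
    then obtain P where P: "P \<subseteq> \<Omega>" "finite P" "s' = (\<lambda>p. k p w) ` P"
      using finite_subset_image[OF insert.hyps(1)] by metis
    obtain p w' where p: "p \<in> \<Omega>" "w' \<in> W" "k p w' = i" using real insert.prems by blast
    obtain u where u: "u \<in> BB" "\<forall>q\<in>\<Omega>. k q w' = i \<longleftrightarrow> u \<in> q" using cl[OF p(2)] by blast
    have "u \<in> p" using u p by auto
    obtain q x where q: "q \<in> \<Omega>" "x \<in> BB" "x \<in> q" "\<forall>r\<in>\<Omega>. x \<in> r \<longrightarrow> u \<in> r" "\<forall>r\<in>P. x \<notin> r"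
      using no_isolated[OF p(1) u(1) \<open>u \<in> p\<close> P(2,1)] by blast
    obtain z where z: "z \<in> W" "\<forall>p\<in>\<Omega>. k p z = (if x \<in> p then k p w' else k p w)"
      using glue[OF w(1) p(2) q(2)] by blast
    have zi: "k r z = i" if "r \<in> \<Omega>" "x \<in> r" for r using z q u that by simp
    have zn: "k r z = k r w" if "r \<in> \<Omega>" "x \<notin> r" for r using z that by simp
    have "\<forall>r\<in>\<Omega>. k r z \<in> s" using zi zn w insert.prems by (metis insert_subset)
    moreover have "i \<in> (\<lambda>p. k p z) ` \<Omega>" using zi q by blast
    moreover have "s' \<subseteq> (\<lambda>p. k p z) ` \<Omega>"
    proof
      fix j assume "j \<in> s'"
      then obtain r where "r \<in> P" "j = k r w" using P(3) by blast
      then have "r \<in> \<Omega>" "k r z = j" using zn q P by auto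
      then show "j \<in> (\<lambda>p. k p z) ` \<Omega>" by blast
    qed
    ultimately show ?case using z(1) by blast
  qed
  from this[OF fin] show ?thesis by blast
qed

text \<open>Both assignments have the same image in the stalk at \<open>p\<close>, where an element
  of \<open>B\<close> becomes the truth value of its membership in \<open>p\<close>.\<close>

definition agr :: "'s bsort var set \<Rightarrow> 'm set \<Rightarrow> ('s bsort var \<Rightarrow> 'm) \<Rightarrow> ('s bsort var \<Rightarrow> 'm) \<Rightarrow> bool" where
  "agr V p v w \<longleftrightarrow> (\<forall>x\<in>V. fst x \<in> sorts BL \<longrightarrow>
     (case fst x of LSort s \<Rightarrow> eqv p s (v x) (w x) | BSort \<Rightarrow> v x \<in> p \<longleftrightarrow> w x \<in> p))"

lemma agrD_L: "agr V p v w \<Longrightarrow> lvar x \<in> V \<Longrightarrow> fst x \<in> sorts L \<Longrightarrow> eqv p (fst x) (v (lvar x)) (w (lvar x))"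
  by (auto simp: agr_def dest!: bspec[of V _ "lvar x"])
lemma agrD_B: "agr V p v w \<Longrightarrow> b \<in> V \<Longrightarrow> fst b = BSort \<Longrightarrow> v b \<in> p \<longleftrightarrow> w b \<in> p"
  by (auto simp: agr_def dest!: bspec[of V _ b])

lemma bvar_cases:
  fixes x :: "'x bsort var"
  obtains (L) y where "x = lvar y" | (B) "fst x = BSort"
proof (cases "fst x")
  case (LSort s)
  then have "x = lvar (s, snd x)" by (auto simp: lvar_def prod_eq_iff)
  then show thesis by (rule L)
qed (rule B)

lemma agr_refl: "gdB v \<Longrightarrow> p \<in> \<Omega> \<Longrightarrow> (\<And>x. x \<in> V \<Longrightarrow> v x = w x) \<Longrightarrow> agr V p v w"
  unfolding agr_def
proof (intro ballI impI)
  fix x :: "'s bsort var" assume a: "gdB v" "p \<in> \<Omega>" "\<And>x. x \<in> V \<Longrightarrow> v x = w x" "x \<in> V" "fst x \<in> sorts BL"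
  then have vx: "v x \<in> univ M (fst x)" "w x = v x" using a(1,5) a(3)[OF a(4)] unfolding gd_def by (blast, metis)
  show "case fst x of LSort s \<Rightarrow> eqv p s (v x) (w x) | BSort \<Rightarrow> (v x \<in> p) = (w x \<in> p)"
    using vx a(2,5) by (cases "fst x") (auto simp: eqv_refl')
qed

lemma agr_mono: "agr V p v w \<Longrightarrow> V' \<subseteq> V \<Longrightarrow> agr V' p v w"
  by (auto simp: agr_def)

lemma agr_all_eq:
  assumes "gdB v" "gdB w" "\<And>p. p \<in> \<Omega> \<Longrightarrow> agr V p v w" "x \<in> V" "fst x \<in> sorts BL"
  shows "v x = w x"
proof -
  have m: "v x \<in> univ M (fst x)" "w x \<in> univ M (fst x)" using assms by (auto simp: gd_def)
  show ?thesis
  proof (cases rule: bvar_cases[of x])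
    case (L y)
    then show ?thesis using m assms agrD_L[of V _ v w y] by (intro eqv_all[of "fst y"]) auto
  next
    case B
    then show ?thesis using m assms agrD_B[of V _ v w x] by (intro B_eqI) auto
  qed
qed

text \<open>The gluing axiom with trivial premises, the conclusions x = y and x = z, and the
  disjoint elements \<open>bcm u\<close> and \<open>u\<close>. The witness for \<open>x\<close>
  equals \<open>a\<close> off \<open>u\<close> and \<open>a'\<close> on \<open>u\<close>.\<close>

lemma glue_elt:
  assumes s: "s \<in> sorts L" "a \<in> U s" "a' \<in> U s" "u \<in> BB"
  shows "\<exists>c\<in>U s. \<forall>p\<in>\<Omega>. (u \<in> p \<longrightarrow> eqv p s c a') \<and> (u \<notin> p \<longrightarrow> eqv p s c a)"
proof -
  obtain v0 where v0: "gdL v0" using gd_ex[of L U] univ_ne by auto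
  let ?x = "(s, 0 :: nat)" and ?y = "(s, 1 :: nat)" and ?z = "(s, 2 :: nat)"
  let ?v = "v0(?y := a, ?z := a')"
  have g: "gdL ?v" using v0 s by (intro gd_upd) auto
  let ?tt = "Neg Bot :: ('s, 'f, 'r) fm"
  let ?ps = "[(?tt, Eq (Var ?x) (Var ?y)), (?tt, Eq (Var ?x) (Var ?z))] :: (('s, 'f, 'r) fm \<times> ('s, 'f, 'r) fm) list"
  let ?\<beta> = "\<lambda>i. if i = 0 then bcm u else u"
  have cu: "bcm u \<in> BB" using s by (simp add: ba.compl_in)
  have tt: "fm_in L [?y, ?z] ?tt" using s by (auto simp: fm_in_def)
  have val_tt: "val ?v [?y, ?z] ?tt = b1"
    by (rule val_valid[OF tt valid_entails g]) (use tt in \<open>auto intro: validI\<close>)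
  have i: "fm_in L ([?x] @ [?y, ?z]) (Eq (Var ?x) (Var ?y))" "fm_in L ([?x] @ [?y, ?z]) (Eq (Var ?x) (Var ?z))"
    using s by (auto simp: fm_in_def)
  have ent: "entails ty L T (Alls [?y, ?z] (Imp ?tt (Exs [?x] (Eq (Var ?x) (Var y)))))" if "y \<in> {?y, ?z}" for y
  proof (intro valid_entails validI)
    fix N :: "('s, 'f, 'r, 'u) struct" and v assume N: "gd L (univ N) v"
    have "v y \<in> univ N s" using that s by (intro gd_in[OF N]) auto
    then show "sat N v (Imp ?tt (Exs [?x] (Eq (Var ?x) (Var y))))"
      using that by (auto simp: Imp_def Exs_def)
  qed (use s that in \<open>auto simp: fm_in_def\<close>)
  note glue = glue_axiom[where ps = ?ps and \<beta> = ?\<beta> and xs = "[?x]" and ys = "[?y, ?z]", OF _ _ g]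
  have P1: "?ps \<noteq> []" by simp
  have P2: "fm_in L [?y, ?z] \<psi> \<and> fm_in L ([?x] @ [?y, ?z]) \<phi> \<and> entails ty L T (Alls [?y, ?z] (Imp \<psi> (Exs [?x] \<phi>)))"
    if "(\<psi>, \<phi>) \<in> set ?ps" for \<psi> \<phi>
  proof -
    from that consider "\<psi> = ?tt" "\<phi> = Eq (Var ?x) (Var ?y)" | "\<psi> = ?tt" "\<phi> = Eq (Var ?x) (Var ?z)" by auto
    then show ?thesis using ent[of ?y] ent[of ?z] i tt by cases simp_all
  qed
  have P3: "?\<beta> i \<in> BB" for i :: nat using s cu by simp
  have P4: "bmt (?\<beta> i) (?\<beta> j) = b0" if "i < length ?ps" "j < i" for i j :: nat
  proof -
    have "i = 1" "j = 0" using that by auto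
    then show ?thesis using s by (simp add: ba.meet_compl)
  qed
  have P5: "bmt (?\<beta> i) (val ?v [?y, ?z] (fst (?ps ! i))) = ?\<beta> i" if "i < length ?ps" for i
  proof -
    have tt_i: "fst (?ps ! i) = ?tt" using that by (auto simp: less_Suc_eq nth_Cons')
    show ?thesis unfolding tt_i val_tt by (rule ba.meet_one[OF P3])
  qed
  have "\<exists>w. gdL w \<and> off (set [?x]) ?v w \<and>
    (\<forall>i<length ?ps. bmt (?\<beta> i) (val w ([?x] @ [?y, ?z]) (snd (?ps ! i))) = ?\<beta> i)"
    by (rule glue[OF P1 P2 P3 P4 P5]) assumption+
  then obtain w where w: "gdL w" "off (set [?x]) ?v w"
    "\<forall>i<length ?ps. bmt (?\<beta> i) (val w ([?x] @ [?y, ?z]) (snd (?ps ! i))) = ?\<beta> i"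
    by (elim exE conjE)
  have 1: "bmt (bcm u) (val w ([?x] @ [?y, ?z]) (Eq (Var ?x) (Var ?y))) = bcm u"
    using w(3)[rule_format, of 0] by simp
  have 2: "bmt u (val w ([?x] @ [?y, ?z]) (Eq (Var ?x) (Var ?z))) = u"
    using w(3)[rule_format, of 1] by simp
  have wy: "w ?y = a" "w ?z = a'" using w(2) by (auto simp: off_def)
  have "(u \<in> p \<longrightarrow> eqv p s (w ?x) a') \<and> (u \<notin> p \<longrightarrow> eqv p s (w ?x) a)" if p: "p \<in> \<Omega>" for p
  proof -
    have "val w ([?x] @ [?y, ?z]) (Eq (Var ?x) (Var ?y)) \<in> p" if "u \<notin> p"
      using 1 that p s cu val_in[OF i(1) w(1)] by (metis point_mem(3,4))
    moreover have "val w ([?x] @ [?y, ?z]) (Eq (Var ?x) (Var ?z)) \<in> p" if "u \<in> p"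
      using 2 that p s val_in[OF i(2) w(1)] by (metis point_mem(4))
    ultimately show ?thesis
      using tr_iff[OF i(1) w(1), of p] tr_iff[OF i(2) w(1), of p] tr_Eq[OF w(1) p, of ?x ?y] tr_Eq[OF w(1) p, of ?x ?z] s wy
      by auto
  qed
  moreover have "w ?x \<in> U s" using w(1) s by (auto intro: gd_in[OF w(1)])
  ultimately show ?thesis by blast
qed

text \<open>All variables are glued simultaneously by choice; for a \<open>B\<close>-variable the
  glued value is the evident Boolean combination. Where \<open>v\<close> and \<open>v'\<close> agree
  the common value is kept literally, so that gluing stays among the assignments that differ from a
  given one on a prescribed set of variables only.\<close>

lemma glue_val:
  assumes "gdB v" "gdB v'" "u \<in> BB"
  shows "\<exists>w. gdB w \<and> (\<forall>X. off X v v' \<longrightarrow> off X v w) \<and>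
    (\<forall>p\<in>\<Omega>. (u \<in> p \<longrightarrow> agr UNIV p w v') \<and> (u \<notin> p \<longrightarrow> agr UNIV p w v))"
proof -
  define ok where "ok x c \<longleftrightarrow> (fst x \<in> sorts BL \<longrightarrow> c \<in> univ M (fst x)) \<and> (v x = v' x \<longrightarrow> c = v x) \<and>
    (fst x \<in> sorts BL \<longrightarrow> (\<forall>p\<in>\<Omega>. case fst x of LSort s \<Rightarrow> (u \<in> p \<longrightarrow> eqv p s c (v' x)) \<and> (u \<notin> p \<longrightarrow> eqv p s c (v x))
      | BSort \<Rightarrow> (u \<in> p \<longrightarrow> (c \<in> p \<longleftrightarrow> v' x \<in> p)) \<and> (u \<notin> p \<longrightarrow> (c \<in> p \<longleftrightarrow> v x \<in> p))))" for x c
  have "\<exists>c. ok x c" for x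
  proof (cases "fst x \<in> sorts BL \<and> v x \<noteq> v' x")
    case False
    have "v x \<in> univ M (fst x)" if "fst x \<in> sorts BL" using assms(1) that by (simp add: gd_def)
    then show ?thesis using False unfolding ok_def
      by (intro exI[of _ "v x"]) (auto split: bsort.split simp: eqv_refl')
  next
    case True
    then have m: "v x \<in> univ M (fst x)" "v' x \<in> univ M (fst x)" using assms by (auto simp: gd_def)
    show ?thesis
    proof (cases "fst x")
      case (LSort s)
      then show ?thesis using glue_elt[of s "v x" "v' x" u] m True assms(3) unfolding ok_def by auto
    next
      case BSort
      let ?c = "bjn (bmt u (v' x)) (bmt (bcm u) (v x))"
      have "?c \<in> BB" using m BSort assms(3) by (simp add: ba.join_in ba.meet_in ba.compl_in)
      moreover have "(u \<in> p \<longrightarrow> (?c \<in> p \<longleftrightarrow> v' x \<in> p)) \<and> (u \<notin> p \<longrightarrow> (?c \<in> p \<longleftrightarrow> v x \<in> p))" if "p \<in> \<Omega>" for p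
        using m BSort assms(3) that by (simp add: ba.meet_in ba.compl_in)
      ultimately show ?thesis using True BSort unfolding ok_def by (intro exI[of _ ?c]) simp
    qed
  qed
  then have "\<forall>x. \<exists>c. ok x c" by blast
  then obtain w where w: "\<And>x. ok x (w x)" using choice[of ok] by blast
  have "gdB w" using w unfolding gd_def ok_def by blast
  moreover have "\<forall>X. off X v v' \<longrightarrow> off X v w" using w unfolding off_def ok_def by metis
  moreover have "(u \<in> p \<longrightarrow> agr UNIV p w v') \<and> (u \<notin> p \<longrightarrow> agr UNIV p w v)" if p: "p \<in> \<Omega>" for p
    unfolding agr_def
  proof (intro conjI impI ballI)
    fix x :: "'s bsort var" assume "u \<in> p" "fst x \<in> sorts BL"
    then show "case fst x of LSort s \<Rightarrow> eqv p s (w x) (v' x) | BSort \<Rightarrow> (w x \<in> p) = (v' x \<in> p)"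
      using w[of x] p unfolding ok_def by (cases "fst x") auto
  next
    fix x :: "'s bsort var" assume "u \<notin> p" "fst x \<in> sorts BL"
    then show "case fst x of LSort s \<Rightarrow> eqv p s (w x) (v x) | BSort \<Rightarrow> (w x \<in> p) = (v x \<in> p)"
      using w[of x] p unfolding ok_def by (cases "fst x") auto
  qed
  ultimately show ?thesis by blast
qed

end

section \<open>Closure properties of local properties\<close>

context bvmodel begin

lemma gdB_gdL: assumes "gdB v" shows "gdL (v \<circ> lvar)"
  unfolding gd_def using gd_in[OF assms, of "lvar x" "LSort (fst x)" for x] by simp

definition sg :: "'s bsort var set \<Rightarrow> 'm set \<Rightarrow> ('s bsort var \<Rightarrow> 'm) \<Rightarrow> 's bsort var set" where
  "sg V p v = {b\<in>V. fst b = BSort \<and> v b \<in> p}"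

text \<open>\<open>F p v\<close> is a property of the values at the point \<open>p\<close>: once it is known which of the
  \<open>B\<close>-variables contain \<open>p\<close>, it is the truth at \<open>p\<close> of an \<open>L\<close>-formula.\<close>

definition loc :: "'s bsort var set \<Rightarrow> ('m set \<Rightarrow> ('s bsort var \<Rightarrow> 'm) \<Rightarrow> bool) \<Rightarrow> bool" where
  "loc V F \<longleftrightarrow> finite V \<and> (\<exists>\<Phi>. (\<forall>\<sigma>. wf_fm L (\<Phi> \<sigma>) \<and> lvar ` fv (\<Phi> \<sigma>) \<subseteq> V) \<and>
     (\<forall>v. gdB v \<longrightarrow> (\<forall>p\<in>\<Omega>. F p v \<longleftrightarrow> tr p (v \<circ> lvar) (\<Phi> (sg V p v)))))"

lemma locI:
  assumes "finite V" "\<And>\<sigma>. wf_fm L (\<Phi> \<sigma>)" "\<And>\<sigma>. lvar ` fv (\<Phi> \<sigma>) \<subseteq> V"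
    "\<And>v p. gdB v \<Longrightarrow> p \<in> \<Omega> \<Longrightarrow> F p v \<longleftrightarrow> tr p (v \<circ> lvar) (\<Phi> (sg V p v))"
  shows "loc V F"
  unfolding loc_def using assms by (intro conjI exI[of _ \<Phi>]) simp_all

lemma locE:
  assumes "loc V F"
  obtains \<Phi> where "finite V" "\<And>\<sigma>. wf_fm L (\<Phi> \<sigma>)" "\<And>\<sigma>. lvar ` fv (\<Phi> \<sigma>) \<subseteq> V"
    "\<And>v p. gdB v \<Longrightarrow> p \<in> \<Omega> \<Longrightarrow> F p v \<longleftrightarrow> tr p (v \<circ> lvar) (\<Phi> (sg V p v))"
proof -
  obtain \<Phi> where "\<forall>\<sigma>. wf_fm L (\<Phi> \<sigma>) \<and> lvar ` fv (\<Phi> \<sigma>) \<subseteq> V"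
    "\<forall>v. gdB v \<longrightarrow> (\<forall>p\<in>\<Omega>. F p v \<longleftrightarrow> tr p (v \<circ> lvar) (\<Phi> (sg V p v)))"
    using assms unfolding loc_def by (elim conjE exE)
  moreover have "finite V" using assms by (simp add: loc_def)
  ultimately show thesis by (intro that[of \<Phi>]) simp_all
qed

lemma loc_cong:
  assumes "loc V F" "\<And>v p. gdB v \<Longrightarrow> p \<in> \<Omega> \<Longrightarrow> F p v = G p v"
  shows "loc V G"
proof -
  obtain \<Phi> where \<Phi>: "finite V" "\<And>\<sigma>. wf_fm L (\<Phi> \<sigma>)" "\<And>\<sigma>. lvar ` fv (\<Phi> \<sigma>) \<subseteq> V"
    "\<And>v p. gdB v \<Longrightarrow> p \<in> \<Omega> \<Longrightarrow> F p v \<longleftrightarrow> tr p (v \<circ> lvar) (\<Phi> (sg V p v))"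
    using assms(1) by (rule locE) blast
  show ?thesis
    by (rule locI[where \<Phi> = \<Phi>]) (rule \<Phi>(1-3) | simp add: \<Phi>(4)[symmetric] assms(2))+
qed

lemma loc_mono:
  assumes "loc V F" "V \<subseteq> V'" "finite V'"
  shows "loc V' F"
proof -
  obtain \<Phi> where \<Phi>: "\<And>\<sigma>. wf_fm L (\<Phi> \<sigma>)" "\<And>\<sigma>. lvar ` fv (\<Phi> \<sigma>) \<subseteq> V"
    "\<And>v p. gdB v \<Longrightarrow> p \<in> \<Omega> \<Longrightarrow> F p v \<longleftrightarrow> tr p (v \<circ> lvar) (\<Phi> (sg V p v))"
    using assms(1) by (rule locE) blast
  have "sg V' p v \<inter> V = sg V p v" for p v using assms(2) by (auto simp: sg_def)
  then show ?thesis using \<Phi>(1,3) assms(3) subset_trans[OF \<Phi>(2) assms(2)]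
    by (intro locI[where \<Phi> = "\<lambda>\<sigma>. \<Phi> (\<sigma> \<inter> V)"]) simp_all
qed

lemma loc_Not: assumes "loc V F" shows "loc V (\<lambda>p v. \<not> F p v)"
proof -
  obtain \<Phi> where \<Phi>: "finite V" "\<And>\<sigma>. wf_fm L (\<Phi> \<sigma>)" "\<And>\<sigma>. lvar ` fv (\<Phi> \<sigma>) \<subseteq> V"
    "\<And>v p. gdB v \<Longrightarrow> p \<in> \<Omega> \<Longrightarrow> F p v \<longleftrightarrow> tr p (v \<circ> lvar) (\<Phi> (sg V p v))"
    using assms by (rule locE) blast
  show ?thesis
    by (rule locI[where \<Phi> = "\<lambda>\<sigma>. Neg (\<Phi> \<sigma>)"]) (use \<Phi>(1-3) in \<open>simp_all add: \<Phi>(4) tr_Neg gdB_gdL\<close>)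
qed

lemma loc_conj: assumes "loc V F" "loc V G" shows "loc V (\<lambda>p v. F p v \<and> G p v)"
proof -
  obtain \<Phi> where \<Phi>: "finite V" "\<And>\<sigma>. wf_fm L (\<Phi> \<sigma>)" "\<And>\<sigma>. lvar ` fv (\<Phi> \<sigma>) \<subseteq> V"
    "\<And>v p. gdB v \<Longrightarrow> p \<in> \<Omega> \<Longrightarrow> F p v \<longleftrightarrow> tr p (v \<circ> lvar) (\<Phi> (sg V p v))"
    using assms(1) by (rule locE) blast
  obtain \<Psi> where \<Psi>: "finite V" "\<And>\<sigma>. wf_fm L (\<Psi> \<sigma>)" "\<And>\<sigma>. lvar ` fv (\<Psi> \<sigma>) \<subseteq> V"
    "\<And>v p. gdB v \<Longrightarrow> p \<in> \<Omega> \<Longrightarrow> G p v \<longleftrightarrow> tr p (v \<circ> lvar) (\<Psi> (sg V p v))"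
    using assms(2) by (rule locE) blast
  show ?thesis
    by (rule locI[where \<Phi> = "\<lambda>\<sigma>. Conj (\<Phi> \<sigma>) (\<Psi> \<sigma>)"])
      (use \<Phi>(1-3) \<Psi>(1-3) in \<open>simp_all add: \<Phi>(4) \<Psi>(4) tr_Conj gdB_gdL image_Un\<close>)
qed

lemma loc_False: "finite V \<Longrightarrow> loc V (\<lambda>p v. False)"
  by (rule locI[where \<Phi> = "\<lambda>_. Bot"]) (auto simp: tr_Bot gdB_gdL)
lemma loc_True: "finite V \<Longrightarrow> loc V (\<lambda>p v. True)"
  using loc_Not[OF loc_False] by simp
lemma loc_const: assumes "finite V" shows "loc V (\<lambda>p v. P)"
proof (cases P)
  case True
  then show ?thesis using loc_True[OF assms] by (simp only: True)
next
  case False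
  then show ?thesis using loc_False[OF assms] by (simp only: False)
qed
lemma loc_disj: assumes "loc V F" "loc V G" shows "loc V (\<lambda>p v. F p v \<or> G p v)"
  using loc_Not[OF loc_conj[OF loc_Not[OF assms(1)] loc_Not[OF assms(2)]]] by simp
lemma loc_imp: assumes "loc V F" "loc V G" shows "loc V (\<lambda>p v. F p v \<longrightarrow> G p v)"
  by (rule loc_cong[OF loc_disj[OF loc_Not[OF assms(1)] assms(2)]]) blast
lemma loc_iff: assumes "loc V F" "loc V G" shows "loc V (\<lambda>p v. F p v \<longleftrightarrow> G p v)"
  by (rule loc_cong[OF loc_conj[OF loc_imp[OF assms] loc_imp[OF assms(2,1)]]]) blast
lemma loc_Ball:
  assumes "finite I" "finite V" "\<And>i. i \<in> I \<Longrightarrow> loc V (F i)"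
  shows "loc V (\<lambda>p v. \<forall>i\<in>I. F i p v)"
  using assms(1,3)
proof (induction I rule: finite_induct)
  case empty
  then show ?case using loc_True[OF assms(2)] by simp
next
  case (insert i I)
  have "loc V (F i)" "loc V (\<lambda>p v. \<forall>i\<in>I. F i p v)" using insert by blast+
  from loc_conj[OF this] show ?case by simp
qed
lemma loc_Bex:
  assumes "finite I" "finite V" "\<And>i. i \<in> I \<Longrightarrow> loc V (F i)"
  shows "loc V (\<lambda>p v. \<exists>i\<in>I. F i p v)"
proof -
  have "loc V (\<lambda>p v. \<not> (\<forall>i\<in>I. \<not> F i p v))"
    by (rule loc_Not, rule loc_Ball[OF assms(1,2)], rule loc_Not, rule assms(3))
  then show ?thesis by simp
qed

lemma loc_tr:
  assumes "wf_fm L \<phi>" "lvar ` fv \<phi> \<subseteq> V" "finite V"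
  shows "loc V (\<lambda>p v. tr p (v \<circ> lvar) \<phi>)"
  by (rule locI[where \<Phi> = "\<lambda>_. \<phi>"]) (rule assms refl)+

lemma loc_bvar: assumes "b \<in> V" "fst b = BSort" "finite V" shows "loc V (\<lambda>p v. v b \<in> p)"
proof (rule locI[where \<Phi> = "\<lambda>\<sigma>. if b \<in> \<sigma> then Neg Bot else Bot"])
  fix v p assume v: "gdB v" "p \<in> \<Omega>"
  have "b \<in> sg V p v \<longleftrightarrow> v b \<in> p" using assms by (simp add: sg_def)
  then show "v b \<in> p \<longleftrightarrow> tr p (v \<circ> lvar) (if b \<in> sg V p v then Neg Bot else Bot)"
    using tr_Bot[OF gdB_gdL[OF v(1)] v(2)] tr_Neg[OF gdB_gdL[OF v(1)] v(2), of Bot] by simp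
qed (use assms in auto)

lemma loc_eqv:
  assumes "fst x = fst y" "fst x \<in> sorts L" "lvar x \<in> V" "lvar y \<in> V" "finite V"
  shows "loc V (\<lambda>p v. eqv p (fst x) (v (lvar x)) (v (lvar y)))"
proof -
  have "loc V (\<lambda>p v. tr p (v \<circ> lvar) (Eq (Var x) (Var y)))" using assms by (intro loc_tr) auto
  then show ?thesis by (rule loc_cong) (simp only: tr_Eq[OF gdB_gdL _ assms(1,2)] comp_apply)
qed

lemma loc_agr:
  assumes "loc V F" "gdB v" "gdB w" "p \<in> \<Omega>" "agr V p v w"
  shows "F p v = F p w"
proof -
  obtain \<Phi> where \<Phi>: "\<And>\<sigma>. wf_fm L (\<Phi> \<sigma>)" "\<And>\<sigma>. lvar ` fv (\<Phi> \<sigma>) \<subseteq> V"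
    "\<And>v p. gdB v \<Longrightarrow> p \<in> \<Omega> \<Longrightarrow> F p v \<longleftrightarrow> tr p (v \<circ> lvar) (\<Phi> (sg V p v))"
    using assms(1) by (rule locE) blast
  have "sg V p v = sg V p w" using agrD_B[OF assms(5)] by (auto simp: sg_def)
  moreover have "tr p (v \<circ> lvar) (\<Phi> \<sigma>) = tr p (w \<circ> lvar) (\<Phi> \<sigma>)" for \<sigma>
  proof (rule tarski.S_eqvs[OF tarski_tr[OF assms(4)]])
    fix x assume "x \<in> fv (\<Phi> \<sigma>)"
    then have "lvar x \<in> V" "fst x \<in> sorts L" using \<Phi>(2)[of \<sigma>] wf_fv_sorts[OF \<Phi>(1), of \<sigma>] by blast+
    then show "eqv p (fst x) ((v \<circ> lvar) x) ((w \<circ> lvar) x)" using agrD_L[OF assms(5)] by simp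
  qed (use assms \<Phi> in \<open>auto simp: gdB_gdL\<close>)
  ultimately show ?thesis using \<Phi>(3) assms by simp
qed

lemma loc_eq:
  assumes "loc V F" "gdB v" "gdB w" "p \<in> \<Omega>" "\<And>x. x \<in> V \<Longrightarrow> v x = w x"
  shows "F p v = F p w"
  using assms agr_refl[of v p V w] by (intro loc_agr[OF assms(1)]) auto

text \<open>For an \<open>L\<close>-variable the quantifier moves into the formula. For a
  \<open>B\<close>-variable only the membership of its value in \<open>p\<close> matters, so the
  values \<open>b0\<close> and \<open>b1\<close> are enough and the quantifier becomes a disjunction
  over two signatures.\<close>

lemma loc_Ex1:
  assumes F: "loc V F" and x: "fst x \<in> sorts BL"
  shows "loc (V - {x}) (\<lambda>p v. \<exists>a\<in>univ M (fst x). F p (v(x := a)))"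
proof -
  obtain \<Phi> where \<Phi>: "finite V" "\<And>\<sigma>. wf_fm L (\<Phi> \<sigma>)" "\<And>\<sigma>. lvar ` fv (\<Phi> \<sigma>) \<subseteq> V"
    "\<And>v p. gdB v \<Longrightarrow> p \<in> \<Omega> \<Longrightarrow> F p v \<longleftrightarrow> tr p (v \<circ> lvar) (\<Phi> (sg V p v))"
    using F by (rule locE) blast
  show ?thesis
  proof (cases rule: bvar_cases[of x])
    case (L y)
    have y: "fst y \<in> sorts L" using L x by simp
    have sg: "sg V p (v(x := a)) = sg (V - {x}) p v" for p v a
      using L by (auto simp: sg_def)
    have o: "v(x := a) \<circ> lvar = (v \<circ> lvar)(y := a)" for v :: "'s bsort var \<Rightarrow> 'm" and a using L by auto
    show ?thesis
    proof (rule locI[where \<Phi> = "\<lambda>\<sigma>. Exists y (\<Phi> \<sigma>)"])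
      fix v p assume v: "gdB v" "p \<in> \<Omega>"
      have "F p (v(x := a)) \<longleftrightarrow> tr p ((v \<circ> lvar)(y := a)) (\<Phi> (sg (V - {x}) p v))" if "a \<in> univ M (fst x)" for a
        using \<Phi>(4)[of "v(x := a)" p] v that by (simp add: gd_upd sg o)
      then show "(\<exists>a\<in>univ M (fst x). F p (v(x := a))) \<longleftrightarrow> tr p (v \<circ> lvar) (Exists y (\<Phi> (sg (V - {x}) p v)))"
        using v \<Phi>(2) y L by (simp add: tr_Exists gdB_gdL)
    qed (use \<Phi>(1-3) y L in \<open>auto simp: image_subset_iff\<close>)
  next
    case B
    have sg: "sg V p (v(x := a)) = (if a \<in> p \<and> x \<in> V then insert x (sg (V - {x}) p v) else sg (V - {x}) p v)" for p v a
      using B by (auto simp: sg_def)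
    have o: "v(x := a) \<circ> lvar = v \<circ> lvar" for v :: "'s bsort var \<Rightarrow> 'm" and a by (rule ext) (use B in auto)
    show ?thesis
    proof (rule locI[where \<Phi> = "\<lambda>\<sigma>. Neg (Conj (Neg (\<Phi> \<sigma>)) (Neg (\<Phi> (if x \<in> V then insert x \<sigma> else \<sigma>))))"])
      fix v p assume v: "gdB v" "p \<in> \<Omega>"
      have g: "gdL (v \<circ> lvar)" using v by (simp add: gdB_gdL)
      have 1: "F p (v(x := a)) \<longleftrightarrow> tr p (v \<circ> lvar) (\<Phi> (if a \<in> p \<and> x \<in> V then insert x (sg (V - {x}) p v) else sg (V - {x}) p v))"
        if "a \<in> univ M (fst x)" for a
        using \<Phi>(4)[of "v(x := a)" p] v that by (simp add: gd_upd sg o)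
      have "(\<exists>a\<in>univ M (fst x). F p (v(x := a))) \<longleftrightarrow> F p (v(x := b0)) \<or> F p (v(x := b1))"
      proof
        assume "\<exists>a\<in>univ M (fst x). F p (v(x := a))"
        then obtain a where a: "a \<in> BB" "F p (v(x := a))" using B by auto
        then show "F p (v(x := b0)) \<or> F p (v(x := b1))"
          using 1[of a] 1[of b0] 1[of b1] B ba.zero_in ba.one_in v(2) by (cases "a \<in> p") auto
      qed (use B ba.zero_in ba.one_in in auto)
      then show "(\<exists>a\<in>univ M (fst x). F p (v(x := a))) \<longleftrightarrow> tr p (v \<circ> lvar)
          (Neg (Conj (Neg (\<Phi> (sg (V - {x}) p v))) (Neg (\<Phi> (if x \<in> V then insert x (sg (V - {x}) p v) else sg (V - {x}) p v)))))"
        using 1[of b0] 1[of b1] v(2) g \<Phi>(2) B ba.zero_in ba.one_in by (simp add: tr_Neg tr_Conj)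
    qed (use \<Phi>(1,2) in simp_all, use \<Phi>(3) B in fastforce)
  qed
qed

lemma loc_ex:
  assumes F: "loc V F" and X: "finite X" "fst ` X \<subseteq> sorts BL"
  shows "loc (V - X) (\<lambda>p v. \<exists>w. gdB w \<and> off X v w \<and> F p w)"
  using X
proof (induction X rule: finite_induct)
  case empty
  have "loc (V - {}) F" using F by simp
  then show ?case by (rule loc_cong) auto
next
  case (insert x X)
  let ?G = "\<lambda>p v. \<exists>w. gdB w \<and> off X v w \<and> F p w"
  have x: "fst x \<in> sorts BL" using insert by simp
  have "loc (V - X - {x}) (\<lambda>p v. \<exists>a\<in>univ M (fst x). ?G p (v(x := a)))"
    using insert by (intro loc_Ex1) auto
  moreover have "V - X - {x} = V - insert x X" by blast
  ultimately have "loc (V - insert x X) (\<lambda>p v. \<exists>a\<in>univ M (fst x). ?G p (v(x := a)))" by simp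
  then show ?case
  proof (rule loc_cong)
    fix v p assume "gdB v"
    show "(\<exists>a\<in>univ M (fst x). ?G p (v(x := a))) \<longleftrightarrow> (\<exists>w. gdB w \<and> off (insert x X) v w \<and> F p w)" (is "?l \<longleftrightarrow> ?r")
    proof
      assume ?l
      then obtain a w where "gdB w" "off X (v(x := a)) w" "F p w" by blast
      then show ?r by (intro exI[of _ w]) (auto simp: off_def)
    next
      assume ?r
      then obtain w where w: "gdB w" "off (insert x X) v w" "F p w" by blast
      have "off X (v(x := w x)) w" using w(2) insert.hyps by (auto simp: off_def)
      moreover have "w x \<in> univ M (fst x)" using w(1) x by (simp add: gd_def)
      ultimately show ?l using w by blast
    qed
  qed
qed

lemma loc_all:
  assumes F: "loc V F" and X: "finite X" "fst ` X \<subseteq> sorts BL"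
  shows "loc (V - X) (\<lambda>p v. \<forall>w. gdB w \<longrightarrow> off X v w \<longrightarrow> F p w)"
  by (rule loc_cong[OF loc_Not[OF loc_ex[OF loc_Not[OF F] X]]]) blast

text \<open>The map \<rho> need not be injective and may send variables into variables already in
  use, which is why \<open>sub\<close> performs the substitution. The formula to be renamed is the
  one that belongs to the preimage of the new signature.\<close>

lemma loc_rename:
  assumes F: "loc V F" and \<rho>: "\<And>x. fst (\<rho> x) = fst x"
  shows "loc (\<rho> ` V) (\<lambda>p v. F p (v \<circ> \<rho>))"
proof -
  obtain \<Phi> where \<Phi>: "finite V" "\<And>\<sigma>. wf_fm L (\<Phi> \<sigma>)" "\<And>\<sigma>. lvar ` fv (\<Phi> \<sigma>) \<subseteq> V"
    "\<And>v p. gdB v \<Longrightarrow> p \<in> \<Omega> \<Longrightarrow> F p v \<longleftrightarrow> tr p (v \<circ> lvar) (\<Phi> (sg V p v))"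
    using F by (rule locE) blast
  let ?r = "\<lambda>x. (fst x, snd (\<rho> (lvar x)))"
  have lr: "lvar (?r x) = \<rho> (lvar x)" for x
    using \<rho>[of "lvar x"] by (simp add: lvar_def prod_eq_iff)
  let ?\<Psi> = "\<lambda>\<sigma>. let \<phi> = \<Phi> {b\<in>V. \<rho> b \<in> \<sigma>} in sub (fvl \<phi>) (map ?r (fvl \<phi>)) \<phi>"
  show ?thesis
  proof (rule locI[where \<Phi> = ?\<Psi>])
    fix \<sigma>
    let ?\<phi> = "\<Phi> {b\<in>V. \<rho> b \<in> \<sigma>}"
    show "wf_fm L (?\<Psi> \<sigma>)"
      unfolding Let_def using \<Phi>(2) fm_in_fvl[OF \<Phi>(2)] by (intro wf_sub) (auto simp: fm_in_def)
    have "fv (?\<Psi> \<sigma>) \<subseteq> set (map ?r (fvl ?\<phi>))" unfolding Let_def by (rule fv_sub) (simp add: fvl)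
    then have "lvar ` fv (?\<Psi> \<sigma>) \<subseteq> lvar ` ?r ` fv ?\<phi>" by (simp add: fvl image_mono)
    also have "\<dots> = \<rho> ` lvar ` fv ?\<phi>" unfolding image_image lr ..
    also have "\<dots> \<subseteq> \<rho> ` V" using \<Phi>(3) by (intro image_mono)
    finally show "lvar ` fv (?\<Psi> \<sigma>) \<subseteq> \<rho> ` V" .
  next
    fix v p assume v: "gdB v" "p \<in> \<Omega>"
    have g: "gdB (v \<circ> \<rho>)" using v(1) unfolding gd_def comp_def by (metis \<rho>)
    have sg: "{b\<in>V. \<rho> b \<in> sg (\<rho> ` V) p v} = sg V p (v \<circ> \<rho>)" using \<rho> by (auto simp: sg_def)
    let ?\<phi> = "\<Phi> (sg V p (v \<circ> \<rho>))"
    have "tr p (v \<circ> lvar) (sub (fvl ?\<phi>) (map ?r (fvl ?\<phi>)) ?\<phi>) \<longleftrightarrow> tr p (v \<circ> \<rho> \<circ> lvar) ?\<phi>"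
    proof (rule tarski.S_sub[OF tarski_tr[OF v(2)]])
      show "map (v \<circ> \<rho> \<circ> lvar) (fvl ?\<phi>) = map (v \<circ> lvar) (map ?r (fvl ?\<phi>))" by (simp add: lr)
    qed (use v g \<Phi>(2) fm_in_fvl[OF \<Phi>(2)] in \<open>auto simp: gdB_gdL fm_in_def\<close>)
    then show "F p (v \<circ> \<rho>) \<longleftrightarrow> tr p (v \<circ> lvar) (?\<Psi> (sg (\<rho> ` V) p v))"
      unfolding Let_def sg using \<Phi>(4)[OF g v(2)] by simp
  qed (use \<Phi> in auto)
qed

lemma loc_override:
  assumes F: "loc V F" and g: "gdB w" "gdB v" "gdB v'" and p: "p \<in> \<Omega>" and a: "agr UNIV p v v'"
  shows "F p (override_on w v Y) = F p (override_on w v' Y)"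
proof (rule loc_agr[OF F gd_override[OF g(1,2)] gd_override[OF g(1,3)] p])
  have r: "agr UNIV p w w" using agr_refl[OF g(1) p] by blast
  show "agr V p (override_on w v Y) (override_on w v' Y)"
    unfolding agr_def
  proof (intro ballI impI)
    fix x :: "'s bsort var" assume x: "fst x \<in> sorts BL"
    have a': "case fst x of LSort s \<Rightarrow> eqv p s (v x) (v' x) | BSort \<Rightarrow> (v x \<in> p) = (v' x \<in> p)"
      using a x unfolding agr_def by blast
    have r': "case fst x of LSort s \<Rightarrow> eqv p s (w x) (w x) | BSort \<Rightarrow> (w x \<in> p) = (w x \<in> p)"
      using r x unfolding agr_def by blast
    show "case fst x of LSort s \<Rightarrow> eqv p s (override_on w v Y x) (override_on w v' Y x)
      | BSort \<Rightarrow> (override_on w v Y x \<in> p) = (override_on w v' Y x \<in> p)"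
      unfolding override_on_def using a' r' by (cases "x \<in> Y") (simp_all only: if_True if_False)
  qed
qed

section \<open>Local properties as terms\<close>

lemma fres_BL [simp]: "fres BL f = BSort" "fargs BL f = boole_fargs f"
  by (simp_all add: boole_lang_def)

lemma funs_BL [simp]: "{Zero, One, Meet, Join, Compl} \<subseteq> funs BL" "Val xs \<phi> \<in> funs BL \<longleftrightarrow> fm_in L xs \<phi>"
  "Zero \<in> funs BL" "One \<in> funs BL" "Meet \<in> funs BL" "Join \<in> funs BL" "Compl \<in> funs BL"
  by (auto simp: boole_lang_def)

text \<open>Shannon expansion along the \<open>B\<close>-variables: if \<open>t1\<close> and
  \<open>t0\<close> serve the signatures with and without \<open>b\<close>, the new term is the join
  of \<open>b\<close> met with \<open>t1\<close> and the complement of \<open>b\<close> met with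
  \<open>t0\<close>. When no \<open>B\<close>-variable is left, the term is the Boolean value of a
  single formula.\<close>

lemma term_of_aux:
  assumes "finite W" "\<And>b. b \<in> W \<Longrightarrow> fst b = BSort" "\<And>\<sigma>. \<sigma> \<subseteq> W \<Longrightarrow> wf_fm L (\<Phi> \<sigma>)"
  shows "\<exists>t. has_sort BL t BSort \<and> fv_tm t \<subseteq> W \<union> (\<Union>\<sigma>\<in>Pow W. lvar ` fv (\<Phi> \<sigma>)) \<and>
    (\<forall>v p. gdB v \<longrightarrow> p \<in> \<Omega> \<longrightarrow> (eval_tm M v t \<in> p \<longleftrightarrow> tr p (v \<circ> lvar) (\<Phi> (sg W p v))))"
  using assms
proof (induction W arbitrary: \<Phi> rule: finite_induct)
  case empty
  let ?t = "bval (fvl (\<Phi> {})) (\<Phi> {})"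
  have sg: "sg {} p v = {}" for p v by (simp add: sg_def)
  show ?case
  proof (intro exI[of _ ?t] conjI allI impI)
    show "has_sort BL ?t BSort"
      using fm_in_fvl[of L "\<Phi> {}"] empty
      by (auto simp: bval_def list_all2_conv_all_nth dest: fm_in_sort nth_mem)
    show "fv_tm ?t \<subseteq> {} \<union> (\<Union>\<sigma>\<in>Pow {}. lvar ` fv (\<Phi> \<sigma>))" by (simp add: fvl)
    show "eval_tm M v ?t \<in> p \<longleftrightarrow> tr p (v \<circ> lvar) (\<Phi> (sg {} p v))" for v p
      unfolding sg tr_def eval_bval ..
  qed
next
  case (insert b W)
  define good where "good t V \<Psi> \<longleftrightarrow> has_sort BL t BSort \<and> fv_tm t \<subseteq> V \<and>
    (\<forall>v p. gdB v \<longrightarrow> p \<in> \<Omega> \<longrightarrow> (eval_tm M v t \<in> p \<longleftrightarrow> tr p (v \<circ> lvar) (\<Psi> (sg W p v))))"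
    for t V and \<Psi> :: "'s bsort var set \<Rightarrow> ('s, 'f, 'r) fm"
  have good: "has_sort BL t BSort" "fv_tm t \<subseteq> V"
    "gdB v \<Longrightarrow> p \<in> \<Omega> \<Longrightarrow> eval_tm M v t \<in> p \<longleftrightarrow> tr p (v \<circ> lvar) (\<Psi> (sg W p v))"
    if "good t V \<Psi>" for t V \<Psi> v p using that unfolding good_def by blast+
  have IH: "\<exists>t. good t (W \<union> (\<Union>\<sigma>\<in>Pow W. lvar ` fv (\<Psi> \<sigma>))) \<Psi>"
    if "\<And>\<sigma>. \<sigma> \<subseteq> W \<Longrightarrow> wf_fm L (\<Psi> \<sigma>)" for \<Psi>
    unfolding good_def by (rule insert.IH) (simp_all add: that insert.prems(1))
  obtain t0 where "good t0 (W \<union> (\<Union>\<sigma>\<in>Pow W. lvar ` fv (\<Phi> \<sigma>))) \<Phi>"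
    using IH[of \<Phi>] insert.prems(2) by blast
  note t0 = good[OF this]
  have "\<exists>t. good t (W \<union> (\<Union>\<sigma>\<in>Pow W. lvar ` fv (\<Phi> (insert b \<sigma>)))) (\<lambda>\<sigma>. \<Phi> (insert b \<sigma>))"
    by (rule IH, rule insert.prems(2), blast)
  then obtain t1 where "good t1 (W \<union> (\<Union>\<sigma>\<in>Pow W. lvar ` fv (\<Phi> (insert b \<sigma>)))) (\<lambda>\<sigma>. \<Phi> (insert b \<sigma>))"
    by (rule exE)
  note t1 = good[OF this]
  let ?t = "bjoin (bmeet (Var b) t1) (bmeet (bcompl (Var b)) t0)"
  have b: "fst b = BSort" using insert.prems by simp
  have 1: "eval_tm M v ?t \<in> p \<longleftrightarrow> tr p (v \<circ> lvar) (\<Phi> (sg (insert b W) p v))" if v: "gdB v" "p \<in> \<Omega>" for v p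
  proof -
    have "v b \<in> BB" using v(1) b by (intro gd_in[OF v(1)]) auto
    moreover have "eval_tm M v t0 \<in> BB" "eval_tm M v t1 \<in> BB"
      using eval_tm_sort[OF is_struct_M v(1)] t0(1) t1(1) by auto
    moreover have "sg (insert b W) p v = (if v b \<in> p then insert b (sg W p v) else sg W p v)"
      using b by (auto simp: sg_def)
    ultimately show ?thesis using v t0(3)[OF v] t1(3)[OF v]
      by (simp add: bjoin_def bmeet_def bcompl_def ba.meet_in ba.compl_in)
  qed
  have 2: "has_sort BL ?t BSort" using b t0(1) t1(1) by (simp add: bjoin_def bmeet_def bcompl_def)
  have 3: "fv_tm ?t \<subseteq> insert b W \<union> (\<Union>\<sigma>\<in>Pow (insert b W). lvar ` fv (\<Phi> \<sigma>))"
  proof -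
    define S0 where "S0 = (\<Union>\<sigma>\<in>Pow W. lvar ` fv (\<Phi> \<sigma>))"
    define S1 where "S1 = (\<Union>\<sigma>\<in>Pow W. lvar ` fv (\<Phi> (insert b \<sigma>)))"
    define S where "S = (\<Union>\<sigma>\<in>Pow (insert b W). lvar ` fv (\<Phi> \<sigma>))"
    have eq: "fv_tm ?t = insert b (fv_tm t0 \<union> fv_tm t1)" by (auto simp: bjoin_def bmeet_def bcompl_def)
    have sub: "S0 \<subseteq> S" "S1 \<subseteq> S" unfolding S0_def S1_def S_def by (rule UN_least, rule UN_upper, blast)+
    have "fv_tm t0 \<subseteq> W \<union> S0" "fv_tm t1 \<subseteq> W \<union> S1" unfolding S0_def S1_def by (rule t0(2), rule t1(2))
    then show ?thesis unfolding eq S_def[symmetric] using sub by blast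
  qed
  show ?case by (intro exI[of _ ?t] conjI allI impI 1 2 3)
qed

lemma term_of:
  assumes "loc V F"
  obtains t where "has_sort BL t BSort" "fv_tm t \<subseteq> V" "\<And>v p. gdB v \<Longrightarrow> p \<in> \<Omega> \<Longrightarrow> F p v \<longleftrightarrow> eval_tm M v t \<in> p"
proof -
  obtain \<Phi> where \<Phi>: "finite V" "\<And>\<sigma>. wf_fm L (\<Phi> \<sigma>)" "\<And>\<sigma>. lvar ` fv (\<Phi> \<sigma>) \<subseteq> V"
    "\<And>v p. gdB v \<Longrightarrow> p \<in> \<Omega> \<Longrightarrow> F p v \<longleftrightarrow> tr p (v \<circ> lvar) (\<Phi> (sg V p v))"
    using assms by (rule locE) blast
  let ?W = "{b\<in>V. fst b = BSort}"
  have sg: "sg ?W p v = sg V p v" for p v by (auto simp: sg_def)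
  have "\<exists>t. has_sort BL t BSort \<and> fv_tm t \<subseteq> ?W \<union> (\<Union>\<sigma>\<in>Pow ?W. lvar ` fv (\<Phi> \<sigma>)) \<and>
    (\<forall>v p. gdB v \<longrightarrow> p \<in> \<Omega> \<longrightarrow> (eval_tm M v t \<in> p \<longleftrightarrow> tr p (v \<circ> lvar) (\<Phi> (sg ?W p v))))"
    by (rule term_of_aux) (simp_all add: \<Phi>(1,2))
  then obtain t where t: "has_sort BL t BSort" "fv_tm t \<subseteq> ?W \<union> (\<Union>\<sigma>\<in>Pow ?W. lvar ` fv (\<Phi> \<sigma>))"
    "\<forall>v p. gdB v \<longrightarrow> p \<in> \<Omega> \<longrightarrow> (eval_tm M v t \<in> p \<longleftrightarrow> tr p (v \<circ> lvar) (\<Phi> (sg V p v)))"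
    unfolding sg by (elim exE conjE)
  have "fv_tm t \<subseteq> V" using t(2) \<Phi>(3) by blast
  then show thesis by (rule that[OF t(1)]) (simp add: \<Phi>(4) t(3))
qed

lemma loc_clopen: assumes "loc V F" "gdB v" shows "\<exists>u\<in>BB. \<forall>p\<in>\<Omega>. F p v \<longleftrightarrow> u \<in> p"
proof -
  obtain t where "has_sort BL t BSort" "\<And>v p. gdB v \<Longrightarrow> p \<in> \<Omega> \<Longrightarrow> F p v \<longleftrightarrow> eval_tm M v t \<in> p"
    using assms(1) by (rule term_of) blast
  then show ?thesis using assms(2) eval_tm_sort[OF is_struct_M assms(2)] by blast
qed

lemma local_global:
  assumes F: "loc V F" and v: "gdB v" and ex: "\<And>p. p \<in> \<Omega> \<Longrightarrow> \<exists>w. gdB w \<and> off X v w \<and> F p w"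
  shows "\<exists>w. gdB w \<and> off X v w \<and> (\<forall>p\<in>\<Omega>. F p w)"
proof -
  have "\<exists>w\<in>{w. gdB w \<and> off X v w}. \<forall>p\<in>\<Omega>. F p w"
  proof (rule local_global_abs)
    fix w w' u assume w: "w \<in> {w. gdB w \<and> off X v w}" "w' \<in> {w. gdB w \<and> off X v w}" "u \<in> BB"
    have "off X w w'" using w by (auto simp: off_def)
    then obtain z where z: "gdB z" "off X w z" "\<forall>p\<in>\<Omega>. (u \<in> p \<longrightarrow> agr UNIV p z w') \<and> (u \<notin> p \<longrightarrow> agr UNIV p z w)"
      using glue_val[of w w' u] w by blast
    have "off X v z" using z(2) w(1) by (auto simp: off_def)
    moreover have "F p z = (if u \<in> p then F p w' else F p w)" if "p \<in> \<Omega>" for p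
    proof (cases "u \<in> p")
      case True
      then have "agr V p z w'" using z(3) that by (blast intro: agr_mono)
      then show ?thesis using True w loc_agr[OF F z(1) _ that] by simp
    next
      case False
      then have "agr V p z w" using z(3) that by (blast intro: agr_mono)
      then show ?thesis using False w loc_agr[OF F z(1) _ that] by simp
    qed
    ultimately show "\<exists>z\<in>{w. gdB w \<and> off X v w}. \<forall>p\<in>\<Omega>. (if u \<in> p then F p w' else F p w) \<longrightarrow> F p z"
      using z(1) by (intro bexI[of _ z]) simp_all
  next
    fix w assume "w \<in> {w. gdB w \<and> off X v w}"
    then show "\<exists>u\<in>BB. \<forall>p\<in>\<Omega>. F p w \<longleftrightarrow> u \<in> p" using loc_clopen[OF F] by simp
  next
    fix p assume "p \<in> \<Omega>"
    then show "\<exists>w\<in>{w. gdB w \<and> off X v w}. F p w" using ex by simp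
  qed
  then show ?thesis by blast
qed

text \<open>A local property holds at all points iff the term that represents it equals one. This is
  the way back from statements about points to first-order formulas over \<open>M\<close>.\<close>

lemma zero_test:
  assumes "loc V F"
  shows "\<exists>\<Psi>. wf_fm BL \<Psi> \<and> fv \<Psi> \<subseteq> V \<and> (\<forall>v. gdB v \<longrightarrow> (sat M v \<Psi> \<longleftrightarrow> (\<forall>p\<in>\<Omega>. F p v)))"
proof -
  obtain t where t: "has_sort BL t BSort" "fv_tm t \<subseteq> V" "\<And>v p. gdB v \<Longrightarrow> p \<in> \<Omega> \<Longrightarrow> F p v \<longleftrightarrow> eval_tm M v t \<in> p"
    using assms by (rule term_of) blast
  show ?thesis
  proof (intro exI[of _ "Eq t bone"] conjI allI impI)
    show "wf_fm BL (Eq t bone)" using t(1) by (auto simp: bone_def intro!: exI[of _ BSort])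
    show "fv (Eq t bone) \<subseteq> V" using t(2) by (simp add: bone_def)
    fix v assume v: "gdB v"
    have m: "eval_tm M v t \<in> BB" using eval_tm_sort[OF is_struct_M v t(1)] .
    have "eval_tm M v t = b1 \<longleftrightarrow> (\<forall>p\<in>\<Omega>. eval_tm M v t \<in> p)"
    proof
      assume "\<forall>p\<in>\<Omega>. eval_tm M v t \<in> p"
      then show "eval_tm M v t = b1" by (intro B_eqI[OF m ba.one_in]) simp
    qed simp
    then show "sat M v (Eq t bone) \<longleftrightarrow> (\<forall>p\<in>\<Omega>. F p v)" using t(3)[OF v] by (simp add: bone_def)
  qed
qed

end

section \<open>Quantifier elimination\<close>

context bvmodel begin

text \<open>All function symbols of \<open>BL\<close> have values in \<open>B\<close>, so a term of
  an \<open>L\<close>-sort can only be a variable.\<close>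

lemma LSort_terms:
  "list_all2 (has_sort BL) ts (map (\<lambda>x. LSort (fst x)) xs) \<Longrightarrow>
    \<exists>vs. ts = map (\<lambda>y. Var (lvar y)) vs \<and> map fst vs = map fst xs"
proof (induction xs arbitrary: ts)
  case Nil
  then show ?case by simp
next
  case (Cons x xs)
  then obtain t ts' where t: "ts = t # ts'" "has_sort BL t (LSort (fst x))"
    "list_all2 (has_sort BL) ts' (map (\<lambda>x. LSort (fst x)) xs)" by (auto simp: list_all2_Cons2)
  then obtain vs where vs: "ts' = map (\<lambda>y. Var (lvar y)) vs" "map fst vs = map fst xs" using Cons.IH by blast
  obtain z where z: "t = Var z" "fst z = LSort (fst x)" using t(2) by (cases t) auto
  then have "z = lvar (fst x, snd z)" by (simp add: lvar_def prod_eq_iff)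
  then have "ts = map (\<lambda>y. Var (lvar y)) ((fst x, snd z) # vs)" using t(1) vs(1) z(1) by simp
  moreover have "map fst ((fst x, snd z) # vs) = map fst (x # xs)" using vs(2) by simp
  ultimately show ?case by blast
qed

text \<open>The symbol may be applied to variables other than its own tuple \<open>xs\<close>,
  possibly with repetitions; \<open>sub\<close> supplies the formula whose truth at a point matches
  that value.\<close>

lemma loc_Val:
  assumes i: "fm_in L xs \<phi>" and vs: "map fst vs = map fst xs"
  shows "loc (lvar ` set vs) (\<lambda>p v. fint M (Val xs \<phi>) (map (\<lambda>y. v (lvar y)) vs) \<in> p)"
proof -
  have wf: "wf_fm L \<phi>" "distinct xs" "fst ` set xs \<subseteq> sorts L" "fv \<phi> \<subseteq> set xs" using i by (auto simp: fm_in_def)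
  have "loc (lvar ` set vs) (\<lambda>p v. tr p (v \<circ> lvar) (sub xs vs \<phi>))"
    by (intro loc_tr wf_sub vs[symmetric] wf image_mono fv_sub) simp
  then show ?thesis
  proof (rule loc_cong)
    fix v p assume v: "gdB v" and p: "p \<in> \<Omega>"
    have len: "length vs = length xs" using vs by (metis length_map)
    have g: "gdL (v \<circ> lvar)" by (rule gdB_gdL[OF v])
    have "list_all2 (\<lambda>a x. a \<in> U (fst x)) (map (v \<circ> lvar) vs) xs"
    proof -
      have "(v \<circ> lvar) (vs ! i) \<in> U (fst (xs ! i))" if "i < length xs" for i
      proof (rule gd_in[OF g])
        show "fst (vs ! i) = fst (xs ! i)" using that len vs by (metis nth_map)
        show "fst (xs ! i) \<in> sorts L" using that wf(3) by (meson image_subset_iff nth_mem)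
      qed
      then show ?thesis using len by (simp add: list_all2_conv_all_nth)
    qed
    then obtain v' where v': "gdL v'" "map v' xs = map (v \<circ> lvar) vs"
      using val_of_list[OF g wf(2)] by blast
    have "tr p (v \<circ> lvar) (sub xs vs \<phi>) = tr p v' \<phi>"
      by (rule tarski.S_sub[OF tarski_tr[OF p] g v'(1) vs[symmetric] wf(3,2,1,4) v'(2)])
    also have "\<dots> \<longleftrightarrow> fint M (Val xs \<phi>) (map v' xs) \<in> p" by (rule tr_iff[OF i v'(1)])
    finally show "tr p (v \<circ> lvar) (sub xs vs \<phi>) \<longleftrightarrow> fint M (Val xs \<phi>) (map (\<lambda>y. v (lvar y)) vs) \<in> p"
      unfolding v'(2) by (simp only: comp_def)
  qed
qed

lemma loc_term: "has_sort BL t BSort \<Longrightarrow> loc (fv_tm t) (\<lambda>p v. eval_tm M v t \<in> p)"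
proof (induction t)
  case (Var b)
  then show ?case using loc_bvar[of b "{b}"] by simp
next
  case (Fn f ts)
  have f: "f \<in> funs BL" and ts: "list_all2 (has_sort BL) ts (boole_fargs f)" using Fn.prems by simp_all
  have ev: "eval_tm M v t \<in> BB" if "gdB v" "has_sort BL t BSort" for v t
    using eval_tm_sort[OF is_struct_M that] .
  show ?case
  proof (cases f)
    case Zero
    have "loc {} (\<lambda>p v. False)" by (rule loc_False) simp
    then have "loc {} (\<lambda>p v. b0 \<in> p)" by (rule loc_cong) simp
    then show ?thesis using ts Zero by simp
  next
    case One
    have "loc {} (\<lambda>p v. True)" by (rule loc_True) simp
    then have "loc {} (\<lambda>p v. b1 \<in> p)" by (rule loc_cong) simp
    then show ?thesis using ts One by simp
  next
    case Compl
    then obtain t where t: "ts = [t]" "has_sort BL t BSort" using ts by (auto simp: list_all2_Cons2)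
    have "loc (fv_tm t) (\<lambda>p v. eval_tm M v t \<in> p)" by (rule Fn.IH) (use t in auto)
    then have "loc (fv_tm t) (\<lambda>p v. \<not> eval_tm M v t \<in> p)" by (rule loc_Not)
    then have "loc (fv_tm t) (\<lambda>p v. bcm (eval_tm M v t) \<in> p)" by (rule loc_cong) (simp add: ev t)
    then show ?thesis using t Compl by simp
  next
    case Meet
    then obtain t u where t: "ts = [t, u]" "has_sort BL t BSort" "has_sort BL u BSort"
      using ts by (auto simp: list_all2_Cons2)
    let ?V = "fv_tm t \<union> fv_tm u"
    have "loc (fv_tm t) (\<lambda>p v. eval_tm M v t \<in> p)" by (rule Fn.IH) (use t in auto)
    then have 1: "loc ?V (\<lambda>p v. eval_tm M v t \<in> p)" by (rule loc_mono) auto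
    have "loc (fv_tm u) (\<lambda>p v. eval_tm M v u \<in> p)" by (rule Fn.IH) (use t in auto)
    then have 2: "loc ?V (\<lambda>p v. eval_tm M v u \<in> p)" by (rule loc_mono) auto
    have "loc ?V (\<lambda>p v. bmt (eval_tm M v t) (eval_tm M v u) \<in> p)"
      by (rule loc_cong[OF loc_conj[OF 1 2]]) (simp add: ev t)
    then show ?thesis using t Meet by simp
  next
    case Join
    then obtain t u where t: "ts = [t, u]" "has_sort BL t BSort" "has_sort BL u BSort"
      using ts by (auto simp: list_all2_Cons2)
    let ?V = "fv_tm t \<union> fv_tm u"
    have "loc (fv_tm t) (\<lambda>p v. eval_tm M v t \<in> p)" by (rule Fn.IH) (use t in auto)
    then have 1: "loc ?V (\<lambda>p v. eval_tm M v t \<in> p)" by (rule loc_mono) auto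
    have "loc (fv_tm u) (\<lambda>p v. eval_tm M v u \<in> p)" by (rule Fn.IH) (use t in auto)
    then have 2: "loc ?V (\<lambda>p v. eval_tm M v u \<in> p)" by (rule loc_mono) auto
    have "loc ?V (\<lambda>p v. bjn (eval_tm M v t) (eval_tm M v u) \<in> p)"
      by (rule loc_cong[OF loc_disj[OF 1 2]]) (simp add: ev t)
    then show ?thesis using t Join by simp
  next
    case (Val xs \<phi>)
    have i: "fm_in L xs \<phi>" using f Val by simp
    obtain vs where vs: "ts = map (\<lambda>y. Var (lvar y)) vs" "map fst vs = map fst xs"
      using LSort_terms[of ts xs] ts Val by auto
    have "fv_tm (Fn f ts) = lvar ` set vs" using vs(1) by auto
    moreover have "eval_tm M v (Fn f ts) = fint M (Val xs \<phi>) (map (\<lambda>y. v (lvar y)) vs)" for v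
      using vs(1) Val by (simp add: comp_def)
    ultimately show ?thesis using loc_Val[OF i vs(2)] by (simp only:)
  qed
qed

text \<open>A partition of \<Omega> into finitely many clopen classes that depends on the assignment
  in a local way. Colours are natural numbers so that pairs of colours and finite sets of colours
  are colours again.\<close>

definition coloured :: "'s bsort var set \<Rightarrow> ('m set \<Rightarrow> ('s bsort var \<Rightarrow> 'm) \<Rightarrow> nat) \<Rightarrow> nat set \<Rightarrow> bool" where
  "coloured V C F \<longleftrightarrow> finite F \<and> (\<forall>i. loc V (\<lambda>p v. C p v = i)) \<and> (\<forall>v p. gdB v \<longrightarrow> p \<in> \<Omega> \<longrightarrow> C p v \<in> F)"

lemma colouredD:
  assumes "coloured V C F"
  shows "finite F" "loc V (\<lambda>p v. C p v = i)" "gdB v \<Longrightarrow> p \<in> \<Omega> \<Longrightarrow> C p v \<in> F"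
  using assms by (simp_all add: coloured_def)

lemma coloured_agr:
  assumes "coloured V C F" "gdB v" "gdB w" "p \<in> \<Omega>" "agr V p v w"
  shows "C p v = C p w"
  using loc_agr[OF colouredD(2)[OF assms(1), of "C p w"] assms(2-5)] by simp

text \<open>Existence of a section with a prescribed set of colours is reduced to existence at
  single points. The latter is local, and can therefore be absorbed into a new colouring.\<close>

lemma coloured_realize:
  assumes C: "coloured V C F" and v: "gdB v" and s: "finite s"
  shows "(\<exists>w. gdB w \<and> off X v w \<and> (\<lambda>p. C p w) ` \<Omega> = s) \<longleftrightarrow>
    (\<forall>p\<in>\<Omega>. \<exists>w. gdB w \<and> off X v w \<and> C p w \<in> s) \<and>
    (\<forall>i\<in>s. \<exists>p\<in>\<Omega>. \<exists>w. gdB w \<and> off X v w \<and> C p w = i)" (is "?l \<longleftrightarrow> ?r")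
proof
  assume ?l
  then obtain w where "gdB w" "off X v w" "(\<lambda>p. C p w) ` \<Omega> = s" by blast
  then show ?r by blast
next
  assume r: ?r
  let ?W = "{w. gdB w \<and> off X v w}"
  have "\<exists>w\<in>?W. (\<lambda>p. C p w) ` \<Omega> = s"
  proof (rule realize_colours)
    fix w i assume "w \<in> ?W"
    then show "\<exists>u\<in>BB. \<forall>p\<in>\<Omega>. (C p w = i) = (u \<in> p)"
      using loc_clopen[OF colouredD(2)[OF C, of i], of w] by simp
  next
    fix w w' u assume w: "w \<in> ?W" "w' \<in> ?W" "u \<in> BB"
    have "off X w w'" using w by (simp add: off_def)
    then obtain z where z: "gdB z" "off X w z" "\<forall>p\<in>\<Omega>. (u \<in> p \<longrightarrow> agr UNIV p z w') \<and> (u \<notin> p \<longrightarrow> agr UNIV p z w)"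
      using glue_val[of w w' u] w by blast
    have "off X v z" using z(2) w(1) by (simp add: off_def)
    moreover have "C p z = (if u \<in> p then C p w' else C p w)" if p: "p \<in> \<Omega>" for p
    proof (cases "u \<in> p")
      case True
      then have "agr V p z w'" using z(3) p by (blast intro: agr_mono)
      then show ?thesis using True coloured_agr[OF C z(1) _ p] w by simp
    next
      case False
      then have "agr V p z w" using z(3) p by (blast intro: agr_mono)
      then show ?thesis using False coloured_agr[OF C z(1) _ p] w by simp
    qed
    ultimately show "\<exists>z\<in>?W. \<forall>p\<in>\<Omega>. C p z = (if u \<in> p then C p w' else C p w)"
      using z(1) by (intro bexI[of _ z]) simp_all
  next
    fix p assume "p \<in> \<Omega>"
    then show "\<exists>w\<in>?W. C p w \<in> s" using r by blast
  next
    fix i assume "i \<in> s"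
    then show "\<exists>p\<in>\<Omega>. \<exists>w\<in>?W. C p w = i" using r by blast
  qed (rule s)
  then show ?l by blast
qed

lemma off_single_ex:
  assumes "gdB v" "fst x \<in> sorts BL"
  shows "(\<exists>w. gdB w \<and> off {x} v w \<and> P w) \<longleftrightarrow> (\<exists>a\<in>univ M (fst x). P (v(x := a)))" (is "?l \<longleftrightarrow> ?r")
proof
  assume ?l
  then obtain w where w: "gdB w" "off {x} v w" "P w" by blast
  have "w = v(x := w x)" using w(2) by (auto simp: off_def)
  moreover have "w x \<in> univ M (fst x)" using w(1) assms(2) by (simp add: gd_def)
  ultimately show ?r using w(3) by metis
next
  assume ?r
  then obtain a where a: "a \<in> univ M (fst x)" "P (v(x := a))" by blast
  have "gdB (v(x := a))" using gd_upd[OF assms(1)] a(1) by simp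
  moreover have "off {x} v (v(x := a))" by (simp add: off_def)
  ultimately show ?l using a(2) by blast
qed

text \<open>A formula can only express which colours occur: as no point is isolated, neither the
  size nor the position of a colour class carries information. This form survives conjunction by
  passing to pairs of colours and quantification by passing to sets of colours.\<close>

lemma quantifier_elimination:
  "wf_fm BL E \<Longrightarrow> \<exists>C F \<E>. coloured (fv E) C F \<and> (\<forall>v. gdB v \<longrightarrow> (sat M v E \<longleftrightarrow> (\<lambda>p. C p v) ` \<Omega> \<in> \<E>))"
proof (induction E)
  case Bot
  have "coloured {} (\<lambda>_ _. 0) {0}" unfolding coloured_def by (simp add: loc_const)
  then show ?case by (intro exI[of _ "\<lambda>_ _. 0"] exI[of _ "{0}"] exI[of _ "{}"]) simp
next
  case (Eq t u)
  have *: ?case if E: "loc (fv_tm t \<union> fv_tm u) R" and R: "\<And>v. gdB v \<Longrightarrow> eval_tm M v t = eval_tm M v u \<longleftrightarrow> (\<forall>p\<in>\<Omega>. R p v)" for R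
  proof (intro exI conjI allI impI)
    let ?C = "\<lambda>p v. if R p v then 0 else 1 :: nat"
    show "coloured (fv (Eq t u)) ?C {0, 1}"
      unfolding coloured_def
    proof (intro conjI allI impI)
      fix i :: nat
      have "loc (fv_tm t \<union> fv_tm u) (\<lambda>p v. (R p v \<longrightarrow> 0 = i) \<and> (\<not> R p v \<longrightarrow> 1 = i))"
        by (intro loc_conj loc_imp loc_Not E loc_const) simp_all
      then show "loc (fv (Eq t u)) (\<lambda>p v. ?C p v = i)" by (simp add: loc_cong if_distrib if_bool_eq_conj)
    qed auto
    fix v assume "gdB v"
    \<comment> \<open>Colour \<open>0\<close> marks the points where \<open>R\<close> holds, so
      equality of the two terms means that no other colour occurs.\<close>
    from R[OF this] show "sat M v (Eq t u) \<longleftrightarrow> (\<lambda>p. ?C p v) ` \<Omega> \<in> {s. s \<subseteq> {0}}" by (auto split: if_splits)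
  qed
  obtain s where s: "has_sort BL t s" "has_sort BL u s" using Eq by auto
  show ?case
  proof (cases s)
    case BSort
    let ?R = "\<lambda>p v. eval_tm M v t \<in> p \<longleftrightarrow> eval_tm M v u \<in> p"
    have 1: "loc (fv_tm t \<union> fv_tm u) (\<lambda>p v. eval_tm M v t \<in> p)"
      by (rule loc_mono[OF loc_term]) (use s BSort in auto)
    have 2: "loc (fv_tm t \<union> fv_tm u) (\<lambda>p v. eval_tm M v u \<in> p)"
      by (rule loc_mono[OF loc_term]) (use s BSort in auto)
    show ?thesis
    proof (rule *[OF loc_iff[OF 1 2]])
      fix v assume v: "gdB v"
      have "eval_tm M v t \<in> BB" "eval_tm M v u \<in> BB"
        using eval_tm_sort[OF is_struct_M v] s BSort by blast+
      then show "eval_tm M v t = eval_tm M v u \<longleftrightarrow> (\<forall>p\<in>\<Omega>. ?R p v)" using B_eqI by metis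
    qed
  next
    case (LSort s')
    obtain x where x: "t = Var (lvar x)" "fst x = s'"
      using LSort_terms[of "[t]" "[(s', 0)]"] s(1) LSort by auto
    obtain y where y: "u = Var (lvar y)" "fst y = s'"
      using LSort_terms[of "[u]" "[(s', 0)]"] s(2) LSort by auto
    have s': "s' \<in> sorts L" using s(1) x LSort by simp
    have 1: "loc (fv_tm t \<union> fv_tm u) (\<lambda>p v. eqv p (fst x) (v (lvar x)) (v (lvar y)))"
      by (rule loc_eqv) (use x y s' in auto)
    show ?thesis
    proof (rule *[OF 1])
      fix v assume v: "gdB v"
      have m: "v (lvar x) \<in> U s'" "v (lvar y) \<in> U s'" by (rule gd_in[OF v], use x y s' in simp_all)+
      show "eval_tm M v t = eval_tm M v u \<longleftrightarrow> (\<forall>p\<in>\<Omega>. eqv p (fst x) (v (lvar x)) (v (lvar y)))"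
      proof
        assume "\<forall>p\<in>\<Omega>. eqv p (fst x) (v (lvar x)) (v (lvar y))"
        then have "v (lvar x) = v (lvar y)" using eqv_all[OF s' m] x(2) by blast
        then show "eval_tm M v t = eval_tm M v u" using x y by simp
      next
        assume "eval_tm M v t = eval_tm M v u"
        then have "v (lvar y) = v (lvar x)" using x y by simp
        then show "\<forall>p\<in>\<Omega>. eqv p (fst x) (v (lvar x)) (v (lvar y))" using eqv_refl'[OF s' m(1)] x(2) by simp
      qed
    qed
  qed
next
  case (Rel r ts)
  then show ?case by (simp add: boole_lang_def)
next
  case (Neg E)
  then obtain C F \<E> where C: "coloured (fv E) C F" "\<forall>v. gdB v \<longrightarrow> (sat M v E \<longleftrightarrow> (\<lambda>p. C p v) ` \<Omega> \<in> \<E>)" by auto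
  show ?case by (rule exI[of _ C], rule exI[of _ F], rule exI[of _ "- \<E>"]) (simp add: C)
next
  case (Conj E1 E2)
  obtain C1 F1 \<E>1 where C1: "coloured (fv E1) C1 F1" "\<forall>v. gdB v \<longrightarrow> (sat M v E1 \<longleftrightarrow> (\<lambda>p. C1 p v) ` \<Omega> \<in> \<E>1)"
    using Conj by auto
  obtain C2 F2 \<E>2 where C2: "coloured (fv E2) C2 F2" "\<forall>v. gdB v \<longrightarrow> (sat M v E2 \<longleftrightarrow> (\<lambda>p. C2 p v) ` \<Omega> \<in> \<E>2)"
    using Conj by auto
  let ?V = "fv E1 \<union> fv E2"
  let ?C = "\<lambda>p v. prod_encode (C1 p v, C2 p v)"
  let ?f = "fst \<circ> prod_decode" and ?g = "snd \<circ> prod_decode"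
  have "coloured ?V ?C (prod_encode ` (F1 \<times> F2))"
    unfolding coloured_def
  proof (intro conjI allI impI)
    fix i
    have "loc ?V (\<lambda>p v. C1 p v = ?f i)" by (rule loc_mono[OF colouredD(2)[OF C1(1)]]) auto
    moreover have "loc ?V (\<lambda>p v. C2 p v = ?g i)" by (rule loc_mono[OF colouredD(2)[OF C2(1)]]) auto
    ultimately have "loc ?V (\<lambda>p v. C1 p v = ?f i \<and> C2 p v = ?g i)" by (rule loc_conj)
    then show "loc ?V (\<lambda>p v. ?C p v = i)"
    proof (rule loc_cong)
      fix v p
      show "(C1 p v = ?f i \<and> C2 p v = ?g i) = (?C p v = i)"
        by (metis comp_apply fst_conv prod.collapse prod_decode_inverse prod_encode_inverse snd_conv)
    qed
  next
    fix v p assume "gdB v" "p \<in> \<Omega>"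
    then show "?C p v \<in> prod_encode ` (F1 \<times> F2)" using colouredD(3)[OF C1(1)] colouredD(3)[OF C2(1)] by simp
  qed (use colouredD(1)[OF C1(1)] colouredD(1)[OF C2(1)] in simp)
  moreover have "sat M v (Conj E1 E2) \<longleftrightarrow> (\<lambda>p. ?C p v) ` \<Omega> \<in> {s. ?f ` s \<in> \<E>1 \<and> ?g ` s \<in> \<E>2}" if "gdB v" for v
    using C1(2) C2(2) that by (simp add: image_image)
  ultimately show ?case by (intro exI[of _ ?C] exI[of _ "prod_encode ` (F1 \<times> F2)"] exI[of _ "{s. ?f ` s \<in> \<E>1 \<and> ?g ` s \<in> \<E>2}"]) simp
next
  case (Exists x E)
  have x: "fst x \<in> sorts BL" using Exists.prems by simp
  obtain C F \<E> where C: "coloured (fv E) C F" and E: "\<forall>v. gdB v \<longrightarrow> (sat M v E \<longleftrightarrow> (\<lambda>p. C p v) ` \<Omega> \<in> \<E>)"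
    using Exists by auto
  \<comment> \<open>The new colour of \<open>p\<close> encodes the set of old colours attainable at
    \<open>p\<close> by some choice of \<open>x\<close>. By \<open>coloured_realize\<close>,
    \<open>s\<close> is the colour set of one choice iff it meets each of these sets and each of its
    members lies in one of them. This condition involves the set of new colours only.\<close>
  let ?D = "\<lambda>p v. {i. \<exists>a\<in>univ M (fst x). C p (v(x := a)) = i}"
  let ?C = "\<lambda>p v. set_encode (?D p v)"
  let ?\<E> = "{t. \<exists>s\<in>\<E>. s \<subseteq> F \<and> (\<forall>d\<in>t. s \<inter> set_decode d \<noteq> {}) \<and> (\<forall>i\<in>s. \<exists>d\<in>t. i \<in> set_decode d)}"
  have DF: "?D p v \<subseteq> F" if "gdB v" "p \<in> \<Omega>" for p v
  proof
    fix i assume "i \<in> ?D p v"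
    then obtain a where a: "a \<in> univ M (fst x)" "C p (v(x := a)) = i" by blast
    have "gdB (v(x := a))" using gd_upd[OF that(1)] a(1) by metis
    then show "i \<in> F" using colouredD(3)[OF C _ that(2)] a(2) by blast
  qed
  have finD: "finite (?D p v)" if "gdB v" "p \<in> \<Omega>" for p v
    using DF[OF that] colouredD(1)[OF C] by (rule finite_subset)
  have dec: "set_decode (?C p v) = ?D p v" if "gdB v" "p \<in> \<Omega>" for p v
    using finD[OF that] by (rule set_encode_inverse)
  have "coloured (fv E - {x}) ?C (set_encode ` Pow F)"
    unfolding coloured_def
  proof (intro conjI allI impI)
    fix j
    have "loc (fv E - {x}) (\<lambda>p v. (\<forall>i\<in>F. i \<in> set_decode j \<longleftrightarrow> (\<exists>a\<in>univ M (fst x). C p (v(x := a)) = i)) \<and> set_decode j \<subseteq> F)"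
      by (intro loc_conj loc_Ball colouredD(1)[OF C] loc_iff loc_const loc_Ex1 colouredD(2)[OF C] x) simp_all
    then show "loc (fv E - {x}) (\<lambda>p v. ?C p v = j)"
    proof (rule loc_cong)
      fix v p assume v: "gdB v" "p \<in> \<Omega>"
      have "?C p v = j \<longleftrightarrow> ?D p v = set_decode j"
      proof
        assume "?C p v = j"
        then have "set_decode (?C p v) = set_decode j" by (rule arg_cong)
        with dec[OF v, symmetric] show "?D p v = set_decode j" by (rule trans)
      next
        assume "?D p v = set_decode j"
        then have "?C p v = set_encode (set_decode j)" by (rule arg_cong)
        then show "?C p v = j" by (rule trans[OF _ set_decode_inverse])
      qed
      also have "\<dots> \<longleftrightarrow> (\<forall>i\<in>F. i \<in> set_decode j \<longleftrightarrow> i \<in> ?D p v) \<and> set_decode j \<subseteq> F" using DF[OF v] by blast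
      finally show "((\<forall>i\<in>F. i \<in> set_decode j \<longleftrightarrow> (\<exists>a\<in>univ M (fst x). C p (v(x := a)) = i)) \<and> set_decode j \<subseteq> F) = (?C p v = j)"
        by simp
    qed
  next
    fix v p assume "gdB v" "p \<in> \<Omega>"
    then show "?C p v \<in> set_encode ` Pow F" using DF by blast
  qed (use colouredD(1)[OF C] in simp)
  moreover have "sat M v (Exists x E) \<longleftrightarrow> (\<lambda>p. ?C p v) ` \<Omega> \<in> ?\<E>" if v: "gdB v" for v
  proof -
    have D: "i \<in> ?D p v \<longleftrightarrow> (\<exists>w. gdB w \<and> off {x} v w \<and> C p w = i)" for p i
      using off_single_ex[OF v x, of "\<lambda>w. C p w = i"] by simp
    have "sat M v (Exists x E) \<longleftrightarrow> (\<exists>w. gdB w \<and> off {x} v w \<and> sat M w E)"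
      using off_single_ex[OF v x, of "\<lambda>w. sat M w E"] by simp
    also have "\<dots> \<longleftrightarrow> (\<exists>w. gdB w \<and> off {x} v w \<and> (\<lambda>p. C p w) ` \<Omega> \<in> \<E>)"
      using E by blast
    also have "\<dots> \<longleftrightarrow> (\<exists>s\<in>\<E>. s \<subseteq> F \<and> (\<exists>w. gdB w \<and> off {x} v w \<and> (\<lambda>p. C p w) ` \<Omega> = s))"
    proof
      assume "\<exists>w. gdB w \<and> off {x} v w \<and> (\<lambda>p. C p w) ` \<Omega> \<in> \<E>"
      then obtain w where w: "gdB w" "off {x} v w" "(\<lambda>p. C p w) ` \<Omega> \<in> \<E>" by blast
      have "(\<lambda>p. C p w) ` \<Omega> \<subseteq> F" using colouredD(3)[OF C w(1)] by blast
      then show "\<exists>s\<in>\<E>. s \<subseteq> F \<and> (\<exists>w. gdB w \<and> off {x} v w \<and> (\<lambda>p. C p w) ` \<Omega> = s)" using w by blast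
    qed blast
    also have "\<dots> \<longleftrightarrow> (\<exists>s\<in>\<E>. s \<subseteq> F \<and> (\<forall>p\<in>\<Omega>. s \<inter> ?D p v \<noteq> {}) \<and> (\<forall>i\<in>s. \<exists>p\<in>\<Omega>. i \<in> ?D p v))"
    proof (intro bex_cong conj_cong refl)
      fix s assume "s \<subseteq> F"
      then have "finite s" using colouredD(1)[OF C] by (rule finite_subset)
      have E: "(\<exists>w. gdB w \<and> off {x} v w \<and> C p w \<in> s) \<longleftrightarrow> s \<inter> ?D p v \<noteq> {}" for p
      proof -
        have "s \<inter> ?D p v \<noteq> {} \<longleftrightarrow> (\<exists>i\<in>s. i \<in> ?D p v)" by blast
        also have "\<dots> \<longleftrightarrow> (\<exists>i\<in>s. \<exists>w. gdB w \<and> off {x} v w \<and> C p w = i)" by (simp only: D)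
        finally show ?thesis by blast
      qed
      show "(\<exists>w. gdB w \<and> off {x} v w \<and> (\<lambda>p. C p w) ` \<Omega> = s) \<longleftrightarrow> (\<forall>p\<in>\<Omega>. s \<inter> ?D p v \<noteq> {}) \<and> (\<forall>i\<in>s. \<exists>p\<in>\<Omega>. i \<in> ?D p v)"
        by (simp only: coloured_realize[OF C v \<open>finite s\<close>] D E)
    qed
    also have "\<dots> \<longleftrightarrow> (\<lambda>p. ?C p v) ` \<Omega> \<in> ?\<E>"
    proof -
      define c where "c p = ?C p v" for p
      have c: "set_decode (c p) = ?D p v" if "p \<in> \<Omega>" for p
        unfolding c_def by (rule dec[OF v that])
      have "c ` \<Omega> \<in> ?\<E> \<longleftrightarrow> (\<exists>s\<in>\<E>. s \<subseteq> F \<and> (\<forall>p\<in>\<Omega>. s \<inter> set_decode (c p) \<noteq> {}) \<and> (\<forall>i\<in>s. \<exists>p\<in>\<Omega>. i \<in> set_decode (c p)))"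
        by simp
      also have "\<dots> \<longleftrightarrow> (\<exists>s\<in>\<E>. s \<subseteq> F \<and> (\<forall>p\<in>\<Omega>. s \<inter> ?D p v \<noteq> {}) \<and> (\<forall>i\<in>s. \<exists>p\<in>\<Omega>. i \<in> ?D p v))"
        by (intro bex_cong conj_cong ball_cong refl) (simp_all only: c)
      finally show ?thesis unfolding c_def by (rule sym)
    qed
    finally show ?thesis .
  qed
  ultimately have *: "coloured (fv E - {x}) ?C (set_encode ` Pow F)"
    "\<And>v. gdB v \<Longrightarrow> sat M v (Exists x E) \<longleftrightarrow> (\<lambda>p. ?C p v) ` \<Omega> \<in> ?\<E>" .
  show ?case
    by (rule exI[of _ ?C], rule exI[of _ "set_encode ` Pow F"], rule exI[of _ ?\<E>], intro conjI allI impI *(2))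
      (simp only: fv.simps *(1))
qed

end

section \<open>Stalks as structures\<close>

text \<open>Names for the elements of a Skolem hull: \<open>Sk x \<phi> l\<close> names a witness of
  \<open>\<exists>x. \<phi>\<close>, with the parameters named in \<open>l\<close>.\<close>

datatype ('s, 'f, 'r) sk = Sk "'s var" "('s, 'f, 'r) fm" "('s var \<times> ('s, 'f, 'r) sk) list"

text \<open>Skolem names are coded as formulas, so an injection of the formulas into
  \<open>'u\<close> provides names in \<open>'u\<close> for a whole hull.
  \<open>Exists y Bot\<close> merely stores the variable \<open>y\<close>.\<close>

fun encl :: "('s var \<times> ('s, 'f, 'r) fm) list \<Rightarrow> ('s, 'f, 'r) fm" where
  "encl [] = Bot"
| "encl ((y, e) # l) = Conj (Conj (Exists y Bot) e) (encl l)"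

lemma encl_inj: "encl l = encl l' \<Longrightarrow> l = l'"
proof (induction l arbitrary: l' rule: encl.induct)
  case 1
  then show ?case by (cases l' rule: encl.cases) auto
next
  case (2 y e l)
  then show ?case by (cases l' rule: encl.cases) auto
qed

primrec enc :: "('s, 'f, 'r) sk \<Rightarrow> ('s, 'f, 'r) fm" where
  "enc (Sk x \<phi> l) = Conj (Exists x \<phi>) (encl (map (map_prod id enc) l))"

lemma enc_inj: "enc t = enc t' \<Longrightarrow> t = t'"
proof (induction t arbitrary: t')
  case (Sk x \<phi> l)
  obtain x' \<phi>' l' where t': "t' = Sk x' \<phi>' l'" by (cases t')
  have "map (map_prod id enc) l = map (map_prod id enc) l'" using Sk.prems t' by (auto dest: encl_inj)
  then have "l = l'"
  proof (rule list.inj_map_strong[rotated])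
    fix z z' assume z: "z \<in> set l" "map_prod id enc z = map_prod id enc z'"
    have "snd z \<in> Basic_BNFs.snds z" by (metis prod_set_simps(2) prod.collapse singletonI)
    then have "snd z = snd z'" using Sk.IH[OF z(1)] z(2) by (metis snd_map_prod)
    moreover have "fst z = fst z'" using z(2) by (metis fst_map_prod id_apply)
    ultimately show "z = z'" by (simp add: prod_eq_iff)
  qed
  then show ?case using Sk.prems t' by simp
qed

text \<open>The value of a name: \<open>ch\<close> picks a witness for the formula at the values of
  the named parameters. Variables that are not listed keep the value of \<open>v0\<close>, so the
  hull is generated by \<open>v0\<close>.\<close>

primrec skv :: "('s var \<Rightarrow> ('s, 'f, 'r) fm \<Rightarrow> ('s var \<Rightarrow> 'a) \<Rightarrow> 'a) \<Rightarrow> ('s var \<Rightarrow> 'a) \<Rightarrow> ('s, 'f, 'r) sk \<Rightarrow> 'a" where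
  "skv ch v0 (Sk x \<phi> l) =
    ch x \<phi> (\<lambda>y. case map_of (map (map_prod id (skv ch v0)) l) y of Some a \<Rightarrow> a | None \<Rightarrow> v0 y)"

section \<open>Values of terms at a point and models made from Skolem hulls\<close>

context bvmodel begin

text \<open>\<open>rep p w s t a\<close>: at \<open>p\<close>, the term \<open>t\<close> has the value \<open>a\<close>.\<close>

definition rep :: "'m set \<Rightarrow> ('s var \<Rightarrow> 'm) \<Rightarrow> 's \<Rightarrow> ('s, 'f) tm \<Rightarrow> 'm \<Rightarrow> bool" where
  "rep p w s t a \<longleftrightarrow> (\<forall>y. fst y = s \<longrightarrow> y \<notin> fv_tm t \<longrightarrow> tr p (w(y := a)) (Eq t (Var y)))"

lemma gdL_upd: "gdL w \<Longrightarrow> fst y = s \<Longrightarrow> a \<in> U s \<Longrightarrow> gdL (w(y := a))"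
  by (rule gd_upd) auto

lemma repI:
  assumes w: "gdL w" and p: "p \<in> \<Omega>" and t: "has_sort L t s" and s: "s \<in> sorts L" and a: "a \<in> U s"
    and y: "fst y = s" "y \<notin> fv_tm t" "tr p (w(y := a)) (Eq t (Var y))"
  shows "rep p w s t a"
  unfolding rep_def
proof (intro allI impI)
  fix z assume z: "fst z = s" "z \<notin> fv_tm t"
  show "tr p (w(z := a)) (Eq t (Var z))"
  proof (cases "z = y")
    case False
    let ?w = "w(y := a, z := a)"
    have g: "gdL ?w" by (rule gdL_upd[OF gdL_upd[OF w y(1) a] z(1) a])
    have wf: "wf_fm L (Eq t (Var y))" "wf_fm L (Eq t (Var z))" "wf_fm L (Eq (Var y) (Var z))"
      using t y z s by auto
    have "valid (Imp (Eq t (Var y)) (Imp (Eq (Var y) (Var z)) (Eq t (Var z))))"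
      by (rule validI) (use wf in \<open>simp_all add: Imp_def\<close>)
    from tr_valid[OF this g p] have "tr p ?w (Eq t (Var y)) \<longrightarrow> tr p ?w (Eq (Var y) (Var z)) \<longrightarrow> tr p ?w (Eq t (Var z))"
      using wf by (simp add: tr_Imp[OF g p])
    moreover have "tr p ?w (Eq t (Var y)) = tr p (w(y := a)) (Eq t (Var y))"
      by (rule tr_fv) (use z False in auto)
    moreover have "tr p ?w (Eq (Var y) (Var z))" by (rule tr_Eq_refl[OF _ _ _ g _ p]) (use False y z s in auto)
    moreover have "tr p ?w (Eq t (Var z)) = tr p (w(z := a)) (Eq t (Var z))"
      by (rule tr_fv) (use y False in auto)
    ultimately show ?thesis using y(3) by blast
  qed (simp add: y)
qed

lemma rep_Var:
  assumes w: "gdL w" and p: "p \<in> \<Omega>" and x: "fst x = s" "s \<in> sorts L" and a: "a \<in> U s" and e: "eqv p s (w x) a"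
  shows "rep p w s (Var x) a"
  unfolding rep_def
proof (intro allI impI)
  fix y assume y: "fst y = s" "y \<notin> fv_tm (Var x :: ('s, 'f) tm)"
  then have "y \<noteq> x" by simp
  have g: "gdL (w(y := a))" by (rule gdL_upd[OF w y(1) a])
  show "tr p (w(y := a)) (Eq (Var x) (Var y))"
    using tr_Eq[OF g p, of x y] x y(1) \<open>y \<noteq> x\<close> e by simp
qed

text \<open>Congruence for formulas in terms. Since terms have no values in \<open>M\<close>, the
  terms are first traded for fresh variables \<open>zs\<close> with values \<open>as\<close>, by the
  valid formula saying that ts = zs implies the equivalence of \<alpha>(ts) and \<alpha>(zs). Both
  sides then become the same formula \<alpha>(zs) at assignments that agree on
  \<open>zs\<close>.\<close>

lemma tr_transport:
  fixes \<alpha> :: "('s, 'f) tm list \<Rightarrow> ('s, 'f, 'r) fm"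
  assumes wf: "\<And>ts. list_all2 (has_sort L) ts ss \<Longrightarrow> wf_fm L (\<alpha> ts)"
    and fv: "\<And>ts. fv (\<alpha> ts) = (\<Union>t\<in>set ts. fv_tm t)"
    and sem: "\<And>(N :: ('s, 'f, 'r, 'u) struct) v ts ts'. map (eval_tm N v) ts = map (eval_tm N v) ts' \<Longrightarrow> sat N v (\<alpha> ts) = sat N v (\<alpha> ts')"
    and p: "p \<in> \<Omega>" and w: "gdL w" and w': "gdL w'"
    and ss: "set ss \<subseteq> sorts L"
    and ts: "list_all2 (has_sort L) ts ss" "list_all2 (has_sort L) ts' ss"
    and as: "length as = length ss" "\<And>i. i < length ss \<Longrightarrow> as ! i \<in> U (ss ! i)"
    and rep: "\<And>i. i < length ss \<Longrightarrow> rep p w (ss ! i) (ts ! i) (as ! i)"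
    and rep': "\<And>i. i < length ss \<Longrightarrow> rep p w' (ss ! i) (ts' ! i) (as ! i)"
  shows "tr p w (\<alpha> ts) = tr p w' (\<alpha> ts')"
proof -
  let ?V = "(\<Union>t\<in>set ts. fv_tm t) \<union> (\<Union>t\<in>set ts'. fv_tm t)"
  have finV: "finite ?V" by simp
  have "\<exists>zs. map fst zs = ss \<and> distinct zs \<and> set zs \<inter> ?V = {}" by (rule fresh_vars[OF finV])
  then obtain zs where zs: "map fst zs = ss" "distinct zs" "set zs \<inter> ?V = {}" by (elim exE conjE)
  have len: "length zs = length ss" using zs(1) by (metis length_map)
  have fz: "fst (zs ! i) = ss ! i" if "i < length ss" for i using that zs(1) len by (metis nth_map)
  have sz: "ss ! i \<in> sorts L" if "i < length ss" for i using that ss nth_mem by blast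
  have vz: "list_all2 (has_sort L) (map Var zs) ss"
    using len fz sz by (simp add: list_all2_conv_all_nth)
  have main: "\<exists>w1. gdL w1 \<and> map w1 zs = as \<and> tr p w (\<alpha> ts) = tr p w1 (\<alpha> (map Var zs))"
    if w: "gdL w" and ts: "list_all2 (has_sort L) ts ss" "(\<Union>t\<in>set ts. fv_tm t) \<inter> set zs = {}"
      and rep: "\<And>i. i < length ss \<Longrightarrow> rep p w (ss ! i) (ts ! i) (as ! i)" for w ts
  proof -
    have "list_all2 (\<lambda>a x. a \<in> U (fst x)) as zs" using as len fz by (simp add: list_all2_conv_all_nth)
    then obtain w1 where w1: "gdL w1" "off (set zs) w w1" "map w1 zs = as" using val_of_list[OF w zs(2)] by blast
    have lt: "length ts = length ss" using ts(1) by (rule list_all2_lengthD)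
    let ?E = "Conjs (map2 (\<lambda>t z. Eq t (Var z)) ts zs) :: ('s, 'f, 'r) fm"
    have sE: "set (map2 (\<lambda>t z. Eq t (Var z)) ts zs) = (\<lambda>i. Eq (ts ! i) (Var (zs ! i)) :: ('s, 'f, 'r) fm) ` {..<length ss}"
      using lt len by (force simp: set_zip)
    have hs: "has_sort L (ts ! i) (ss ! i)" if "i < length ss" for i
      using ts(1) that by (simp add: list_all2_conv_all_nth)
    have wfe: "wf_fm L (Eq (ts ! i) (Var (zs ! i)) :: ('s, 'f, 'r) fm)" if "i < length ss" for i
      using hs[OF that] fz[OF that] sz[OF that] by auto
    have wfE: "wf_fm L ?E" unfolding wf_Conjs sE using wfe by simp
    have wfI: "wf_fm L (\<alpha> ts)" "wf_fm L (\<alpha> (map Var zs))" using wf[OF ts(1)] wf[OF vz] .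
    have "valid (Imp ?E (Iff (\<alpha> ts) (\<alpha> (map Var zs))))"
    proof (rule validI)
      show "wf_fm L (Imp ?E (Iff (\<alpha> ts) (\<alpha> (map Var zs))))" unfolding wf_Imp wf_Iff using wfE wfI by blast
      fix N :: "('s, 'f, 'r, 'u) struct" and v
      have "sat N v (\<alpha> ts) = sat N v (\<alpha> (map Var zs))" if "sat N v ?E"
      proof (rule sem)
        have "eval_tm N v (ts ! i) = v (zs ! i)" if "i < length ss" for i
          using \<open>sat N v ?E\<close> that unfolding sat_Conjs sE by simp
        then show "map (eval_tm N v) ts = map (eval_tm N v) (map Var zs)"
          using lt len by (intro nth_equalityI) simp_all
      qed
      then show "sat N v (Imp ?E (Iff (\<alpha> ts) (\<alpha> (map Var zs))))" by (auto simp: Imp_def Iff_def)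
    qed
    from tr_valid[OF this w1(1) p]
    have imp: "tr p w1 ?E \<Longrightarrow> tr p w1 (\<alpha> ts) = tr p w1 (\<alpha> (map Var zs))"
      using wfE wfI by (simp add: tr_Imp[OF w1(1) p] tr_Iff[OF w1(1) p])
    have "tr p w1 ?E"
    proof -
      have "tr p w1 \<phi>" if "\<phi> \<in> set (map2 (\<lambda>t z. Eq t (Var z)) ts zs)" for \<phi>
      proof -
        obtain i where i: "i < length ss" "\<phi> = Eq (ts ! i) (Var (zs ! i))" using \<open>\<phi> \<in> _\<close> unfolding sE by blast
        have "ts ! i \<in> set ts" using i lt by simp
        then have nz: "fv_tm (ts ! i) \<inter> set zs = {}" using ts(2) by blast
        have zi: "zs ! i \<in> set zs" using i len by simp
        then have "tr p (w(zs ! i := as ! i)) \<phi>" using rep[OF i(1)] fz[OF i(1)] nz i(2) unfolding rep_def by blast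
        moreover have "w1 (zs ! i) = as ! i" using w1(3) i(1) len by (metis nth_map)
        moreover have "w1 x = w x" if "x \<in> fv_tm (ts ! i)" for x using w1(2) that nz by (auto simp: off_def)
        ultimately show ?thesis using i(2)
          by (subst tr_fv[of \<phi> w1 "w(zs ! i := as ! i)"]) (auto)
      qed
      then show ?thesis using tarski.S_Conjs[OF tarski_tr[OF p] w1(1), of "map2 (\<lambda>t z. Eq t (Var z)) ts zs"] wfE unfolding wf_Conjs by blast
    qed
    moreover have "tr p w1 (\<alpha> ts) = tr p w (\<alpha> ts)"
      by (rule tr_fv) (use w1(2) ts(2) fv in \<open>auto simp: off_def\<close>)
    ultimately show ?thesis using imp w1 by blast
  qed
  obtain w1 where w1: "map w1 zs = as" "tr p w (\<alpha> ts) = tr p w1 (\<alpha> (map Var zs))"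
    using main[OF w ts(1) _ rep] zs(3) by blast
  obtain w2 where w2: "map w2 zs = as" "tr p w' (\<alpha> ts') = tr p w2 (\<alpha> (map Var zs))"
    using main[OF w' ts(2) _ rep'] zs(3) by blast
  have "map w1 zs = map w2 zs" using w1(1) w2(1) by simp
  then have "tr p w1 (\<alpha> (map Var zs)) = tr p w2 (\<alpha> (map Var zs))"
    by (intro tr_fv) (auto simp: fv)
  then show ?thesis using w1(2) w2(2) by simp
qed

lemma rep_unique:
  assumes "p \<in> \<Omega>" "gdL w" "has_sort L t s" "s \<in> sorts L" "a \<in> U s" "b \<in> U s" "rep p w s t a" "rep p w s t b"
  shows "eqv p s a b"
proof -
  obtain y where y: "fst y = s" "y \<notin> fv_tm t" by (rule fresh_var[of "fv_tm t"]) auto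
  obtain z where z: "fst z = s" "z \<notin> insert y (fv_tm t)" by (rule fresh_var[of "insert y (fv_tm t)"]) auto
  let ?w = "w(y := a, z := b)"
  have g: "gdL ?w" by (rule gdL_upd[OF gdL_upd[OF assms(2) y(1) assms(5)] z(1) assms(6)])
  have wf: "wf_fm L (Eq t (Var y))" "wf_fm L (Eq t (Var z))" "wf_fm L (Eq (Var y) (Var z))" using assms y z by auto
  have "valid (Imp (Eq t (Var y)) (Imp (Eq t (Var z)) (Eq (Var y) (Var z))))"
    by (rule validI) (use wf in \<open>simp_all add: Imp_def\<close>)
  from tr_valid[OF this g assms(1)]
  have "tr p ?w (Eq t (Var y)) \<longrightarrow> tr p ?w (Eq t (Var z)) \<longrightarrow> tr p ?w (Eq (Var y) (Var z))"
    using wf by (simp add: tr_Imp[OF g assms(1)])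
  moreover have "tr p ?w (Eq t (Var y)) = tr p (w(y := a)) (Eq t (Var y))" by (rule tr_fv) (use z y in auto)
  moreover have "tr p ?w (Eq t (Var z)) = tr p (w(z := b)) (Eq t (Var z))" by (rule tr_fv) (use z y in auto)
  moreover have "tr p (w(y := a)) (Eq t (Var y))" "tr p (w(z := b)) (Eq t (Var z))"
    using assms(7,8) y z unfolding rep_def by blast+
  ultimately have "tr p ?w (Eq (Var y) (Var z))" by blast
  then show ?thesis using tr_Eq[OF g assms(1), of y z] y z assms(4) by auto
qed

lemma rep_eqv:
  assumes "p \<in> \<Omega>" "gdL w" "has_sort L t s" "s \<in> sorts L" "a \<in> U s" "b \<in> U s" "rep p w s t a" "eqv p s a b"
  shows "rep p w s t b"
proof -
  obtain y where y: "fst y = s" "y \<notin> fv_tm t" by (rule fresh_var[of "fv_tm t"]) auto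
  have g: "gdL (w(y := a))" by (rule gdL_upd[OF assms(2) y(1) assms(5)])
  have wf: "wf_fm L (Eq t (Var y))" using assms y by auto
  have "tr p (w(y := a)) (Eq t (Var y))" using assms(7) y unfolding rep_def by blast
  then have "tr p (w(y := a, y := b)) (Eq t (Var y))"
    using tr_eqv[OF g wf, of y b p] y assms by simp
  then show ?thesis by (intro repI[OF assms(2,1,3,4,6) y]) simp
qed

text \<open>\<open>N\<close> is the stalk at \<open>p\<close> restricted to the Skolem hull of
  \<open>v0\<close>, with every \<open>eqv\<close>-class replaced by a name in \<open>'u\<close>. It
  satisfies exactly the formulas true at \<open>p\<close>; for quantifiers this holds because the
  hull contains a witness for each existential formula with parameters in the hull.\<close>

lemma loewenheim_skolem:
  fixes \<iota> :: "('s, 'f, 'r) fm \<Rightarrow> 'u"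
  assumes \<iota>: "inj \<iota>" and p: "p \<in> \<Omega>" and v0: "gdL v0"
  shows "\<exists>(N :: ('s, 'f, 'r, 'u) struct) \<nu>. is_struct L N \<and> gd L (univ N) \<nu> \<and>
    (\<forall>\<phi>. wf_fm L \<phi> \<longrightarrow> (sat N \<nu> \<phi> \<longleftrightarrow> tr p v0 \<phi>))"
proof -
  interpret P: tarski L U "tr p" "eqv p" by (rule tarski_tr[OF p])
  define ch where "ch x \<phi> w = (SOME a. a \<in> U (fst x) \<and> tr p (w(x := a)) \<phi>)"
    for x :: "'s var" and \<phi> and w :: "'s var \<Rightarrow> 'm"
  define H where "H s = {a \<in> U s. \<exists>t. skv ch v0 t = a}" for s
  define hull where "hull w \<longleftrightarrow> (\<forall>y. fst y \<in> sorts L \<longrightarrow> w y \<in> H (fst y))" for w :: "'s var \<Rightarrow> 'm"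
  have HU: "a \<in> U s" if "a \<in> H s" for a s using that by (simp add: H_def)
  have hull_gd: "gdL w" if "hull w" for w using that HU unfolding hull_def gd_def by blast
  have hull_in: "w y \<in> H s" if "hull w" "fst y = s" "s \<in> sorts L" for w s and y :: "'s var" using that unfolding hull_def by blast
  have hull_upd: "hull (w(y := a))" if "hull w" "fst y = s" "a \<in> H s" for w a s and y :: "'s var"
    using that unfolding hull_def by auto
  have witness: "\<exists>a\<in>H (fst x). tr p (w(x := a)) \<phi>"
    if par: "\<And>y. y \<in> fv \<phi> - {x} \<Longrightarrow> (\<exists>t. skv ch v0 t = w y) \<or> w y = v0 y" and ex: "\<exists>a\<in>U (fst x). tr p (w(x := a)) \<phi>" for x :: "'s var" and \<phi> and w :: "'s var \<Rightarrow> 'm"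
  proof -
    obtain ys where ys: "set ys = {y \<in> fv \<phi>. \<exists>t. skv ch v0 t = w y}" using finite_list[of "{y \<in> fv \<phi>. \<exists>t. skv ch v0 t = w y}"] by auto
    define tt where "tt y = (SOME t. skv ch v0 t = w y)" for y
    have tt: "skv ch v0 (tt y) = w y" if "y \<in> set ys" for y
    proof -
      have "\<exists>t. skv ch v0 t = w y" using that ys by blast
      then show ?thesis unfolding tt_def by (rule someI_ex)
    qed
    let ?l = "map (\<lambda>y. (y, tt y)) ys"
    define w' where "w' y = (case map_of (map (map_prod id (skv ch v0)) ?l) y of Some a \<Rightarrow> a | None \<Rightarrow> v0 y)" for y
    have eq: "map (map_prod id (skv ch v0)) ?l = map (\<lambda>y. (y, w y)) ys" using tt by simp
    have w': "w' y = w y" if "y \<in> fv \<phi> - {x}" for y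
    proof (cases "y \<in> set ys")
      case True
      then have "map_of (map (\<lambda>y. (y, w y)) ys) y = Some (w y)" by (simp add: map_of_map_restrict)
      then show ?thesis unfolding w'_def eq by simp
    next
      case False
      then have "map_of (map (\<lambda>y. (y, w y)) ys) y = None" by (simp add: map_of_eq_None_iff image_image)
      moreover have "w y = v0 y" using par[OF that] False ys that by blast
      ultimately show ?thesis unfolding w'_def eq by simp
    qed
    have upd: "tr p (w'(x := a)) \<phi> = tr p (w(x := a)) \<phi>" for a by (rule tr_fv) (use w' in auto)
    have "ch x \<phi> w' \<in> U (fst x) \<and> tr p (w'(x := ch x \<phi> w')) \<phi>"
      unfolding ch_def by (rule someI_ex) (use ex upd in blast)
    moreover have "skv ch v0 (Sk x \<phi> ?l) = ch x \<phi> w'" unfolding w'_def skv.simps ..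
    ultimately show ?thesis using upd unfolding H_def by blast
  qed
  have hull_witness: "\<exists>a\<in>H (fst x). tr p (w(x := a)) \<phi>"
    if "hull w" "wf_fm L \<phi>" "\<exists>a\<in>U (fst x). tr p (w(x := a)) \<phi>" for x :: "'s var" and \<phi> and w :: "'s var \<Rightarrow> 'm"
  proof (rule witness[OF _ that(3)])
    fix y assume "y \<in> fv \<phi> - {x}"
    then have "fst y \<in> sorts L" using wf_fv_sorts[OF that(2)] by blast
    then have "w y \<in> H (fst y)" using hull_in[OF that(1)] by blast
    then show "(\<exists>t. skv ch v0 t = w y) \<or> w y = v0 y" unfolding H_def by blast
  qed
  \<comment> \<open>The values of \<open>v0\<close> need not lie in the hull, but each is
    \<open>eqv\<close>-equal to an element of it: the witness of \<exists>x. y = x for the parameter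
    \<open>y\<close>.\<close>
  have "\<exists>a. fst y \<in> sorts L \<longrightarrow> a \<in> H (fst y) \<and> eqv p (fst y) (v0 y) a" for y :: "'s var"
  proof (cases "fst y \<in> sorts L")
    case True
    obtain x where x: "fst x = fst y" "x \<noteq> y" using fresh_var[of "{y}" "fst y"] by auto
    have vy: "v0 y \<in> U (fst y)" using v0 True by (simp add: gd_def)
    have g: "gdL (v0(x := a))" if "a \<in> U (fst y)" for a by (rule gdL_upd[OF v0 x(1) that])
    have "\<exists>a\<in>H (fst x). tr p (v0(x := a)) (Eq (Var y) (Var x))"
    proof (rule witness)
      show "\<exists>a\<in>U (fst x). tr p (v0(x := a)) (Eq (Var y) (Var x))"
        by (rule bexI[of _ "v0 y"], subst tr_Eq[OF g[OF vy] p]) (use x True vy in \<open>auto intro: eqv_refl' p\<close>)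
    qed simp
    then obtain a where a: "a \<in> H (fst y)" "tr p (v0(x := a)) (Eq (Var y) (Var x))" using x(1) by metis
    have "eqv p (fst y) (v0 y) a" using a(2) tr_Eq[OF g[OF HU[OF a(1)]] p, of y x] x True by simp
    then show ?thesis using a(1) by blast
  qed blast
  then obtain w0 where w0: "\<And>y. fst y \<in> sorts L \<Longrightarrow> w0 y \<in> H (fst y) \<and> eqv p (fst y) (v0 y) (w0 y)" by metis
  have hull0: "hull w0" using w0 unfolding hull_def by blast
  have w0_v0: "tr p v0 \<phi> = tr p w0 \<phi>" if wf: "wf_fm L \<phi>" for \<phi>
  proof (rule P.S_eqvs[OF v0 hull_gd[OF hull0] wf])
    fix x assume "x \<in> fv \<phi>"
    then have "fst x \<in> sorts L" using wf_fv_sorts[OF wf] by blast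
    then show "eqv p (fst x) (v0 x) (w0 x)" using w0 by blast
  qed
  \<comment> \<open>The predicate under \<open>SOME\<close> is the same for \<open>eqv\<close>-equal
    elements, so the chosen name depends on the class of \<open>a\<close> only. This realises the
    quotient inside \<open>'u\<close>.\<close>
  define nm where "nm s a = \<iota> (enc (SOME t. skv ch v0 t \<in> U s \<and> eqv p s (skv ch v0 t) a))" for s a
  have nm_iff: "nm s a = nm s b \<longleftrightarrow> eqv p s a b" if s: "s \<in> sorts L" and a: "a \<in> H s" and b: "b \<in> H s" for s a b
  proof
    let ?P = "\<lambda>a t. skv ch v0 t \<in> U s \<and> eqv p s (skv ch v0 t) a"
    have ex: "?P a (SOME t. ?P a t)" if "a \<in> H s" for a
    proof (rule someI_ex)
      obtain t where "skv ch v0 t = a" using \<open>a \<in> H s\<close> unfolding H_def by blast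
      then show "\<exists>t. ?P a t" using HU[OF \<open>a \<in> H s\<close>] P.eqv_refl[OF s] by blast
    qed
    assume "nm s a = nm s b"
    then have "(SOME t. ?P a t) = (SOME t. ?P b t)" unfolding nm_def by (meson enc_inj injD[OF \<iota>])
    then have "?P a (SOME t. ?P a t)" "?P b (SOME t. ?P a t)" using ex[OF a] ex[OF b] by simp_all
    then obtain t where ta: "t \<in> U s" "eqv p s t a" "eqv p s t b" by blast
    show "eqv p s a b"
      by (rule P.eqv_trans[OF s HU[OF a] ta(1) HU[OF b] P.eqv_sym[OF s ta(1) HU[OF a] ta(2)] ta(3)])
  next
    assume e: "eqv p s a b"
    have "(skv ch v0 t \<in> U s \<and> eqv p s (skv ch v0 t) a) = (skv ch v0 t \<in> U s \<and> eqv p s (skv ch v0 t) b)" for t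
      using P.eqv_trans[OF s _ HU[OF a] HU[OF b] _ e]
        P.eqv_trans[OF s _ HU[OF b] HU[OF a] _ P.eqv_sym[OF s HU[OF a] HU[OF b] e]] by blast
    then show "nm s a = nm s b" unfolding nm_def by simp
  qed
  define nms where "nms w xs = map (\<lambda>x. nm (fst x) (w x)) xs" for w and xs :: "'s var list"
  \<comment> \<open>A value of \<open>f\<close> at the names \<open>us\<close> is an element
    \<open>b\<close> for which f(xs) = b is true at \<open>p\<close>, for some hull assignment whose
    values at \<open>xs\<close> have the names \<open>us\<close>. Neither the assignment nor
    \<open>b\<close> is unique; the facts below show that the name of \<open>b\<close> is.\<close>
  define FI where "FI f us b \<longleftrightarrow> b \<in> H (fres L f) \<and> (\<exists>w xs. hull w \<and> map fst xs = fargs L f \<and> us = nms w xs \<and>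
     rep p w (fres L f) (Fn f (map Var xs)) b)" for f us b
  define RI where "RI r us \<longleftrightarrow> (\<exists>w xs. hull w \<and> map fst xs = rargs L r \<and> us = nms w xs \<and> tr p w (Rel r (map Var xs)))" for r us
  define N :: "('s, 'f, 'r, 'u) struct" where
    "N = \<lparr>univ = \<lambda>s. nm s ` H s, fint = \<lambda>f us. nm (fres L f) (SOME b. FI f us b), rint = RI\<rparr>"
  have N: "univ N s = nm s ` H s" "fint N f us = nm (fres L f) (SOME b. FI f us b)" "rint N r us = RI r us" for s f us r
    by (simp_all add: N_def)
  define nmw where "nmw w x = nm (fst x) (w x)" for w :: "'s var \<Rightarrow> 'm" and x
  have vars: "list_all2 (has_sort L) (map Var xs) ss" if "map fst xs = ss" "set ss \<subseteq> sorts L" for xs :: "'s var list" and ss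
  proof -
    have "length xs = length ss" using that(1) by (metis length_map)
    moreover have "fst (xs ! i) = ss ! i \<and> ss ! i \<in> sorts L" if "i < length xs" for i
      using \<open>map fst xs = ss\<close> \<open>set ss \<subseteq> sorts L\<close> that by (metis length_map nth_map nth_mem subsetD)
    ultimately show ?thesis by (simp add: list_all2_conv_all_nth)
  qed
  have nms_rep: "rep p w (ss ! i) (map Var xs ! i) (as ! i)"
    if w: "hull w" and xs: "map fst xs = ss" "set ss \<subseteq> sorts L" and as: "length as = length ss" "\<And>i. i < length ss \<Longrightarrow> as ! i \<in> H (ss ! i)"
      and e: "map2 nm ss as = nms w xs" and i: "i < length ss" for w xs ss as i
  proof -
    have len: "length xs = length ss" using xs(1) by (metis length_map)
    have f: "fst (xs ! i) = ss ! i" using xs(1) i len by (metis nth_map)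
    have s: "ss ! i \<in> sorts L" using xs(2) i nth_mem by blast
    have "nm (ss ! i) (as ! i) = nm (ss ! i) (w (xs ! i))"
      using arg_cong[OF e, of "\<lambda>l. l ! i"] i as(1) len f by (simp add: nms_def)
    then have "eqv p (ss ! i) (as ! i) (w (xs ! i))" using nm_iff[OF s as(2)[OF i] hull_in[OF w f s]] by blast
    then have "eqv p (ss ! i) (w (xs ! i)) (as ! i)"
      using P.eqv_sym[OF s HU[OF as(2)[OF i]] HU[OF hull_in[OF w f s]]] by blast
    then have "rep p w (ss ! i) (Var (xs ! i)) (as ! i)"
      by (rule rep_Var[OF hull_gd[OF w] p f s HU[OF as(2)[OF i]]])
    then show ?thesis using i len by simp
  qed
  have hull_list: "\<exists>w xs. hull w \<and> map fst xs = ss \<and> map2 nm ss as = nms w xs"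
    if ss: "set ss \<subseteq> sorts L" and as: "length as = length ss" "\<And>i. i < length ss \<Longrightarrow> as ! i \<in> H (ss ! i)" for ss as
  proof -
    have fe: "finite ({} :: 's var set)" by simp
    obtain xs :: "'s var list" where xs: "map fst xs = ss" "distinct xs" "set xs \<inter> {} = {}"
      using fresh_vars[OF fe, of ss] by (elim exE conjE)
    have len: "length xs = length ss" using xs(1) by (metis length_map)
    have f: "fst (xs ! i) = ss ! i" if "i < length ss" for i using xs(1) that len by (metis nth_map)
    have "gd L H w0" using hull0 unfolding hull_def gd_def .
    moreover have "list_all2 (\<lambda>a x. a \<in> H (fst x)) as xs" using as len f by (simp add: list_all2_conv_all_nth)
    ultimately obtain w where w: "gd L H w" "map w xs = as" using val_of_list[of L H w0 xs as] xs(2) by blast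
    have "hull w" using w(1) unfolding hull_def gd_def .
    moreover have "map2 nm ss as = nms w xs"
      using len f as(1) w(2) by (intro nth_equalityI) (auto simp: nms_def)
    ultimately show ?thesis using xs(1) by blast
  qed
  have terms: "has_sort L t s \<Longrightarrow> s \<in> sorts L \<and> (\<exists>a\<in>H s. rep p w s t a \<and> eval_tm N (nmw w) t = nm s a)" if w: "hull w" for w t s
  proof (induction t arbitrary: s)
    case (Var x)
    then have x: "fst x = s" "s \<in> sorts L" by simp_all
    have "rep p w s (Var x) (w x)"
      by (rule rep_Var[OF hull_gd[OF w] p x HU[OF hull_in[OF w x]] P.eqv_refl[OF x(2) HU[OF hull_in[OF w x]]]])
    then show ?case using x hull_in[OF w x] by (auto simp: nmw_def)
  next
    case (Fn f ts)
    let ?ss = "fargs L f"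
    have f: "f \<in> funs L" "fres L f = s" and ts: "list_all2 (has_sort L) ts ?ss" using Fn.prems by simp_all
    have s: "s \<in> sorts L" and ss: "set ?ss \<subseteq> sorts L" using f wfL unfolding wf_lang_def by blast+
    have lt: "length ts = length ?ss" using ts by (rule list_all2_lengthD)
    have "\<exists>a. a \<in> H (?ss ! i) \<and> rep p w (?ss ! i) (ts ! i) a \<and> eval_tm N (nmw w) (ts ! i) = nm (?ss ! i) a"
      if "i < length ?ss" for i
    proof -
      have "has_sort L (ts ! i) (?ss ! i)" using ts that by (simp add: list_all2_conv_all_nth)
      moreover have "ts ! i \<in> set ts" using that lt by simp
      ultimately show ?thesis using Fn.IH by blast
    qed
    then obtain g where g: "\<And>i. i < length ?ss \<Longrightarrow> g i \<in> H (?ss ! i) \<and> rep p w (?ss ! i) (ts ! i) (g i) \<and> eval_tm N (nmw w) (ts ! i) = nm (?ss ! i) (g i)"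
      by metis
    define as where "as = map g [0..<length ?ss]"
    have as: "length as = length ?ss" "\<And>i. i < length ?ss \<Longrightarrow> as ! i = g i" by (simp_all add: as_def)
    have asH: "as ! i \<in> H (?ss ! i)" if "i < length ?ss" for i using as(2)[OF that] g[OF that] by simp
    have ev: "map (eval_tm N (nmw w)) ts = map2 nm ?ss as"
      using lt as g by (intro nth_equalityI) auto
    obtain y where y: "fst y = s" "y \<notin> fv_tm (Fn f ts)" by (rule fresh_var[of "fv_tm (Fn f ts)"]) auto
    have hs: "has_sort L (Fn f ts) s" by (rule Fn.prems)
    have wfy: "wf_fm L (Eq (Fn f ts) (Var y))" using hs y s by auto
    have "valid (Exists y (Eq (Fn f ts) (Var y)))"
    proof (rule validI)
      show "wf_fm L (Exists y (Eq (Fn f ts) (Var y)))" using wfy y s by simp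
      fix N :: "('s, 'f, 'r, 'u) struct" and v assume NN: "is_struct L N" "gd L (univ N) v"
      have "eval_tm N v (Fn f ts) \<in> univ N (fst y)" using eval_tm_sort[OF NN hs] y by simp
      moreover have "eval_tm N (v(y := eval_tm N v (Fn f ts))) (Fn f ts) = eval_tm N v (Fn f ts)"
        by (rule eval_tm_cong) (use y in auto)
      ultimately show "sat N v (Exists y (Eq (Fn f ts) (Var y)))"
        unfolding sat.simps by (intro bexI[of _ "eval_tm N v (Fn f ts)"]) simp_all
    qed
    from tr_valid[OF this hull_gd[OF w] p] have "\<exists>b\<in>U (fst y). tr p (w(y := b)) (Eq (Fn f ts) (Var y))"
      using P.S_Exists[OF hull_gd[OF w] wfy] y s by simp
    from hull_witness[OF w wfy this] obtain b where b: "b \<in> H s" "tr p (w(y := b)) (Eq (Fn f ts) (Var y))" using y by blast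
    have rb: "rep p w s (Fn f ts) b" by (rule repI[OF hull_gd[OF w] p hs s HU[OF b(1)] y b(2)])
    have transport: "rep p w' s (Fn f (map Var xs)) b"
      if w': "hull w'" and xs: "map fst xs = ?ss" and e: "map2 nm ?ss as = nms w' xs" for w' xs
    proof -
      let ?us = "map Var xs :: ('s, 'f) tm list"
      have us: "list_all2 (has_sort L) ?us ?ss" by (rule vars[OF xs ss])
      obtain z where z: "fst z = s" "z \<notin> fv_tm (Fn f ts) \<union> fv_tm (Fn f ?us)"
        by (rule fresh_var[of "fv_tm (Fn f ts) \<union> fv_tm (Fn f ?us)"]) auto
      \<comment> \<open>\<open>tr_transport\<close> treats formulas in one list of terms. The last
        entry of the list plays the right-hand side of the equation, and \<open>Bot\<close> covers
        the empty list, which has no last entry.\<close>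
      let ?\<alpha> = "\<lambda>l. if l = [] then Bot else Eq (Fn f (butlast l)) (last l) :: ('s, 'f, 'r) fm"
      have g1: "gdL (w(z := b))" "gdL (w'(z := b))"
        by (rule gdL_upd[OF hull_gd[OF w] z(1) HU[OF b(1)]], rule gdL_upd[OF hull_gd[OF w'] z(1) HU[OF b(1)]])
      have rz: "rep p (w(z := b)) s (Var z) b" "rep p (w'(z := b)) s (Var z) b"
        by (rule rep_Var[OF g1(1) p z(1) s HU[OF b(1)]], simp add: P.eqv_refl[OF s HU[OF b(1)]],
            rule rep_Var[OF g1(2) p z(1) s HU[OF b(1)]], simp add: P.eqv_refl[OF s HU[OF b(1)]])
      have keep: "rep p (w(z := b)) s' t a" if "rep p w s' t a" "z \<notin> fv_tm t" "has_sort L t s'" "s' \<in> sorts L" "a \<in> U s'" "hull w" for w s' t a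
      proof -
        obtain y where y: "fst y = s'" "y \<notin> insert z (fv_tm t)" by (rule fresh_var[of "insert z (fv_tm t)"]) auto
        have "tr p (w(y := a)) (Eq t (Var y))" using that(1) y unfolding rep_def by blast
        moreover have "tr p (w(z := b, y := a)) (Eq t (Var y)) = tr p (w(y := a)) (Eq t (Var y))"
          by (rule tr_fv) (use y that(2) in auto)
        moreover have "gdL (w(z := b))" by (rule gdL_upd[OF hull_gd[OF that(6)] z(1) HU[OF b(1)]])
        ultimately show ?thesis using y by (intro repI[OF _ p that(3,4,5), of _ y]) auto
      qed
      have "tr p (w(z := b)) (?\<alpha> (ts @ [Var z])) = tr p (w'(z := b)) (?\<alpha> (?us @ [Var z]))"
      proof (rule tr_transport[OF _ _ _ p g1, where ss = "?ss @ [s]" and as = "as @ [b]"])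
        fix l assume "list_all2 (has_sort L) l (?ss @ [s])"
        then obtain l1 t where l: "l = l1 @ [t]" "list_all2 (has_sort L) l1 ?ss" "has_sort L t s"
          by (auto simp: list_all2_append2 list_all2_Cons2)
        then show "wf_fm L (?\<alpha> l)" using f by auto
      next
        fix l show "fv (?\<alpha> l) = (\<Union>t\<in>set l. fv_tm t)"
          by (cases l rule: rev_cases) auto
      next
        fix N :: "('s, 'f, 'r, 'u) struct" and v l l' assume "map (eval_tm N v) l = map (eval_tm N v) l'"
        then show "sat N v (?\<alpha> l) = sat N v (?\<alpha> l')"
          by (cases l rule: rev_cases; cases l' rule: rev_cases) auto
      next
        fix i assume i: "i < length (?ss @ [s])"
        have m: "ts ! i \<in> set ts" "?us ! i \<in> set ?us" "has_sort L (ts ! i) (?ss ! i)" "has_sort L (?us ! i) (?ss ! i)" "?ss ! i \<in> sorts L"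
          if "i < length ?ss"
          using that lt ts us ss by (auto simp: list_all2_conv_all_nth dest: nth_mem)
        show "(as @ [b]) ! i \<in> U ((?ss @ [s]) ! i)"
          using i as(1) HU[OF asH] HU[OF b(1)] by (cases "i < length ?ss") (auto simp: nth_append less_Suc_eq)
        show "rep p (w(z := b)) ((?ss @ [s]) ! i) ((ts @ [Var z]) ! i) ((as @ [b]) ! i)"
        proof (cases "i < length ?ss")
          case True
          have "z \<notin> fv_tm (ts ! i)" using z(2) m(1)[OF True] by auto
          then have "rep p (w(z := b)) (?ss ! i) (ts ! i) (as ! i)"
            using keep[OF _ _ m(3)[OF True] m(5)[OF True] HU[OF asH[OF True]] w] g[OF True] as(2)[OF True] by simp
          then show ?thesis using True lt as(1) by (simp add: nth_append)
        next
          case False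
          then have "i = length ?ss" using i by simp
          then show ?thesis using rz(1) lt as(1) by (simp add: nth_append)
        qed
        show "rep p (w'(z := b)) ((?ss @ [s]) ! i) ((?us @ [Var z]) ! i) ((as @ [b]) ! i)"
        proof (cases "i < length ?ss")
          case True
          have "z \<notin> fv_tm (?us ! i)" using z(2) m(2)[OF True] by auto
          then have "rep p (w'(z := b)) (?ss ! i) (?us ! i) (as ! i)"
            using keep[OF _ _ m(4)[OF True] m(5)[OF True] HU[OF asH[OF True]] w'] nms_rep[OF w' xs ss as(1) asH e True] by simp
          then show ?thesis using True us as(1) by (simp add: nth_append list_all2_conv_all_nth)
        next
          case False
          then have "i = length ?ss" using i by simp
          then show ?thesis using rz(2) us as(1) by (simp add: nth_append list_all2_conv_all_nth)
        qed
      qed (use ss s ts us as(1) z(1) in \<open>auto simp: list_all2_appendI\<close>)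
      moreover have "tr p (w(z := b)) (Eq (Fn f ts) (Var z))" using rb z unfolding rep_def by blast
      ultimately have "tr p (w'(z := b)) (Eq (Fn f ?us) (Var z))" by simp
      moreover have "has_sort L (Fn f ?us) s" using f us by simp
      ultimately show ?thesis using z by (intro repI[OF hull_gd[OF w'] p _ s HU[OF b(1)], of _ z]) auto
    qed
    obtain w1 xs1 where w1: "hull w1" "map fst xs1 = ?ss" "map2 nm ?ss as = nms w1 xs1" using hull_list[OF ss as(1) asH] by blast
    have "FI f (map2 nm ?ss as) b" unfolding FI_def f(2) using b(1) w1 transport[OF w1] by blast
    then have "FI f (map2 nm ?ss as) (SOME b. FI f (map2 nm ?ss as) b)" by (rule someI)
    \<comment> \<open>The interpretation selects some value \<open>c\<close>, perhaps different from
      \<open>b\<close>. Both are values of the same term at \<open>w2\<close>, hence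
      \<open>eqv\<close>-equal, and they have the same name.\<close>
    then obtain c w2 xs2 where c: "c = (SOME b. FI f (map2 nm ?ss as) b)" "c \<in> H s" "hull w2" "map fst xs2 = ?ss"
      "map2 nm ?ss as = nms w2 xs2" "rep p w2 s (Fn f (map Var xs2)) c" unfolding FI_def f(2) by blast
    have "has_sort L (Fn f (map Var xs2)) s" using f vars[OF c(4) ss] by simp
    then have "eqv p s b c"
      using rep_unique[OF p hull_gd[OF c(3)] _ s HU[OF b(1)] HU[OF c(2)] transport[OF c(3,4,5)] c(6)] by blast
    then have "nm s b = nm s c" using nm_iff[OF s b(1) c(2)] by blast
    then have "eval_tm N (nmw w) (Fn f ts) = nm s b" using c(1) f(2) by (simp add: N ev)
    then show ?case using s b(1) rb by blast
  qed
  have truth: "wf_fm L \<phi> \<Longrightarrow> hull w \<Longrightarrow> sat N (nmw w) \<phi> \<longleftrightarrow> tr p w \<phi>" for \<phi> w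
  proof (induction \<phi> arbitrary: w)
    case Bot
    then show ?case using P.S_Bot hull_gd by simp
  next
    case (Eq t u)
    then obtain s where hs: "has_sort L t s" "has_sort L u s" by auto
    obtain a where s: "s \<in> sorts L" and a: "a \<in> H s" "rep p w s t a" "eval_tm N (nmw w) t = nm s a" using terms[OF Eq(2) hs(1)] by blast
    obtain b where b: "b \<in> H s" "rep p w s u b" "eval_tm N (nmw w) u = nm s b" using terms[OF Eq(2) hs(2)] by blast
    have gw: "gdL w" by (rule hull_gd[OF Eq(2)])
    obtain y where y: "fst y = s" "y \<notin> fv_tm t \<union> fv_tm u" by (rule fresh_var[of "fv_tm t \<union> fv_tm u"]) auto
    have g: "gdL (w(y := a))" by (rule gdL_upd[OF gw y(1) HU[OF a(1)]])
    have wf: "wf_fm L (Eq t u)" "wf_fm L (Eq t (Var y))" "wf_fm L (Eq u (Var y))" using hs y s by auto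
    have "valid (Imp (Eq t (Var y)) (Iff (Eq t u) (Eq u (Var y))))"
      by (rule validI) (use wf in \<open>auto simp: Imp_def Iff_def\<close>)
    from tr_valid[OF this g p] have "tr p (w(y := a)) (Eq t (Var y)) \<longrightarrow> (tr p (w(y := a)) (Eq t u) \<longleftrightarrow> tr p (w(y := a)) (Eq u (Var y)))"
      using wf by (simp add: P.S_Imp[OF g] P.S_Iff[OF g])
    moreover have "tr p (w(y := a)) (Eq t (Var y))" using a(2) y unfolding rep_def by blast
    moreover have "tr p (w(y := a)) (Eq t u) = tr p w (Eq t u)" by (rule tr_fv) (use y in auto)
    ultimately have 1: "tr p w (Eq t u) \<longleftrightarrow> tr p (w(y := a)) (Eq u (Var y))" by blast
    have 2: "tr p (w(y := a)) (Eq u (Var y)) \<longleftrightarrow> rep p w s u a"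
      using repI[OF gw p hs(2) s HU[OF a(1)] y(1)] y unfolding rep_def by blast
    have "rep p w s u a \<longleftrightarrow> eqv p s b a"
      using rep_unique[OF p gw hs(2) s HU[OF b(1)] HU[OF a(1)] b(2)] rep_eqv[OF p gw hs(2) s HU[OF b(1)] HU[OF a(1)] b(2)] by blast
    also have "\<dots> \<longleftrightarrow> nm s b = nm s a" using nm_iff[OF s b(1) a(1)] by blast
    finally show ?case using 1 2 a(3) b(3) by auto
  next
    case (Rel r ts)
    let ?ss = "rargs L r"
    have ts: "list_all2 (has_sort L) ts ?ss" and r: "r \<in> rels L" using Rel(1) by simp_all
    have ss: "set ?ss \<subseteq> sorts L" using r wfL unfolding wf_lang_def by blast
    have lt: "length ts = length ?ss" using ts by (rule list_all2_lengthD)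
    have "\<exists>a. a \<in> H (?ss ! i) \<and> rep p w (?ss ! i) (ts ! i) a \<and> eval_tm N (nmw w) (ts ! i) = nm (?ss ! i) a"
      if "i < length ?ss" for i
    proof -
      have "has_sort L (ts ! i) (?ss ! i)" using ts that by (simp add: list_all2_conv_all_nth)
      then show ?thesis using terms[OF Rel(2)] by blast
    qed
    then obtain g where g: "\<And>i. i < length ?ss \<Longrightarrow> g i \<in> H (?ss ! i) \<and> rep p w (?ss ! i) (ts ! i) (g i) \<and> eval_tm N (nmw w) (ts ! i) = nm (?ss ! i) (g i)"
      by metis
    define as where "as = map g [0..<length ?ss]"
    have as: "length as = length ?ss" "\<And>i. i < length ?ss \<Longrightarrow> as ! i = g i" by (simp_all add: as_def)
    have asH: "as ! i \<in> H (?ss ! i)" if "i < length ?ss" for i using as(2)[OF that] g[OF that] by simp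
    have ev: "map (eval_tm N (nmw w)) ts = map2 nm ?ss as"
      using lt as g by (intro nth_equalityI) auto
    have transport: "tr p w (Rel r ts) = tr p w' (Rel r (map Var xs))"
      if w': "hull w'" and xs: "map fst xs = ?ss" and e: "map2 nm ?ss as = nms w' xs" for w' xs
    proof (rule tr_transport[OF _ _ _ p hull_gd[OF Rel(2)] hull_gd[OF w'] ss ts vars[OF xs ss] as(1)])
      fix i assume i: "i < length ?ss"
      show "as ! i \<in> U (?ss ! i)" by (rule HU[OF asH[OF i]])
      show "rep p w (?ss ! i) (ts ! i) (as ! i)" using g[OF i] as(2)[OF i] by simp
      show "rep p w' (?ss ! i) (map Var xs ! i) (as ! i)" by (rule nms_rep[OF w' xs ss as(1) asH e i])
    next
      fix N :: "('s, 'f, 'r, 'u) struct" and v l l' assume "map (eval_tm N v) l = map (eval_tm N v) l'"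
      then show "sat N v (Rel r l) = sat N v (Rel r l')" by (simp only: sat.simps)
    qed (use r in auto)
    obtain w1 xs1 where w1: "hull w1" "map fst xs1 = ?ss" "map2 nm ?ss as = nms w1 xs1" using hull_list[OF ss as(1) asH] by blast
    have "RI r (map2 nm ?ss as) \<longleftrightarrow> tr p w (Rel r ts)"
      unfolding RI_def using transport w1 by blast
    then show ?case by (simp add: N ev)
  next
    case (Neg \<phi>)
    then show ?case using P.S_Neg[OF hull_gd[OF Neg(3)]] by simp
  next
    case (Conj \<phi> \<psi>)
    then show ?case using P.S_Conj[OF hull_gd[OF Conj(4)]] by simp
  next
    case (Exists x \<phi>)
    have x: "fst x \<in> sorts L" and wf: "wf_fm L \<phi>" using Exists.prems by simp_all
    have upd: "(nmw w)(x := nm (fst x) a) = nmw (w(x := a))" for a by (rule ext) (simp add: nmw_def)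
    have "sat N (nmw w) (Exists x \<phi>) \<longleftrightarrow> (\<exists>a\<in>H (fst x). sat N (nmw (w(x := a))) \<phi>)"
      by (simp add: N upd)
    also have "\<dots> \<longleftrightarrow> (\<exists>a\<in>H (fst x). tr p (w(x := a)) \<phi>)"
      using Exists.IH[OF wf] hull_upd[OF Exists.prems(2) refl] by blast
    also have "\<dots> \<longleftrightarrow> (\<exists>a\<in>U (fst x). tr p (w(x := a)) \<phi>)"
      using hull_witness[OF Exists.prems(2) wf] HU by blast
    also have "\<dots> \<longleftrightarrow> tr p w (Exists x \<phi>)" using P.S_Exists[OF hull_gd[OF Exists.prems(2)] wf x] by simp
    finally show ?case .
  qed
  have gN: "gd L (univ N) (nmw w0)" unfolding gd_def N nmw_def using hull_in[OF hull0] by blast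
  have "is_struct L N"
    unfolding is_struct_def
  proof (intro conjI ballI)
    fix s assume s: "s \<in> sorts L"
    have "w0 (s, 0) \<in> H s" by (rule hull_in[OF hull0]) (use s in simp_all)
    then show "univ N s \<noteq> {}" by (auto simp: N)
  next
    fix f us assume f: "f \<in> funs L" and us: "us \<in> tuples N (fargs L f)"
    let ?ss = "fargs L f"
    have ss: "set ?ss \<subseteq> sorts L" using f wfL unfolding wf_lang_def by blast
    have l: "length us = length ?ss" and u: "\<And>i. i < length ?ss \<Longrightarrow> us ! i \<in> nm (?ss ! i) ` H (?ss ! i)"
      using us by (auto simp: tuples_iff list_all2_conv_all_nth N)
    have "\<exists>a. a \<in> H (?ss ! i) \<and> us ! i = nm (?ss ! i) a" if "i < length ?ss" for i using u[OF that] by blast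
    then obtain g where g: "\<And>i. i < length ?ss \<Longrightarrow> g i \<in> H (?ss ! i) \<and> us ! i = nm (?ss ! i) (g i)" by metis
    define as where "as = map g [0..<length ?ss]"
    have as: "length as = length ?ss" "\<And>i. i < length ?ss \<Longrightarrow> as ! i = g i" by (simp_all add: as_def)
    have us_eq: "us = map2 nm ?ss as" using l as g by (intro nth_equalityI) auto
    have asH: "as ! i \<in> H (?ss ! i)" if "i < length ?ss" for i using as(2)[OF that] g[OF that] by simp
    obtain w xs where w: "hull w" "map fst xs = ?ss" "us = nms w xs" using hull_list[OF ss as(1) asH] us_eq by blast
    have hs: "has_sort L (Fn f (map Var xs)) (fres L f)" using f vars[OF w(2) ss] by simp
    obtain a where a: "a \<in> H (fres L f)" "eval_tm N (nmw w) (Fn f (map Var xs)) = nm (fres L f) a" using terms[OF w(1) hs] by blast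
    have "map (eval_tm N (nmw w)) (map Var xs) = us" unfolding w(3) nms_def nmw_def by simp
    then have "fint N f us = nm (fres L f) a" using a(2) by (simp only: eval_tm.simps)
    then show "fint N f us \<in> univ N (fres L f)" using a(1) by (simp add: N)
  qed
  then show ?thesis using gN truth[OF _ hull0] w0_v0 by blast
qed

end

section \<open>Formulas about imaginaries as formulas of the language\<close>

lemma Var_sorts:
  assumes "map fst zs = ss" "set ss \<subseteq> sorts L"
  shows "list_all2 (has_sort L) (map Var zs) ss"
proof -
  have "length zs = length ss" using assms(1) by (metis length_map)
  moreover have "fst (zs ! i) = ss ! i \<and> ss ! i \<in> sorts L" if "i < length zs" for i
    using assms that by (metis length_map nth_map nth_mem subsetD)
  ultimately show ?thesis by (simp add: list_all2_conv_all_nth)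
qed

lemma set_map2:
  assumes "length xs = n" "length ys = n"
  shows "set (map2 f xs ys) = (\<lambda>i. f (xs ! i) (ys ! i)) ` {..<n}"
proof -
  have "map2 f xs ys = map (\<lambda>i. f (xs ! i) (ys ! i)) [0..<n]"
    using assms by (intro nth_equalityI) simp_all
  then show ?thesis by (simp add: atLeast0LessThan)
qed

text \<open>Substitution of terms through fresh variables: \<exists>zs. zs = ts \<and> \<phi>(zs).
  Freshness with respect to the terms prevents capture, while \<open>sub\<close> takes care of
  overlaps of \<open>zs\<close> with \<open>xs\<close>.\<close>

lemma subst_terms:
  fixes \<phi> :: "('s, 'f, 'r) fm" and N :: "('s, 'f, 'r, 'a) struct"
  assumes N: "is_struct L N" and \<phi>: "fm_in L xs \<phi>" and ts: "list_all2 (has_sort L) ts (map fst xs)"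
  shows "\<exists>\<phi>'. wf_fm L \<phi>' \<and> fv \<phi>' \<subseteq> (\<Union>t\<in>set ts. fv_tm t) \<and>
    (\<forall>v. gd L (univ N) v \<longrightarrow> (sat N v \<phi>' \<longleftrightarrow> holds N xs \<phi> (map (eval_tm N v) ts)))"
proof -
  interpret N: tarski L "univ N" "sat N" "\<lambda>_. (=)" by (rule tarski_sat[OF N])
  have xs: "fst ` set xs \<subseteq> sorts L" "distinct xs" "fv \<phi> \<subseteq> set xs" "wf_fm L \<phi>" using \<phi> by (auto simp: fm_in_def)
  have fin: "finite (\<Union>t\<in>set ts. fv_tm t)" by simp
  obtain zs where zs: "map fst zs = map fst xs" "distinct zs" "set zs \<inter> (\<Union>t\<in>set ts. fv_tm t) = {}"
    using fresh_vars[OF fin, of "map fst xs"] by (elim exE conjE)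
  have len: "length zs = length xs" "length ts = length xs"
    using zs(1) list_all2_lengthD[OF ts] by (metis length_map, simp)
  have zsorts: "fst ` set zs \<subseteq> sorts L" using zs(1) xs(1) by (metis set_map)
  have fz: "fst (zs ! i) = fst (xs ! i)" if "i < length xs" for i using that zs(1) len by (metis nth_map)
  have hs: "has_sort L (ts ! i) (fst (xs ! i))" if "i < length xs" for i
    using list_all2_nthD2[OF ts, of i] that by simp
  let ?es = "map2 (\<lambda>z t. Eq (Var z) t) zs ts :: ('s, 'f, 'r) fm list"
  have es: "set ?es = (\<lambda>i. Eq (Var (zs ! i)) (ts ! i)) ` {..<length xs}"
    by (rule set_map2) (simp_all add: len)
  let ?\<phi> = "Exs zs (Conj (Conjs ?es) (sub xs zs \<phi>))"
  have wfe: "wf_fm L (Conjs ?es)"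
  proof -
    have "wf_fm L (Eq (Var (zs ! i)) (ts ! i))" if "i < length xs" for i
    proof -
      have "fst (zs ! i) \<in> sorts L" using zsorts that len by (metis image_subset_iff nth_mem)
      then show ?thesis using hs[OF that] fz[OF that] by auto
    qed
    then show ?thesis unfolding wf_Conjs es by simp
  qed
  have wfs: "wf_fm L (sub xs zs \<phi>)" by (rule wf_sub[OF zs(1)[symmetric] xs(1,4)])
  show ?thesis
  proof (intro exI[of _ ?\<phi>] conjI allI impI)
    show "wf_fm L ?\<phi>" using wfe wfs zsorts by simp
    have "fv (Conjs ?es) \<subseteq> set zs \<union> (\<Union>t\<in>set ts. fv_tm t)"
    proof
      fix x assume "x \<in> fv (Conjs ?es)"
      then obtain i where "i < length xs" "x = zs ! i \<or> x \<in> fv_tm (ts ! i)" unfolding fv_Conjs es by auto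
      moreover from this have "zs ! i \<in> set zs" "ts ! i \<in> set ts" using len by simp_all
      ultimately show "x \<in> set zs \<union> (\<Union>t\<in>set ts. fv_tm t)" by blast
    qed
    then show "fv ?\<phi> \<subseteq> (\<Union>t\<in>set ts. fv_tm t)" using fv_sub[OF xs(3), of zs] by auto
    fix v assume v: "gd L (univ N) v"
    let ?as = "map (eval_tm N v) ts"
    have ev: "eval_tm N w (ts ! i) = eval_tm N v (ts ! i)" if "off (set zs) v w" "i < length xs" for w i
    proof (rule eval_tm_cong)
      fix x assume "x \<in> fv_tm (ts ! i)"
      then have "x \<notin> set zs" using zs(3) that(2) len nth_mem by fastforce
      then show "w x = v x" using that(1) by (simp add: off_def)
    qed
    have holds_iff: "sat N w (sub xs zs \<phi>) \<longleftrightarrow> holds N xs \<phi> ?as" if w: "gd L (univ N) w" "map w zs = ?as" for w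
    proof -
      have "list_all2 (\<lambda>a x. a \<in> univ N (fst x)) ?as xs"
        using eval_tm_sort[OF N v] hs len by (simp add: list_all2_conv_all_nth)
      then obtain v' where v': "gd L (univ N) v'" "off (set xs) w v'" "map v' xs = ?as" by (rule val_of_list[OF w(1) xs(2)])
      have "sat N w (sub xs zs \<phi>) = sat N v' \<phi>"
        by (rule N.S_sub[OF w(1) v'(1) zs(1)[symmetric] xs(1,2,4,3)]) (simp only: v'(3) w(2))
      then show ?thesis using holds_map[OF xs(3), of N v'] v'(3) by simp
    qed
    have C: "sat N w (Conjs ?es) \<longleftrightarrow> map w zs = ?as" if "off (set zs) v w" for w
    proof -
      have "sat N w (Conjs ?es) \<longleftrightarrow> (\<forall>i<length xs. w (zs ! i) = eval_tm N w (ts ! i))"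
        unfolding sat_Conjs es by auto
      also have "\<dots> \<longleftrightarrow> (\<forall>i<length xs. w (zs ! i) = eval_tm N v (ts ! i))" using ev[OF that] by simp
      also have "\<dots> \<longleftrightarrow> map w zs = ?as" using len by (simp add: list_eq_iff_nth_eq)
      finally show ?thesis .
    qed
    have "sat N v ?\<phi> \<longleftrightarrow> (\<exists>w. gd L (univ N) w \<and> off (set zs) v w \<and> map w zs = ?as \<and> holds N xs \<phi> ?as)"
      using N.S_Exs[of "Conj (Conjs ?es) (sub xs zs \<phi>)" zs v] wfe wfs zsorts v C holds_iff by (auto simp del: wf_Conjs)
    also have "\<dots> \<longleftrightarrow> holds N xs \<phi> ?as"
    proof
      assume "holds N xs \<phi> ?as"
      moreover have "list_all2 (\<lambda>a x. a \<in> univ N (fst x)) ?as zs"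
        using eval_tm_sort[OF N v] hs len fz by (simp add: list_all2_conv_all_nth)
      then obtain w where "gd L (univ N) w" "off (set zs) v w" "map w zs = ?as" by (rule val_of_list[OF v zs(2)])
      ultimately show "\<exists>w. gd L (univ N) w \<and> off (set zs) v w \<and> map w zs = ?as \<and> holds N xs \<phi> ?as" by blast
    qed blast
    finally show "sat N v ?\<phi> \<longleftrightarrow> holds N xs \<phi> ?as" .
  qed
qed

section \<open>Translation from the language of imaginaries to the language of the structure\<close>

lemma eq_lang_simps [simp]:
  "Real s \<in> sorts (eq_lang L N) \<longleftrightarrow> s \<in> sorts L"
  "Imag xs ys E \<in> sorts (eq_lang L N) \<longleftrightarrow> defines_equiv L N xs ys E"
  "RealF f \<in> funs (eq_lang L N) \<longleftrightarrow> f \<in> funs L"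
  "Proj xs ys E \<in> funs (eq_lang L N) \<longleftrightarrow> defines_equiv L N xs ys E"
  "rels (eq_lang L N) = rels L" "fargs (eq_lang L N) = eq_fargs L" "fres (eq_lang L N) = eq_fres L"
  "rargs (eq_lang L N) r = map Real (rargs L r)"
  by (auto simp: eq_lang_def)

lemma eq_struct_simps [simp]:
  "univ (eq_struct N) = eq_univ N" "fint (eq_struct N) = eq_fint N"
  "rint (eq_struct N) r as = rint N r (map projl as)"
  by (auto simp: eq_struct_def)

lemma list_choice:
  assumes "list_all2 P as bs" "\<And>a b. P a b \<Longrightarrow> a \<in> set as \<Longrightarrow> \<exists>c. Q a b c"
  shows "\<exists>cs. length cs = length as \<and> (\<forall>i<length as. Q (as ! i) (bs ! i) (cs ! i))"
proof -
  have "\<exists>c. Q (as ! i) (bs ! i) c" if "i < length as" for i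
    using assms(1) that by (intro assms(2)) (simp_all add: list_all2_conv_all_nth)
  then obtain c where c: "\<And>i. i < length as \<Longrightarrow> Q (as ! i) (bs ! i) (c i)" by metis
  then show ?thesis by (intro exI[of _ "map c [0..<length as]"]) simp
qed

text \<open>\<kappa> represents a variable of the expanded language by ordinary ones: a single
  variable for a real sort, and a tuple that holds a representative for a sort of classes.
  \<open>eqval\<close> is the assignment that results when each tuple is replaced by its
  class.\<close>

definition kok :: "(('s, 'f, 'r) eq_sort \<times> nat \<Rightarrow> 's var list) \<Rightarrow> ('s, 'f, 'r) eq_sort \<times> nat \<Rightarrow> bool" where
  "kok \<kappa> w \<longleftrightarrow> (case fst w of Real s \<Rightarrow> map fst (\<kappa> w) = [s] | Imag xs ys E \<Rightarrow> map fst (\<kappa> w) = map fst xs)"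

definition eqval :: "('s, 'f, 'r, 'a) struct \<Rightarrow> (('s, 'f, 'r) eq_sort \<times> nat \<Rightarrow> 's var list) \<Rightarrow> ('s var \<Rightarrow> 'a) \<Rightarrow>
    ('s, 'f, 'r) eq_sort \<times> nat \<Rightarrow> 'a + 'a list set" where
  "eqval N \<kappa> v w = (case fst w of Real s \<Rightarrow> Inl (v (hd (\<kappa> w))) | Imag xs ys E \<Rightarrow> Inr (eqrel N xs ys E `` {map v (\<kappa> w)}))"

abbreviation "fvk \<kappa> W \<equiv> (\<Union>w\<in>W. set (\<kappa> w))"

lemma translate_real_tm:
  fixes t :: "(('s, 'f, 'r) eq_sort, ('s, 'f, 'r) eq_fun) tm" and N :: "('s, 'f, 'r, 'a) struct"
  assumes "\<And>w. w \<in> fv_tm t \<Longrightarrow> kok \<kappa> w" "has_sort (eq_lang L N) t (Real s)"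
  shows "\<exists>t'. has_sort L t' s \<and> fv_tm t' \<subseteq> fvk \<kappa> (fv_tm t) \<and> (\<forall>v. eval_tm (eq_struct N) (eqval N \<kappa> v) t = Inl (eval_tm N v t'))"
  using assms
proof (induction t arbitrary: s)
  case (Var w)
  then have "kok \<kappa> w" "fst w = Real s" "s \<in> sorts L" by auto
  then obtain x where x: "\<kappa> w = [x]" "fst x = s" by (auto simp: kok_def)
  then show ?case using \<open>fst w = Real s\<close> \<open>s \<in> sorts L\<close> by (intro exI[of _ "Var x"]) (simp add: eqval_def)
next
  case (Fn g ts)
  then obtain f where f: "g = RealF f" "f \<in> funs L" "fres L f = s" by (cases g) auto
  have ts: "list_all2 (has_sort (eq_lang L N)) ts (map Real (fargs L f))" using Fn.prems(2) f by simp
  have "list_all2 (\<lambda>t s. has_sort (eq_lang L N) t (Real s)) ts (fargs L f)" using ts by (simp add: list_all2_map2)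
  then have "\<exists>us. length us = length ts \<and> (\<forall>i<length ts. has_sort L (us ! i) (fargs L f ! i) \<and> fv_tm (us ! i) \<subseteq> fvk \<kappa> (fv_tm (ts ! i)) \<and>
      (\<forall>v. eval_tm (eq_struct N) (eqval N \<kappa> v) (ts ! i) = Inl (eval_tm N v (us ! i))))"
  proof (rule list_choice)
    fix t s assume t: "has_sort (eq_lang L N) t (Real s)" "t \<in> set ts"
    show "\<exists>t'. has_sort L t' s \<and> fv_tm t' \<subseteq> fvk \<kappa> (fv_tm t) \<and> (\<forall>v. eval_tm (eq_struct N) (eqval N \<kappa> v) t = Inl (eval_tm N v t'))"
    proof (rule Fn.IH[OF t(2) _ t(1)])
      fix w assume "w \<in> fv_tm t"
      then have "w \<in> fv_tm (Fn g ts)" using t(2) by auto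
      then show "kok \<kappa> w" by (rule Fn.prems(1))
    qed
  qed
  then obtain us where us: "length us = length ts" "\<And>i. i < length ts \<Longrightarrow> has_sort L (us ! i) (fargs L f ! i)"
    "\<And>i. i < length ts \<Longrightarrow> fv_tm (us ! i) \<subseteq> fvk \<kappa> (fv_tm (ts ! i))"
    "\<And>i v. i < length ts \<Longrightarrow> eval_tm (eq_struct N) (eqval N \<kappa> v) (ts ! i) = Inl (eval_tm N v (us ! i))" by blast
  have len: "length ts = length (fargs L f)" using list_all2_lengthD[OF ts] by simp
  have "has_sort L (Fn f us) s" using f us(1,2) len by (simp add: list_all2_conv_all_nth)
  moreover have "fv_tm (Fn f us) \<subseteq> fvk \<kappa> (fv_tm (Fn g ts))"
  proof
    fix x assume "x \<in> fv_tm (Fn f us)"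
    then obtain i where i: "i < length us" "x \<in> fv_tm (us ! i)" by (auto simp: in_set_conv_nth)
    then have "x \<in> fvk \<kappa> (fv_tm (ts ! i))" "ts ! i \<in> set ts" using us(1) us(3)[of i] by auto
    then show "x \<in> fvk \<kappa> (fv_tm (Fn g ts))" by auto
  qed
  moreover have "map projl (map (eval_tm (eq_struct N) (eqval N \<kappa> v)) ts) = map (eval_tm N v) us" for v
    using us(1,4) by (intro nth_equalityI) simp_all
  then have "eval_tm (eq_struct N) (eqval N \<kappa> v) (Fn g ts) = Inl (eval_tm N v (Fn f us))" for v
    unfolding f(1) by (simp del: map_map)
  ultimately show ?case by blast
qed

lemma translate_real_tms:
  fixes ts :: "(('s, 'f, 'r) eq_sort, ('s, 'f, 'r) eq_fun) tm list" and N :: "('s, 'f, 'r, 'a) struct"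
  assumes "\<And>w. w \<in> (\<Union>t\<in>set ts. fv_tm t) \<Longrightarrow> kok \<kappa> w" "list_all2 (has_sort (eq_lang L N)) ts (map Real ss)"
  shows "\<exists>us. list_all2 (has_sort L) us ss \<and> (\<Union>t\<in>set us. fv_tm t) \<subseteq> fvk \<kappa> (\<Union>t\<in>set ts. fv_tm t) \<and>
    (\<forall>v. map projl (map (eval_tm (eq_struct N) (eqval N \<kappa> v)) ts) = map (eval_tm N v) us)"
proof -
  have "list_all2 (\<lambda>t s. has_sort (eq_lang L N) t (Real s)) ts ss" using assms(2) by (simp add: list_all2_map2)
  then have "\<exists>us. length us = length ts \<and> (\<forall>i<length ts. has_sort L (us ! i) (ss ! i) \<and> fv_tm (us ! i) \<subseteq> fvk \<kappa> (fv_tm (ts ! i)) \<and>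
      (\<forall>v. eval_tm (eq_struct N) (eqval N \<kappa> v) (ts ! i) = Inl (eval_tm N v (us ! i))))"
  proof (rule list_choice)
    fix t s assume t: "has_sort (eq_lang L N) t (Real s)" "t \<in> set ts"
    show "\<exists>t'. has_sort L t' s \<and> fv_tm t' \<subseteq> fvk \<kappa> (fv_tm t) \<and> (\<forall>v. eval_tm (eq_struct N) (eqval N \<kappa> v) t = Inl (eval_tm N v t'))"
      by (rule translate_real_tm[OF _ t(1)]) (use t(2) assms(1) in blast)
  qed
  then obtain us where us: "length us = length ts" "\<And>i. i < length ts \<Longrightarrow> has_sort L (us ! i) (ss ! i)"
    "\<And>i. i < length ts \<Longrightarrow> fv_tm (us ! i) \<subseteq> fvk \<kappa> (fv_tm (ts ! i))"
    "\<And>i v. i < length ts \<Longrightarrow> eval_tm (eq_struct N) (eqval N \<kappa> v) (ts ! i) = Inl (eval_tm N v (us ! i))" by blast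
  have len: "length ts = length ss" using list_all2_lengthD[OF assms(2)] by simp
  show ?thesis
  proof (intro exI[of _ us] conjI allI)
    show "list_all2 (has_sort L) us ss" using us(1,2) len by (simp add: list_all2_conv_all_nth)
    show "(\<Union>t\<in>set us. fv_tm t) \<subseteq> fvk \<kappa> (\<Union>t\<in>set ts. fv_tm t)"
    proof
      fix x assume "x \<in> (\<Union>t\<in>set us. fv_tm t)"
      then obtain i where i: "i < length us" "x \<in> fv_tm (us ! i)" by (auto simp: in_set_conv_nth)
      then have "x \<in> fvk \<kappa> (fv_tm (ts ! i))" "ts ! i \<in> set ts" using us(1) us(3)[of i] by auto
      then show "x \<in> fvk \<kappa> (\<Union>t\<in>set ts. fv_tm t)" by auto
    qed
    show "map projl (map (eval_tm (eq_struct N) (eqval N \<kappa> v)) ts) = map (eval_tm N v) us" for v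
      using us(1,4) by (intro nth_equalityI) simp_all
  qed
qed

lemma translate_imag_tm:
  fixes t :: "(('s, 'f, 'r) eq_sort, ('s, 'f, 'r) eq_fun) tm" and N :: "('s, 'f, 'r, 'a) struct"
  assumes k: "\<And>w. w \<in> fv_tm t \<Longrightarrow> kok \<kappa> w" and t: "has_sort (eq_lang L N) t (Imag xs ys E)"
  shows "\<exists>us. list_all2 (has_sort L) us (map fst xs) \<and> (\<Union>t\<in>set us. fv_tm t) \<subseteq> fvk \<kappa> (fv_tm t) \<and>
    (\<forall>v. eval_tm (eq_struct N) (eqval N \<kappa> v) t = Inr (eqrel N xs ys E `` {map (eval_tm N v) us}))"
proof (cases t)
  case (Var w)
  then have w: "fst w = Imag xs ys E" "defines_equiv L N xs ys E" using t by auto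
  have m: "map fst (\<kappa> w) = map fst xs" using k[of w] Var w by (simp add: kok_def)
  have "set (map fst xs) \<subseteq> sorts L" using w(2) by (auto simp: defines_equiv_def fm_in_def)
  then have "list_all2 (has_sort L) (map Var (\<kappa> w)) (map fst xs)" by (rule Var_sorts[OF m])
  then show ?thesis using Var w by (intro exI[of _ "map Var (\<kappa> w)"]) (simp add: eqval_def comp_def)
next
  case (Fn g ts)
  then have g: "g = Proj xs ys E" using t by (cases g) auto
  have ts: "list_all2 (has_sort (eq_lang L N)) ts (map Real (map fst xs))" using t Fn g by (simp add: comp_def)
  have k': "kok \<kappa> w" if "w \<in> (\<Union>t\<in>set ts. fv_tm t)" for w using k that Fn by simp
  obtain us where us: "list_all2 (has_sort L) us (map fst xs)" "(\<Union>t\<in>set us. fv_tm t) \<subseteq> fvk \<kappa> (\<Union>t\<in>set ts. fv_tm t)"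
    "\<forall>v. map projl (map (eval_tm (eq_struct N) (eqval N \<kappa> v)) ts) = map (eval_tm N v) us"
    using translate_real_tms[OF k' ts] by blast
  then show ?thesis using Fn g by (intro exI[of _ us]) (simp del: map_map)
qed

lemma eqrel_class_iff:
  assumes "defines_equiv L N xs ys E" "as \<in> tuples N (map fst xs)" "bs \<in> tuples N (map fst xs)"
  shows "eqrel N xs ys E `` {as} = eqrel N xs ys E `` {bs} \<longleftrightarrow> holds N (xs @ ys) E (as @ bs)"
proof -
  have e: "equiv (tuples N (map fst xs)) (eqrel N xs ys E)" "map fst ys = map fst xs"
    using assms(1) by (auto simp: defines_equiv_def)
  have "eqrel N xs ys E `` {as} = eqrel N xs ys E `` {bs} \<longleftrightarrow> (as, bs) \<in> eqrel N xs ys E"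
    by (rule eq_equiv_class_iff[OF e(1) assms(2,3)])
  also have "\<dots> \<longleftrightarrow> holds N (xs @ ys) E (as @ bs)" using assms(2,3) e(2) by (simp add: eqrel_def)
  finally show ?thesis .
qed

lemma eval_tuples:
  assumes "is_struct L N" "gd L (univ N) v" "list_all2 (has_sort L) us ss"
  shows "map (eval_tm N v) us \<in> tuples N ss"
  using assms(3) eval_tm_sort[OF assms(1,2)] by (auto simp: tuples_iff list_all2_conv_all_nth)

text \<open>An equation between imaginaries becomes the formula of the equivalence relation at
  representatives, and a quantifier over classes becomes a block of quantifiers over
  representatives. The translation is made for one structure \<open>N\<close>, as the sorts of
  imaginaries themselves depend on \<open>N\<close>.\<close>

lemma translate:
  fixes \<Theta> :: "(('s, 'f, 'r) eq_sort, ('s, 'f, 'r) eq_fun, 'r) fm" and N :: "('s, 'f, 'r, 'a) struct"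
  assumes N: "is_struct L N"
  shows "wf_fm (eq_lang L N) \<Theta> \<Longrightarrow> (\<And>w. w \<in> fv \<Theta> \<Longrightarrow> kok \<kappa> w) \<Longrightarrow>
    \<exists>\<phi>. wf_fm L \<phi> \<and> fv \<phi> \<subseteq> fvk \<kappa> (fv \<Theta>) \<and>
      (\<forall>v. gd L (univ N) v \<longrightarrow> (sat N v \<phi> \<longleftrightarrow> sat (eq_struct N) (eqval N \<kappa> v) \<Theta>))"
proof (induction \<Theta> arbitrary: \<kappa>)
  case Bot
  show ?case by (rule exI[of _ Bot]) simp
next
  case (Eq t u)
  obtain s where s: "has_sort (eq_lang L N) t s" "has_sort (eq_lang L N) u s" using Eq(1) by auto
  have k: "\<And>w. w \<in> fv_tm t \<Longrightarrow> kok \<kappa> w" "\<And>w. w \<in> fv_tm u \<Longrightarrow> kok \<kappa> w" using Eq(2) by simp_all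
  show ?case
  proof (cases s)
    case (Real s')
    obtain t' where t': "has_sort L t' s'" "fv_tm t' \<subseteq> fvk \<kappa> (fv_tm t)" "\<forall>v. eval_tm (eq_struct N) (eqval N \<kappa> v) t = Inl (eval_tm N v t')"
      using translate_real_tm[OF k(1) s(1)[unfolded Real]] by blast
    obtain u' where u': "has_sort L u' s'" "fv_tm u' \<subseteq> fvk \<kappa> (fv_tm u)" "\<forall>v. eval_tm (eq_struct N) (eqval N \<kappa> v) u = Inl (eval_tm N v u')"
      using translate_real_tm[OF k(2) s(2)[unfolded Real]] by blast
    show ?thesis
    proof (intro exI[of _ "Eq t' u'"] conjI allI impI)
      show "wf_fm L (Eq t' u')" using t'(1) u'(1) by auto
      show "fv (Eq t' u') \<subseteq> fvk \<kappa> (fv (Eq t u))" using t'(2) u'(2) by auto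
    qed (simp add: t'(3) u'(3))
  next
    case (Imag xs ys E)
    have d: "defines_equiv L N xs ys E"
      using s(1) Imag by (cases t) (auto split: eq_fun.splits elim: eq_fargs.elims, (metis eq_fres.simps eq_fun.exhaust eq_lang_simps(4) eq_sort.distinct(1) eq_sort.inject(2)))
    obtain us where us: "list_all2 (has_sort L) us (map fst xs)" "(\<Union>t\<in>set us. fv_tm t) \<subseteq> fvk \<kappa> (fv_tm t)"
      "\<forall>v. eval_tm (eq_struct N) (eqval N \<kappa> v) t = Inr (eqrel N xs ys E `` {map (eval_tm N v) us})"
      using translate_imag_tm[OF k(1) s(1)[unfolded Imag]] by blast
    obtain us' where us': "list_all2 (has_sort L) us' (map fst xs)" "(\<Union>t\<in>set us'. fv_tm t) \<subseteq> fvk \<kappa> (fv_tm u)"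
      "\<forall>v. eval_tm (eq_struct N) (eqval N \<kappa> v) u = Inr (eqrel N xs ys E `` {map (eval_tm N v) us'})"
      using translate_imag_tm[OF k(2) s(2)[unfolded Imag]] by blast
    have E: "fm_in L (xs @ ys) E" "map fst ys = map fst xs" using d by (simp_all add: defines_equiv_def)
    have "list_all2 (has_sort L) (us @ us') (map fst (xs @ ys))" using us(1) us'(1) E(2) by (simp add: list_all2_appendI)
    from subst_terms[OF N E(1) this] obtain \<phi> where \<phi>: "wf_fm L \<phi>" "fv \<phi> \<subseteq> (\<Union>t\<in>set (us @ us'). fv_tm t)"
      "\<forall>v. gd L (univ N) v \<longrightarrow> (sat N v \<phi> \<longleftrightarrow> holds N (xs @ ys) E (map (eval_tm N v) (us @ us')))" by blast
    show ?thesis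
    proof (intro exI[of _ \<phi>] conjI allI impI)
      show "wf_fm L \<phi>" by (rule \<phi>(1))
      have "fv \<phi> \<subseteq> (\<Union>t\<in>set us. fv_tm t) \<union> (\<Union>t\<in>set us'. fv_tm t)" using \<phi>(2) by simp
      also have "\<dots> \<subseteq> fvk \<kappa> (fv_tm t) \<union> fvk \<kappa> (fv_tm u)" using us(2) us'(2) by (rule Un_mono)
      finally show "fv \<phi> \<subseteq> fvk \<kappa> (fv (Eq t u))" by (simp add: UN_Un)
      fix v assume v: "gd L (univ N) v"
      have "sat N v \<phi> \<longleftrightarrow> holds N (xs @ ys) E (map (eval_tm N v) us @ map (eval_tm N v) us')" using \<phi>(3) v by simp
      also have "\<dots> \<longleftrightarrow> eqrel N xs ys E `` {map (eval_tm N v) us} = eqrel N xs ys E `` {map (eval_tm N v) us'}"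
        by (rule eqrel_class_iff[OF d eval_tuples[OF N v us(1)] eval_tuples[OF N v us'(1)], symmetric])
      finally show "sat N v \<phi> \<longleftrightarrow> sat (eq_struct N) (eqval N \<kappa> v) (Eq t u)" by (simp add: us(3) us'(3))
    qed
  qed
next
  case (Rel r ts)
  have r: "r \<in> rels L" and ts: "list_all2 (has_sort (eq_lang L N)) ts (map Real (rargs L r))" using Rel(1) by simp_all
  have k: "kok \<kappa> w" if "w \<in> (\<Union>t\<in>set ts. fv_tm t)" for w using Rel(2) that by simp
  obtain us where us: "list_all2 (has_sort L) us (rargs L r)" "(\<Union>t\<in>set us. fv_tm t) \<subseteq> fvk \<kappa> (\<Union>t\<in>set ts. fv_tm t)"
    "\<forall>v. map projl (map (eval_tm (eq_struct N) (eqval N \<kappa> v)) ts) = map (eval_tm N v) us"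
    using translate_real_tms[OF k ts] by blast
  show ?case
    by (rule exI[of _ "Rel r us"]) (use r us in \<open>simp del: map_map\<close>)
next
  case (Neg \<Theta>)
  obtain \<phi> where "wf_fm L \<phi>" "fv \<phi> \<subseteq> fvk \<kappa> (fv \<Theta>)" "\<forall>v. gd L (univ N) v \<longrightarrow> (sat N v \<phi> \<longleftrightarrow> sat (eq_struct N) (eqval N \<kappa> v) \<Theta>)"
    using Neg.IH[of \<kappa>] Neg.prems by auto
  then show ?case by (intro exI[of _ "Neg \<phi>"]) simp
next
  case (Conj \<Theta>1 \<Theta>2)
  obtain \<phi>1 where 1: "wf_fm L \<phi>1" "fv \<phi>1 \<subseteq> fvk \<kappa> (fv \<Theta>1)" "\<forall>v. gd L (univ N) v \<longrightarrow> (sat N v \<phi>1 \<longleftrightarrow> sat (eq_struct N) (eqval N \<kappa> v) \<Theta>1)"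
    using Conj.IH(1)[of \<kappa>] Conj.prems by auto
  obtain \<phi>2 where 2: "wf_fm L \<phi>2" "fv \<phi>2 \<subseteq> fvk \<kappa> (fv \<Theta>2)" "\<forall>v. gd L (univ N) v \<longrightarrow> (sat N v \<phi>2 \<longleftrightarrow> sat (eq_struct N) (eqval N \<kappa> v) \<Theta>2)"
    using Conj.IH(2)[of \<kappa>] Conj.prems by auto
  have "fv \<phi>1 \<union> fv \<phi>2 \<subseteq> fvk \<kappa> (fv \<Theta>1 \<union> fv \<Theta>2)" using 1(2) 2(2) by blast
  then show ?case using 1 2 by (intro exI[of _ "Conj \<phi>1 \<phi>2"]) simp
next
  case (Exists w \<Theta>)
  let ?ss = "case fst w of Real s \<Rightarrow> [s] | Imag xs ys E \<Rightarrow> map fst xs"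
  have w: "fst w \<in> sorts (eq_lang L N)" and wf: "wf_fm (eq_lang L N) \<Theta>" using Exists.prems(1) by simp_all
  have fin: "finite (fvk \<kappa> (fv \<Theta>))" by simp
  \<comment> \<open>The representative of the bound variable gets fresh variables, so that changing
    it does not disturb the values that represent the other variables.\<close>
  obtain zs where zs: "map fst zs = ?ss" "distinct zs" "set zs \<inter> fvk \<kappa> (fv \<Theta>) = {}"
    using fresh_vars[OF fin, of ?ss] by (elim exE conjE)
  let ?k = "\<kappa>(w := zs)"
  have "kok ?k u" if "u \<in> fv \<Theta>" for u
    using zs(1) Exists.prems(2)[of u] that by (cases "u = w") (auto simp: kok_def split: eq_sort.split)
  then obtain \<phi> where \<phi>: "wf_fm L \<phi>" "fv \<phi> \<subseteq> fvk ?k (fv \<Theta>)"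
    "\<forall>v. gd L (univ N) v \<longrightarrow> (sat N v \<phi> \<longleftrightarrow> sat (eq_struct N) (eqval N ?k v) \<Theta>)"
    using Exists.IH[OF wf, of ?k] by blast
  have ssorts: "set ?ss \<subseteq> sorts L" using w by (cases "fst w") (auto simp: defines_equiv_def fm_in_def)
  have zsorts: "fst ` set zs \<subseteq> sorts L" using zs(1) ssorts by (metis set_map)
  interpret N: tarski L "univ N" "sat N" "\<lambda>_. (=)" by (rule tarski_sat[OF N])
  show ?case
  proof (intro exI[of _ "Exs zs \<phi>"] conjI allI impI)
    show "wf_fm L (Exs zs \<phi>)" using \<phi>(1) zsorts by simp
    show "fv (Exs zs \<phi>) \<subseteq> fvk \<kappa> (fv (Exists w \<Theta>))"
    proof
      fix x assume "x \<in> fv (Exs zs \<phi>)"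
      then have x: "x \<in> fv \<phi>" "x \<notin> set zs" by simp_all
      then obtain u where u: "u \<in> fv \<Theta>" "x \<in> set (?k u)" using \<phi>(2) by blast
      then show "x \<in> fvk \<kappa> (fv (Exists w \<Theta>))" using x(2) by (cases "u = w") auto
    qed
    fix v assume v: "gd L (univ N) v"
    have upd: "sat (eq_struct N) (eqval N ?k v') \<Theta> = sat (eq_struct N) ((eqval N \<kappa> v)(w := eqval N ?k v' w)) \<Theta>"
      if "off (set zs) v v'" for v'
    proof (rule sat_cong)
      fix u assume u: "u \<in> fv \<Theta>"
      show "eqval N ?k v' u = ((eqval N \<kappa> v)(w := eqval N ?k v' w)) u"
      proof (cases "u = w")
        case False
        have "v' x = v x" if "x \<in> set (\<kappa> u)" for x
        proof -
          have "x \<notin> set zs" using that u zs(3) by blast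
          then show ?thesis using \<open>off (set zs) v v'\<close> by (simp add: off_def)
        qed
        then have m: "map v' (\<kappa> u) = map v (\<kappa> u)" by simp
        have ku: "kok \<kappa> u" using Exists.prems(2)[of u] u False by simp
        have "eqval N ?k v' u = eqval N \<kappa> v u"
        proof (cases "fst u")
          case (Real s)
          then obtain x where "\<kappa> u = [x]" using ku by (auto simp: kok_def)
          then show ?thesis using Real False m by (simp add: eqval_def)
        next
          case (Imag xs ys E)
          have "eqval N ?k v' u = Inr (eqrel N xs ys E `` {map v' (\<kappa> u)})"
          proof -
            have "?k u = \<kappa> u" using False by simp
            then show ?thesis unfolding eqval_def Imag by (simp only: eq_sort.case)
          qed
          also have "\<dots> = eqval N \<kappa> v u" unfolding m eqval_def Imag by (simp only: eq_sort.case)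
          finally show ?thesis .
        qed
        then show ?thesis using False by simp
      qed simp
    qed
    have "sat N v (Exs zs \<phi>) \<longleftrightarrow> (\<exists>v'. gd L (univ N) v' \<and> off (set zs) v v' \<and> sat N v' \<phi>)" by (rule N.S_Exs[OF \<phi>(1) zsorts v])
    also have "\<dots> \<longleftrightarrow> (\<exists>v'. gd L (univ N) v' \<and> off (set zs) v v' \<and> sat (eq_struct N) ((eqval N \<kappa> v)(w := eqval N ?k v' w)) \<Theta>)"
      using \<phi>(3) upd by blast
    also have "\<dots> \<longleftrightarrow> (\<exists>a\<in>eq_univ N (fst w). sat (eq_struct N) ((eqval N \<kappa> v)(w := a)) \<Theta>)"
    proof -
      have 1: "eqval N ?k v' w \<in> eq_univ N (fst w)" if g: "gd L (univ N) v'" for v'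
      proof (cases "fst w")
        case (Real s)
        then obtain z where z: "zs = [z]" "fst z = s" using zs(1) by auto
        then show ?thesis using Real gd_in[OF g z(2)] w by (simp add: eqval_def)
      next
        case (Imag xs ys E)
        have "map v' zs \<in> tuples N (map fst xs)" using tuples_map[OF g zsorts] zs(1) Imag by simp
        then show ?thesis using Imag by (auto simp: eqval_def quotientI)
      qed
      have 2: "\<exists>v'. gd L (univ N) v' \<and> off (set zs) v v' \<and> eqval N ?k v' w = a" if a: "a \<in> eq_univ N (fst w)" for a
      proof (cases "fst w")
        case (Real s)
        then obtain z where z: "zs = [z]" "fst z = s" using zs(1) by auto
        obtain b where b: "a = Inl b" "b \<in> univ N s" using a Real by auto
        then have "list_all2 (\<lambda>a x. a \<in> univ N (fst x)) [b] zs" using z by simp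
        then obtain v' where "gd L (univ N) v'" "off (set zs) v v'" "map v' zs = [b]" by (rule val_of_list[OF v zs(2)])
        then show ?thesis using Real z b by (intro exI[of _ v']) (simp add: eqval_def)
      next
        case (Imag xs ys E)
        then obtain as where as: "as \<in> tuples N (map fst xs)" "a = Inr (eqrel N xs ys E `` {as})" using a by (auto elim!: quotientE)
        have "list_all2 (\<lambda>a s. a \<in> univ N s) as (map fst zs)" using as(1) zs(1) Imag by (simp add: tuples_iff)
        then have "list_all2 (\<lambda>a x. a \<in> univ N (fst x)) as zs" by (simp add: list_all2_map2)
        then obtain v' where "gd L (univ N) v'" "off (set zs) v v'" "map v' zs = as" by (rule val_of_list[OF v zs(2)])
        then show ?thesis using Imag as(2) by (intro exI[of _ v']) (simp add: eqval_def)
      qed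
      show ?thesis using 1 2 by blast
    qed
    finally show "sat N v (Exs zs \<phi>) \<longleftrightarrow> sat (eq_struct N) (eqval N \<kappa> v) (Exists w \<Theta>)" by simp
  qed
qed

text \<open>A definition of the element \<open>z\<close> over the class \<open>C\<close> is turned
  into a formula about representatives. It defines \<open>z\<close> for every assignment that puts
  some representative of \<open>C\<close> on \<open>xl\<close>.\<close>

lemma dcl_of_imaginary:
  fixes N :: "('s, 'f, 'r, 'a) struct"
  assumes N: "is_struct L N" and dcl: "(Real s, Inl z) \<in> dcl_eq L N {(Imag xs ys E, Inr C)}"
    and xl: "map fst xl = map fst xs" and x0: "fst x0 = s"
  shows "\<exists>\<phi>. wf_fm L \<phi> \<and> fv \<phi> \<subseteq> insert x0 (set xl) \<and>
    (\<forall>v. gd L (univ N) v \<longrightarrow> eqrel N xs ys E `` {map v xl} = C \<longrightarrow> (sat N v \<phi> \<longleftrightarrow> v x0 = z))"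
proof -
  from dcl obtain x ws \<Theta> bs where x: "fst x = Real s" and i: "fm_in (eq_lang L N) (x # ws) \<Theta>" and len: "length bs = length ws"
    and zp: "set (zip (map fst ws) bs) \<subseteq> {(Imag xs ys E, Inr C)}"
    and D: "{Inl z} = {a \<in> univ (eq_struct N) (Real s). holds (eq_struct N) (x # ws) \<Theta> (a # bs)}"
    unfolding dcl_def definable_over_def by blast
  have s: "s \<in> sorts L" using i x by (auto simp: fm_in_def)
  have ws: "fst (ws ! i) = Imag xs ys E" "bs ! i = Inr C" if "i < length ws" for i
  proof -
    have "zip (map fst ws) bs ! i \<in> set (zip (map fst ws) bs)" by (rule nth_mem) (simp add: that len)
    then have "(map fst ws ! i, bs ! i) \<in> set (zip (map fst ws) bs)" using that len by simp
    then show "fst (ws ! i) = Imag xs ys E" "bs ! i = Inr C" using zp that by auto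
  qed
  have nx: "w \<noteq> x \<and> fst w = Imag xs ys E" if "w \<in> set ws" for w
    using that ws(1) x by (metis eq_sort.distinct(1) in_set_conv_nth)
  \<comment> \<open>All parameters \<open>ws\<close> take the same value, the class
    \<open>C\<close>, so they can share the one representing tuple \<open>xl\<close>.\<close>
  let ?k = "\<lambda>w. if w = x then [x0] else xl"
  have fvT: "fv \<Theta> \<subseteq> set (x # ws)" and wf: "wf_fm (eq_lang L N) \<Theta>" using i by (auto simp: fm_in_def)
  have "kok ?k w" if "w \<in> fv \<Theta>" for w
  proof (cases "w = x")
    case True
    then show ?thesis using x x0 by (simp add: kok_def)
  next
    case False
    then have "w \<in> set ws" using fvT that by auto
    then show ?thesis using nx[of w] xl by (simp add: kok_def)
  qed
  from translate[OF N wf this] obtain \<phi> where \<phi>: "wf_fm L \<phi>" "fv \<phi> \<subseteq> fvk ?k (fv \<Theta>)"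
    "\<forall>v. gd L (univ N) v \<longrightarrow> (sat N v \<phi> \<longleftrightarrow> sat (eq_struct N) (eqval N ?k v) \<Theta>)" by blast
  show ?thesis
  proof (intro exI[of _ \<phi>] conjI allI impI)
    show "wf_fm L \<phi>" by (rule \<phi>(1))
    show "fv \<phi> \<subseteq> insert x0 (set xl)" using \<phi>(2) by (rule subset_trans) (auto split: if_splits)
    fix v assume v: "gd L (univ N) v" and C: "eqrel N xs ys E `` {map v xl} = C"
    have "eqval N ?k v w = Inr C" if "w \<in> set ws" for w
      using nx[OF that] C by (simp add: eqval_def)
    then have "map (eqval N ?k v) ws = bs"
      using ws(2) len by (intro nth_equalityI) simp_all
    moreover have "eqval N ?k v x = Inl (v x0)" using x by (simp add: eqval_def)
    ultimately have m: "map (eqval N ?k v) (x # ws) = Inl (v x0) # bs" by simp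
    have "sat N v \<phi> \<longleftrightarrow> holds (eq_struct N) (x # ws) \<Theta> (Inl (v x0) # bs)"
      using \<phi>(3) v holds_map[OF fvT, of "eq_struct N" "eqval N ?k v"] unfolding m by blast
    also have "\<dots> \<longleftrightarrow> Inl (v x0) \<in> {a \<in> univ (eq_struct N) (Real s). holds (eq_struct N) (x # ws) \<Theta> (a # bs)}"
      using gd_in[OF v x0 s] by simp
    also have "\<dots> \<longleftrightarrow> v x0 = z" unfolding D[symmetric] by simp
    finally show "sat N v \<phi> \<longleftrightarrow> v x0 = z" .
  qed
qed

lemma dcl_of_reals:
  fixes N :: "('s, 'f, 'r, 'a) struct"
  assumes N: "is_struct L N" and dcl: "(Imag xs ys E, Inr C) \<in> dcl_eq L N (set ds)"
    and xl: "map fst xl = map fst xs" and zs: "length zs = length ds" "length vals = length ds"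
      "\<And>i. i < length ds \<Longrightarrow> ds ! i = (Real (fst (zs ! i)), Inl (vals ! i))"
  shows "\<exists>\<phi>. wf_fm L \<phi> \<and> fv \<phi> \<subseteq> set xl \<union> set zs \<and>
    (\<forall>v. gd L (univ N) v \<longrightarrow> map v zs = vals \<longrightarrow> (sat N v \<phi> \<longleftrightarrow> eqrel N xs ys E `` {map v xl} = C))"
proof -
  from dcl obtain x ws \<Theta> bs where x: "fst x = Imag xs ys E" and i: "fm_in (eq_lang L N) (x # ws) \<Theta>" and len: "length bs = length ws"
    and zp: "set (zip (map fst ws) bs) \<subseteq> set ds"
    and D: "{Inr C} = {a \<in> univ (eq_struct N) (Imag xs ys E). holds (eq_struct N) (x # ws) \<Theta> (a # bs)}"
    unfolding dcl_def definable_over_def by blast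
  have d: "defines_equiv L N xs ys E" using i x by (auto simp: fm_in_def)
  have dist: "distinct (x # ws)" and fvT: "fv \<Theta> \<subseteq> set (x # ws)" and wf: "wf_fm (eq_lang L N) \<Theta>" using i by (auto simp: fm_in_def)
  have "\<exists>j<length ds. fst (ws ! i) = Real (fst (zs ! j)) \<and> bs ! i = Inl (vals ! j)" if "i < length ws" for i
  proof -
    have "zip (map fst ws) bs ! i \<in> set (zip (map fst ws) bs)" by (rule nth_mem) (simp add: that len)
    then have "(map fst ws ! i, bs ! i) \<in> set (zip (map fst ws) bs)" using that len by simp
    then have "(fst (ws ! i), bs ! i) \<in> set ds" using zp that by auto
    then obtain j where "j < length ds" "ds ! j = (fst (ws ! i), bs ! i)" by (metis in_set_conv_nth)
    then show ?thesis using zs(3)[of j] by auto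
  qed
  then obtain J where J: "\<And>i. i < length ws \<Longrightarrow> J i < length ds \<and> fst (ws ! i) = Real (fst (zs ! J i)) \<and> bs ! i = Inl (vals ! J i)"
    by metis
  \<comment> \<open>The list \<open>ws\<close> is distinct, so each of its variables has a unique
    position and can be represented by the code variable that carries its value.\<close>
  define ix where "ix w = (THE i. i < length ws \<and> ws ! i = w)" for w
  have ix: "ix (ws ! i) = i" if "i < length ws" for i
    unfolding ix_def using that dist by (intro the_equality) (auto simp: nth_eq_iff_index_eq)
  let ?k = "\<lambda>w. if w = x then xl else [zs ! J (ix w)]"
  have nx: "ws ! i \<noteq> x" if "i < length ws" for i using that dist by auto
  have "kok ?k w" if "w \<in> fv \<Theta>" for w
  proof (cases "w = x")
    case True
    then show ?thesis using x xl by (simp add: kok_def)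
  next
    case False
    then have "w \<in> set ws" using fvT that by auto
    then obtain i where i: "i < length ws" "w = ws ! i" by (metis in_set_conv_nth)
    then show ?thesis using J[OF i(1)] ix[OF i(1)] False by (simp add: kok_def)
  qed
  from translate[OF N wf this] obtain \<phi> where \<phi>: "wf_fm L \<phi>" "fv \<phi> \<subseteq> fvk ?k (fv \<Theta>)"
    "\<forall>v. gd L (univ N) v \<longrightarrow> (sat N v \<phi> \<longleftrightarrow> sat (eq_struct N) (eqval N ?k v) \<Theta>)" by blast
  show ?thesis
  proof (intro exI[of _ \<phi>] conjI allI impI)
    show "wf_fm L \<phi>" by (rule \<phi>(1))
    show "fv \<phi> \<subseteq> set xl \<union> set zs"
    proof
      fix y assume "y \<in> fv \<phi>"
      then obtain w where w: "w \<in> fv \<Theta>" "y \<in> set (?k w)" using \<phi>(2) by blast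
      show "y \<in> set xl \<union> set zs"
      proof (cases "w = x")
        case False
        then have "w \<in> set ws" using fvT w(1) by auto
        then obtain i where i: "i < length ws" "w = ws ! i" by (metis in_set_conv_nth)
        then have "y = zs ! J i" using w(2) False ix by simp
        then show ?thesis using J[OF i(1)] zs(1) by simp
      qed (use w in simp)
    qed
    fix v assume v: "gd L (univ N) v" and vals: "map v zs = vals"
    have "eqval N ?k v (ws ! i) = bs ! i" if "i < length ws" for i
    proof -
      have "v (zs ! J i) = vals ! J i" using J[OF that] zs(1) vals by (metis nth_map)
      then show ?thesis using J[OF that] ix[OF that] nx[OF that] by (simp add: eqval_def)
    qed
    then have "map (eqval N ?k v) ws = bs" using len by (intro nth_equalityI) simp_all
    moreover have "eqval N ?k v x = Inr (eqrel N xs ys E `` {map v xl})" using x by (simp add: eqval_def)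
    ultimately have m: "map (eqval N ?k v) (x # ws) = Inr (eqrel N xs ys E `` {map v xl}) # bs" by simp
    have "set (map fst xs) \<subseteq> sorts L" using d by (auto simp: defines_equiv_def fm_in_def)
    then have "fst ` set xl \<subseteq> sorts L" unfolding xl[symmetric] by simp
    then have "map v xl \<in> tuples N (map fst xs)" using tuples_map[OF v, of xl] xl by simp
    then have u: "Inr (eqrel N xs ys E `` {map v xl}) \<in> univ (eq_struct N) (Imag xs ys E)" by (simp add: quotientI)
    have "sat N v \<phi> \<longleftrightarrow> holds (eq_struct N) (x # ws) \<Theta> (Inr (eqrel N xs ys E `` {map v xl}) # bs)"
      using \<phi>(3) v holds_map[OF fvT, of "eq_struct N" "eqval N ?k v"] unfolding m by blast
    also have "\<dots> \<longleftrightarrow> Inr (eqrel N xs ys E `` {map v xl}) \<in> {a \<in> univ (eq_struct N) (Imag xs ys E). holds (eq_struct N) (x # ws) \<Theta> (a # bs)}"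
      using u by simp
    also have "\<dots> \<longleftrightarrow> eqrel N xs ys E `` {map v xl} = C" unfolding D[symmetric] by simp
    finally show "sat N v \<phi> \<longleftrightarrow> eqrel N xs ys E `` {map v xl} = C" .
  qed
qed

text \<open>\<chi> combines a definition of the class from the code with definitions of the entries
  of the code from the class. Having no parameters, it is guaranteed to do this for the class and
  the code at hand only; that it does so is later expressed by \<open>theta\<close>.\<close>

lemma code_formula:
  fixes N :: "('s, 'f, 'r, 'a) struct"
  assumes N: "is_struct L N" and \<nu>: "gd L (univ N) \<nu>" and d: "defines_equiv L N xl xl' \<psi>"
    and ds: "set ds \<subseteq> reals L N" "(Imag xl xl' \<psi>, Inr (eqrel N xl xl' \<psi> `` {map \<nu> xl})) \<in> dcl_eq L N (set ds)"
      "set ds \<subseteq> dcl_eq L N {(Imag xl xl' \<psi>, Inr (eqrel N xl xl' \<psi> `` {map \<nu> xl}))}"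
    and W: "finite W" "set xl \<subseteq> W"
  obtains zs \<nu>1 \<chi> where "distinct zs" "set zs \<inter> W = {}" "fst ` set zs \<subseteq> sorts L" "gd L (univ N) \<nu>1" "off (set zs) \<nu> \<nu>1"
    "wf_fm L \<chi>" "fv \<chi> \<subseteq> set xl \<union> set zs" "sat N \<nu>1 \<chi>"
    "\<And>\<mu>. gd L (univ N) \<mu> \<Longrightarrow> sat N \<mu> \<chi> \<Longrightarrow> map \<mu> zs = map \<nu>1 zs \<Longrightarrow> eqrel N xl xl' \<psi> `` {map \<mu> xl} = eqrel N xl xl' \<psi> `` {map \<nu> xl}"
    "\<And>\<mu>. gd L (univ N) \<mu> \<Longrightarrow> sat N \<mu> \<chi> \<Longrightarrow> eqrel N xl xl' \<psi> `` {map \<mu> xl} = eqrel N xl xl' \<psi> `` {map \<nu> xl} \<Longrightarrow> map \<mu> zs = map \<nu>1 zs"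
proof -
  let ?C = "eqrel N xl xl' \<psi> `` {map \<nu> xl}"
  have "\<exists>s a. ds ! i = (Real s, Inl a) \<and> s \<in> sorts L \<and> a \<in> univ N s" if "i < length ds" for i
    using ds(1) that nth_mem by (fastforce simp: reals_def elems_def)
  then obtain sf af where sa: "\<And>i. i < length ds \<Longrightarrow> ds ! i = (Real (sf i), Inl (af i)) \<and> sf i \<in> sorts L \<and> af i \<in> univ N (sf i)"
    by metis
  let ?ss = "map sf [0..<length ds]" and ?vals = "map af [0..<length ds]"
  obtain zs where zs: "map fst zs = ?ss" "distinct zs" "set zs \<inter> W = {}"
    using fresh_vars[OF W(1), of ?ss] by (elim exE conjE)
  have len: "length zs = length ds" using zs(1) by (metis length_map diff_zero length_upt)
  have fz: "fst (zs ! i) = sf i" if "i < length ds" for i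
    using arg_cong[OF zs(1), of "\<lambda>l. l ! i"] that len by simp
  have zsorts: "fst ` set zs \<subseteq> sorts L"
  proof -
    have "set ?ss \<subseteq> sorts L" using sa by auto
    then show ?thesis using zs(1) by (metis set_map)
  qed
  have "list_all2 (\<lambda>a x. a \<in> univ N (fst x)) ?vals zs" using sa fz len by (simp add: list_all2_conv_all_nth)
  then obtain \<nu>1 where \<nu>1: "gd L (univ N) \<nu>1" "off (set zs) \<nu> \<nu>1" "map \<nu>1 zs = ?vals" by (rule val_of_list[OF \<nu> zs(2)])
  have xl\<nu>: "map \<nu>1 xl = map \<nu> xl" using \<nu>1(2) zs(3) W(2) by (auto simp: off_def)
  have dsi: "ds ! i = (Real (fst (zs ! i)), Inl (?vals ! i))" if "i < length ds" for i using sa[OF that] fz[OF that] that by simp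
  have lv: "length ?vals = length ds" by simp
  from dcl_of_reals[OF N ds(2) refl len lv dsi] obtain \<chi>0 where \<chi>0: "wf_fm L \<chi>0" "fv \<chi>0 \<subseteq> set xl \<union> set zs"
    "\<forall>v. gd L (univ N) v \<longrightarrow> map v zs = ?vals \<longrightarrow> (sat N v \<chi>0 \<longleftrightarrow> eqrel N xl xl' \<psi> `` {map v xl} = ?C)" by blast
  have "\<exists>\<phi>. wf_fm L \<phi> \<and> fv \<phi> \<subseteq> insert (zs ! i) (set xl) \<and>
    (\<forall>v. gd L (univ N) v \<longrightarrow> eqrel N xl xl' \<psi> `` {map v xl} = ?C \<longrightarrow> (sat N v \<phi> \<longleftrightarrow> v (zs ! i) = af i))" if "i < length ds" for i
  proof (rule dcl_of_imaginary[OF N _ refl fz[OF that]])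
    have "ds ! i \<in> set ds" using that by simp
    then show "(Real (sf i), Inl (af i)) \<in> dcl_eq L N {(Imag xl xl' \<psi>, Inr ?C)}" using ds(3) sa[OF that] by auto
  qed
  then obtain X where X: "\<And>i. i < length ds \<Longrightarrow> wf_fm L (X i) \<and> fv (X i) \<subseteq> insert (zs ! i) (set xl) \<and>
    (\<forall>v. gd L (univ N) v \<longrightarrow> eqrel N xl xl' \<psi> `` {map v xl} = ?C \<longrightarrow> (sat N v (X i) \<longleftrightarrow> v (zs ! i) = af i))" by metis
  let ?\<chi> = "Conj \<chi>0 (Conjs (map X [0..<length ds]))"
  have sat: "sat N v ?\<chi> \<longleftrightarrow> sat N v \<chi>0 \<and> (\<forall>i<length ds. sat N v (X i))" for v by (auto simp: sat_Conjs)
  have X1: "sat N v (X i) \<longleftrightarrow> v (zs ! i) = af i" if "i < length ds" "gd L (univ N) v" "eqrel N xl xl' \<psi> `` {map v xl} = ?C" for i v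
    using X[OF that(1)] that(2,3) by blast
  have z1: "\<nu>1 (zs ! i) = af i" if "i < length ds" for i using arg_cong[OF \<nu>1(3), of "\<lambda>l. l ! i"] that len by simp
  show thesis
  proof (rule that[of zs \<nu>1 ?\<chi>])
    show "wf_fm L ?\<chi>" using \<chi>0(1) X by auto
    have "fv (X i) \<subseteq> set xl \<union> set zs" if "i < length ds" for i using X[OF that] len that by fastforce
    then have "(\<Union>\<phi>\<in>set (map X [0..<length ds]). fv \<phi>) \<subseteq> set xl \<union> set zs" by (intro UN_least) force
    then show "fv ?\<chi> \<subseteq> set xl \<union> set zs" using \<chi>0(2) unfolding fv.simps fv_Conjs by (rule Un_least[rotated])
    have C1: "eqrel N xl xl' \<psi> `` {map \<nu>1 xl} = ?C" unfolding xl\<nu> ..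
    then have "sat N \<nu>1 \<chi>0" using \<chi>0(3) \<nu>1(1,3) by blast
    moreover have "sat N \<nu>1 (X i)" if "i < length ds" for i using X1[OF that \<nu>1(1) C1] z1[OF that] by blast
    ultimately show "sat N \<nu>1 ?\<chi>" unfolding sat by blast
  next
    fix \<mu> assume \<mu>: "gd L (univ N) \<mu>" "sat N \<mu> ?\<chi>" "map \<mu> zs = map \<nu>1 zs"
    then show "eqrel N xl xl' \<psi> `` {map \<mu> xl} = ?C" using \<chi>0(3) \<nu>1(3) unfolding sat by simp
  next
    fix \<mu> assume \<mu>: "gd L (univ N) \<mu>" "sat N \<mu> ?\<chi>" "eqrel N xl xl' \<psi> `` {map \<mu> xl} = ?C"
    then have "\<mu> (zs ! i) = af i" if "i < length ds" for i using X1[OF that \<mu>(1,3)] that unfolding sat by blast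
    then show "map \<mu> zs = map \<nu>1 zs" unfolding \<nu>1(3) using len by (intro nth_equalityI) simp_all
  qed (use zs zsorts \<nu>1 in blast)+
qed

section \<open>Formulas of the language as formulas about imaginaries\<close>

definition rv :: "'s var \<Rightarrow> ('s, 'f, 'r) eq_sort var" where "rv x = (Real (fst x), snd x)"

primrec lift_tm :: "('s, 'f) tm \<Rightarrow> (('s, 'f, 'r) eq_sort, ('s, 'f, 'r) eq_fun) tm" where
  "lift_tm (Var x) = Var (rv x)"
| "lift_tm (Fn f ts) = Fn (RealF f) (map lift_tm ts)"

primrec lift :: "('s, 'f, 'r) fm \<Rightarrow> (('s, 'f, 'r) eq_sort, ('s, 'f, 'r) eq_fun, 'r) fm" where
  "lift Bot = Bot"
| "lift (Eq t u) = Eq (lift_tm t) (lift_tm u)"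
| "lift (Rel r ts) = Rel r (map lift_tm ts)"
| "lift (Neg \<phi>) = Neg (lift \<phi>)"
| "lift (Conj \<phi> \<psi>) = Conj (lift \<phi>) (lift \<psi>)"
| "lift (Exists x \<phi>) = Exists (rv x) (lift \<phi>)"

lemma fst_rv [simp]: "fst (rv x) = Real (fst x)" by (simp add: rv_def)
lemma rv_inj [simp]: "rv x = rv y \<longleftrightarrow> x = y" by (auto simp: rv_def prod_eq_iff)

lemma has_sort_lift: "has_sort L t s \<Longrightarrow> has_sort (eq_lang L N) (lift_tm t) (Real s)"
proof (induction t arbitrary: s)
  case (Fn f ts)
  then have "list_all2 (\<lambda>t s. has_sort (eq_lang L N) (lift_tm t) (Real s)) ts (fargs L f)"
    by (auto simp: list_all2_conv_all_nth)
  then show ?case using Fn.prems by (simp add: list_all2_map1 list_all2_map2)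
qed simp

lemma wf_lift: "wf_fm L \<phi> \<Longrightarrow> wf_fm (eq_lang L N) (lift \<phi>)"
proof (induction \<phi>)
  case (Eq t u)
  then show ?case using has_sort_lift[of L t _ N] has_sort_lift[of L u _ N] by auto
next
  case (Rel r ts)
  then have "list_all2 (\<lambda>t s. has_sort (eq_lang L N) (lift_tm t) (Real s)) ts (rargs L r)"
    by (auto simp: list_all2_conv_all_nth intro!: has_sort_lift)
  then show ?case using Rel by (simp add: list_all2_map1 list_all2_map2)
qed simp_all

lemma fv_lift_tm: "fv_tm (lift_tm t) = rv ` fv_tm t"
  by (induction t) auto

lemma fv_lift: "fv (lift \<phi>) = rv ` fv \<phi>"
  by (induction \<phi>) (auto simp: fv_lift_tm)

lemma eval_lift: "(\<And>x. x \<in> fv_tm t \<Longrightarrow> V (rv x) = Inl (v x)) \<Longrightarrow> eval_tm (eq_struct N) V (lift_tm t) = Inl (eval_tm N v t)"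
proof (induction t)
  case (Fn f ts)
  have m: "map (projl \<circ> (eval_tm (eq_struct N) V \<circ> lift_tm)) ts = map (eval_tm N v) ts"
  proof (rule map_cong[OF refl])
    fix t assume t: "t \<in> set ts"
    have "eval_tm (eq_struct N) V (lift_tm t) = Inl (eval_tm N v t)"
      by (rule Fn.IH[OF t], rule Fn.prems) (use t in auto)
    then show "(projl \<circ> (eval_tm (eq_struct N) V \<circ> lift_tm)) t = eval_tm N v t" by simp
  qed
  show ?case by (simp only: lift_tm.simps eval_tm.simps eq_struct_simps eq_fint.simps map_map comp_assoc m)
qed simp

lemma sat_lift: "(\<And>x. x \<in> fv \<phi> \<Longrightarrow> V (rv x) = Inl (v x)) \<Longrightarrow> sat (eq_struct N) V (lift \<phi>) \<longleftrightarrow> sat N v \<phi>"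
proof (induction \<phi> arbitrary: V v)
  case (Eq t u)
  have "eval_tm (eq_struct N) V (lift_tm t) = Inl (eval_tm N v t)" by (rule eval_lift, rule Eq) simp
  moreover have "eval_tm (eq_struct N) V (lift_tm u) = Inl (eval_tm N v u)" by (rule eval_lift, rule Eq) simp
  ultimately show ?case by simp
next
  case (Rel r ts)
  have m: "map (projl \<circ> (eval_tm (eq_struct N) V \<circ> lift_tm)) ts = map (eval_tm N v) ts"
  proof (rule map_cong[OF refl])
    fix t assume t: "t \<in> set ts"
    have "eval_tm (eq_struct N) V (lift_tm t) = Inl (eval_tm N v t)"
      by (rule eval_lift, rule Rel) (use t in auto)
    then show "(projl \<circ> (eval_tm (eq_struct N) V \<circ> lift_tm)) t = eval_tm N v t" by simp
  qed
  show ?case by (simp only: lift.simps sat.simps eq_struct_simps map_map comp_assoc m)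
next
  case (Neg \<phi>)
  have "sat (eq_struct N) V (lift \<phi>) \<longleftrightarrow> sat N v \<phi>" by (rule Neg.IH, rule Neg.prems) simp
  then show ?case by simp
next
  case (Conj \<phi> \<psi>)
  have "sat (eq_struct N) V (lift \<phi>) \<longleftrightarrow> sat N v \<phi>" by (rule Conj.IH, rule Conj.prems) simp
  moreover have "sat (eq_struct N) V (lift \<psi>) \<longleftrightarrow> sat N v \<psi>" by (rule Conj.IH, rule Conj.prems) simp
  ultimately show ?case by simp
next
  case (Exists x \<phi>)
  have "sat (eq_struct N) (V(rv x := Inl a)) (lift \<phi>) \<longleftrightarrow> sat N (v(x := a)) \<phi>" for a
    by (rule Exists.IH) (use Exists.prems in auto)
  then show ?case by simp
qed simp

section \<open>The combinatorial core\<close>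

context bvmodel begin

text \<open>\<open>realize_colours\<close> applied to the pairs of colours that one and the same
  section \<open>w\<close> has relative to two tuples of parameters.\<close>

lemma pair_realize:
  assumes C: "coloured V C F" and v: "gdB v" "gdB v'" and S: "finite S"
    and ex: "\<And>p. p \<in> \<Omega> \<Longrightarrow> \<exists>w. gdB w \<and> (C p (override_on v w Y), C p (override_on v' w Y)) \<in> S"
    and real: "\<And>i j :: nat. (i, j) \<in> S \<Longrightarrow> \<exists>p\<in>\<Omega>. \<exists>w. gdB w \<and> C p (override_on v w Y) = i \<and> C p (override_on v' w Y) = j"
  shows "\<exists>w. gdB w \<and> (\<lambda>p. (C p (override_on v w Y), C p (override_on v' w Y))) ` \<Omega> = S"
proof -
  let ?k = "\<lambda>p w. (C p (override_on v w Y), C p (override_on v' w Y))"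
  have agr: "C p (override_on u z Y) = C p (override_on u w Y)" if "gdB u" "gdB z" "gdB w" "p \<in> \<Omega>" "agr UNIV p z w" for u z w p
    using loc_override[OF colouredD(2)[OF C, of "C p (override_on u w Y)"] that, of Y] by simp
  have "\<exists>w\<in>{w. gdB w}. (\<lambda>p. ?k p w) ` \<Omega> = S"
  proof (rule realize_colours)
    fix w and ij :: "nat \<times> nat" assume "w \<in> {w. gdB w}"
    then have w: "gdB w" by simp
    obtain i j where ij: "ij = (i, j)" by (cases ij)
    obtain a where a: "a \<in> BB" "\<forall>p\<in>\<Omega>. C p (override_on v w Y) = i \<longleftrightarrow> a \<in> p"
      using loc_clopen[OF colouredD(2)[OF C, of i] gd_override[OF v(1) w]] by blast
    obtain b where b: "b \<in> BB" "\<forall>p\<in>\<Omega>. C p (override_on v' w Y) = j \<longleftrightarrow> b \<in> p"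
      using loc_clopen[OF colouredD(2)[OF C, of j] gd_override[OF v(2) w]] by blast
    have "\<forall>p\<in>\<Omega>. ?k p w = ij \<longleftrightarrow> bmt a b \<in> p" using a b ij by simp
    then show "\<exists>u\<in>BB. \<forall>p\<in>\<Omega>. ?k p w = ij \<longleftrightarrow> u \<in> p" using ba.meet_in[OF a(1) b(1)] by blast
  next
    fix w w' u assume w: "w \<in> {w. gdB w}" "w' \<in> {w. gdB w}" "u \<in> BB"
    then obtain z where z: "gdB z" "\<forall>p\<in>\<Omega>. (u \<in> p \<longrightarrow> agr UNIV p z w') \<and> (u \<notin> p \<longrightarrow> agr UNIV p z w)"
      using glue_val[of w w' u] by blast
    have "?k p z = (if u \<in> p then ?k p w' else ?k p w)" if p: "p \<in> \<Omega>" for p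
    proof (cases "u \<in> p")
      case True
      then have "agr UNIV p z w'" using z(2) p by blast
      then show ?thesis using True agr[OF v(1) z(1) _ p] agr[OF v(2) z(1) _ p] w by simp
    next
      case False
      then have "agr UNIV p z w" using z(2) p by blast
      then show ?thesis using False agr[OF v(1) z(1) _ p] agr[OF v(2) z(1) _ p] w by simp
    qed
    then show "\<exists>z\<in>{w. gdB w}. \<forall>p\<in>\<Omega>. ?k p z = (if u \<in> p then ?k p w' else ?k p w)" using z(1) by blast
  next
    fix p assume "p \<in> \<Omega>"
    then show "\<exists>w\<in>{w. gdB w}. ?k p w \<in> S" using ex by blast
  next
    fix ij assume "ij \<in> S"
    then show "\<exists>p\<in>\<Omega>. \<exists>w\<in>{w. gdB w}. ?k p w = ij" using real[of "fst ij" "snd ij"] by (cases ij) fastforce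
  qed (rule S)
  then show ?thesis by blast
qed

end

text \<open>Throughout, an assignment \<open>v\<close> supplies the tuple at \<open>xs\<close> and
  another assignment \<open>w\<close> the tuple at \<open>ys\<close>. Here \<open>s\<close> is any
  set of colours that makes \<open>E\<close> true; its maximality enters through
  \<open>AA\<close>.\<close>

locale imag_class = bvmodel ty L T M
  for ty :: "'u itself" and L :: "('s, 'f, 'r) lang" and T :: "('s, 'f, 'r) fm set"
    and M :: "('s bsort, ('s, 'f, 'r) bfun, unit, 'm) struct" +
  fixes xs ys :: "'s bsort var list" and E :: "('s, 'f, 'r) bfm"
    and C :: "'m set \<Rightarrow> ('s bsort var \<Rightarrow> 'm) \<Rightarrow> nat" and F :: "nat set" and \<E> :: "nat set set" and s :: "nat set"
  assumes d: "defines_equiv BL M xs ys E" and C: "coloured (fv E) C F"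
    and \<E>: "\<And>v. gdB v \<Longrightarrow> sat M v E \<longleftrightarrow> (\<lambda>p. C p v) ` \<Omega> \<in> \<E>"
    and s: "s \<in> \<E>" "s \<subseteq> F"
begin

abbreviation "X \<equiv> set xs"
abbreviation "Y \<equiv> set ys"

lemma XY: "X \<inter> Y = {}" "distinct xs" "distinct ys" "fv E \<subseteq> X \<union> Y" "fst ` X \<subseteq> sorts BL" "fst ` Y \<subseteq> sorts BL" "map fst ys = map fst xs"
  using d by (auto simp: defines_equiv_def fm_in_def)

lemma finF: "finite F" by (rule colouredD(1)[OF C])

definition "im v w = (\<lambda>p. C p (override_on v w Y)) ` \<Omega>"

lemma C_cong: "gdB v \<Longrightarrow> gdB w \<Longrightarrow> p \<in> \<Omega> \<Longrightarrow> (\<And>x. x \<in> X \<union> Y \<Longrightarrow> v x = w x) \<Longrightarrow> C p v = C p w"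
  using loc_eq[OF colouredD(2)[OF C, of "C p w"], of v w p] XY(4) by blast

lemma C_F: "gdB v \<Longrightarrow> gdB w \<Longrightarrow> p \<in> \<Omega> \<Longrightarrow> C p (override_on v w Y) \<in> F"
  by (rule colouredD(3)[OF C gd_override])

definition sim :: "('s bsort var \<Rightarrow> 'm) \<Rightarrow> ('s bsort var \<Rightarrow> 'm) \<Rightarrow> bool" where
  "sim v v' \<longleftrightarrow> (map v xs, map v' xs) \<in> eqrel M xs ys E"

lemma im_iff: assumes "gdB v" "gdB w" shows "(map v xs, map w ys) \<in> eqrel M xs ys E \<longleftrightarrow> im v w \<in> \<E>"
proof -
  have m: "map (override_on v w Y) (xs @ ys) = map v xs @ map w ys"
    using XY(1) by (auto simp: override_on_def)
  have "fv E \<subseteq> set (xs @ ys)" using XY(4) by simp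
  from holds_map[OF this, of M "override_on v w Y"]
  have "holds M (xs @ ys) E (map v xs @ map w ys) \<longleftrightarrow> sat M (override_on v w Y) E" unfolding m .
  moreover have "map v xs \<in> tuples M (map fst xs)" "map w ys \<in> tuples M (map fst ys)"
    using tuples_map[OF assms(1) XY(5)] tuples_map[OF assms(2) XY(6)] .
  ultimately show ?thesis using \<E>[OF gd_override[OF assms]] by (simp add: eqrel_def im_def)
qed

lemma equiv: "equiv (tuples M (map fst xs)) (eqrel M xs ys E)" using d unfolding defines_equiv_def by blast

lemma sim_im: assumes "gdB v" "gdB v'" "gdB w" "sim v v'" "im v w \<in> \<E>" shows "im v' w \<in> \<E>"
proof -
  have "(map v' xs, map v xs) \<in> eqrel M xs ys E" using assms(4) equiv unfolding sim_def equiv_def sym_def by blast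
  moreover have "(map v xs, map w ys) \<in> eqrel M xs ys E" using im_iff[OF assms(1,3)] assms(5) by blast
  ultimately have "(map v' xs, map w ys) \<in> eqrel M xs ys E" using equiv unfolding equiv_def trans_def by blast
  then show ?thesis using im_iff[OF assms(2,3)] by blast
qed

lemma im_sim: assumes "gdB v" "gdB v'" "gdB w" "im v w \<in> \<E>" "im v' w \<in> \<E>" shows "sim v v'"
proof -
  have "(map v xs, map w ys) \<in> eqrel M xs ys E" "(map v' xs, map w ys) \<in> eqrel M xs ys E"
    using im_iff assms by blast+
  then show ?thesis using equiv unfolding sim_def equiv_def trans_def sym_def by blast
qed

text \<open>The fibres of \<open>v\<close> and \<open>v'\<close> at \<open>p\<close> coincide.
  Assignments over \<open>M\<close> suffice to run through the stalk, as each of its elements is the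
  class of an element of \<open>M\<close>.\<close>

definition PE :: "'m set \<Rightarrow> ('s bsort var \<Rightarrow> 'm) \<Rightarrow> ('s bsort var \<Rightarrow> 'm) \<Rightarrow> bool" where
  "PE p v v' \<longleftrightarrow> (\<forall>w. gdB w \<longrightarrow> (C p (override_on v w Y) \<in> s \<longleftrightarrow> C p (override_on v' w Y) \<in> s))"

definition AA :: "('s bsort var \<Rightarrow> 'm) \<Rightarrow> bool" where
  "AA v \<longleftrightarrow> (\<exists>w. gdB w \<and> im v w = s) \<and> \<not> (\<exists>w. gdB w \<and> im v w \<in> \<E> \<and> s \<subset> im v w)"

definition "types v0 v = {j. \<exists>p\<in>\<Omega>. \<exists>w. gdB w \<and> C p (override_on v w Y) \<in> s \<and> C p (override_on v0 w Y) = j}"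

lemma types_F: "gdB v0 \<Longrightarrow> types v0 v \<subseteq> F"
  unfolding types_def using C_F by blast

lemma PE_refl: "PE p v v" by (simp add: PE_def)
lemma PE_sym: "PE p v w \<Longrightarrow> PE p w v" by (simp add: PE_def)
lemma PE_trans: "PE p u v \<Longrightarrow> PE p v w \<Longrightarrow> PE p u w" by (simp add: PE_def)

lemma PE_cong:
  assumes "gdB v" "gdB v'" "p \<in> \<Omega>" "\<And>x. x \<in> X \<Longrightarrow> v x = v' x"
  shows "PE p v v'"
  unfolding PE_def
proof (intro allI impI)
  fix w assume w: "gdB w"
  have "C p (override_on v w Y) = C p (override_on v' w Y)"
    by (rule C_cong[OF gd_override[OF assms(1) w] gd_override[OF assms(2) w] assms(3)]) (use assms(4) in \<open>auto simp: override_on_def\<close>)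
  then show "C p (override_on v w Y) \<in> s \<longleftrightarrow> C p (override_on v' w Y) \<in> s" by simp
qed

text \<open>All pairs of colours that occur together, with the first one in \<open>s\<close>, occur in a single section.\<close>

lemma generic_section:
  assumes v: "gdB v" "gdB v'" and w0: "gdB w0" "im v w0 = s"
    and S: "S = {(i, j). i \<in> s \<and> (\<exists>p\<in>\<Omega>. \<exists>w. gdB w \<and> C p (override_on v w Y) = i \<and> C p (override_on v' w Y) = j)}"
    and S': "S' \<supseteq> S" "\<And>i j. (i, j) \<in> S' \<Longrightarrow> \<exists>p\<in>\<Omega>. \<exists>w. gdB w \<and> C p (override_on v w Y) = i \<and> C p (override_on v' w Y) = j"
  obtains w where "gdB w" "im v w = fst ` S'" "im v' w = snd ` S'"
proof -
  have "S' \<subseteq> F \<times> F"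
  proof
    fix z assume "z \<in> S'"
    then obtain p w where "p \<in> \<Omega>" "gdB w" "C p (override_on v w Y) = fst z" "C p (override_on v' w Y) = snd z"
      using S'(2)[of "fst z" "snd z"] by auto
    then have "fst z \<in> F" "snd z \<in> F" using C_F[OF v(1), of w p] C_F[OF v(2), of w p] by simp_all
    then show "z \<in> F \<times> F" by (simp add: mem_Times_iff)
  qed
  then have fin: "finite S'" using finF by (meson finite_SigmaI finite_subset)
  have "\<exists>w. gdB w \<and> (\<lambda>p. (C p (override_on v w Y), C p (override_on v' w Y))) ` \<Omega> = S'"
  proof (rule pair_realize[OF C v fin])
    fix p assume p: "p \<in> \<Omega>"
    then have "C p (override_on v w0 Y) \<in> s" using w0(2) unfolding im_def by blast
    then have "(C p (override_on v w0 Y), C p (override_on v' w0 Y)) \<in> S" unfolding S using p w0(1) by blast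
    then show "\<exists>w. gdB w \<and> (C p (override_on v w Y), C p (override_on v' w Y)) \<in> S'" using S'(1) w0(1) by blast
  qed (rule S'(2))
  then obtain w where w: "gdB w" "(\<lambda>p. (C p (override_on v w Y), C p (override_on v' w Y))) ` \<Omega> = S'" by blast
  have "im v w = fst ` S'" "im v' w = snd ` S'" unfolding im_def w(2)[symmetric] by (simp_all add: image_image)
  then show thesis using that w(1) by blast
qed

lemma fst_S:
  assumes "im v w0 = s" "gdB w0"
  shows "fst ` {(i, j). i \<in> s \<and> (\<exists>p\<in>\<Omega>. \<exists>w. gdB w \<and> C p (override_on v w Y) = i \<and> C p (override_on v' w Y) = j)} = s" (is "fst ` ?S = s")
proof
  show "s \<subseteq> fst ` ?S"
  proof
    fix i assume i: "i \<in> s"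
    then obtain p where "p \<in> \<Omega>" "C p (override_on v w0 Y) = i" using assms(1) unfolding im_def by blast
    then have "(i, C p (override_on v' w0 Y)) \<in> ?S" using i assms(2) by blast
    then show "i \<in> fst ` ?S" by force
  qed
qed auto

lemma snd_S: "snd ` {(i, j). i \<in> s \<and> (\<exists>p\<in>\<Omega>. \<exists>w. gdB w \<and> C p (override_on v w Y) = i \<and> C p (override_on v' w Y) = j)} = types v' v"
  unfolding types_def by force

text \<open>Take a section that realises all pairs of colours possible inside the fibres of
  \<open>v\<close>. Its colours relative to \<open>v\<close> form \<open>s\<close>, so it is
  \<open>E\<close>-related to \<open>v\<close>, and then also to \<open>v0\<close>. Its colours
  relative to \<open>v0\<close> form exactly \<open>types v0 v\<close>.\<close>

lemma types_in:
  assumes v: "gdB v0" "gdB v" and A: "AA v" and sim: "sim v0 v"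
  shows "types v0 v \<in> \<E>"
proof -
  obtain w0 where w0: "gdB w0" "im v w0 = s" using A unfolding AA_def by blast
  obtain w where w: "gdB w" "im v w = s" "im v0 w = types v0 v"
    using generic_section[OF v(2,1) w0 refl subset_refl] unfolding fst_S[OF w0(2,1)] snd_S by blast
  have "sim v v0" using sim equiv unfolding sim_def equiv_def sym_def by blast
  then have "im v0 w \<in> \<E>" using sim_im[OF v(2,1) w(1)] w(2) s(1) by simp
  then show ?thesis using w(3) by simp
qed

text \<open>Suppose \<open>q\<close> lies in the fibre of \<open>v2\<close> at \<open>p\<close> but
  not in that of \<open>v1\<close>. Its pair of colours is added to the generic section for
  \<open>v1\<close> and \<open>v0\<close>. Relative to \<open>v0\<close> the colour set does not
  grow, because the colour of \<open>q\<close> already belongs to \<open>types v0 v2\<close>, the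
  same set; so the section is \<open>E\<close>-related to \<open>v0\<close>, hence to
  \<open>v1\<close>. Relative to \<open>v1\<close> its colour set is \<open>s\<close> with one
  further colour, against the maximality in \<open>AA v1\<close>.\<close>

lemma types_sub:
  assumes v: "gdB v0" "gdB v1" "gdB v2" and A: "AA v1" "AA v2" and sim: "sim v0 v1" "sim v0 v2"
    and t: "types v0 v1 = types v0 v2" and p: "p \<in> \<Omega>" and q: "gdB q" "C p (override_on v2 q Y) \<in> s"
  shows "C p (override_on v1 q Y) \<in> s"
proof (rule ccontr)
  let ?i = "C p (override_on v1 q Y)" and ?j = "C p (override_on v0 q Y)"
  assume ni: "?i \<notin> s"
  obtain w0 where w0: "gdB w0" "im v1 w0 = s" using A(1) unfolding AA_def by blast
  let ?S = "{(i, j). i \<in> s \<and> (\<exists>p\<in>\<Omega>. \<exists>w. gdB w \<and> C p (override_on v1 w Y) = i \<and> C p (override_on v0 w Y) = j)}"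
  let ?S' = "insert (?i, ?j) ?S"
  obtain w where w: "gdB w" "im v1 w = fst ` ?S'" "im v0 w = snd ` ?S'"
    by (rule generic_section[OF v(2,1) w0 refl, of ?S']) (use p q in auto)
  have "?j \<in> types v0 v2" unfolding types_def using p q by blast
  then have "im v0 w = types v0 v1" unfolding w(3) image_insert snd_S t by auto
  then have "im v0 w \<in> \<E>" using types_in[OF v(1,2) A(1) sim(1)] by simp
  then have "im v1 w \<in> \<E>" by (rule sim_im[OF v(1,2) w(1) sim(1)])
  moreover have "im v1 w = insert ?i s" unfolding w(2) image_insert fst_S[OF w0(2,1)] by simp
  then have "s \<subset> im v1 w" using ni by blast
  ultimately show False using A(1) w(1) unfolding AA_def by blast
qed

lemma types_determine:
  assumes v: "gdB v0" "gdB v1" "gdB v2" and A: "AA v1" "AA v2" and sim: "sim v0 v1" "sim v0 v2"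
    and t: "types v0 v1 = types v0 v2" and p: "p \<in> \<Omega>"
  shows "PE p v1 v2"
  unfolding PE_def
  using types_sub[OF v A sim t p] types_sub[OF v(1,3,2) A(2,1) sim(2,1) t[symmetric] p] by blast

text \<open>The generic section for \<open>v\<close> has colour set \<open>s\<close> relative to
  \<open>v\<close>. Since the fibres agree, and since \<open>s\<close> is also realised over
  \<open>v'\<close>, its colour set relative to \<open>v'\<close> is \<open>s\<close> again. The
  section is thus \<open>E\<close>-related to both.\<close>

lemma PE_sim:
  assumes v: "gdB v" "gdB v'" and A: "AA v" "AA v'" and PE: "\<And>p. p \<in> \<Omega> \<Longrightarrow> PE p v v'"
  shows "sim v v'"
proof -
  obtain w0 where w0: "gdB w0" "im v w0 = s" using A(1) unfolding AA_def by blast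
  obtain w0' where w0': "gdB w0'" "im v' w0' = s" using A(2) unfolding AA_def by blast
  obtain w where w: "gdB w" "im v w = s" "im v' w = types v' v"
    using generic_section[OF v w0 refl subset_refl] unfolding fst_S[OF w0(2,1)] snd_S by blast
  have "types v' v = s"
  proof
    show "types v' v \<subseteq> s" unfolding types_def using PE unfolding PE_def by blast
    show "s \<subseteq> types v' v"
    proof
      fix j assume j: "j \<in> s"
      then obtain p where p: "p \<in> \<Omega>" "C p (override_on v' w0' Y) = j" using w0'(2) unfolding im_def by blast
      then have "C p (override_on v w0' Y) \<in> s" using PE[OF p(1)] w0'(1) j unfolding PE_def by blast
      then show "j \<in> types v' v" unfolding types_def using p w0'(1) by blast
    qed
  qed
  then show ?thesis using im_sim[OF v w(1)] w s(1) by simp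
qed

end

section \<open>Comparing fibres by a formula\<close>

text \<open>\<open>psi xl xl' yl \<Phi>s\<close> says that \<open>xl\<close> and \<open>xl'\<close> define the same sets in the variables \<open>yl\<close> by
  the formulas in \<open>\<Phi>s\<close>.\<close>

definition psi :: "'s var list \<Rightarrow> 's var list \<Rightarrow> 's var list \<Rightarrow> ('s, 'f, 'r) fm list \<Rightarrow> ('s, 'f, 'r) fm" where
  "psi xl xl' yl \<Phi>s = Conjs (map (\<lambda>\<phi>. Alls yl (Iff \<phi> (ren xl xl' \<phi>))) \<Phi>s)"

text \<open>If \<open>\<chi>\<close> relates codes \<open>zl\<close> to parameters \<open>xl\<close>, then \<open>theta\<close> says that moreover \<open>zl\<close> and the
  \<open>psi\<close>-class of \<open>xl\<close> determine each other.\<close>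

definition theta :: "'s var list \<Rightarrow> 's var list \<Rightarrow> 's var list \<Rightarrow> 's var list \<Rightarrow> ('s, 'f, 'r) fm \<Rightarrow> ('s, 'f, 'r) fm \<Rightarrow> ('s, 'f, 'r) fm" where
  "theta xl xl' zl zl' \<psi> \<chi> = Conj \<chi> (Conj
     (Alls (xl' @ zl') (Imp (Conj (ren (xl @ zl) (xl' @ zl') \<chi>) \<psi>) (eqs zl zl')))
     (Alls xl' (Imp (ren xl xl' \<chi>) \<psi>)))"

context tarski begin

text \<open>What \<open>psi\<close> expresses, kept in the abstract locale because it is used in a
  model over \<open>'u\<close>, where codes exist, and at the points of \<Omega>, where they are
  applied.\<close>

definition PP :: "'s var list \<Rightarrow> ('s, 'f, 'r) fm list \<Rightarrow> ('s var \<Rightarrow> 'a) \<Rightarrow> ('s var \<Rightarrow> 'a) \<Rightarrow> bool" where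
  "PP yl \<Phi>s v v' \<longleftrightarrow> (\<forall>\<phi>\<in>set \<Phi>s. \<forall>w. gd L U w \<longrightarrow> (S (override_on v w (set yl)) \<phi> \<longleftrightarrow> S (override_on v' w (set yl)) \<phi>))"

lemma PP_sym: "PP yl \<Phi>s v v' \<Longrightarrow> PP yl \<Phi>s v' v" by (simp add: PP_def)
lemma PP_trans: "PP yl \<Phi>s u v \<Longrightarrow> PP yl \<Phi>s v w \<Longrightarrow> PP yl \<Phi>s u w" by (simp add: PP_def)
lemma PP_refl: "PP yl \<Phi>s v v" by (simp add: PP_def)

lemma copy_val:
  assumes "gd L U v" "gd L U v'" "distinct xs" "map fst xs = map fst zs" "fst ` set xs \<subseteq> sorts L"
  obtains w where "gd L U w" "off (set xs) v w" "map w xs = map v' zs"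
proof -
  have len: "length xs = length zs" using assms(4) by (metis length_map)
  have "list_all2 (\<lambda>a x. a \<in> U (fst x)) (map v' zs) xs"
  proof -
    have "v' (zs ! i) \<in> U (fst (xs ! i))" if "i < length xs" for i
    proof (rule gd_in[OF assms(2)])
      show "fst (zs ! i) = fst (xs ! i)" using that len assms(4) by (metis nth_map)
      show "fst (xs ! i) \<in> sorts L" using that assms(5) by (meson image_subset_iff nth_mem)
    qed
    then show ?thesis using len by (simp add: list_all2_conv_all_nth)
  qed
  then show thesis using val_of_list[OF assms(1,3)] that by blast
qed

text \<open>\<open>psi\<close> sees the two tuples side by side in one assignment \<open>v\<close>,
  whereas \<open>PP\<close> compares two assignments on the same variables \<open>xl\<close>; hence
  the third assignment.\<close>

lemma S_psi:
  assumes xl: "map fst xl = map fst xl'" "distinct xl" "fst ` set xl \<subseteq> sorts L" "fst ` set yl \<subseteq> sorts L"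
    "set xl \<inter> set xl' = {}" "set xl \<inter> set yl = {}" "set xl' \<inter> set yl = {}"
    and \<Phi>s: "\<And>\<phi>. \<phi> \<in> set \<Phi>s \<Longrightarrow> wf_fm L \<phi> \<and> fv \<phi> \<subseteq> set xl \<union> set yl"
    and v: "gd L U v" "gd L U v1" "gd L U v2" "map v xl = map v1 xl" "map v xl' = map v2 xl"
  shows "S v (psi xl xl' yl \<Phi>s) \<longleftrightarrow> PP yl \<Phi>s v1 v2"
proof -
  have wfr: "wf_fm L (ren xl xl' \<phi>)" if "\<phi> \<in> set \<Phi>s" for \<phi> using wf_ren[OF xl(1,3)] \<Phi>s[OF that] by blast
  have wfA: "wf_fm L (Alls yl (Iff \<phi> (ren xl xl' \<phi>)))" if "\<phi> \<in> set \<Phi>s" for \<phi>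
    using wfr[OF that] \<Phi>s[OF that] xl(4) by simp
  have "S v (Alls yl (Iff \<phi> (ren xl xl' \<phi>))) \<longleftrightarrow>
    (\<forall>w. gd L U w \<longrightarrow> (S (override_on v1 w (set yl)) \<phi> \<longleftrightarrow> S (override_on v2 w (set yl)) \<phi>))" if \<phi>: "\<phi> \<in> set \<Phi>s" for \<phi>
  proof -
    have f: "wf_fm L \<phi>" "fv \<phi> \<subseteq> set xl \<union> set yl" using \<Phi>s[OF \<phi>] by blast+
    have eq: "S w (Iff \<phi> (ren xl xl' \<phi>)) \<longleftrightarrow> (S (override_on v1 w (set yl)) \<phi> \<longleftrightarrow> S (override_on v2 w (set yl)) \<phi>)"
      if w: "gd L U w" "off (set yl) v w" for w
    proof -
      have wx: "w x = v x" if "x \<in> set xl \<union> set xl'" for x using w(2) that xl(6,7) by (auto simp: off_def)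
      have 1: "S w \<phi> = S (override_on v1 w (set yl)) \<phi>"
      proof (rule S_fv[OF w(1) gd_override[OF v(2) w(1)] f(1)])
        fix x assume "x \<in> fv \<phi>"
        then show "w x = override_on v1 w (set yl) x"
          using f(2) wx[of x] v(4) by (cases "x \<in> set yl") auto
      qed
      obtain w' where w': "gd L U w'" "off (set xl) w w'" "map w' xl = map w xl'"
        by (rule copy_val[OF w(1) w(1) xl(2,1,3)])
      have "S w (ren xl xl' \<phi>) = S w' \<phi>" by (rule S_ren[OF w(1) w'(1) xl(1,3,5) w'(2,3) f(1)])
      also have "\<dots> = S (override_on v2 w (set yl)) \<phi>"
      proof (rule S_fv[OF w'(1) gd_override[OF v(3) w(1)] f(1)])
        have "map w xl' = map v xl'" using wx by simp
        then have m: "map w' xl = map v2 xl" using w'(3) v(5) by (simp only:)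
        fix x assume "x \<in> fv \<phi>"
        then show "w' x = override_on v2 w (set yl) x"
          using f(2) m w'(2) xl(6) by (cases "x \<in> set yl") (auto simp: off_def)
      qed
      finally show ?thesis using 1 S_Iff[OF w(1) f(1) wfr[OF \<phi>]] by simp
    qed
    have "S v (Alls yl (Iff \<phi> (ren xl xl' \<phi>))) \<longleftrightarrow> (\<forall>w. gd L U w \<longrightarrow> off (set yl) v w \<longrightarrow> S w (Iff \<phi> (ren xl xl' \<phi>)))"
      using S_Alls[of "Iff \<phi> (ren xl xl' \<phi>)" yl v] f(1) wfr[OF \<phi>] xl(4) v(1) by simp
    also have "\<dots> \<longleftrightarrow> (\<forall>w. gd L U w \<longrightarrow> (S (override_on v1 w (set yl)) \<phi> \<longleftrightarrow> S (override_on v2 w (set yl)) \<phi>))"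
    proof (rule iffI, rule allI, rule impI)
      fix w assume a: "\<forall>w. gd L U w \<longrightarrow> off (set yl) v w \<longrightarrow> S w (Iff \<phi> (ren xl xl' \<phi>))" and w: "gd L U w"
      let ?w = "override_on v w (set yl)"
      have g: "gd L U ?w" by (rule gd_override[OF v(1) w])
      have "override_on u ?w (set yl) = override_on u w (set yl)" for u by (rule ext) (simp add: override_on_def)
      then show "S (override_on v1 w (set yl)) \<phi> \<longleftrightarrow> S (override_on v2 w (set yl)) \<phi>"
        using a g off_override[of "set yl" v w] eq[OF g off_override] by simp
    qed (use eq in blast)
    finally show ?thesis .
  qed
  then show ?thesis unfolding psi_def PP_def using S_Conjs[OF v(1), of "map (\<lambda>\<phi>. Alls yl (Iff \<phi> (ren xl xl' \<phi>))) \<Phi>s"] wfA by simp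
qed

text \<open>The relation \<open>R\<close> stands for what \<psi> expresses about two assignments. In
  a structure the equivalence is used to establish \<open>theta\<close>, at a point to exploit it;
  there the codes agree only up to \<open>eqv\<close>.\<close>

lemma S_theta:
  assumes xl: "map fst xl = map fst xl'" "fst ` set xl \<subseteq> sorts L" and zl: "map fst zl = map fst zl'" "fst ` set zl \<subseteq> sorts L"
    and dist: "distinct (xl @ zl @ xl' @ zl')"
    and \<chi>: "wf_fm L \<chi>" "fv \<chi> \<subseteq> set xl \<union> set zl" and \<psi>: "wf_fm L \<psi>" "fv \<psi> \<subseteq> set xl \<union> set xl'"
    and R: "\<And>u u1 u2. gd L U u \<Longrightarrow> gd L U u1 \<Longrightarrow> gd L U u2 \<Longrightarrow> map u xl = map u1 xl \<Longrightarrow> map u xl' = map u2 xl \<Longrightarrow> S u \<psi> \<longleftrightarrow> R u1 u2"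
    and v: "gd L U v"
  shows "S v (theta xl xl' zl zl' \<psi> \<chi>) \<longleftrightarrow> S v \<chi> \<and>
    (\<forall>v'. gd L U v' \<longrightarrow> S v' \<chi> \<longrightarrow> R v v' \<longrightarrow> (\<forall>z\<in>set zl. eqv (fst z) (v z) (v' z))) \<and>
    (\<forall>v'. gd L U v' \<longrightarrow> map v' zl = map v zl \<longrightarrow> S v' \<chi> \<longrightarrow> R v v')"
proof -
  have sl: "fst ` set xl' \<subseteq> sorts L" "fst ` set zl' \<subseteq> sorts L" using xl zl by (metis set_map)+
  have xz: "map fst (xl @ zl) = map fst (xl' @ zl')" "fst ` set (xl @ zl) \<subseteq> sorts L" "set (xl @ zl) \<inter> set (xl' @ zl') = {}" "distinct (xl @ zl)"
    using xl zl dist by auto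
  have wr: "wf_fm L (ren (xl @ zl) (xl' @ zl') \<chi>)" "wf_fm L (ren xl xl' \<chi>)" "wf_fm L (eqs zl zl')"
    using wf_ren[OF xz(1,2) \<chi>(1)] wf_ren[OF xl \<chi>(1)] wf_eqs[OF zl] .
  have wf1: "wf_fm L (Imp (Conj (ren (xl @ zl) (xl' @ zl') \<chi>) \<psi>) (eqs zl zl'))" and wf2: "wf_fm L (Imp (ren xl xl' \<chi>) \<psi>)"
    using wr \<psi> by simp_all
  have s12: "fst ` set (xl' @ zl') \<subseteq> sorts L" using sl by (simp add: image_Un)
  let ?A1 = "Alls (xl' @ zl') (Imp (Conj (ren (xl @ zl) (xl' @ zl') \<chi>) \<psi>) (eqs zl zl'))"
  let ?A2 = "Alls xl' (Imp (ren xl xl' \<chi>) \<psi>)"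
  have len: "length zl = length zl'" "length xl = length xl'" using zl(1) xl(1) by (metis length_map)+
  have A1: "S v ?A1 \<longleftrightarrow> (\<forall>v'. gd L U v' \<longrightarrow> S v' \<chi> \<longrightarrow> R v v' \<longrightarrow> (\<forall>z\<in>set zl. eqv (fst z) (v z) (v' z)))"
  proof -
    have eq: "S w (Imp (Conj (ren (xl @ zl) (xl' @ zl') \<chi>) \<psi>) (eqs zl zl')) \<longleftrightarrow>
        (S v' \<chi> \<longrightarrow> R v v' \<longrightarrow> (\<forall>z\<in>set zl. eqv (fst z) (v z) (v' z)))"
      if w: "gd L U w" "off (set (xl' @ zl')) v w" and v': "gd L U v'" "map w (xl' @ zl') = map v' (xl @ zl)" for w v'
    proof -
      have m: "map w xl' = map v' xl" "map w zl' = map v' zl" using v'(2) len by simp_all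
      have wx: "w x = v x" if "x \<in> set xl \<union> set zl" for x using w(2) that dist by (auto simp: off_def)
      obtain w' where w': "gd L U w'" "off (set (xl @ zl)) w w'" "map w' (xl @ zl) = map w (xl' @ zl')"
        by (rule copy_val[OF w(1) w(1) xz(4,1,2)])
      have "S w (ren (xl @ zl) (xl' @ zl') \<chi>) = S w' \<chi>" by (rule S_ren[OF w(1) w'(1) xz(1,2,3) w'(2,3) \<chi>(1)])
      also have "\<dots> = S v' \<chi>"
      proof (rule S_fv[OF w'(1) v'(1) \<chi>(1)])
        have "map w' (xl @ zl) = map v' (xl @ zl)" using w'(3) v'(2) by (rule trans)
        then have a: "w' x = v' x" if "x \<in> set (xl @ zl)" for x using that by (simp only: map_eq_conv)
        have "fv \<chi> \<subseteq> set (xl @ zl)" using \<chi>(2) by simp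
        then show "w' x = v' x" if "x \<in> fv \<chi>" for x using that a by blast
      qed
      finally have 1: "S w (ren (xl @ zl) (xl' @ zl') \<chi>) = S v' \<chi>" .
      have "map w xl = map v xl" using wx by simp
      then have 2: "S w \<psi> \<longleftrightarrow> R v v'" using R[OF w(1) v v'(1)] m(1) by blast
      have "S w (eqs zl zl') \<longleftrightarrow> (\<forall>i<length zl. eqv (fst (zl ! i)) (w (zl ! i)) (w (zl' ! i)))" by (rule S_eqs[OF w(1) zl])
      also have "\<dots> \<longleftrightarrow> (\<forall>i<length zl. eqv (fst (zl ! i)) (v (zl ! i)) (v' (zl ! i)))"
      proof -
        have "w (zl ! i) = v (zl ! i)" "w (zl' ! i) = v' (zl ! i)" if "i < length zl" for i
        proof -
          show "w (zl ! i) = v (zl ! i)" using wx that by simp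
          show "w (zl' ! i) = v' (zl ! i)" using arg_cong[OF m(2), of "\<lambda>l. l ! i"] that len by simp
        qed
        then show ?thesis by simp
      qed
      also have "\<dots> \<longleftrightarrow> (\<forall>z\<in>set zl. eqv (fst z) (v z) (v' z))" by (simp add: all_set_conv_all_nth)
      finally have 3: "S w (eqs zl zl') \<longleftrightarrow> (\<forall>z\<in>set zl. eqv (fst z) (v z) (v' z))" .
      show ?thesis using 1 2 3 S_Imp[OF w(1)] S_Conj[OF w(1) wr(1) \<psi>(1)] wr \<psi>(1) by (simp add: imp_conjL)
    qed
    have "S v ?A1 \<longleftrightarrow> (\<forall>w. gd L U w \<longrightarrow> off (set (xl' @ zl')) v w \<longrightarrow> S w (Imp (Conj (ren (xl @ zl) (xl' @ zl') \<chi>) \<psi>) (eqs zl zl')))"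
      by (rule S_Alls[OF wf1 s12 v])
    also have "\<dots> \<longleftrightarrow> (\<forall>v'. gd L U v' \<longrightarrow> S v' \<chi> \<longrightarrow> R v v' \<longrightarrow> (\<forall>z\<in>set zl. eqv (fst z) (v z) (v' z)))" (is "?l \<longleftrightarrow> ?r")
    proof
      assume l: ?l
      show ?r
      proof (rule allI, rule impI)
        fix v' assume v': "gd L U v'"
        have d': "distinct (xl' @ zl')" using dist by auto
        obtain w where w: "gd L U w" "off (set (xl' @ zl')) v w" "map w (xl' @ zl') = map v' (xl @ zl)"
          by (rule copy_val[OF v v' d' xz(1)[symmetric] s12])
        then show "S v' \<chi> \<longrightarrow> R v v' \<longrightarrow> (\<forall>z\<in>set zl. eqv (fst z) (v z) (v' z))" using l eq[OF w(1,2) v' w(3)] by blast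
      qed
    next
      assume r: ?r
      show ?l
      proof (intro allI impI)
        fix w assume w: "gd L U w" "off (set (xl' @ zl')) v w"
        obtain v' where v': "gd L U v'" "off (set (xl @ zl)) w v'" "map v' (xl @ zl) = map w (xl' @ zl')"
          by (rule copy_val[OF w(1) w(1) xz(4,1,2)])
        show "S w (Imp (Conj (ren (xl @ zl) (xl' @ zl') \<chi>) \<psi>) (eqs zl zl'))" using r eq[OF w v'(1) v'(3)[symmetric]] v'(1) by blast
      qed
    qed
    finally show ?thesis .
  qed
  have A2: "S v ?A2 \<longleftrightarrow> (\<forall>v'. gd L U v' \<longrightarrow> map v' zl = map v zl \<longrightarrow> S v' \<chi> \<longrightarrow> R v v')"
  proof -
    have dxl: "distinct xl" "distinct xl'" "set xl \<inter> set xl' = {}" using dist by auto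
    have eq: "S w (Imp (ren xl xl' \<chi>) \<psi>) \<longleftrightarrow> (S v' \<chi> \<longrightarrow> R v v')"
      if w: "gd L U w" "off (set xl') v w" and v': "gd L U v'" "map w xl' = map v' xl" "map v' zl = map v zl" for w v'
    proof -
      have wx: "w x = v x" if "x \<in> set xl \<union> set zl" for x using w(2) that dist by (auto simp: off_def)
      obtain w' where w': "gd L U w'" "off (set xl) w w'" "map w' xl = map w xl'"
        by (rule copy_val[OF w(1) w(1) dxl(1) xl])
      have "S w (ren xl xl' \<chi>) = S w' \<chi>" by (rule S_ren[OF w(1) w'(1) xl dxl(3) w'(2,3) \<chi>(1)])
      also have "\<dots> = S v' \<chi>"
      proof (rule S_fv[OF w'(1) v'(1) \<chi>(1)])
        have "map w' xl = map v' xl" using w'(3) v'(2) by (rule trans)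
        then have a: "w' x = v' x" if "x \<in> set xl" for x using that by (simp only: map_eq_conv)
        have b: "w' x = v' x" if "x \<in> set zl" for x
        proof -
          have "x \<notin> set xl" using that dist by auto
          then have "w' x = v x" using w'(2) wx[of x] that by (simp add: off_def)
          then show ?thesis using v'(3) that by (simp only: map_eq_conv)
        qed
        show "w' x = v' x" if "x \<in> fv \<chi>" for x using that \<chi>(2) a b by blast
      qed
      finally have 1: "S w (ren xl xl' \<chi>) = S v' \<chi>" .
      have "map w xl = map v xl" using wx by simp
      then have 2: "S w \<psi> \<longleftrightarrow> R v v'" using R[OF w(1) v v'(1)] v'(2) by blast
      show ?thesis using 1 2 S_Imp[OF w(1) wr(2) \<psi>(1)] by simp
    qed
    have "S v ?A2 \<longleftrightarrow> (\<forall>w. gd L U w \<longrightarrow> off (set xl') v w \<longrightarrow> S w (Imp (ren xl xl' \<chi>) \<psi>))"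
      by (rule S_Alls[OF wf2 sl(1) v])
    also have "\<dots> \<longleftrightarrow> (\<forall>v'. gd L U v' \<longrightarrow> map v' zl = map v zl \<longrightarrow> S v' \<chi> \<longrightarrow> R v v')" (is "?l \<longleftrightarrow> ?r")
    proof
      assume l: ?l
      show ?r
      proof (rule allI, rule impI, rule impI)
        fix v' assume v': "gd L U v'" "map v' zl = map v zl"
        obtain w where w: "gd L U w" "off (set xl') v w" "map w xl' = map v' xl"
          by (rule copy_val[OF v v'(1) dxl(2) xl(1)[symmetric] sl(1)])
        then show "S v' \<chi> \<longrightarrow> R v v'" using l eq[OF w(1,2) v'(1) w(3) v'(2)] by blast
      qed
    next
      assume r: ?r
      show ?l
      proof (intro allI impI)
        fix w assume w: "gd L U w" "off (set xl') v w"
        obtain v' where v': "gd L U v'" "off (set xl) v v'" "map v' xl = map w xl'"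
          by (rule copy_val[OF v w(1) dxl(1) xl])
        have z: "map v' zl = map v zl" using v'(2) dist by (auto simp: off_def)
        show "S w (Imp (ren xl xl' \<chi>) \<psi>)" using r eq[OF w v'(1) v'(3)[symmetric] z] v'(1) z by blast
      qed
    qed
    finally show ?thesis .
  qed
  have wA: "wf_fm L ?A1" "wf_fm L ?A2" using wf1 wf2 s12 sl by simp_all
  show ?thesis unfolding theta_def using A1 A2 S_Conj[OF v] wA \<chi>(1) by simp
qed

end

section \<open>Codes at a point\<close>

lemma wf_psi:
  assumes "map fst xl = map fst xl'" "fst ` set xl \<subseteq> sorts L" "fst ` set yl \<subseteq> sorts L" "\<And>\<phi>. \<phi> \<in> set \<Phi>s \<Longrightarrow> wf_fm L \<phi>"
  shows "wf_fm L (psi xl xl' yl \<Phi>s)"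
  using assms wf_ren[OF assms(1,2)] by (auto simp: psi_def)

lemma fv_psi:
  assumes "\<And>\<phi>. \<phi> \<in> set \<Phi>s \<Longrightarrow> fv \<phi> \<subseteq> set xl \<union> set yl"
  shows "fv (psi xl xl' yl \<Phi>s) \<subseteq> set xl \<union> set xl'"
proof -
  have "fv (Alls yl (Iff \<phi> (ren xl xl' \<phi>))) \<subseteq> set xl \<union> set xl'" if "\<phi> \<in> set \<Phi>s" for \<phi>
    using assms[OF that] fv_ren[of xl xl' \<phi>] by auto
  then have "(\<Union>\<phi>\<in>set (map (\<lambda>\<phi>. Alls yl (Iff \<phi> (ren xl xl' \<phi>))) \<Phi>s). fv \<phi>) \<subseteq> set xl \<union> set xl'"
    unfolding set_map by (intro UN_least) (auto simp del: fv_Alls)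
  then show ?thesis unfolding psi_def fv_Conjs .
qed

lemma wf_theta:
  assumes "map fst xl = map fst xl'" "fst ` set xl \<subseteq> sorts L" "map fst zl = map fst zl'" "fst ` set zl \<subseteq> sorts L"
    "wf_fm L \<psi>" "wf_fm L \<chi>"
  shows "wf_fm L (theta xl xl' zl zl' \<psi> \<chi>)"
proof -
  have s: "fst ` set xl' \<subseteq> sorts L" "fst ` set zl' \<subseteq> sorts L" using assms by (metis set_map)+
  have "wf_fm L (ren (xl @ zl) (xl' @ zl') \<chi>)" by (rule wf_ren) (use assms in \<open>auto simp: image_Un\<close>)
  then show ?thesis using s assms wf_ren[OF assms(1,2,6)] wf_eqs[OF assms(3,4)]
    by (simp add: theta_def image_Un)
qed

lemma fv_theta:
  assumes "fv \<chi> \<subseteq> set xl \<union> set zl" "fv \<psi> \<subseteq> set xl \<union> set xl'"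
  shows "fv (theta xl xl' zl zl' \<psi> \<chi>) \<subseteq> set xl \<union> set zl"
proof -
  have "fv (ren (xl @ zl) (xl' @ zl') \<chi>) \<subseteq> set xl' \<union> set zl'"
    using fv_ren[of "xl @ zl" "xl' @ zl'" \<chi>] assms(1) by auto
  moreover have "fv (ren xl xl' \<chi>) \<subseteq> set zl \<union> set xl'" using fv_ren[of xl xl' \<chi>] assms(1) by auto
  moreover have "fv (eqs zl zl') \<subseteq> set zl \<union> set zl'" by (rule fv_eqs)
  ultimately show ?thesis using assms unfolding theta_def fv.simps fv_Alls fv_Imp set_append by blast
qed

lemma finite_lvar_vimage: "finite V \<Longrightarrow> finite (lvar -` V)"
  by (rule finite_vimageI) (simp_all add: inj_def)

lemma BSort_bvar: "fst b = BSort \<Longrightarrow> b = bvar (snd b)"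
  by (simp add: bvar_def prod_eq_iff)

context bvmodel begin

lemma theory_valid: assumes "\<phi> \<in> T" shows "valid \<phi>"
proof -
  have \<phi>: "fm_in L [] \<phi>" using TL assms by (simp add: theory_in_def)
  show ?thesis
  proof (rule validI)
    show "wf_fm L \<phi>" using \<phi> by (simp add: fm_in_def)
    fix N :: "('s, 'f, 'r, 'u) struct" and v assume "is_model L T N"
    then have "holds N [] \<phi> []" using assms by (simp add: is_model_def)
    moreover have "sat N v \<phi> = sat N (\<lambda>x. the (map_of (zip [] []) x)) \<phi>"
      by (rule sat_cong) (use \<phi> in \<open>simp add: fm_in_def\<close>)
    ultimately show "sat N v \<phi>" by (simp add: holds_def)
  qed
qed

end

section \<open>Locality of the property of having a code\<close>

context imag_class begin

lemma finXY: "finite (X \<union> Y)" "finite X" "finite Y" by simp_all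

lemma loc_s: "loc (X \<union> Y) (\<lambda>p v. C p v \<in> s)"
proof -
  have "finite s" using s(2) finF by (rule finite_subset)
  have "loc (X \<union> Y) (\<lambda>p v. \<exists>i\<in>s. C p v = i)"
  proof (rule loc_Bex[OF \<open>finite s\<close> finXY(1)])
    show "loc (X \<union> Y) (\<lambda>p v. C p v = i)" for i by (rule loc_mono[OF colouredD(2)[OF C] XY(4) finXY(1)])
  qed
  then show ?thesis by (rule loc_cong) blast
qed

text \<open>The quantifier over \<open>u\<close> changes the values on \<open>X\<close>, yet
  \<open>PE\<close> still has to compare with the original ones. So the \<open>X\<close>-part of
  \<open>u\<close> is moved to a fresh copy \<open>xs'\<close>, read through \<rho>. The quantifier
  then runs over a block of variables disjoint from \<open>X\<close> and \<open>Z\<close>, and the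
  comparison of fibres becomes a universal block over \<open>Y\<close>.\<close>

lemma loc_code:
  assumes \<Theta>: "wf_fm L \<Theta>" "lvar ` fv \<Theta> \<subseteq> X \<union> Z" and Z: "finite Z" "Z \<inter> (X \<union> Y) = {}" "fst ` Z \<subseteq> sorts BL"
  shows "loc (X \<union> Z) (\<lambda>q w. \<exists>u. gdB u \<and> (\<forall>z\<in>Z. u z = w z) \<and> PE q w u \<and> sg X q u = \<sigma> \<and> tr q (u \<circ> lvar) \<Theta>)"
proof -
  have "finite (X \<union> Y \<union> Z)" using Z(1) by simp
  from fresh_vars[OF this, of "map fst xs"] obtain xs' where xs': "map fst xs' = map fst xs" "distinct xs'" "set xs' \<inter> (X \<union> Y \<union> Z) = {}"
    by (elim exE conjE)
  have len: "length xs' = length xs" using xs'(1) by (metis length_map)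
  define \<rho> where "\<rho> x = (case map_of (zip xs xs') x of Some y \<Rightarrow> y | None \<Rightarrow> x)" for x
  have \<rho>X: "\<rho> (xs ! i) = xs' ! i" if "i < length xs" for i
    unfolding \<rho>_def using map_of_zip_nth[OF len[symmetric] XY(2), of i] that len by simp
  have \<rho>n: "\<rho> x = x" if "x \<notin> X" for x
  proof -
    have "map_of (zip xs xs') x = None" using that len by (simp add: map_of_zip_is_None)
    then show ?thesis by (simp add: \<rho>_def)
  qed
  have X_ex: "\<exists>i<length xs. x = xs ! i" if "x \<in> X" for x using that unfolding in_set_conv_nth by blast
  have fst_nth: "fst (xs' ! i) = fst (xs ! i)" if "i < length xs" for i
  proof -
    have "map fst xs' ! i = map fst xs ! i" by (simp only: xs'(1))
    then show ?thesis using that len by (simp only: nth_map)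
  qed
  have \<rho>s: "fst (\<rho> x) = fst x" for x
  proof (cases "x \<in> X")
    case True
    then obtain i where i: "i < length xs" "x = xs ! i" using X_ex by blast
    show ?thesis unfolding i(2) \<rho>X[OF i(1)] by (rule fst_nth[OF i(1)])
  next
    case False
    show ?thesis by (simp only: \<rho>n[OF False])
  qed
  have \<rho>im: "\<rho> x \<in> set xs'" if x: "x \<in> X" for x
  proof -
    obtain i where i: "i < length xs" "x = xs ! i" using X_ex[OF x] by blast
    show ?thesis unfolding i(2) \<rho>X[OF i(1)] by (rule nth_mem) (simp only: len i(1))
  qed
  have g\<rho>: "gdB (v \<circ> \<rho>)" if "gdB v" for v
    unfolding gd_def
  proof (intro allI impI)
    fix x :: "'s bsort var" assume "fst x \<in> sorts BL"
    then show "(v \<circ> \<rho>) x \<in> univ M (fst x)" using gd_in[OF that, of "\<rho> x" "fst x"] \<rho>s by simp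
  qed
  let ?X' = "set xs'"
  \<comment> \<open>\<open>?Q1\<close> compares the fibres of the original and of the copy,
    \<open>?Q2\<close> prescribes the signature of the copy, and \<open>?Q3\<close> asserts \<Theta>
    of the copy.\<close>
  let ?Q1 = "\<lambda>q v. \<forall>u. gdB u \<longrightarrow> off Y v u \<longrightarrow> (C q u \<in> s \<longleftrightarrow> C q (u \<circ> \<rho>) \<in> s)"
  let ?Q2 = "\<lambda>q v. \<forall>b\<in>{b\<in>X. fst b = BSort}. v (\<rho> b) \<in> q \<longleftrightarrow> b \<in> \<sigma>"
  let ?Q3 = "\<lambda>q v. tr q ((v \<circ> \<rho>) \<circ> lvar) \<Theta>"
  let ?V1 = "X \<union> ?X' \<union> Z"
  have Q1: "loc ?V1 ?Q1"
  proof -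
    have "loc (X \<union> Y \<union> ?X') (\<lambda>q u. C q u \<in> s)" by (rule loc_mono[OF loc_s]) auto
    moreover have "loc (X \<union> Y \<union> ?X') (\<lambda>q u. C q (u \<circ> \<rho>) \<in> s)"
    proof (rule loc_mono[OF loc_rename[OF loc_s \<rho>s]])
      show "\<rho> ` (X \<union> Y) \<subseteq> X \<union> Y \<union> ?X'"
      proof
        fix y assume "y \<in> \<rho> ` (X \<union> Y)"
        then obtain x where "y = \<rho> x" "x \<in> X \<union> Y" by blast
        then show "y \<in> X \<union> Y \<union> ?X'" using \<rho>im[of x] \<rho>n[of x] by (cases "x \<in> X") auto
      qed
    qed simp
    ultimately have "loc (X \<union> Y \<union> ?X' - Y) ?Q1" by (intro loc_all loc_iff XY(6)) simp_all
    then show ?thesis by (rule loc_mono) (use Z(1) in auto)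
  qed
  have Q2: "loc ?V1 ?Q2"
    by (rule loc_Ball) (use \<rho>im \<rho>s Z(1) in \<open>auto intro!: loc_iff loc_bvar loc_const\<close>)
  have Q3: "loc ?V1 ?Q3"
  proof (rule loc_mono[OF loc_rename[OF loc_tr[OF \<Theta>] \<rho>s]])
    show "\<rho> ` (X \<union> Z) \<subseteq> ?V1"
    proof
      fix y assume "y \<in> \<rho> ` (X \<union> Z)"
      then obtain x where "y = \<rho> x" "x \<in> X \<union> Z" by blast
      then show "y \<in> ?V1" using \<rho>im[of x] \<rho>n[of x] by (cases "x \<in> X") auto
    qed
  qed (use Z(1) in simp_all)
  have X's: "fst ` ?X' \<subseteq> sorts BL" using xs'(1) XY(5) by (metis set_map)
  have "loc (?V1 - ?X') (\<lambda>q v. \<exists>u. gdB u \<and> off ?X' v u \<and> (?Q1 q u \<and> ?Q2 q u \<and> ?Q3 q u))"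
    by (rule loc_ex[OF loc_conj[OF Q1 loc_conj[OF Q2 Q3]] _ X's]) simp
  moreover have "?V1 - ?X' = X \<union> Z" using xs'(3) by blast
  ultimately have main: "loc (X \<union> Z) (\<lambda>q v. \<exists>u. gdB u \<and> off ?X' v u \<and> (?Q1 q u \<and> ?Q2 q u \<and> ?Q3 q u))" by simp
  have Q1_PE: "?Q1 q u \<longleftrightarrow> PE q u (u \<circ> \<rho>)" if u: "gdB u" and q: "q \<in> \<Omega>" for u q
  proof -
    have eq: "C q u1 = C q (override_on u u1 Y)" "C q (u1 \<circ> \<rho>) = C q (override_on (u \<circ> \<rho>) u1 Y)"
      if u1: "gdB u1" "\<And>x. x \<in> X \<union> ?X' \<Longrightarrow> u1 x = u x" for u1
    proof -
      show "C q u1 = C q (override_on u u1 Y)"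
        by (rule C_cong[OF u1(1) gd_override[OF u u1(1)] q]) (use u1(2) in \<open>auto simp: override_on_def\<close>)
      show "C q (u1 \<circ> \<rho>) = C q (override_on (u \<circ> \<rho>) u1 Y)"
      proof (rule C_cong[OF g\<rho>[OF u1(1)] gd_override[OF g\<rho>[OF u] u1(1)] q])
        fix x assume "x \<in> X \<union> Y"
        then show "(u1 \<circ> \<rho>) x = override_on (u \<circ> \<rho>) u1 Y x"
          using \<rho>im[of x] \<rho>n[of x] u1(2)[of "\<rho> x"] XY(1) by (cases "x \<in> X") (auto simp: override_on_def)
      qed
    qed
    show ?thesis
    proof
      assume l: "?Q1 q u"
      show "PE q u (u \<circ> \<rho>)" unfolding PE_def
      proof (intro allI impI)
        fix w assume w: "gdB w"
        let ?u = "override_on u w Y"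
        have g: "gdB ?u" by (rule gd_override[OF u w])
        have "?u x = u x" if "x \<in> X \<union> ?X'" for x using that XY(1) xs'(3) by (auto simp: override_on_def)
        note e = eq(2)[OF g this]
        have o: "override_on v ?u Y = override_on v w Y" for v by (rule ext) (simp add: override_on_def)
        have "C q ?u \<in> s \<longleftrightarrow> C q (?u \<circ> \<rho>) \<in> s" by (rule l[rule_format, OF g off_override])
        also have "C q (?u \<circ> \<rho>) = C q (override_on (u \<circ> \<rho>) w Y)" using e by (simp only: o)
        finally show "C q (override_on u w Y) \<in> s \<longleftrightarrow> C q (override_on (u \<circ> \<rho>) w Y) \<in> s" .
      qed
    next
      assume PE: "PE q u (u \<circ> \<rho>)"
      show "?Q1 q u"
      proof (intro allI impI)
        fix u1 assume u1: "gdB u1" "off Y u u1"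
        have "u1 x = u x" if "x \<in> X \<union> ?X'" for x using u1(2) that XY(1) xs'(3) by (auto simp: off_def)
        note e = eq[OF u1(1) this]
        have "C q u1 \<in> s \<longleftrightarrow> C q (override_on u u1 Y) \<in> s" by (rule arg_cong[where f = "\<lambda>z. z \<in> s", OF e(1)])
        also have "\<dots> \<longleftrightarrow> C q (override_on (u \<circ> \<rho>) u1 Y) \<in> s" by (rule PE[unfolded PE_def, rule_format, OF u1(1)])
        also have "\<dots> \<longleftrightarrow> C q (u1 \<circ> \<rho>) \<in> s" by (rule arg_cong[where f = "\<lambda>z. z \<in> s", OF e(2)[symmetric]])
        finally show "C q u1 \<in> s \<longleftrightarrow> C q (u1 \<circ> \<rho>) \<in> s" .
      qed
    qed
  qed
  have Q2_sg: "?Q2 q u \<longleftrightarrow> sg X q (u \<circ> \<rho>) = \<sigma> \<inter> {b\<in>X. fst b = BSort}" for q u unfolding sg_def by auto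
  show ?thesis
  proof (cases "\<sigma> \<subseteq> {b\<in>X. fst b = BSort}")
    case False
    have "sg X q u \<noteq> \<sigma>" for q u using False by (auto simp: sg_def)
    then show ?thesis using loc_False[of "X \<union> Z"] Z(1) by simp
  next
    case True
    show ?thesis
    proof (rule loc_cong[OF main])
      fix v q assume v: "gdB v" and q: "q \<in> \<Omega>"
      show "(\<exists>u. gdB u \<and> off ?X' v u \<and> (?Q1 q u \<and> ?Q2 q u \<and> ?Q3 q u)) \<longleftrightarrow>
        (\<exists>u. gdB u \<and> (\<forall>z\<in>Z. u z = v z) \<and> PE q v u \<and> sg X q u = \<sigma> \<and> tr q (u \<circ> lvar) \<Theta>)" (is "?l \<longleftrightarrow> ?r")
      proof
        assume ?l
        then obtain u where u: "gdB u" "off ?X' v u" "?Q1 q u" "?Q2 q u" "?Q3 q u" by (elim exE conjE)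
        have 1: "(u \<circ> \<rho>) z = v z" if "z \<in> Z" for z
        proof -
          have "z \<notin> X" "z \<notin> ?X'" using that Z(2) xs'(3) by blast+
          then show ?thesis using \<rho>n[of z] u(2) by (simp add: off_def)
        qed
        have "v x = u x" if "x \<in> X" for x using u(2) that xs'(3) by (auto simp: off_def)
        then have "PE q v u" using PE_cong[OF v u(1) q] by blast
        then have 2: "PE q v (u \<circ> \<rho>)" by (rule PE_trans) (rule iffD1[OF Q1_PE[OF u(1) q] u(3)])
        have 3: "sg X q (u \<circ> \<rho>) = \<sigma>" using u(4) True unfolding Q2_sg by blast
        show ?r
        proof (intro exI conjI ballI)
          show "gdB (u \<circ> \<rho>)" by (rule g\<rho>[OF u(1)])
          show "(u \<circ> \<rho>) z = v z" if "z \<in> Z" for z by (rule 1[OF that])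
        qed (rule 2 3 u(5))+
      next
        assume ?r
        then obtain u where u: "gdB u" "\<forall>z\<in>Z. u z = v z" "PE q v u" "sg X q u = \<sigma>" "tr q (u \<circ> lvar) \<Theta>" by (elim exE conjE)
        have "list_all2 (\<lambda>a x. a \<in> univ M (fst x)) (map u xs) xs'"
        proof -
          have "u (xs ! i) \<in> univ M (fst (xs' ! i))" if "i < length xs" for i
          proof (rule gd_in[OF u(1)])
            show "fst (xs ! i) = fst (xs' ! i)" by (rule fst_nth[OF that, symmetric])
            show "fst (xs' ! i) \<in> sorts BL" using X's that len by (metis image_subset_iff nth_mem)
          qed
          then show ?thesis using len by (simp add: list_all2_conv_all_nth)
        qed
        then obtain u1 where u1: "gdB u1" "off ?X' v u1" "map u1 xs' = map u xs" by (rule val_of_list[OF v xs'(2)])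
        have uX: "(u1 \<circ> \<rho>) x = u x" if x: "x \<in> X" for x
        proof -
          obtain i where i: "i < length xs" "x = xs ! i" using X_ex[OF x] by blast
          have "map u1 xs' ! i = map u xs ! i" by (simp only: u1(3))
          then show ?thesis unfolding i(2) comp_apply \<rho>X[OF i(1)] using i(1) len by (simp only: nth_map)
        qed
        have uZ: "(u1 \<circ> \<rho>) z = u z" if "z \<in> Z" for z
        proof -
          have "z \<notin> X" "z \<notin> ?X'" using that Z(2) xs'(3) by blast+
          then show ?thesis using \<rho>n[of z] u1(2) u(2) that by (simp add: off_def)
        qed
        have "v x = u1 x" if "x \<in> X" for x using u1(2) that xs'(3) by (auto simp: off_def)
        then have "PE q u1 v" using PE_cong[OF v u1(1) q] PE_sym by blast
        moreover have "PE q u (u1 \<circ> \<rho>)" using PE_cong[OF u(1) g\<rho>[OF u1(1)] q] uX by simp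
        ultimately have "PE q u1 (u1 \<circ> \<rho>)" using u(3) PE_trans by blast
        then have 1: "?Q1 q u1" by (rule iffD2[OF Q1_PE[OF u1(1) q]])
        have "sg X q (u1 \<circ> \<rho>) = sg X q u" unfolding sg_def using uX by auto
        then have 2: "?Q2 q u1" using u(4) True unfolding Q2_sg by blast
        have "tr q ((u1 \<circ> \<rho>) \<circ> lvar) \<Theta> = tr q (u \<circ> lvar) \<Theta>"
        proof (rule tr_fv)
          fix x assume "x \<in> fv \<Theta>"
          then have "lvar x \<in> X \<union> Z" using \<Theta>(2) by blast
          then show "((u1 \<circ> \<rho>) \<circ> lvar) x = (u \<circ> lvar) x" using uX[of "lvar x"] uZ[of "lvar x"] by auto
        qed
        then have "?Q3 q u1" using u(5) by (rule iffD2)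
        with u1(1,2) 1 2 show ?l by (intro exI conjI)
      qed
    qed
  qed
qed

end

context tarski begin

text \<open>\<open>PP\<close> is an equivalence by its form, and each tuple of the right sorts is
  the value of some assignment; this carries the equivalence over to tuples. The two equations for
  \<open>U\<close> and \<open>S\<close> specialise the locale to a structure.\<close>

lemma PP_equiv_tuples:
  assumes M: "U = univ N" "S = sat N" and ex: "gd L U \<nu>"
    and xl: "map fst xl = map fst xl'" "distinct xl" "distinct xl'" "fst ` set xl \<subseteq> sorts L" "fst ` set yl \<subseteq> sorts L"
    "set xl \<inter> set xl' = {}" "set xl \<inter> set yl = {}" "set xl' \<inter> set yl = {}"
    and \<Phi>s: "\<And>\<phi>. \<phi> \<in> set \<Phi>s \<Longrightarrow> wf_fm L \<phi> \<and> fv \<phi> \<subseteq> set xl \<union> set yl"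
  shows "gd L U u1 \<Longrightarrow> gd L U u2 \<Longrightarrow> (map u1 xl, map u2 xl) \<in> eqrel N xl xl' (psi xl xl' yl \<Phi>s) \<longleftrightarrow> PP yl \<Phi>s u1 u2"
    and "defines_equiv L N xl xl' (psi xl xl' yl \<Phi>s)"
proof -
  let ?\<psi> = "psi xl xl' yl \<Phi>s"
  have s': "fst ` set xl' \<subseteq> sorts L" using xl(1,4) by (metis set_map)
  have wf: "wf_fm L ?\<psi>" by (rule wf_psi[OF xl(1,4,5)]) (use \<Phi>s in blast)
  have fv: "fv ?\<psi> \<subseteq> set xl \<union> set xl'" by (rule fv_psi) (use \<Phi>s in blast)
  have iff: "(map u1 xl, map u2 xl) \<in> eqrel N xl xl' ?\<psi> \<longleftrightarrow> PP yl \<Phi>s u1 u2" if g: "gd L U u1" "gd L U u2" for u1 u2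
  proof -
    obtain u where u: "gd L U u" "off (set xl') u1 u" "map u xl' = map u2 xl"
      by (rule copy_val[OF g xl(3) xl(1)[symmetric] s'])
    have "map u xl = map u1 xl" using u(2) xl(6) by (auto simp: off_def)
    then have m: "map u (xl @ xl') = map u1 xl @ map u2 xl" using u(3) by simp
    have t: "map u1 xl \<in> tuples N (map fst xl)" "map u2 xl \<in> tuples N (map fst xl')"
      using tuples_map[of L N, OF _ xl(4)] g unfolding M(1) xl(1)[symmetric] by blast+
    have "holds N (xl @ xl') ?\<psi> (map u1 xl @ map u2 xl) \<longleftrightarrow> sat N u ?\<psi>"
      unfolding m[symmetric] by (rule holds_map) (use fv in simp)
    also have "\<dots> \<longleftrightarrow> PP yl \<Phi>s u1 u2"
      using S_psi[OF xl(1,2,4,5,6,7,8) \<Phi>s u(1) g \<open>map u xl = map u1 xl\<close> u(3)] unfolding M(2) .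
    finally show ?thesis using t by (simp add: eqrel_def)
  qed
  then show "gd L U u1 \<Longrightarrow> gd L U u2 \<Longrightarrow> (map u1 xl, map u2 xl) \<in> eqrel N xl xl' ?\<psi> \<longleftrightarrow> PP yl \<Phi>s u1 u2" .
  have val: "\<exists>u. gd L U u \<and> map u xl = as" if as: "as \<in> tuples N (map fst xl)" for as
  proof -
    have "list_all2 (\<lambda>a x. a \<in> U (fst x)) as xl" using as unfolding tuples_iff M(1) list_all2_map2 .
    then show ?thesis using val_of_list[OF ex xl(2)] by blast
  qed
  have sub: "eqrel N xl xl' ?\<psi> \<subseteq> tuples N (map fst xl) \<times> tuples N (map fst xl)"
    using xl(1) by (auto simp: eqrel_def)
  have "equiv (tuples N (map fst xl)) (eqrel N xl xl' ?\<psi>)"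
  proof (rule equivI[OF sub])
    show "refl_on (tuples N (map fst xl)) (eqrel N xl xl' ?\<psi>)"
    proof (rule refl_onI)
      fix as assume "as \<in> tuples N (map fst xl)"
      then obtain u where "gd L U u" "map u xl = as" using val by blast
      then show "(as, as) \<in> eqrel N xl xl' ?\<psi>" using iff[of u u] PP_refl by blast
    qed
    show "sym (eqrel N xl xl' ?\<psi>)"
    proof (rule symI)
      fix as bs assume ab: "(as, bs) \<in> eqrel N xl xl' ?\<psi>"
      then obtain u u' where u: "gd L U u" "map u xl = as" "gd L U u'" "map u' xl = bs" using val sub by (metis (no_types) mem_Sigma_iff subsetD)
      have "PP yl \<Phi>s u u'" using ab iff[OF u(1,3)] u by simp
      then show "(bs, as) \<in> eqrel N xl xl' ?\<psi>" using iff[OF u(3,1)] PP_sym u by simp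
    qed
    show "trans (eqrel N xl xl' ?\<psi>)"
    proof (rule transI)
      fix as bs cs assume ab: "(as, bs) \<in> eqrel N xl xl' ?\<psi>" "(bs, cs) \<in> eqrel N xl xl' ?\<psi>"
      obtain u u' where u: "gd L U u" "map u xl = as" "gd L U u'" "map u' xl = bs"
        using val sub ab(1) by (metis (no_types) mem_Sigma_iff subsetD)
      obtain u'' where u'': "gd L U u''" "map u'' xl = cs"
        using val sub ab(2) by (metis (no_types) mem_Sigma_iff subsetD)
      have "PP yl \<Phi>s u u'" "PP yl \<Phi>s u' u''" using ab iff[OF u(1,3)] iff[OF u(3) u''(1)] u u'' by simp_all
      then have "PP yl \<Phi>s u u''" by (rule PP_trans)
      then show "(as, cs) \<in> eqrel N xl xl' ?\<psi>" using iff[OF u(1) u''(1)] u u'' by simp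
    qed
  qed
  moreover have "fm_in L (xl @ xl') ?\<psi>"
    unfolding fm_in_def using wf fv xl s' by auto
  ultimately show "defines_equiv L N xl xl' ?\<psi>" using xl(1) by (simp add: defines_equiv_def)
qed

end

section \<open>Elimination of imaginaries carried over to a point\<close>

context bvmodel begin

lemma gdB_mkv: assumes "gdL v" "\<And>i. \<beta> i \<in> BB" shows "gdB (mkv v \<beta>)"
  unfolding gd_def
proof (intro allI impI)
  fix x :: "'s bsort var" assume x: "fst x \<in> sorts BL"
  show "mkv v \<beta> x \<in> univ M (fst x)"
  proof (cases x rule: bvar_cases)
    case (L y)
    then have "fst y \<in> sorts L" using x by simp
    then show ?thesis using L gd_in[OF assms(1), of y "fst y"] by simp
  next
    case B
    then show ?thesis using BSort_bvar[OF B] assms(2) by (metis mkv_simps(2))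
  qed
qed

lemma model_of_complete:
  assumes "is_struct L N" "p \<in> \<Omega>" "gdL v0" "\<And>\<phi>. wf_fm L \<phi> \<Longrightarrow> sat N \<nu> \<phi> \<longleftrightarrow> tr p v0 \<phi>"
  shows "is_model L T N"
  unfolding is_model_def
proof (intro conjI ballI)
  fix \<phi> assume \<phi>: "\<phi> \<in> T"
  have v: "valid \<phi>" by (rule theory_valid[OF \<phi>])
  have "sat N \<nu> \<phi>" using tr_valid[OF v assms(3,2)] assms(4) v by (simp add: valid_def)
  moreover have "fv \<phi> \<subseteq> set []" using TL \<phi> by (simp add: theory_in_def fm_in_def)
  ultimately show "holds N [] \<phi> []" using holds_map[of \<phi> "[]" N \<nu>] by simp
qed (rule assms(1))

text \<open>Elimination of imaginaries is applied in a model over \<open>'u\<close> that satisfies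
  the same formulas as the point \<open>p\<close>. The code found there lives in that model only,
  but its existence is the single formula \<exists>zl. theta in the variables \<open>xl\<close>,
  which is therefore true at \<open>p\<close> as well.\<close>

lemma theta_exists:
  fixes \<iota> :: "('s, 'f, 'r) fm \<Rightarrow> 'u"
  assumes \<iota>: "inj \<iota>" and EI: "elim_imaginaries ty L T" and p: "p \<in> \<Omega>" and v0: "gdL v0"
    and xl: "map fst xl = map fst xl'" "distinct xl" "distinct xl'" "fst ` set xl \<subseteq> sorts L" "fst ` set yl \<subseteq> sorts L"
    "set xl \<inter> set xl' = {}" "set xl \<inter> set yl = {}" "set xl' \<inter> set yl = {}"
    and \<Phi>s: "\<And>\<phi>. \<phi> \<in> set \<Phi>s \<Longrightarrow> wf_fm L \<phi> \<and> fv \<phi> \<subseteq> set xl \<union> set yl"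
    and W: "finite W" "set xl \<subseteq> W" "set xl' \<subseteq> W"
  obtains zl zl' \<chi> u where "distinct (xl @ zl @ xl' @ zl')" "map fst zl = map fst zl'" "set zl \<inter> W = {}" "fst ` set zl \<subseteq> sorts L"
    "wf_fm L \<chi>" "fv \<chi> \<subseteq> set xl \<union> set zl" "gdL u" "off (set zl) v0 u" "tr p u (theta xl xl' zl zl' (psi xl xl' yl \<Phi>s) \<chi>)"
proof -
  let ?\<psi> = "psi xl xl' yl \<Phi>s"
  have wf: "wf_fm L ?\<psi>" by (rule wf_psi[OF xl(1,4,5)]) (use \<Phi>s in blast)
  have fv: "fv ?\<psi> \<subseteq> set xl \<union> set xl'" by (rule fv_psi) (use \<Phi>s in blast)
  from loewenheim_skolem[OF \<iota> p v0] obtain N :: "('s, 'f, 'r, 'u) struct" and \<nu>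
    where N: "is_struct L N" "gd L (univ N) \<nu>" "\<forall>\<phi>. wf_fm L \<phi> \<longrightarrow> (sat N \<nu> \<phi> \<longleftrightarrow> tr p v0 \<phi>)"
    by (elim exE conjE)
  have mod: "is_model L T N" by (rule model_of_complete[OF N(1) p v0]) (use N(3) in blast)
  interpret N: tarski L "univ N" "sat N" "\<lambda>_. (=)" by (rule tarski_sat[OF N(1)])
  have eqN: "(map u1 xl, map u2 xl) \<in> eqrel N xl xl' ?\<psi> \<longleftrightarrow> N.PP yl \<Phi>s u1 u2"
    if "gd L (univ N) u1" "gd L (univ N) u2" for u1 u2
    by (rule N.PP_equiv_tuples(1)[OF refl refl N(2) xl \<Phi>s that])
  have dN: "defines_equiv L N xl xl' ?\<psi>" by (rule N.PP_equiv_tuples(2)[OF refl refl N(2) xl \<Phi>s])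
  have eN: "equiv (tuples N (map fst xl)) (eqrel N xl xl' ?\<psi>)" using dN unfolding defines_equiv_def by blast
  let ?e = "(Imag xl xl' ?\<psi>, Inr (eqrel N xl xl' ?\<psi> `` {map \<nu> xl}))"
  have "map \<nu> xl \<in> tuples N (map fst xl)" by (rule tuples_map[OF N(2) xl(4)])
  then have "?e \<in> imaginaries L N"
    unfolding imaginaries_def elems_def using dN by (auto intro: quotientI)
  then obtain ds where ds: "set ds \<subseteq> reals L N" "?e \<in> dcl_eq L N (set ds)" "set ds \<subseteq> dcl_eq L N {?e}"
    using EI mod unfolding elim_imaginaries_def by blast
  obtain zl \<nu>1 \<chi> where z: "distinct zl" "set zl \<inter> W = {}" "fst ` set zl \<subseteq> sorts L" "gd L (univ N) \<nu>1" "off (set zl) \<nu> \<nu>1"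
    "wf_fm L \<chi>" "fv \<chi> \<subseteq> set xl \<union> set zl" "sat N \<nu>1 \<chi>"
    and c1: "\<And>\<mu>. gd L (univ N) \<mu> \<Longrightarrow> sat N \<mu> \<chi> \<Longrightarrow> map \<mu> zl = map \<nu>1 zl \<Longrightarrow> eqrel N xl xl' ?\<psi> `` {map \<mu> xl} = eqrel N xl xl' ?\<psi> `` {map \<nu> xl}"
    and c2: "\<And>\<mu>. gd L (univ N) \<mu> \<Longrightarrow> sat N \<mu> \<chi> \<Longrightarrow> eqrel N xl xl' ?\<psi> `` {map \<mu> xl} = eqrel N xl xl' ?\<psi> `` {map \<nu> xl} \<Longrightarrow> map \<mu> zl = map \<nu>1 zl"
    using ds W(1,2) by (rule code_formula[OF N(1,2) dN]) blast
  have "finite (W \<union> set zl)" using W(1) by simp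
  from fresh_vars[OF this, of "map fst zl"] obtain zl' where zl': "map fst zl' = map fst zl" "distinct zl'" "set zl' \<inter> (W \<union> set zl) = {}"
    by (elim exE conjE)
  have dist: "distinct (xl @ zl @ xl' @ zl')" using z(1,2) zl'(2,3) xl(2,3,6) W(2,3) by (simp, blast)
  have m: "map \<nu>1 xl = map \<nu> xl" using z(2,5) W(2) by (auto simp: off_def)
  let ?\<Theta> = "theta xl xl' zl zl' ?\<psi> \<chi>"
  have "sat N \<nu>1 ?\<Theta> \<longleftrightarrow> sat N \<nu>1 \<chi> \<and>
    (\<forall>v'. gd L (univ N) v' \<longrightarrow> sat N v' \<chi> \<longrightarrow> N.PP yl \<Phi>s \<nu>1 v' \<longrightarrow> (\<forall>z\<in>set zl. \<nu>1 z = v' z)) \<and>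
    (\<forall>v'. gd L (univ N) v' \<longrightarrow> map v' zl = map \<nu>1 zl \<longrightarrow> sat N v' \<chi> \<longrightarrow> N.PP yl \<Phi>s \<nu>1 v')"
  proof (rule N.S_theta[OF xl(1,4) zl'(1)[symmetric] z(3) dist z(6,7) wf fv _ z(4)])
    fix u u1 u2 assume g: "gd L (univ N) u" "gd L (univ N) u1" "gd L (univ N) u2" "map u xl = map u1 xl" "map u xl' = map u2 xl"
    show "sat N u ?\<psi> \<longleftrightarrow> N.PP yl \<Phi>s u1 u2" by (rule N.S_psi[OF xl(1,2,4,5,6,7,8) \<Phi>s g])
  qed
  moreover have "\<nu>1 x = v' x" if v': "gd L (univ N) v'" "sat N v' \<chi>" "N.PP yl \<Phi>s \<nu>1 v'" and x: "x \<in> set zl" for v' x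
  proof -
    have "(map \<nu> xl, map v' xl) \<in> eqrel N xl xl' ?\<psi>" using eqN[OF z(4) v'(1)] v'(3) m by simp
    then have "map v' zl = map \<nu>1 zl" using c2[OF v'(1,2)] equiv_class_eq[OF eN] by metis
    then show ?thesis using x by (simp add: map_eq_conv)
  qed
  moreover have "N.PP yl \<Phi>s \<nu>1 v'" if v': "gd L (univ N) v'" "map v' zl = map \<nu>1 zl" "sat N v' \<chi>" for v'
  proof -
    have "(map v' xl, map \<nu> xl) \<in> eqrel N xl xl' ?\<psi>"
      by (rule eq_equiv_class[OF c1[OF v'(1,3,2)] eN]) (rule tuples_map[OF N(2) xl(4)])
    then have "N.PP yl \<Phi>s v' \<nu>1" using eqN[OF v'(1) z(4)] m by simp
    then show ?thesis by (rule N.PP_sym)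
  qed
  ultimately have s\<Theta>: "sat N \<nu>1 ?\<Theta>" using z(8) by blast
  have wf\<Theta>: "wf_fm L ?\<Theta>" by (rule wf_theta[OF xl(1,4) zl'(1)[symmetric] z(3) wf z(6)])
  have "sat N \<nu> (Exs zl ?\<Theta>)" using N.S_Exs[OF wf\<Theta> z(3) N(2)] z(4,5) s\<Theta> by blast
  then have t: "tr p v0 (Exs zl ?\<Theta>)" using N(3) wf\<Theta> z(3) by simp
  interpret tq: tarski L U "tr p" "eqv p" by (rule tarski_tr[OF p])
  obtain u where "gdL u" "off (set zl) v0 u" "tr p u ?\<Theta>" using tq.S_Exs[OF wf\<Theta> z(3) v0] t by blast
  then show thesis using that[OF dist zl'(1)[symmetric] z(2,3,6,7)] by blast
qed

end

context imag_class begin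

text \<open>Once the signature \<sigma> of the \<open>B\<close>-variables in \<open>X\<close> is
  fixed, the fibre at a point is described by finitely many \<open>L\<close>-formulas, one for each
  signature \<tau> of the \<open>B\<close>-variables in \<open>Y\<close>.\<close>

lemma PE_PP:
  assumes \<Phi>: "\<And>\<sigma>. wf_fm L (\<Phi> \<sigma>)" "\<And>v p. gdB v \<Longrightarrow> p \<in> \<Omega> \<Longrightarrow> C p v \<in> s \<longleftrightarrow> tr p (v \<circ> lvar) (\<Phi> (sg (X \<union> Y) p v))"
    and q: "q \<in> \<Omega>" and v: "gdB v1" "gdB v2" "sg X q v1 = \<sigma>" "sg X q v2 = \<sigma>"
    and yl: "set yl = lvar -` Y" and \<Phi>s: "set \<Phi>s = (\<lambda>\<tau>. \<Phi> (\<sigma> \<union> \<tau>)) ` Pow {b\<in>Y. fst b = BSort}"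
  shows "PE q v1 v2 \<longleftrightarrow> tarski.PP L U (tr q) yl \<Phi>s (v1 \<circ> lvar) (v2 \<circ> lvar)"
proof -
  interpret tq: tarski L U "tr q" "eqv q" by (rule tarski_tr[OF q])
  have key: "C q (override_on v w Y) \<in> s \<longleftrightarrow> tr q (override_on (v \<circ> lvar) (w \<circ> lvar) (set yl)) (\<Phi> (\<sigma> \<union> sg Y q w))"
    if "gdB v" "gdB w" "sg X q v = \<sigma>" for v w
  proof -
    have 1: "override_on v w Y \<circ> lvar = override_on (v \<circ> lvar) (w \<circ> lvar) (set yl)"
      unfolding yl by (rule ext) (simp add: override_on_def)
    have "sg (X \<union> Y) q (override_on v w Y) = sg X q v \<union> sg Y q w"
      using XY(1) unfolding sg_def override_on_def by auto
    then have 2: "sg (X \<union> Y) q (override_on v w Y) = \<sigma> \<union> sg Y q w" using that(3) by simp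
    show ?thesis using \<Phi>(2)[OF gd_override[OF that(1,2)] q, of Y] unfolding 1 2 .
  qed
  show ?thesis
  proof
    assume PE: "PE q v1 v2"
    show "tq.PP yl \<Phi>s (v1 \<circ> lvar) (v2 \<circ> lvar)" unfolding tq.PP_def
    proof (intro ballI allI impI)
      fix \<phi> u assume \<phi>: "\<phi> \<in> set \<Phi>s" and u: "gdL u"
      then obtain \<tau> where \<tau>: "\<tau> \<subseteq> {b\<in>Y. fst b = BSort}" "\<phi> = \<Phi> (\<sigma> \<union> \<tau>)" unfolding \<Phi>s by blast
      \<comment> \<open>The constants \<open>b1\<close> and \<open>b0\<close> as values of the
        \<open>B\<close>-variables realise the signature \<tau> at every point.\<close>
      let ?w = "mkv u (\<lambda>i. if bvar i \<in> \<tau> then b1 else b0)"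
      have w: "gdB ?w" by (rule gdB_mkv[OF u]) (simp add: ba.zero_in ba.one_in)
      have "?w b \<in> q \<longleftrightarrow> b \<in> \<tau>" if "fst b = BSort" for b
      proof -
        have b: "b = bvar (snd b)" by (rule BSort_bvar[OF that])
        have "?w (bvar (snd b)) \<in> q \<longleftrightarrow> bvar (snd b) \<in> \<tau>" using point_mem(1,2)[OF q] by simp
        then show ?thesis unfolding b[symmetric] .
      qed
      then have "sg Y q ?w = \<tau>" using \<tau>(1) unfolding sg_def by blast
      then have "C q (override_on v ?w Y) \<in> s \<longleftrightarrow> tr q (override_on (v \<circ> lvar) u (set yl)) \<phi>" if "gdB v" "sg X q v = \<sigma>" for v
        using key[OF that(1) w that(2)] \<tau>(2) by simp
      moreover have "C q (override_on v1 ?w Y) \<in> s \<longleftrightarrow> C q (override_on v2 ?w Y) \<in> s"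
        by (rule PE[unfolded PE_def, rule_format, OF w])
      ultimately show "tr q (override_on (v1 \<circ> lvar) u (set yl)) \<phi> \<longleftrightarrow> tr q (override_on (v2 \<circ> lvar) u (set yl)) \<phi>"
        using v by blast
    qed
  next
    assume PP: "tq.PP yl \<Phi>s (v1 \<circ> lvar) (v2 \<circ> lvar)"
    show "PE q v1 v2" unfolding PE_def
    proof (intro allI impI)
      fix w assume w: "gdB w"
      have "sg Y q w \<in> Pow {b\<in>Y. fst b = BSort}" unfolding sg_def by blast
      then have "\<Phi> (\<sigma> \<union> sg Y q w) \<in> set \<Phi>s" unfolding \<Phi>s by (rule imageI)
      then show "C q (override_on v1 w Y) \<in> s \<longleftrightarrow> C q (override_on v2 w Y) \<in> s"
        unfolding key[OF v(1) w v(3)] key[OF v(2) w v(4)]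
        by (rule PP[unfolded tq.PP_def, rule_format, OF _ gdB_gdL[OF w]])
    qed
  qed
qed

text \<open>The signature of the \<open>B\<close>-variables in \<open>X\<close> at \<open>p\<close>
  is frozen, which reduces the fibres to an equivalence relation definable in the stalk. Its code is
  described by the formula \<open>theta\<close>, and a formula can be asserted at any point: hence
  the last three properties hold at all \<open>q\<close>, although the formula was found at
  \<open>p\<close>.\<close>

lemma local_code:
  fixes \<iota> :: "('s, 'f, 'r) fm \<Rightarrow> 'u"
  assumes \<iota>: "inj \<iota>" and EI: "elim_imaginaries ty L T" and p: "p \<in> \<Omega>" and v0: "gdB v0" and W: "finite W"
  obtains Z H where "finite Z" "Z \<subseteq> range lvar" "Z \<inter> (W \<union> X \<union> Y) = {}" "fst ` Z \<subseteq> sorts BL" "loc (X \<union> Z) H"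
    "\<exists>w. gdB w \<and> off Z v0 w \<and> H p w"
    "\<And>q w w'. q \<in> \<Omega> \<Longrightarrow> gdB w \<Longrightarrow> gdB w' \<Longrightarrow> \<forall>z\<in>Z. w z = w' z \<Longrightarrow> H q w \<Longrightarrow> H q w' \<Longrightarrow> PE q w w'"
    "\<And>q w w'. q \<in> \<Omega> \<Longrightarrow> gdB w \<Longrightarrow> gdB w' \<Longrightarrow> H q w \<Longrightarrow> H q w' \<Longrightarrow> PE q w w' \<Longrightarrow> agr Z q w w'"
    "\<And>q w w'. \<forall>z\<in>Z. w z = w' z \<Longrightarrow> PE q w w' \<Longrightarrow> H q w \<Longrightarrow> H q w'"
proof -
  obtain \<Phi> where \<Phi>: "\<And>\<sigma>. wf_fm L (\<Phi> \<sigma>)" "\<And>\<sigma>. lvar ` fv (\<Phi> \<sigma>) \<subseteq> X \<union> Y"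
    "\<And>v p. gdB v \<Longrightarrow> p \<in> \<Omega> \<Longrightarrow> C p v \<in> s \<longleftrightarrow> tr p (v \<circ> lvar) (\<Phi> (sg (X \<union> Y) p v))"
    using loc_s by (rule locE) blast
  let ?\<sigma> = "sg X p v0"
  obtain xl where xl: "set xl = lvar -` X" "distinct xl"
    using finite_distinct_list[OF finite_lvar_vimage[OF finXY(2)]] by blast
  obtain yl where yl: "set yl = lvar -` Y" using finite_list[OF finite_lvar_vimage[OF finXY(3)]] by blast
  have "finite ((\<lambda>\<tau>. \<Phi> (?\<sigma> \<union> \<tau>)) ` Pow {b\<in>Y. fst b = BSort})" by simp
  then obtain \<Phi>s where \<Phi>s: "set \<Phi>s = (\<lambda>\<tau>. \<Phi> (?\<sigma> \<union> \<tau>)) ` Pow {b\<in>Y. fst b = BSort}" using finite_list by blast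
  have "finite (set xl \<union> set yl \<union> lvar -` W)" using finite_lvar_vimage[OF W] by simp
  from fresh_vars[OF this, of "map fst xl"] obtain xl' where xl': "map fst xl' = map fst xl" "distinct xl'" "set xl' \<inter> (set xl \<union> set yl \<union> lvar -` W) = {}"
    by (elim exE conjE)
  have sX: "fst ` set xl \<subseteq> sorts L"
  proof
    fix t assume "t \<in> fst ` set xl"
    then obtain x where x: "t = fst x" "lvar x \<in> X" using xl(1) by blast
    then have "fst (lvar x) \<in> sorts BL" using XY(5) by blast
    then show "t \<in> sorts L" using x(1) by simp
  qed
  have sY: "fst ` set yl \<subseteq> sorts L"
  proof
    fix t assume "t \<in> fst ` set yl"
    then obtain x where x: "t = fst x" "lvar x \<in> Y" using yl by blast
    then have "fst (lvar x) \<in> sorts BL" using XY(6) by blast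
    then show "t \<in> sorts L" using x(1) by simp
  qed
  have dj: "set xl \<inter> set xl' = {}" "set xl \<inter> set yl = {}" "set xl' \<inter> set yl = {}"
    using xl'(3) xl(1) yl XY(1) by blast+
  have f\<Phi>: "wf_fm L \<phi> \<and> fv \<phi> \<subseteq> set xl \<union> set yl" if \<phi>: "\<phi> \<in> set \<Phi>s" for \<phi>
  proof -
    obtain \<tau> where \<tau>: "\<phi> = \<Phi> \<tau>" using \<phi> unfolding \<Phi>s by blast
    show ?thesis unfolding \<tau> xl(1) yl using \<Phi>(1) \<Phi>(2)[of \<tau>] by blast
  qed
  let ?W = "set xl \<union> set xl' \<union> set yl \<union> lvar -` W"
  have W': "finite ?W" "set xl \<subseteq> ?W" "set xl' \<subseteq> ?W" using finite_lvar_vimage[OF W] by auto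
  let ?\<psi> = "psi xl xl' yl \<Phi>s"
  obtain zl zl' \<chi> u0 where z: "distinct (xl @ zl @ xl' @ zl')" "map fst zl = map fst zl'" "set zl \<inter> ?W = {}" "fst ` set zl \<subseteq> sorts L"
    "wf_fm L \<chi>" "fv \<chi> \<subseteq> set xl \<union> set zl" "gdL u0" "off (set zl) (v0 \<circ> lvar) u0" "tr p u0 (theta xl xl' zl zl' ?\<psi> \<chi>)"
    by (rule theta_exists[OF \<iota> EI p gdB_gdL[OF v0] xl'(1)[symmetric] xl(2) xl'(2) sX sY dj f\<Phi> W'])
  let ?\<Theta> = "theta xl xl' zl zl' ?\<psi> \<chi>"
  have wf: "wf_fm L ?\<psi>" by (rule wf_psi[OF xl'(1)[symmetric] sX sY]) (use f\<Phi> in blast)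
  have fv: "fv ?\<psi> \<subseteq> set xl \<union> set xl'" by (rule fv_psi) (use f\<Phi> in blast)
  have wf\<Theta>: "wf_fm L ?\<Theta>" by (rule wf_theta[OF xl'(1)[symmetric] sX z(2,4) wf z(5)])
  have fv\<Theta>: "fv ?\<Theta> \<subseteq> set xl \<union> set zl" by (rule fv_theta[OF z(6) fv])
  define Z where "Z = lvar ` set zl"
  have finZ: "finite Z" unfolding Z_def by simp
  have djZ: "Z \<inter> (W \<union> X \<union> Y) = {}" unfolding Z_def using z(3) xl(1) yl by blast
  have sZ: "fst ` Z \<subseteq> sorts BL" unfolding Z_def using z(4) by auto
  have lv\<Theta>: "lvar ` fv ?\<Theta> \<subseteq> X \<union> Z" unfolding Z_def using fv\<Theta> xl(1) by blast
  define H where "H q w \<longleftrightarrow> (\<exists>u. gdB u \<and> (\<forall>z\<in>Z. u z = w z) \<and> PE q w u \<and> sg X q u = ?\<sigma> \<and> tr q (u \<circ> lvar) ?\<Theta>)" for q w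
  have locH: "loc (X \<union> Z) H" unfolding H_def
    by (rule loc_code[OF wf\<Theta> lv\<Theta> finZ _ sZ]) (use djZ in blast)
  have PEPP: "PE q u u' \<longleftrightarrow> tarski.PP L U (tr q) yl \<Phi>s (u \<circ> lvar) (u' \<circ> lvar)"
    if "q \<in> \<Omega>" "gdB u" "gdB u'" "sg X q u = ?\<sigma>" "sg X q u' = ?\<sigma>" for q u u'
    by (rule PE_PP[OF \<Phi>(1,3) that yl \<Phi>s])
  have \<Theta>: "tr q v \<chi>"
    "\<And>v'. gdL v' \<Longrightarrow> tr q v' \<chi> \<Longrightarrow> tarski.PP L U (tr q) yl \<Phi>s v v' \<Longrightarrow> x \<in> set zl \<Longrightarrow> eqv q (fst x) (v x) (v' x)"
    "\<And>v'. gdL v' \<Longrightarrow> map v' zl = map v zl \<Longrightarrow> tr q v' \<chi> \<Longrightarrow> tarski.PP L U (tr q) yl \<Phi>s v v'"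
    if q: "q \<in> \<Omega>" and v: "gdL v" "tr q v ?\<Theta>" for q v x
  proof -
    interpret tq: tarski L U "tr q" "eqv q" by (rule tarski_tr[OF q])
    have "tr q v ?\<Theta> \<longleftrightarrow> tr q v \<chi> \<and>
      (\<forall>v'. gdL v' \<longrightarrow> tr q v' \<chi> \<longrightarrow> tq.PP yl \<Phi>s v v' \<longrightarrow> (\<forall>z\<in>set zl. eqv q (fst z) (v z) (v' z))) \<and>
      (\<forall>v'. gdL v' \<longrightarrow> map v' zl = map v zl \<longrightarrow> tr q v' \<chi> \<longrightarrow> tq.PP yl \<Phi>s v v')"
    proof (rule tq.S_theta[OF xl'(1)[symmetric] sX z(2,4,1,5,6) wf fv _ v(1)])
      fix u u1 u2 assume g: "gdL u" "gdL u1" "gdL u2" "map u xl = map u1 xl" "map u xl' = map u2 xl"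
      show "tr q u ?\<psi> \<longleftrightarrow> tq.PP yl \<Phi>s u1 u2" by (rule tq.S_psi[OF xl'(1)[symmetric] xl(2) sX sY dj f\<Phi> g])
    qed
    then show "tr q v \<chi>"
      "\<And>v'. gdL v' \<Longrightarrow> tr q v' \<chi> \<Longrightarrow> tq.PP yl \<Phi>s v v' \<Longrightarrow> x \<in> set zl \<Longrightarrow> eqv q (fst x) (v x) (v' x)"
      "\<And>v'. gdL v' \<Longrightarrow> map v' zl = map v zl \<Longrightarrow> tr q v' \<chi> \<Longrightarrow> tq.PP yl \<Phi>s v v'" using v(2) by simp_all
  qed
  have e: "\<exists>w. gdB w \<and> off Z v0 w \<and> H p w"
  proof -
    let ?\<beta> = "\<lambda>i. v0 (bvar i)"
    let ?w = "mkv u0 ?\<beta>"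
    have "?\<beta> i \<in> BB" for i using gd_in[OF v0, of "bvar i" BSort] by simp
    then have w: "gdB ?w" by (rule gdB_mkv[OF z(7)])
    have off: "off Z v0 ?w" unfolding off_def
    proof (intro allI impI)
      fix x :: "'s bsort var" assume x: "x \<notin> Z"
      show "?w x = v0 x"
      proof (cases x rule: bvar_cases)
        case (L y)
        then have "y \<notin> set zl" using x unfolding Z_def by blast
        then have "u0 y = (v0 \<circ> lvar) y" by (rule off_apply[OF z(8)])
        then show ?thesis unfolding L by simp
      next
        case B
        have "?w (bvar (snd x)) = v0 (bvar (snd x))" by simp
        then show ?thesis unfolding BSort_bvar[OF B, symmetric] .
      qed
    qed
    have "sg X p ?w = ?\<sigma>"
    proof -
      have "?w x = v0 x" if "x \<in> X" for x by (rule off_apply[OF off]) (use that djZ in blast)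
      then show ?thesis unfolding sg_def by auto
    qed
    then have "H p ?w" unfolding H_def using w PE_refl z(9) by (intro exI[of _ ?w]) simp
    then show ?thesis using w off by blast
  qed
  have f: "PE q w w'" if q: "q \<in> \<Omega>" and w: "gdB w" "gdB w'" "\<forall>z\<in>Z. w z = w' z" "H q w" "H q w'" for q w w'
  proof -
    obtain u where u: "gdB u" "\<forall>z\<in>Z. u z = w z" "PE q w u" "sg X q u = ?\<sigma>" "tr q (u \<circ> lvar) ?\<Theta>"
      using w(4) unfolding H_def by (elim exE conjE)
    obtain u' where u': "gdB u'" "\<forall>z\<in>Z. u' z = w' z" "PE q w' u'" "sg X q u' = ?\<sigma>" "tr q (u' \<circ> lvar) ?\<Theta>"
      using w(5) unfolding H_def by (elim exE conjE)
    have "map (u' \<circ> lvar) zl = map (u \<circ> lvar) zl" using w(3) u(2) u'(2) unfolding Z_def by simp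
    then have "tarski.PP L U (tr q) yl \<Phi>s (u \<circ> lvar) (u' \<circ> lvar)"
      by (rule \<Theta>(3)[OF q gdB_gdL[OF u(1)] u(5) gdB_gdL[OF u'(1)] _ \<Theta>(1)[OF q gdB_gdL[OF u'(1)] u'(5)]])
    then have "PE q u u'" unfolding PEPP[OF q u(1) u'(1) u(4) u'(4)] .
    then show ?thesis using PE_trans[OF PE_trans[OF u(3)] PE_sym[OF u'(3)]] by blast
  qed
  have g: "agr Z q w w'" if q: "q \<in> \<Omega>" and w: "gdB w" "gdB w'" "H q w" "H q w'" "PE q w w'" for q w w'
  proof -
    obtain u where u: "gdB u" "\<forall>z\<in>Z. u z = w z" "PE q w u" "sg X q u = ?\<sigma>" "tr q (u \<circ> lvar) ?\<Theta>"
      using w(3) unfolding H_def by (elim exE conjE)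
    obtain u' where u': "gdB u'" "\<forall>z\<in>Z. u' z = w' z" "PE q w' u'" "sg X q u' = ?\<sigma>" "tr q (u' \<circ> lvar) ?\<Theta>"
      using w(4) unfolding H_def by (elim exE conjE)
    have "PE q u u'" using PE_trans[OF PE_trans[OF PE_sym[OF u(3)] w(5)] u'(3)] .
    then have PP: "tarski.PP L U (tr q) yl \<Phi>s (u \<circ> lvar) (u' \<circ> lvar)" unfolding PEPP[OF q u(1) u'(1) u(4) u'(4)] .
    show ?thesis unfolding agr_def
    proof (intro ballI impI)
      fix x assume "x \<in> Z"
      then obtain y where y: "x = lvar y" "y \<in> set zl" unfolding Z_def by blast
      have "eqv q (fst y) ((u \<circ> lvar) y) ((u' \<circ> lvar) y)"
        by (rule \<Theta>(2)[OF q gdB_gdL[OF u(1)] u(5) gdB_gdL[OF u'(1)] \<Theta>(1)[OF q gdB_gdL[OF u'(1)] u'(5)] PP y(2)])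
      moreover have "u x = w x" "u' x = w' x" using u(2) u'(2) \<open>x \<in> Z\<close> by blast+
      ultimately show "case fst x of LSort s \<Rightarrow> eqv q s (w x) (w' x) | BSort \<Rightarrow> w x \<in> q \<longleftrightarrow> w' x \<in> q"
        using y(1) by simp
    qed
  qed
  have h: "H q w'" if w: "\<forall>z\<in>Z. w z = w' z" "PE q w w'" "H q w" for q w w'
  proof -
    obtain u where u: "gdB u" "\<forall>z\<in>Z. u z = w z" "PE q w u" "sg X q u = ?\<sigma>" "tr q (u \<circ> lvar) ?\<Theta>"
      using w(3) unfolding H_def by (elim exE conjE)
    have "PE q w' u" by (rule PE_trans[OF PE_sym[OF w(2)] u(3)])
    moreover have "\<forall>z\<in>Z. u z = w' z" using u(2) w(1) by simp
    ultimately show ?thesis unfolding H_def using u(1,4,5) by blast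
  qed
  show thesis by (rule that[OF finZ _ djZ sZ locH e f g h]) (simp_all add: Z_def image_subset_iff)
qed

end

section \<open>Global codes\<close>

text \<open>\<rho> exchanges \<open>Z\<close> with a copy of it beyond all numbers in use. Being its
  own inverse, it translates assignments in both directions.\<close>

lemma shift_involution:
  fixes Z W :: "'s var set"
  assumes "finite Z" "finite W"
  shows "\<exists>\<rho>. (\<forall>x. fst (\<rho> x) = fst x) \<and> (\<forall>x. \<rho> (\<rho> x) = x) \<and> \<rho> ` Z \<inter> W = {} \<and> (\<forall>x\<in>W - Z. \<rho> x = x)"
proof -
  have "finite (snd ` (Z \<union> W))" using assms by simp
  then obtain m where m: "\<And>n. n \<in> snd ` (Z \<union> W) \<Longrightarrow> n < m" by (meson finite_nat_set_iff_bounded)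
  have mZ: "n < m" if "(t, n) \<in> Z \<union> W" for t n using m[of n] that by force
  define \<rho> :: "'s var \<Rightarrow> 's var" where
    "\<rho> x = (if x \<in> Z then (fst x, snd x + m) else if m \<le> snd x \<and> (fst x, snd x - m) \<in> Z then (fst x, snd x - m) else x)" for x
  show ?thesis
  proof (intro exI[of _ \<rho>] conjI allI ballI)
    show "fst (\<rho> x) = fst x" for x by (simp add: \<rho>_def)
    show "\<rho> (\<rho> x) = x" for x
    proof (cases x)
      case (Pair t n)
      have "(t, k + m) \<notin> Z" for k using mZ[of t "k + m"] by auto
      then show ?thesis unfolding Pair \<rho>_def by auto
    qed
    show "\<rho> ` Z \<inter> W = {}"
    proof -
      have "(t, n + m) \<notin> W" for t n using mZ[of t "n + m"] by auto
      then show ?thesis unfolding \<rho>_def by auto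
    qed
    show "\<rho> x = x" if "x \<in> W - Z" for x
    proof (cases x)
      case (Pair t n)
      then have "n < m" using mZ[of t n] that by blast
      then show ?thesis using that Pair by (simp add: \<rho>_def)
    qed
  qed
qed

section \<open>Default values from definable elements\<close>

context bvmodel begin

text \<open>Existence and uniqueness of the definable element are valid formulas, so they hold at
  each point. At a point uniqueness is up to \<open>eqv\<close>, which is what \<open>agr\<close>
  expresses.\<close>

lemma defaults:
  assumes DE: "sort_has_definable_element ty L T s" and s: "s \<in> sorts L" and y: "fst y = s"
  obtains D where "loc {lvar y} D" "\<And>q v. q \<in> \<Omega> \<Longrightarrow> gdB v \<Longrightarrow> \<exists>a\<in>U s. D q (v(lvar y := a))"
    "\<And>q v v'. q \<in> \<Omega> \<Longrightarrow> gdB v \<Longrightarrow> gdB v' \<Longrightarrow> D q v \<Longrightarrow> D q v' \<Longrightarrow> agr {lvar y} q v v'"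
proof -
  from DE[unfolded sort_has_definable_element_def] obtain x \<phi> where x: "fst x = s" "fm_in L [x] \<phi>"
    "\<forall>N :: ('s, 'f, 'r, 'u) struct. is_model L T N \<longrightarrow> (\<exists>!a. a \<in> univ N s \<and> holds N [x] \<phi> [a])"
    by (elim exE conjE)
  have \<phi>: "wf_fm L \<phi>" "fv \<phi> \<subseteq> {x}" using x(2) by (simp_all add: fm_in_def)
  have h: "holds N [x] \<phi> [a] \<longleftrightarrow> sat N (\<nu>(x := a)) \<phi>" for N :: "('s, 'f, 'r, 'u) struct" and \<nu> a
    using holds_map[of \<phi> "[x]" N "\<nu>(x := a)"] \<phi>(2) by simp
  have wfs: "wf_fm L (sub [x] [z] \<phi>)" if "fst z = s" for z
    by (rule wf_sub) (use that x(1) s \<phi>(1) in simp_all)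
  have subS: "S v (sub [x] [z] \<phi>) \<longleftrightarrow> S (v(x := v z)) \<phi>"
    if "tarski L V S e" "gd L V v" "fst z = s" for V :: "'s \<Rightarrow> 'y set" and S e v z
  proof -
    interpret tarski L V S e by (rule that(1))
    have g: "gd L V (v(x := v z))" by (rule gd_upd[OF that(2)]) (use gd_in[OF that(2), of z s] that(3) x(1) s in simp)
    show ?thesis by (rule S_sub[OF that(2) g]) (use that(3) x(1) s \<phi> in simp_all)
  qed
  have "finite {x}" by simp
  then obtain z where z: "fst z = s" "z \<notin> {x}" by (rule fresh_var)
  have V1: "valid (Exists x \<phi>)"
  proof (rule validI)
    show "wf_fm L (Exists x \<phi>)" using \<phi>(1) x(1) s by simp
    fix N :: "('s, 'f, 'r, 'u) struct" and \<nu> assume N: "is_model L T N"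
    obtain a where "a \<in> univ N s" "holds N [x] \<phi> [a]" using x(3) N by blast
    then show "sat N \<nu> (Exists x \<phi>)" using x(1) h[of N a \<nu>] by auto
  qed
  have wf2: "wf_fm L (Imp (Conj \<phi> (sub [x] [z] \<phi>)) (Eq (Var x) (Var z)))"
    using \<phi>(1) wfs[OF z(1)] x(1) z(1) s by simp
  have V2: "valid (Imp (Conj \<phi> (sub [x] [z] \<phi>)) (Eq (Var x) (Var z)))"
  proof (rule validI[OF wf2])
    fix N :: "('s, 'f, 'r, 'u) struct" and \<nu> assume N: "is_struct L N" "is_model L T N" "gd L (univ N) \<nu>"
    have "sat N \<nu> (sub [x] [z] \<phi>) \<longleftrightarrow> sat N (\<nu>(x := \<nu> z)) \<phi>" by (rule subS[OF tarski_sat[OF N(1)] N(3) z(1)])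
    moreover have "\<nu> x \<in> univ N s" "\<nu> z \<in> univ N s" using gd_in[OF N(3)] x(1) z(1) s by blast+
    moreover have "\<nu>(x := \<nu> x) = \<nu>" by simp
    ultimately show "sat N \<nu> (Imp (Conj \<phi> (sub [x] [z] \<phi>)) (Eq (Var x) (Var z)))"
      using x(3) N(2) h[of N "\<nu> x" \<nu>] h[of N "\<nu> z" \<nu>] unfolding Imp_def by (auto simp del: fun_upd_triv)
  qed
  define D where "D q v \<longleftrightarrow> tr q (v \<circ> lvar) (sub [x] [y] \<phi>)" for q and v :: "'s bsort var \<Rightarrow> 'm"
  have Dx: "D q v \<longleftrightarrow> tr q ((w :: 's var \<Rightarrow> 'm)(x := v (lvar y))) \<phi>" if "q \<in> \<Omega>" "gdB v" for q v w
  proof -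
    have "D q v \<longleftrightarrow> tr q ((v \<circ> lvar)(x := (v \<circ> lvar) y)) \<phi>"
      unfolding D_def by (rule subS[OF tarski_tr[OF that(1)] gdB_gdL[OF that(2)] y])
    also have "\<dots> \<longleftrightarrow> tr q (w(x := v (lvar y))) \<phi>" by (rule tr_fv) (use \<phi>(2) in auto)
    finally show ?thesis .
  qed
  have "lvar ` fv (sub [x] [y] \<phi>) \<subseteq> {lvar y}" using fv_sub[of \<phi> "[x]" "[y]"] \<phi>(2) by auto
  then have 1: "loc {lvar y} D" unfolding D_def by (intro loc_tr wfs y) simp_all
  have 2: "\<exists>a\<in>U s. D q (v(lvar y := a))" if q: "q \<in> \<Omega>" and v: "gdB v" for q v
  proof -
    have xs: "fst x \<in> sorts L" using x(1) s by simp
    have "tr q (v \<circ> lvar) (Exists x \<phi>)" by (rule tr_valid[OF V1 gdB_gdL[OF v] q])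
    then obtain a where a: "a \<in> U s" "tr q ((v \<circ> lvar)(x := a)) \<phi>"
      unfolding tr_Exists[OF gdB_gdL[OF v] \<phi>(1) xs q] x(1) by blast
    have g: "gdB (v(lvar y := a))" by (rule gd_upd[OF v]) (use a(1) y in simp)
    have "D q (v(lvar y := a))" unfolding Dx[OF q g, of "v \<circ> lvar"] using a(2) by simp
    then show ?thesis using a(1) by blast
  qed
  have 3: "agr {lvar y} q v v'" if q: "q \<in> \<Omega>" and v: "gdB v" "gdB v'" "D q v" "D q v'" for q v v'
  proof -
    let ?a = "v (lvar y)" and ?a' = "v' (lvar y)"
    let ?u = "(v \<circ> lvar)(x := ?a, z := ?a')"
    have aU: "?a \<in> U s" "?a' \<in> U s" using gd_in[OF v(1), of "lvar y"] gd_in[OF v(2), of "lvar y"] y s by simp_all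
    have u: "gdL ?u" by (intro gd_upd gdB_gdL[OF v(1)]) (use aU x(1) z(1) in simp_all)
    have "tr q ((v \<circ> lvar)(x := ?a)) \<phi>" using v(3) unfolding Dx[OF q v(1), of "v \<circ> lvar"] .
    moreover have "tr q ((v \<circ> lvar)(x := ?a)) \<phi> = tr q ?u \<phi>" by (rule tr_fv) (use \<phi>(2) z(2) in auto)
    ultimately have t1: "tr q ?u \<phi>" by (rule iffD1[rotated])
    have "tr q (?u(x := ?a')) \<phi>" by (rule iffD1[OF Dx[OF q v(2)] v(4)])
    moreover have "?u z = ?a'" by simp
    ultimately have "tr q (?u(x := ?u z)) \<phi>" by (simp only:)
    then have t2: "tr q ?u (sub [x] [z] \<phi>)" by (rule iffD2[OF subS[OF tarski_tr[OF q] u z(1)]])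
    have xz: "fst x = fst z" "fst x \<in> sorts L" using x(1) z(1) s by simp_all
    have "tr q ?u (Eq (Var x) (Var z))"
    proof -
      have "wf_fm L (Conj \<phi> (sub [x] [z] \<phi>))" "wf_fm L (Eq (Var x) (Var z))" using \<phi>(1) wfs[OF z(1)] xz by simp_all
      from tr_Imp[OF u q this] tr_Conj[OF u q \<phi>(1) wfs[OF z(1)]] tr_valid[OF V2 u q] t1 t2 show ?thesis by blast
    qed
    then have "eqv q (fst x) (?u x) (?u z)" unfolding tr_Eq[OF u q xz] .
    moreover have "?u x = ?a" "?u z = ?a'" using z(2) by simp_all
    ultimately have "eqv q s ?a ?a'" using x(1) by (simp only:)
    then show ?thesis unfolding agr_def using y by simp
  qed
  show thesis by (rule that[OF 1 2 3])
qed

end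

locale coding = imag_class ty L T M xs ys E C F \<E> s
  for ty :: "'u itself" and L :: "('s, 'f, 'r) lang" and T :: "('s, 'f, 'r) fm set"
    and M :: "('s bsort, ('s, 'f, 'r) bfun, unit, 'm) struct"
    and xs ys E C F \<E> s +
  fixes \<iota> :: "('s, 'f, 'r) fm \<Rightarrow> 'u" and v0 :: "'s bsort var \<Rightarrow> 'm"
  assumes \<iota>: "inj \<iota>" and EI: "elim_imaginaries ty L T"
    and DE: "\<forall>s\<in>sorts L. sort_has_definable_element ty L T s" and v0: "gdB v0"
begin

text \<open>The variables \<open>Z\<close>, with values \<open>w0\<close>, code \<open>PE p v0\<close> for all points \<open>p\<close> in \<open>u\<close>.\<close>

definition code :: "'m \<Rightarrow> 's bsort var set \<Rightarrow> ('m set \<Rightarrow> ('s bsort var \<Rightarrow> 'm) \<Rightarrow> bool) \<Rightarrow> ('s bsort var \<Rightarrow> 'm) \<Rightarrow> bool" where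
  "code u Z G w0 \<longleftrightarrow> finite Z \<and> Z \<inter> (X \<union> Y) = {} \<and> fst ` Z \<subseteq> sorts BL \<and> loc (X \<union> Z) G \<and>
    gdB w0 \<and> off Z v0 w0 \<and> (\<forall>p\<in>\<Omega>. G p w0) \<and>
    (\<forall>w. gdB w \<longrightarrow> (\<forall>p\<in>\<Omega>. G p w) \<longrightarrow> (\<forall>z\<in>Z. w z = w0 z) \<longrightarrow> (\<forall>p\<in>\<Omega>. u \<in> p \<longrightarrow> PE p w w0)) \<and>
    (\<forall>w w'. gdB w \<longrightarrow> gdB w' \<longrightarrow> (\<forall>p\<in>\<Omega>. G p w) \<longrightarrow> (\<forall>p\<in>\<Omega>. G p w') \<longrightarrow> (\<forall>p\<in>\<Omega>. PE p w w') \<longrightarrow> (\<forall>z\<in>Z. w z = w' z))"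

lemma codeD:
  assumes "code u Z G w0"
  shows "finite Z" "Z \<inter> (X \<union> Y) = {}" "fst ` Z \<subseteq> sorts BL" "loc (X \<union> Z) G" "gdB w0" "off Z v0 w0" "p \<in> \<Omega> \<Longrightarrow> G p w0"
    "gdB w \<Longrightarrow> (\<And>p. p \<in> \<Omega> \<Longrightarrow> G p w) \<Longrightarrow> (\<And>z. z \<in> Z \<Longrightarrow> w z = w0 z) \<Longrightarrow> p \<in> \<Omega> \<Longrightarrow> u \<in> p \<Longrightarrow> PE p w w0"
    "gdB w \<Longrightarrow> gdB w' \<Longrightarrow> (\<And>p. p \<in> \<Omega> \<Longrightarrow> G p w) \<Longrightarrow> (\<And>p. p \<in> \<Omega> \<Longrightarrow> G p w') \<Longrightarrow> (\<And>p. p \<in> \<Omega> \<Longrightarrow> PE p w w') \<Longrightarrow> z \<in> Z \<Longrightarrow> w z = w' z"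
  using assms unfolding code_def by simp_all

lemma codeI:
  assumes "finite Z" "Z \<inter> (X \<union> Y) = {}" "fst ` Z \<subseteq> sorts BL" "loc (X \<union> Z) G" "gdB w0" "off Z v0 w0" "\<And>p. p \<in> \<Omega> \<Longrightarrow> G p w0"
    "\<And>w p. gdB w \<Longrightarrow> (\<And>p. p \<in> \<Omega> \<Longrightarrow> G p w) \<Longrightarrow> (\<And>z. z \<in> Z \<Longrightarrow> w z = w0 z) \<Longrightarrow> p \<in> \<Omega> \<Longrightarrow> u \<in> p \<Longrightarrow> PE p w w0"
    "\<And>w w' z. gdB w \<Longrightarrow> gdB w' \<Longrightarrow> (\<And>p. p \<in> \<Omega> \<Longrightarrow> G p w) \<Longrightarrow> (\<And>p. p \<in> \<Omega> \<Longrightarrow> G p w') \<Longrightarrow> (\<And>p. p \<in> \<Omega> \<Longrightarrow> PE p w w') \<Longrightarrow> z \<in> Z \<Longrightarrow> w z = w' z"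
  shows "code u Z G w0"
  using assms unfolding code_def by simp

lemma code_zero: "code b0 {} (\<lambda>p v. True) v0"
  by (rule codeI) (simp_all add: v0 loc_True)

lemma code_down: assumes "code u Z G w0" "\<And>p. p \<in> \<Omega> \<Longrightarrow> u' \<in> p \<Longrightarrow> u \<in> p" shows "code u' Z G w0"
  by (rule codeI[OF codeD(1-7)[OF assms(1)]], assumption, rule codeD(8)[OF assms(1)], (assumption | rule assms(2))+, rule codeD(9)[OF assms(1)])

lemma code_rename:
  assumes c: "code u Z G w0" and W: "finite W"
  obtains Z' G' w0' where "code u Z' G' w0'" "Z' \<inter> W = {}"
proof -
  note c = codeD[OF c]
  have "finite (W \<union> X \<union> Y)" using W by simp
  from shift_involution[OF c(1) this] obtain \<rho> :: "'s bsort var \<Rightarrow> 's bsort var" where r: "\<forall>x. fst (\<rho> x) = fst x" "\<forall>x. \<rho> (\<rho> x) = x"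
    and \<rho>3: "\<rho> ` Z \<inter> (W \<union> X \<union> Y) = {}" and r4: "\<forall>x\<in>W \<union> X \<union> Y - Z. \<rho> x = x"
    by (elim exE conjE)
  note \<rho> = r[rule_format] \<rho>3
  have \<rho>X: "\<rho> x = x" if "x \<in> X" for x by (rule bspec[OF r4]) (use that c(2) in blast)
  let ?Z = "\<rho> ` Z"
  let ?G = "\<lambda>p v. G p (v \<circ> \<rho>)"
  \<comment> \<open>\<open>w0 \<circ> \<rho>\<close> may differ from \<open>v0\<close> on variables
    outside the new ones, so only the new variables take their values from it.\<close>
  let ?w = "override_on v0 (w0 \<circ> \<rho>) ?Z"
  have g: "gdB (v \<circ> \<rho>)" if "gdB v" for v
    unfolding gd_def
  proof (intro allI impI)
    fix x :: "'s bsort var" assume "fst x \<in> sorts BL"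
    then show "(v \<circ> \<rho>) x \<in> univ M (fst x)" using gd_in[OF that, of "\<rho> x" "fst x"] \<rho>(1) by simp
  qed
  have gw: "gdB ?w" by (rule gd_override[OF v0 g[OF c(5)]])
  have wX: "?w x = w0 x" if "x \<in> X" for x
  proof -
    have "x \<notin> ?Z" "x \<notin> Z" using that \<rho>(3) c(2) by blast+
    then show ?thesis using off_apply[OF c(6)] by (simp add: override_on_def)
  qed
  have w\<rho>: "(?w \<circ> \<rho>) x = w0 x" if "x \<in> X \<union> Z" for x
  proof (cases "x \<in> X")
    case True then show ?thesis using wX \<rho>X by simp
  next
    case False
    then have "\<rho> x \<in> ?Z" using that by blast
    then show ?thesis using \<rho>(2) by (simp add: override_on_def)
  qed
  have PE\<rho>: "PE p v (v \<circ> \<rho>)" if "gdB v" "p \<in> \<Omega>" for v p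
    by (rule PE_cong[OF that(1) g[OF that(1)] that(2)]) (simp add: \<rho>X)
  have "code u ?Z ?G ?w"
  proof (rule codeI)
    show "finite ?Z" using c(1) by simp
    show "?Z \<inter> (X \<union> Y) = {}" using \<rho>(3) by blast
    show "fst ` ?Z \<subseteq> sorts BL" using c(3) \<rho>(1) by (simp add: image_subset_iff)
    have "\<rho> ` (X \<union> Z) = X \<union> ?Z" using \<rho>X by (simp add: image_Un)
    then show "loc (X \<union> ?Z) ?G" using loc_rename[of "X \<union> Z" G \<rho>, OF c(4) \<rho>(1)] by simp
    show "gdB ?w" by (rule gw)
    show "off ?Z v0 ?w" by (rule off_override)
    show "?G p ?w" if "p \<in> \<Omega>" for p
      by (rule iffD2[OF loc_eq[OF c(4) g[OF gw] c(5) that w\<rho>] c(7)[OF that]])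
    show "PE p w ?w" if w: "gdB w" "\<And>p. p \<in> \<Omega> \<Longrightarrow> ?G p w" "\<And>z. z \<in> ?Z \<Longrightarrow> w z = ?w z" and p: "p \<in> \<Omega>" "u \<in> p" for w p
    proof -
      have "PE p (w \<circ> \<rho>) w0"
      proof (rule c(8)[OF g[OF w(1)] _ _ p])
        show "G p (w \<circ> \<rho>)" if "p \<in> \<Omega>" for p by (rule w(2)[OF that])
        show "(w \<circ> \<rho>) z = w0 z" if z: "z \<in> Z" for z
        proof -
          have "(w \<circ> \<rho>) z = (?w \<circ> \<rho>) z" using w(3)[OF imageI[OF z, of \<rho>]] by (simp only: comp_apply)
          then show ?thesis using w\<rho>[of z] z by (simp only: UnI2)
        qed
      qed
      then have "PE p w w0" by (rule PE_trans[OF PE\<rho>[OF w(1) p(1)]])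
      then show ?thesis by (rule PE_trans) (rule PE_cong[OF c(5) gw p(1)], simp only: wX)
    qed
    show "w z = w' z" if w: "gdB w" "gdB w'" "\<And>p. p \<in> \<Omega> \<Longrightarrow> ?G p w" "\<And>p. p \<in> \<Omega> \<Longrightarrow> ?G p w'" "\<And>p. p \<in> \<Omega> \<Longrightarrow> PE p w w'"
      and z: "z \<in> ?Z" for w w' z
    proof -
      obtain z1 where z1: "z = \<rho> z1" "z1 \<in> Z" using z by blast
      have "(w \<circ> \<rho>) z1 = (w' \<circ> \<rho>) z1"
      proof (rule c(9)[OF g[OF w(1)] g[OF w(2)] _ _ _ z1(2)])
        show "G p (w \<circ> \<rho>)" if "p \<in> \<Omega>" for p by (rule w(3)[OF that])
        show "G p (w' \<circ> \<rho>)" if "p \<in> \<Omega>" for p by (rule w(4)[OF that])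
        show "PE p (w \<circ> \<rho>) (w' \<circ> \<rho>)" if "p \<in> \<Omega>" for p
          by (rule PE_trans[OF PE_trans[OF PE_sym[OF PE\<rho>[OF w(1) that]] w(5)[OF that]] PE\<rho>[OF w(2) that]])
      qed
      then show ?thesis using z1(1) by simp
    qed
  qed
  moreover have "?Z \<inter> W = {}" using \<rho>(3) by blast
  ultimately show thesis by (rule that)
qed

text \<open>Concatenation of codes: at a point of the join at least one component determines the
  fibre, and conversely both components are determined by the family of fibres. Disjointness of
  \<open>Z1\<close> and \<open>Z2\<close> allows both values to be present in one
  assignment.\<close>

lemma code_join:
  assumes c1: "code u1 Z1 G1 w1" and c2: "code u2 Z2 G2 w2" and dj: "Z2 \<inter> Z1 = {}"
    and u: "u1 \<in> BB" "u2 \<in> BB"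
  shows "code (bjn u1 u2) (Z1 \<union> Z2) (\<lambda>p v. G1 p v \<and> G2 p v) (override_on w1 w2 Z2)"
proof -
  note c = codeD[OF c1] note e = codeD[OF c2]
  let ?w = "override_on w1 w2 Z2"
  have g: "gdB ?w" by (rule gd_override[OF c(5) e(5)])
  have 1: "?w x = w1 x" if "x \<in> X \<union> Z1" for x
    using that dj e(2) by (auto simp: override_on_def)
  have 2: "?w x = w2 x" if "x \<in> X \<union> Z2" for x
  proof (cases "x \<in> Z2")
    case False
    then have "x \<in> X" "x \<notin> Z1" using that c(2) by blast+
    then show ?thesis using False off_apply[OF c(6), of x] off_apply[OF e(6), of x] by (simp add: override_on_def)
  qed (simp add: override_on_def)
  show ?thesis
  proof (rule codeI)
    show "finite (Z1 \<union> Z2)" "(Z1 \<union> Z2) \<inter> (X \<union> Y) = {}" "fst ` (Z1 \<union> Z2) \<subseteq> sorts BL"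
      using c(1-3) e(1-3) by auto
    show "loc (X \<union> (Z1 \<union> Z2)) (\<lambda>p v. G1 p v \<and> G2 p v)"
      by (rule loc_conj[OF loc_mono[OF c(4)] loc_mono[OF e(4)]]) (use c(1) e(1) in auto)
    show "gdB ?w" by (rule g)
    show "off (Z1 \<union> Z2) v0 ?w" by (rule off_trans[OF c(6) off_override])
    show "G1 p ?w \<and> G2 p ?w" if p: "p \<in> \<Omega>" for p
      using loc_eq[OF c(4) g c(5) p 1] loc_eq[OF e(4) g e(5) p 2] c(7)[OF p] e(7)[OF p] by simp
    show "PE p w ?w" if w: "gdB w" "\<And>p. p \<in> \<Omega> \<Longrightarrow> G1 p w \<and> G2 p w" "\<And>z. z \<in> Z1 \<union> Z2 \<Longrightarrow> w z = ?w z" and p: "p \<in> \<Omega>" "bjn u1 u2 \<in> p" for w p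
    proof -
      have "u1 \<in> p \<or> u2 \<in> p" using p u by simp
      then show ?thesis
      proof
        assume "u1 \<in> p"
        have "PE p w w1"
        proof (rule c(8)[OF w(1) _ _ p(1) \<open>u1 \<in> p\<close>])
          show "G1 p w" if "p \<in> \<Omega>" for p using w(2)[OF that] by (rule conjunct1)
          show "w z = w1 z" if "z \<in> Z1" for z using w(3)[of z] 1[of z] that by simp
        qed
        then show ?thesis by (rule PE_trans) (rule PE_cong[OF c(5) g p(1)], simp add: 1)
      next
        assume "u2 \<in> p"
        have "PE p w w2"
        proof (rule e(8)[OF w(1) _ _ p(1) \<open>u2 \<in> p\<close>])
          show "G2 p w" if "p \<in> \<Omega>" for p using w(2)[OF that] by (rule conjunct2)
          show "w z = w2 z" if "z \<in> Z2" for z using w(3)[of z] 2[of z] that by simp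
        qed
        then show ?thesis by (rule PE_trans) (rule PE_cong[OF e(5) g p(1)], simp add: 2)
      qed
    qed
    show "w z = w' z" if w: "gdB w" "gdB w'" "\<And>p. p \<in> \<Omega> \<Longrightarrow> G1 p w \<and> G2 p w" "\<And>p. p \<in> \<Omega> \<Longrightarrow> G1 p w' \<and> G2 p w'" "\<And>p. p \<in> \<Omega> \<Longrightarrow> PE p w w'"
      and z: "z \<in> Z1 \<union> Z2" for w w' z
    proof -
      have 1: "w z = w' z" if "z \<in> Z1"
        by (rule c(9)[OF w(1,2) _ _ w(5) that]) (use w(3,4) in blast)+
      have 2: "w z = w' z" if "z \<in> Z2"
        by (rule e(9)[OF w(1,2) _ _ w(5) that]) (use w(3,4) in blast)+
      show ?thesis using z 1 2 by blast
    qed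
  qed
qed

text \<open>The condition \<open>H\<close> chosen at \<open>p\<close> is solvable for
  \<open>v0\<close> on a clopen neighbourhood \<open>u\<close> of \<open>p\<close>, but possibly not
  elsewhere. The code has to be determined by the fibres as a global tuple, and free values away
  from that region would destroy this. The element \<beta> that marks the region is itself
  determined, because solvability of \<open>H\<close> depends on the fibre alone.\<close>

lemma code_point:
  assumes p: "p \<in> \<Omega>"
  obtains u Z G w0 where "u \<in> BB" "u \<in> p" "code u Z G w0"
proof -
  obtain Z H where Z: "finite Z" "Z \<subseteq> range lvar" "Z \<inter> ({} \<union> X \<union> Y) = {}" "fst ` Z \<subseteq> sorts BL" "loc (X \<union> Z) H"
    "\<exists>w. gdB w \<and> off Z v0 w \<and> H p w"
    and f: "\<And>q w w'. q \<in> \<Omega> \<Longrightarrow> gdB w \<Longrightarrow> gdB w' \<Longrightarrow> \<forall>z\<in>Z. w z = w' z \<Longrightarrow> H q w \<Longrightarrow> H q w' \<Longrightarrow> PE q w w'"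
    and g: "\<And>q w w'. q \<in> \<Omega> \<Longrightarrow> gdB w \<Longrightarrow> gdB w' \<Longrightarrow> H q w \<Longrightarrow> H q w' \<Longrightarrow> PE q w w' \<Longrightarrow> agr Z q w w'"
    and h: "\<And>q w w'. \<forall>z\<in>Z. w z = w' z \<Longrightarrow> PE q w w' \<Longrightarrow> H q w \<Longrightarrow> H q w'"
    by (rule local_code[OF \<iota> EI p v0 finite.emptyI]) blast
  have djX: "X \<inter> Z = {}" using Z(3) by blast
  have "finite (X \<union> Y)" by simp
  then obtain \<beta> where \<beta>: "fst \<beta> = BSort" "\<beta> \<notin> X \<union> Y" by (rule fresh_var)
  have \<beta>Z: "\<beta> \<notin> Z" using Z(2) \<beta>(1) by auto
  let ?Z = "insert \<beta> Z"
  let ?R = "\<lambda>q v. \<exists>w. gdB w \<and> off Z v w \<and> H q w"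
  have locR: "loc X ?R"
  proof -
    have "X \<union> Z - Z = X" using djX by blast
    then show ?thesis using loc_ex[OF Z(5,1,4)] by simp
  qed
  obtain u where u: "u \<in> BB" "\<forall>q\<in>\<Omega>. ?R q v0 \<longleftrightarrow> u \<in> q" using loc_clopen[OF locR v0] by (elim bexE)
  have "\<forall>z\<in>Z. \<exists>D. loc {z} D \<and> (\<forall>q\<in>\<Omega>. \<forall>v. gdB v \<longrightarrow> (\<exists>a\<in>univ M (fst z). D q (v(z := a)))) \<and>
     (\<forall>q\<in>\<Omega>. \<forall>v v'. gdB v \<longrightarrow> gdB v' \<longrightarrow> D q v \<longrightarrow> D q v' \<longrightarrow> agr {z} q v v')"
  proof
    fix z assume z: "z \<in> Z"
    obtain y where y: "z = lvar y" using Z(2) z by blast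
    have "LSort (fst y) \<in> sorts BL" using Z(4) z y by auto
    then have s: "fst y \<in> sorts L" by simp
    obtain D where D: "loc {lvar y} D" "\<And>q v. q \<in> \<Omega> \<Longrightarrow> gdB v \<Longrightarrow> \<exists>a\<in>U (fst y). D q (v(lvar y := a))"
      "\<And>q v v'. q \<in> \<Omega> \<Longrightarrow> gdB v \<Longrightarrow> gdB v' \<Longrightarrow> D q v \<Longrightarrow> D q v' \<Longrightarrow> agr {lvar y} q v v'"
      using s by (rule defaults[OF bspec[OF DE s] _ refl]) blast
    show "\<exists>D. loc {z} D \<and> (\<forall>q\<in>\<Omega>. \<forall>v. gdB v \<longrightarrow> (\<exists>a\<in>univ M (fst z). D q (v(z := a)))) \<and>
      (\<forall>q\<in>\<Omega>. \<forall>v v'. gdB v \<longrightarrow> gdB v' \<longrightarrow> D q v \<longrightarrow> D q v' \<longrightarrow> agr {z} q v v')"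
      unfolding y by (rule exI[of _ D]) (simp add: D)
  qed
  from bchoice[OF this] obtain D where D': "\<forall>z\<in>Z. loc {z} (D z) \<and> (\<forall>q\<in>\<Omega>. \<forall>v. gdB v \<longrightarrow> (\<exists>a\<in>univ M (fst z). D z q (v(z := a)))) \<and>
     (\<forall>q\<in>\<Omega>. \<forall>v v'. gdB v \<longrightarrow> gdB v' \<longrightarrow> D z q v \<longrightarrow> D z q v' \<longrightarrow> agr {z} q v v')" ..
  have D: "z \<in> Z \<Longrightarrow> loc {z} (D z)"
    "z \<in> Z \<Longrightarrow> q \<in> \<Omega> \<Longrightarrow> gdB v \<Longrightarrow> \<exists>a\<in>univ M (fst z). D z q (v(z := a))"
    "z \<in> Z \<Longrightarrow> q \<in> \<Omega> \<Longrightarrow> gdB v \<Longrightarrow> gdB v' \<Longrightarrow> D z q v \<Longrightarrow> D z q v' \<Longrightarrow> agr {z} q v v'" for z q v v'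
    using D' by simp_all
  define G where "G q w \<longleftrightarrow> (w \<beta> \<in> q \<longleftrightarrow> ?R q w) \<and> (w \<beta> \<in> q \<longrightarrow> H q w) \<and> (w \<beta> \<notin> q \<longrightarrow> (\<forall>z\<in>Z. D z q w))" for q w
  have GD: "w \<beta> \<in> q \<longleftrightarrow> ?R q w" "w \<beta> \<in> q \<Longrightarrow> H q w" "w \<beta> \<notin> q \<Longrightarrow> z \<in> Z \<Longrightarrow> D z q w" if "G q w" for q w z
    using that unfolding G_def by simp_all
  let ?V = "X \<union> ?Z"
  have finV: "finite ?V" using Z(1) by simp
  have locG: "loc ?V G" unfolding G_def
  proof (intro loc_conj loc_iff loc_imp loc_Not)
    show b: "loc ?V (\<lambda>q w. w \<beta> \<in> q)" by (rule loc_bvar[OF _ \<beta>(1) finV]) simp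
    show "loc ?V ?R" by (rule loc_mono[OF locR _ finV]) blast
    show "loc ?V H" by (rule loc_mono[OF Z(5) _ finV]) blast
    show "loc ?V (\<lambda>q w. \<forall>z\<in>Z. D z q w)"
    proof (rule loc_Ball[OF Z(1) finV])
      show "loc ?V (D z)" if "z \<in> Z" for z by (rule loc_mono[OF D(1)[OF that] _ finV]) (use that in blast)
    qed
  qed (rule loc_bvar[OF _ \<beta>(1) finV], simp)+
  have Heq: "H q w \<longleftrightarrow> H q w'" if "q \<in> \<Omega>" "gdB w" "gdB w'" "\<And>x. x \<in> X \<union> Z \<Longrightarrow> w x = w' x" for q w w'
    by (rule loc_eq[OF Z(5) that(2,3,1,4)])
  have Req: "?R q w \<longleftrightarrow> ?R q w'" if "q \<in> \<Omega>" "gdB w" "gdB w'" "\<And>x. x \<in> X \<Longrightarrow> w x = w' x" for q w w'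
    by (rule loc_eq[OF locR that(2,3,1,4)])
  have ex: "\<exists>w. gdB w \<and> off ?Z v0 w \<and> G q w" if q: "q \<in> \<Omega>" for q
  proof (cases "u \<in> q")
    case True
    then obtain w where w: "gdB w" "off Z v0 w" "H q w" using u(2) q by blast
    let ?w = "w(\<beta> := u)"
    have g: "gdB ?w" by (rule gd_upd[OF w(1)]) (use u(1) \<beta>(1) in simp)
    have "H q ?w \<longleftrightarrow> H q w" by (rule Heq[OF q g w(1)]) (use \<beta>(2) \<beta>Z in auto)
    then have "H q ?w" using w(3) by blast
    moreover have "?R q ?w" using g \<open>H q ?w\<close> off_refl by blast
    moreover have "?w \<beta> \<in> q" using True by simp
    ultimately have "G q ?w" unfolding G_def by blast
    moreover have "off ?Z v0 ?w" using w(2) by (simp add: off_def)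
    ultimately show ?thesis using g by blast
  next
    case False
    have "\<forall>z\<in>Z. \<exists>a. a \<in> univ M (fst z) \<and> D z q (v0(z := a))" using D(2)[OF _ q v0] by blast
    from bchoice[OF this] obtain a where a': "\<forall>z\<in>Z. a z \<in> univ M (fst z) \<and> D z q (v0(z := a z))" ..
    note a = bspec[OF a']
    let ?w = "\<lambda>x. if x \<in> Z then a x else if x = \<beta> then u else v0 x"
    have g: "gdB ?w" unfolding gd_def
    proof (intro allI impI)
      fix x :: "'s bsort var" assume "fst x \<in> sorts BL"
      then show "?w x \<in> univ M (fst x)" using a[of x] u(1) \<beta>(1) gd_in[OF v0 refl, of x] by auto
    qed
    have "D z q ?w" if z: "z \<in> Z" for z
    proof -
      have "gdB (v0(z := a z))" by (rule gd_upd[OF v0]) (use a[OF z] in blast)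
      from loc_eq[OF D(1)[OF z] g this q] show ?thesis using a[OF z] z by auto
    qed
    moreover have "?R q ?w \<longleftrightarrow> ?R q v0" by (rule Req[OF q g v0]) (use djX \<beta>(2) in auto)
    moreover have "?w \<beta> \<notin> q" using False \<beta>Z by simp
    moreover have "\<not> ?R q v0" using u(2) q False by blast
    ultimately have "G q ?w" unfolding G_def by blast
    moreover have "off ?Z v0 ?w" by (simp add: off_def)
    ultimately show ?thesis using g by blast
  qed
  have sZ: "fst ` ?Z \<subseteq> sorts BL" using Z(4) \<beta>(1) by simp
  have "\<exists>w. gdB w \<and> off ?Z v0 w \<and> (\<forall>q\<in>\<Omega>. G q w)" by (rule local_global[OF locG v0 ex])
  then obtain w0 where w0: "gdB w0" "off ?Z v0 w0" "\<forall>q\<in>\<Omega>. G q w0" by (elim exE conjE)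
  have w0X: "v0 x = w0 x" if "x \<in> X" for x by (rule off_apply[OF w0(2), symmetric]) (use that djX \<beta>(2) in blast)
  have "code u ?Z G w0"
  proof (rule codeI)
    show "finite ?Z" using Z(1) by simp
    show "?Z \<inter> (X \<union> Y) = {}" using Z(3) \<beta>(2) by blast
    show "G q w0" if "q \<in> \<Omega>" for q using w0(3) that by blast
    show "PE q w w0" if w: "gdB w" "\<And>q. q \<in> \<Omega> \<Longrightarrow> G q w" "\<And>z. z \<in> ?Z \<Longrightarrow> w z = w0 z" and q: "q \<in> \<Omega>" "u \<in> q" for w q
    proof -
      have G0: "G q w0" using w0(3) q(1) by blast
      have "?R q v0" using u(2) q by blast
      then have "?R q w0" using Req[OF q(1) v0 w0(1) w0X] by blast
      then have b: "w0 \<beta> \<in> q" using GD(1)[OF G0] by blast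
      have "H q w0" by (rule GD(2)[OF G0 b])
      moreover have "H q w" by (rule GD(2)[OF w(2)[OF q(1)]]) (simp add: w(3) b)
      moreover have "\<forall>z\<in>Z. w z = w0 z" by (simp add: w(3))
      ultimately show ?thesis using f[OF q(1) w(1) w0(1)] by blast
    qed
    show "w z = w' z" if w: "gdB w" "gdB w'" "\<And>q. q \<in> \<Omega> \<Longrightarrow> G q w" "\<And>q. q \<in> \<Omega> \<Longrightarrow> G q w'" "\<And>q. q \<in> \<Omega> \<Longrightarrow> PE q w w'"
      and z: "z \<in> ?Z" for w w' z
    proof -
      \<comment> \<open>A solution for \<open>w\<close> is a tuple of codes together with the fibre
        of \<open>w\<close>. Combined with the \<open>X\<close>-part of \<open>w'\<close>, which has
        the same fibre, it solves \<open>H\<close> for \<open>w'\<close>.\<close>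
      have RR: "?R q w'" if q: "q \<in> \<Omega>" and w: "gdB w" "gdB w'" "PE q w w'" "?R q w" for q w w'
      proof -
        obtain w1 where w1: "gdB w1" "off Z w w1" "H q w1" using w(4) by blast
        let ?w = "override_on w' w1 Z"
        have g: "gdB ?w" by (rule gd_override[OF w(2) w1(1)])
        have "PE q w1 w" by (rule PE_cong[OF w1(1) w(1) q]) (use off_apply[OF w1(2)] djX in blast)
        moreover have "PE q w' ?w" by (rule PE_cong[OF w(2) g q]) (use djX in \<open>auto simp: override_on_def\<close>)
        ultimately have "PE q w1 ?w" using PE_trans w(3) by blast
        then have "H q ?w" by (rule h[rotated]) (simp_all add: w1(3))
        then show ?thesis using g off_override[of Z w' w1] by blast
      qed
      have \<beta>eq: "w \<beta> \<in> q \<longleftrightarrow> w' \<beta> \<in> q" if q: "q \<in> \<Omega>" for q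
        using GD(1)[OF w(3)[OF q]] GD(1)[OF w(4)[OF q]] RR[OF q w(1,2) w(5)[OF q]] RR[OF q w(2,1) PE_sym[OF w(5)[OF q]]] by blast
      show ?thesis
      proof (cases "z = \<beta>")
        case True
        have "w \<beta> \<in> BB" "w' \<beta> \<in> BB" using gd_in[OF w(1) \<beta>(1)] gd_in[OF w(2) \<beta>(1)] by simp_all
        then show ?thesis unfolding True using \<beta>eq by (rule B_eqI)
      next
        case False
        then have z': "z \<in> Z" using z by blast
        show ?thesis
        proof (rule agr_all_eq[OF w(1,2)])
          show "z \<in> {z}" by simp
          show "fst z \<in> sorts BL" using Z(4) z' by blast
          show "agr {z} q w w'" if q: "q \<in> \<Omega>" for q
          proof (cases "w \<beta> \<in> q")
            case True
            then have "H q w" "H q w'" using GD(2)[OF w(3)[OF q]] GD(2)[OF w(4)[OF q]] \<beta>eq[OF q] by blast+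
            then have "agr Z q w w'" by (rule g[OF q w(1,2) _ _ w(5)[OF q]])
            then show ?thesis by (rule agr_mono) (use z' in blast)
          next
            case False
            then have "D z q w" "D z q w'" using GD(3)[OF w(3)[OF q] _ z'] GD(3)[OF w(4)[OF q] _ z'] \<beta>eq[OF q] by blast+
            then show ?thesis by (rule D(3)[OF z' q w(1,2)])
          qed
        qed
      qed
    qed
  qed (rule sZ locG w0(1,2))+
  moreover have "u \<in> p" using u(2) p Z(6) by blast
  ultimately show thesis using that u(1) by blast
qed

text \<open>The elements over which a code exists form an ideal that covers \<Omega>. The argument
  resembles \<open>local_global_abs\<close>, but the variables and the condition of the code vary
  with the region, so two codes are joined by concatenation after their variables have been made
  disjoint.\<close>

lemma code_exists: obtains Z G w0 where "code b1 Z G w0"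
proof -
  let ?K = "{u\<in>BB. \<exists>Z G w0. code u Z G w0}"
  have "b1 \<in> ?K"
  proof (rule ba.ultra_compact)
    show "bjn x y \<in> ?K" if x: "x \<in> ?K" and y: "y \<in> ?K" for x y
    proof -
      from x obtain Z1 G1 w1 where 1: "code x Z1 G1 w1" by blast
      from y obtain Z2 G2 w2 where 2: "code y Z2 G2 w2" by blast
      obtain Z3 G3 w3 where 3: "code y Z3 G3 w3" "Z3 \<inter> Z1 = {}" by (rule code_rename[OF 2 codeD(1)[OF 1]])
      have "x \<in> BB" "y \<in> BB" using x y by blast+
      then show ?thesis using code_join[OF 1 3] ba.join_in by blast
    qed
    show "y \<in> ?K" if x: "x \<in> ?K" and y: "y \<in> BB" "\<And>p. ba.ultra p \<Longrightarrow> y \<in> p \<Longrightarrow> x \<in> p" for x y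
    proof -
      from x obtain Z G w0 where "code x Z G w0" by blast
      then have "code y Z G w0" by (rule code_down) (use y(2) in \<open>simp add: \<Omega>_def\<close>)
      then show ?thesis using y(1) by blast
    qed
    show "b0 \<in> ?K" using code_zero ba.zero_in by blast
    show "\<exists>u\<in>?K. u \<in> p" if "ba.ultra p" for p
    proof -
      have "p \<in> \<Omega>" using that by (simp add: \<Omega>_def)
      then obtain u Z G w0 where "u \<in> BB" "u \<in> p" "code u Z G w0" by (rule code_point)
      then show ?thesis by blast
    qed
  qed blast
  then show thesis using that by blast
qed

end

section \<open>Weak elimination of imaginaries\<close>

text \<open>Nothing is assumed of \<open>V\<close> outside \<open>xs\<close>. The assignments into
  \<open>eq_struct M\<close> below are controlled at a few variables only, so the version for good
  assignments does not fit them.\<close>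

lemma sat_Exs:
  "sat N V (Exs xs \<phi>) \<longleftrightarrow> (\<exists>V'. off (set xs) V V' \<and> (\<forall>x\<in>set xs. V' x \<in> univ N (fst x)) \<and> sat N V' \<phi>)"
proof (induction xs arbitrary: V)
  case (Cons x xs)
  have "sat N V (Exs (x # xs) \<phi>) \<longleftrightarrow> (\<exists>a\<in>univ N (fst x). sat N (V(x := a)) (Exs xs \<phi>))"
    by (simp add: Exs_def)
  also have "\<dots> \<longleftrightarrow> (\<exists>V'. off (set (x # xs)) V V' \<and> (\<forall>y\<in>set (x # xs). V' y \<in> univ N (fst y)) \<and> sat N V' \<phi>)" (is "?l \<longleftrightarrow> ?r")
  proof
    assume ?l
    then obtain a V' where V': "a \<in> univ N (fst x)" "off (set xs) (V(x := a)) V'" "\<forall>y\<in>set xs. V' y \<in> univ N (fst y)" "sat N V' \<phi>"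
      unfolding Cons.IH by blast
    have "V' x \<in> univ N (fst x)" using V'(1-3) by (cases "x \<in> set xs") (auto simp: off_def)
    moreover have "off (set (x # xs)) V V'" using V'(2) by (auto simp: off_def)
    ultimately show ?r using V'(3,4) by (intro exI[of _ V']) simp
  next
    assume ?r
    then obtain V' where V': "off (set (x # xs)) V V'" "\<forall>y\<in>set (x # xs). V' y \<in> univ N (fst y)" "sat N V' \<phi>" by (elim exE conjE)
    have "off (set xs) (V(x := V' x)) V'" using V'(1) by (auto simp: off_def)
    then show ?l unfolding Cons.IH using V'(2,3) by (intro bexI[of _ "V' x"] exI[of _ V']) simp_all
  qed
  finally show ?case .
qed (auto simp: Exs_def)

lemma finite_image_factor:
  assumes "finite (g ` A)" "\<And>a b. a \<in> A \<Longrightarrow> b \<in> A \<Longrightarrow> g a = g b \<Longrightarrow> f a = f b"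
  shows "finite (f ` A)"
proof -
  have "f a = f (inv_into A g (g a))" if "a \<in> A" for a
    by (rule assms(2)[OF that]) (use that in \<open>simp_all add: inv_into_into f_inv_into_f\<close>)
  then have "f ` A \<subseteq> (\<lambda>b. f (inv_into A g b)) ` g ` A" by (simp add: image_image)
  then show ?thesis using assms(1) by (meson finite_imageI finite_subset)
qed

lemma definable_self:
  assumes "(s, a) \<in> elems L N" shows "definable_over L N {(s, a)} s {a}"
  unfolding definable_over_def
proof (intro exI conjI)
  let ?x = "(s, 0) :: 'a var" and ?y = "(s, 1) :: 'a var"
  show "fst ?x = s" by simp
  show "fm_in L (?x # [?y]) (Eq (Var ?x) (Var ?y))" using assms by (auto simp: fm_in_def elems_def)
  show "length [a] = length [?y]" by simp
  show "set (zip (map fst [?y]) [a]) \<subseteq> {(s, a)}" by simp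
  show "{a} = {b \<in> univ N s. holds N (?x # [?y]) (Eq (Var ?x) (Var ?y)) (b # [a])}"
    using assms by (auto simp: holds_def elems_def)
qed

lemma dcl_self: "d \<in> elems L N \<Longrightarrow> d \<in> dcl L N {d}"
  using definable_self[of "fst d" "snd d" L N] by (cases d) (auto simp: dcl_def)

lemma dcl_acl: "d \<in> dcl L N A \<Longrightarrow> d \<in> acl L N A"
  unfolding dcl_def acl_def by blast

section \<open>Properties of assignments definable in the Boolean-valued model\<close>

context bvmodel begin

definition dfn :: "'s bsort var set \<Rightarrow> (('s bsort var \<Rightarrow> 'm) \<Rightarrow> bool) \<Rightarrow> bool" where
  "dfn V P \<longleftrightarrow> (\<exists>\<Psi> :: ('s, 'f, 'r) bfm. wf_fm BL \<Psi> \<and> fv \<Psi> \<subseteq> V \<and> (\<forall>v. gdB v \<longrightarrow> (sat M v \<Psi> \<longleftrightarrow> P v)))"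

lemma dfn_zero: "loc V F \<Longrightarrow> dfn V (\<lambda>v. \<forall>p\<in>\<Omega>. F p v)"
  unfolding dfn_def by (rule zero_test)

lemma dfn_Not: assumes "dfn V P" shows "dfn V (\<lambda>v. \<not> P v)"
proof -
  from assms obtain \<Psi> :: "('s, 'f, 'r) bfm" where "wf_fm BL \<Psi>" "fv \<Psi> \<subseteq> V" "\<forall>v. gdB v \<longrightarrow> (sat M v \<Psi> \<longleftrightarrow> P v)"
    unfolding dfn_def by (elim exE conjE)
  then show ?thesis unfolding dfn_def by (intro exI[of _ "Neg \<Psi>"]) simp
qed

lemma dfn_conj: assumes "dfn V P" "dfn V Q" shows "dfn V (\<lambda>v. P v \<and> Q v)"
proof -
  from assms(1) obtain \<Psi> :: "('s, 'f, 'r) bfm" where 1: "wf_fm BL \<Psi>" "fv \<Psi> \<subseteq> V" "\<forall>v. gdB v \<longrightarrow> (sat M v \<Psi> \<longleftrightarrow> P v)"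
    unfolding dfn_def by (elim exE conjE)
  from assms(2) obtain \<Phi> :: "('s, 'f, 'r) bfm" where 2: "wf_fm BL \<Phi>" "fv \<Phi> \<subseteq> V" "\<forall>v. gdB v \<longrightarrow> (sat M v \<Phi> \<longleftrightarrow> Q v)"
    unfolding dfn_def by (elim exE conjE)
  show ?thesis unfolding dfn_def using 1 2 by (intro exI[of _ "Conj \<Psi> \<Phi>"]) simp
qed

lemma dfn_cong: assumes "dfn V P" "\<And>v. gdB v \<Longrightarrow> P v \<longleftrightarrow> Q v" shows "dfn V Q"
  using assms unfolding dfn_def by simp

lemma dfn_mono: "dfn V P \<Longrightarrow> V \<subseteq> V' \<Longrightarrow> dfn V' P"
  unfolding dfn_def by (meson subset_trans)

lemma dfn_Ball:
  assumes "finite I" "\<And>i. i \<in> I \<Longrightarrow> dfn V (P i)" shows "dfn V (\<lambda>v. \<forall>i\<in>I. P i v)"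
  using assms
proof (induction I)
  case empty
  show ?case unfolding dfn_def by (intro exI[of _ "Neg Bot"]) simp
next
  case (insert i I)
  have "dfn V (\<lambda>v. P i v \<and> (\<forall>i\<in>I. P i v))" using insert by (intro dfn_conj) simp_all
  then show ?case by (rule dfn_cong) simp
qed

lemma dfn_ex:
  assumes "dfn V P" "fst ` set ys \<subseteq> sorts BL"
  shows "dfn (V - set ys) (\<lambda>v. \<exists>u. gdB u \<and> off (set ys) v u \<and> P u)"
proof -
  interpret t: tarski BL "univ M" "sat M" "\<lambda>_. (=)" by (rule tarski_sat[OF is_struct_M])
  from assms(1) obtain \<Psi> :: "('s, 'f, 'r) bfm" where 1: "wf_fm BL \<Psi>" "fv \<Psi> \<subseteq> V" "\<forall>v. gdB v \<longrightarrow> (sat M v \<Psi> \<longleftrightarrow> P v)"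
    unfolding dfn_def by (elim exE conjE)
  show ?thesis unfolding dfn_def
  proof (intro exI[of _ "Exs ys \<Psi>"] conjI allI impI)
    show "wf_fm BL (Exs ys \<Psi>)" using 1(1) assms(2) by simp
    show "fv (Exs ys \<Psi>) \<subseteq> V - set ys" using 1(2) by auto
    fix v assume "gdB v"
    then show "sat M v (Exs ys \<Psi>) \<longleftrightarrow> (\<exists>u. gdB u \<and> off (set ys) v u \<and> P u)"
      using t.S_Exs[OF 1(1) assms(2)] 1(3) by blast
  qed
qed

end

section \<open>The imaginary and its code over each other\<close>

context coding begin

lemma AA_ex_off:
  assumes v: "gdB v"
  shows "(\<exists>w. gdB w \<and> Q (im v w)) \<longleftrightarrow> (\<exists>u. gdB u \<and> off Y v u \<and> Q ((\<lambda>p. C p u) ` \<Omega>))" (is "?l \<longleftrightarrow> ?r")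
proof
  assume ?l
  then obtain w where "gdB w" "Q (im v w)" by blast
  then show ?r using gd_override[OF v] off_override[of Y v w] unfolding im_def by blast
next
  assume ?r
  then obtain u where u: "gdB u" "off Y v u" "Q ((\<lambda>p. C p u) ` \<Omega>)" by blast
  have "override_on v u Y = u"
  proof
    fix x
    show "override_on v u Y x = u x" using off_apply[OF u(2), of x] by (cases "x \<in> Y") simp_all
  qed
  then show ?l using u(1,3) unfolding im_def by (intro exI[of _ u]) simp
qed

lemma dfn_image: assumes "finite t" shows "dfn (X \<union> Y) (\<lambda>u. (\<lambda>p. C p u) ` \<Omega> = t)"
proof -
  have l: "loc (X \<union> Y) (\<lambda>p v. C p v = i)" for i
    by (rule loc_mono[OF colouredD(2)[OF C] XY(4) finXY(1)])
  have "dfn (X \<union> Y) (\<lambda>u. (\<forall>p\<in>\<Omega>. \<exists>i\<in>t. C p u = i) \<and> (\<forall>i\<in>t. \<not> (\<forall>p\<in>\<Omega>. \<not> C p u = i)))"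
    by (intro dfn_conj dfn_Ball dfn_Not dfn_zero loc_Bex loc_Not l assms finXY(1))
  then show ?thesis
  proof (rule dfn_cong)
    fix v
    have 1: "(\<forall>p\<in>\<Omega>. \<exists>i\<in>t. C p v = i) \<longleftrightarrow> (\<lambda>p. C p v) ` \<Omega> \<subseteq> t" by (simp add: image_subset_iff)
    have 2: "(\<forall>i\<in>t. \<not> (\<forall>p\<in>\<Omega>. \<not> C p v = i)) \<longleftrightarrow> t \<subseteq> (\<lambda>p. C p v) ` \<Omega>" unfolding subset_iff image_iff by metis
    show "(\<forall>p\<in>\<Omega>. \<exists>i\<in>t. C p v = i) \<and> (\<forall>i\<in>t. \<not> (\<forall>p\<in>\<Omega>. \<not> C p v = i)) \<longleftrightarrow> (\<lambda>p. C p v) ` \<Omega> = t"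
      unfolding 1 2 set_eq_subset ..
  qed
qed

text \<open>The maximality in \<open>AA\<close> speaks of sets of colours, all of which are subsets
  of the finite set \<open>F\<close>. It thus amounts to a finite Boolean combination of conditions
  on the set of colours, under a quantifier over \<open>ys\<close>.\<close>

lemma dfn_AA: "dfn X AA"
proof -
  have XYY: "X \<union> Y - set ys = X" using XY(1) by blast
  have "finite s" using s(2) finF by (rule finite_subset)
  have 1: "dfn X (\<lambda>v. \<exists>u. gdB u \<and> off Y v u \<and> (\<lambda>p. C p u) ` \<Omega> = s)"
    using dfn_ex[OF dfn_image[OF \<open>finite s\<close>] XY(6)] unfolding XYY .
  let ?I = "{t\<in>Pow F. t \<in> \<E> \<and> s \<subset> t}"
  have I: "finite ?I" using finF by simp
  have ft: "finite t" if "t \<in> ?I" for t using that finF by (auto intro: finite_subset)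
  have "dfn (X \<union> Y) (\<lambda>u. \<not> (\<forall>t\<in>?I. \<not> (\<lambda>p. C p u) ` \<Omega> = t))"
    by (intro dfn_Not dfn_Ball I dfn_image ft)
  then have "dfn (X \<union> Y) (\<lambda>u. (\<lambda>p. C p u) ` \<Omega> \<in> \<E> \<and> s \<subset> (\<lambda>p. C p u) ` \<Omega>)"
  proof (rule dfn_cong)
    fix u assume "gdB u"
    then have "(\<lambda>p. C p u) ` \<Omega> \<subseteq> F" using colouredD(3)[OF C] by blast
    then show "\<not> (\<forall>t\<in>?I. \<not> (\<lambda>p. C p u) ` \<Omega> = t) \<longleftrightarrow> (\<lambda>p. C p u) ` \<Omega> \<in> \<E> \<and> s \<subset> (\<lambda>p. C p u) ` \<Omega>" by auto
  qed
  from dfn_ex[OF this XY(6)] have 2: "dfn X (\<lambda>v. \<exists>u. gdB u \<and> off Y v u \<and> ((\<lambda>p. C p u) ` \<Omega> \<in> \<E> \<and> s \<subset> (\<lambda>p. C p u) ` \<Omega>))"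
    unfolding XYY .
  show ?thesis
  proof (rule dfn_cong[OF dfn_conj[OF 1 dfn_Not[OF 2]]])
    fix v assume v: "gdB v"
    have e1: "(\<exists>w. gdB w \<and> im v w = s) \<longleftrightarrow> (\<exists>u. gdB u \<and> off Y v u \<and> (\<lambda>p. C p u) ` \<Omega> = s)"
      by (rule AA_ex_off[OF v, of "\<lambda>t. t = s"])
    have e2: "(\<exists>w. gdB w \<and> im v w \<in> \<E> \<and> s \<subset> im v w) \<longleftrightarrow> (\<exists>u. gdB u \<and> off Y v u \<and> ((\<lambda>p. C p u) ` \<Omega> \<in> \<E> \<and> s \<subset> (\<lambda>p. C p u) ` \<Omega>))"
      by (rule AA_ex_off[OF v, of "\<lambda>t. t \<in> \<E> \<and> s \<subset> t"])
    show "(\<exists>u. gdB u \<and> off Y v u \<and> (\<lambda>p. C p u) ` \<Omega> = s) \<and> \<not> (\<exists>u. gdB u \<and> off Y v u \<and> ((\<lambda>p. C p u) ` \<Omega> \<in> \<E> \<and> s \<subset> (\<lambda>p. C p u) ` \<Omega>)) \<longleftrightarrow> AA v"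
      unfolding AA_def e1 e2 ..
  qed
qed

lemma AA_cong: assumes "gdB v" "gdB v'" "\<And>x. x \<in> X \<Longrightarrow> v x = v' x" "AA v" shows "AA v'"
proof -
  from dfn_AA obtain \<Psi> :: "('s, 'f, 'r) bfm" where "fv \<Psi> \<subseteq> X" "\<forall>v. gdB v \<longrightarrow> (sat M v \<Psi> \<longleftrightarrow> AA v)"
    unfolding dfn_def by (elim exE conjE)
  moreover from this(1) have "sat M v \<Psi> = sat M v' \<Psi>" by (intro sat_cong assms(3)) blast
  ultimately show ?thesis using assms(1,2,4) by blast
qed

text \<open>The formula says that \<open>y0\<close> is the class of some tuple \<open>xs\<close>
  which, together with \<open>rs\<close>, satisfies \<Phi>. The division into bound variables
  \<open>qs\<close> and free variables \<open>rs\<close> is left open: to define the class over the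
  code only \<open>xs\<close> is bound, and to bound one entry of the code over the class all other
  entries are bound too.\<close>

lemma sat_Xi:
  assumes qs: "X \<subseteq> set qs" "set qs \<inter> set rs = {}" "fst ` set qs \<subseteq> sorts BL" and \<Phi>: "fv \<Phi> \<subseteq> set qs \<union> set rs"
    and y0: "fst y0 = Imag xs ys E" and V: "V y0 = Inr K" "\<And>r. r \<in> set rs \<Longrightarrow> V (rv r) = Inl (u r)" and u: "gdB u"
  shows "sat (eq_struct M) V (Exs (map rv qs) (Conj (Eq (Fn (Proj xs ys E) (map (Var \<circ> rv) xs)) (Var y0)) (lift \<Phi>))) \<longleftrightarrow>
    (\<exists>v. gdB v \<and> (\<forall>r\<in>set rs. v r = u r) \<and> eqrel M xs ys E `` {map v xs} = K \<and> sat M v \<Phi>)" (is "?l \<longleftrightarrow> ?r")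
proof -
  have y0q: "y0 \<notin> rv ` A" for A using y0 by auto
  have ev: "eval_tm (eq_struct M) V' (Fn (Proj xs ys E) (map (Var \<circ> rv) xs)) = Inr (eqrel M xs ys E `` {map v xs})"
    if "\<And>x. x \<in> X \<Longrightarrow> V' (rv x) = Inl (v x)" for V' v
  proof -
    have "map (projl \<circ> (\<lambda>x. V' (rv x))) xs = map v xs" using that by simp
    then show ?thesis by (simp add: comp_def del: map_eq_conv)
  qed
  show ?thesis
  proof
    assume ?l
    then obtain V' where V': "off (rv ` set qs) V V'" "\<forall>x\<in>rv ` set qs. V' x \<in> univ (eq_struct M) (fst x)"
      "eval_tm (eq_struct M) V' (Fn (Proj xs ys E) (map (Var \<circ> rv) xs)) = V' y0" "sat (eq_struct M) V' (lift \<Phi>)"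
      unfolding sat_Exs sat.simps eval_tm.simps(1) set_map by (elim exE conjE)
    let ?v = "\<lambda>x. if x \<in> set qs then projl (V' (rv x)) else u x"
    have q: "V' (rv x) = Inl (?v x) \<and> ?v x \<in> univ M (fst x)" if "x \<in> set qs" for x
    proof -
      have "V' (rv x) \<in> univ (eq_struct M) (fst (rv x :: ('s bsort, ('s, 'f, 'r) bfun, unit) eq_sort var))" using V'(2) that by simp
      then have "V' (rv x) \<in> Inl ` univ M (fst x)" by simp
      then show ?thesis using that by auto
    qed
    have r: "V' (rv x) = Inl (?v x)" if "x \<in> set rs" for x
    proof -
      have nq: "x \<notin> set qs" using that qs(2) by blast
      then have "rv x \<notin> rv ` set qs" by auto
      then have "V' (rv x) = V (rv x)" by (rule off_apply[OF V'(1)])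
      then show ?thesis using V(2)[OF that] nq by simp
    qed
    have v: "gdB ?v" unfolding gd_def
    proof (intro allI impI)
      fix x :: "'s bsort var" assume "fst x \<in> sorts BL"
      then show "?v x \<in> univ M (fst x)" using q[of x] gd_in[OF u refl, of x] by auto
    qed
    have "V' y0 = Inr K" using off_apply[OF V'(1) y0q] V(1) by simp
    moreover have "eval_tm (eq_struct M) V' (Fn (Proj xs ys E) (map (Var \<circ> rv) xs)) = Inr (eqrel M xs ys E `` {map ?v xs})"
      by (rule ev) (use q qs(1) in blast)
    ultimately have "eqrel M xs ys E `` {map ?v xs} = K" using V'(3) by simp
    moreover have "sat (eq_struct M) V' (lift \<Phi>) \<longleftrightarrow> sat M ?v \<Phi>"
      by (rule sat_lift) (use \<Phi> q r in blast)
    ultimately have "gdB ?v \<and> (\<forall>r\<in>set rs. ?v r = u r) \<and> eqrel M xs ys E `` {map ?v xs} = K \<and> sat M ?v \<Phi>" using V'(4) v qs(2) by auto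
    then show ?r by (rule exI[of _ ?v])
  next
    assume ?r
    then obtain v where v: "gdB v" "\<forall>r\<in>set rs. v r = u r" "eqrel M xs ys E `` {map v xs} = K" "sat M v \<Phi>" by (elim exE conjE)
    let ?V = "\<lambda>t. if t \<in> rv ` set qs then Inl (v (inv_into UNIV rv t)) else V t"
    have inj: "inj (rv :: 's bsort var \<Rightarrow> ('s bsort, ('s, 'f, 'r) bfun, unit) eq_sort var)" by (simp add: inj_def)
    have q: "?V (rv x) = Inl (v x)" if "x \<in> set qs" for x using that by (simp add: inv_f_f[OF inj])
    have r: "?V (rv x) = Inl (v x)" if "x \<in> set rs" for x
    proof -
      have "x \<notin> set qs" using that qs(2) by blast
      then have "?V (rv x) = V (rv x)" by auto
      then show ?thesis using V(2)[OF that] v(2) that by simp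
    qed
    have "sat (eq_struct M) ?V (lift \<Phi>) \<longleftrightarrow> sat M v \<Phi>" by (rule sat_lift) (use \<Phi> q r in blast)
    moreover have "eval_tm (eq_struct M) ?V (Fn (Proj xs ys E) (map (Var \<circ> rv) xs)) = Inr (eqrel M xs ys E `` {map v xs})"
      by (rule ev) (use q qs(1) in blast)
    moreover have "?V y0 = Inr K" using y0q[of "set qs"] V(1) by simp
    ultimately have s: "sat (eq_struct M) ?V (Conj (Eq (Fn (Proj xs ys E) (map (Var \<circ> rv) xs)) (Var y0)) (lift \<Phi>))"
      using v(3,4) unfolding sat.simps eval_tm.simps(1)[of _ _ y0] by (simp only:)
    have o: "off (rv ` set qs) V ?V" by (simp add: off_def)
    have "?V t \<in> univ (eq_struct M) (fst t)" if t: "t \<in> rv ` set qs" for t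
    proof -
      obtain x where x: "t = rv x" "x \<in> set qs" using t by blast
      have "fst x \<in> sorts BL" using qs(3) x(2) by blast
      then have "v x \<in> univ M (fst x)" by (rule gd_in[OF v(1) refl])
      then show ?thesis unfolding x(1) q[OF x(2)] by simp
    qed
    then show ?l unfolding sat_Exs set_map using s o by blast
  qed
qed

lemma wf_Xi:
  assumes qs: "fst ` set qs \<subseteq> sorts BL" and rs: "fst ` set rs \<subseteq> sorts BL" "distinct rs" and X: "X \<subseteq> set qs"
    and \<Phi>: "wf_fm BL \<Phi>" "fv \<Phi> \<subseteq> set qs \<union> set rs" and y0: "fst y0 = Imag xs ys E"
  shows "fm_in (eq_lang BL M) (y0 # map rv rs) (Exs (map rv qs) (Conj (Eq (Fn (Proj xs ys E) (map (Var \<circ> rv) xs)) (Var y0)) (lift \<Phi>)))"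
proof -
  have "list_all2 (has_sort (eq_lang BL M)) (map (Var \<circ> rv) xs) (map (\<lambda>x. Real (fst x)) xs)"
    using XY(5) by (auto simp: list_all2_conv_all_nth image_subset_iff)
  then have "wf_fm (eq_lang BL M) (Eq (Fn (Proj xs ys E) (map (Var \<circ> rv) xs)) (Var y0))" using y0 d by simp
  moreover have "wf_fm (eq_lang BL M) (lift \<Phi>)" by (rule wf_lift[OF \<Phi>(1)])
  moreover have "fst ` set (map rv qs :: ('s bsort, ('s, 'f, 'r) bfun, unit) eq_sort var list) \<subseteq> sorts (eq_lang BL M)" using qs by auto
  moreover have "distinct (y0 # map rv rs)" using rs(2) y0 by (auto simp: distinct_map inj_on_def)
  moreover have "fst ` set (y0 # map rv rs) \<subseteq> sorts (eq_lang BL M)" using rs(1) y0 d by auto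
  moreover have "fv (Exs (map rv qs) (Conj (Eq (Fn (Proj xs ys E) (map (Var \<circ> rv) xs)) (Var y0)) (lift \<Phi>))) \<subseteq> set (y0 # map rv rs)"
  proof -
    have "fv_tm (Fn (Proj xs ys E) (map (Var \<circ> rv) xs)) = rv ` X" by auto
    moreover have "rv ` X \<subseteq> rv ` set qs" using X by blast
    moreover have "rv ` fv \<Phi> \<subseteq> rv ` set qs \<union> rv ` set rs" using \<Phi>(2) by blast
    ultimately show ?thesis unfolding fv_Exs fv.simps fv_lift by auto
  qed
  ultimately show ?thesis unfolding fm_in_def by simp
qed

lemma weak_code:
  assumes A: "AA v0"
  shows "\<exists>ds. (\<forall>d\<in>set ds. set d \<subseteq> reals BL M \<and> set d \<subseteq> acl_eq BL M {(Imag xs ys E, Inr (eqrel M xs ys E `` {map v0 xs}))}) \<and>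
    (Imag xs ys E, Inr (eqrel M xs ys E `` {map v0 xs})) \<in> dcl_eq BL M (\<Union>d\<in>set ds. set d)"
proof -
  obtain Z G w0 where "code b1 Z G w0" by (rule code_exists)
  note c = codeD[OF this]
  let ?K = "eqrel M xs ys E `` {map v0 xs}"
  let ?e = "(Imag xs ys E, Inr ?K)"
  have w0X: "w0 x = v0 x" if "x \<in> X" for x by (rule off_apply[OF c(6)]) (use that c(2) in blast)
  have Aw: "AA w0" by (rule AA_cong[OF v0 c(5) w0X[symmetric] A])
  have Kw: "eqrel M xs ys E `` {map w0 xs} = ?K" using w0X by (simp cong: map_cong)
  have eK: "Inr ?K \<in> eq_univ M (Imag xs ys E)" using tuples_map[OF v0 XY(5)] by (simp add: quotientI)
  have simK: "sim v0 v" if v: "gdB v" "eqrel M xs ys E `` {map v xs} = ?K" for v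
    unfolding sim_def by (rule eq_equiv_class[OF v(2)[symmetric] equiv tuples_map[OF v(1) XY(5)]])
  obtain zl where zl: "set zl = Z" "distinct zl" using finite_distinct_list[OF c(1)] by blast
  \<comment> \<open>The conjunct \<open>AA\<close> restricts to tuples between which equal fibres
    imply equivalence under \<open>E\<close>. The other conjunct attaches to each tuple at most one
    code, which depends on its fibres alone.\<close>
  have "dfn (X \<union> Z) (\<lambda>v. AA v \<and> (\<forall>p\<in>\<Omega>. G p v))"
    by (rule dfn_conj[OF dfn_mono[OF dfn_AA] dfn_zero[OF c(4)]]) blast
  then obtain \<Phi> :: "('s, 'f, 'r) bfm" where \<Phi>: "wf_fm BL \<Phi>" "fv \<Phi> \<subseteq> X \<union> Z" "\<forall>v. gdB v \<longrightarrow> (sat M v \<Phi> \<longleftrightarrow> AA v \<and> (\<forall>p\<in>\<Omega>. G p v))"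
    unfolding dfn_def by (elim exE conjE)
  define y0 :: "('s bsort, ('s, 'f, 'r) bfun, unit) eq_sort var" where "y0 = (Imag xs ys E, 0)"
  have y0: "fst y0 = Imag xs ys E" by (simp add: y0_def)
  have \<Phi>0: "sat M w0 \<Phi>" using \<Phi>(3) c(5,7) Aw by blast
  let ?\<Xi> = "\<lambda>qs. Exs (map rv qs) (Conj (Eq (Fn (Proj xs ys E) (map (Var \<circ> rv) xs)) (Var y0)) (lift \<Phi>))"
  let ?d = "map (\<lambda>z. (Real (fst z), Inl (w0 z))) zl :: (('s bsort, ('s, 'f, 'r) bfun, unit) eq_sort \<times> ('m + 'm list set)) list"
  have e_dcl: "?e \<in> dcl_eq BL M (set ?d)"
  proof -
    have f: "fv \<Phi> \<subseteq> X \<union> set zl" using \<Phi>(2) zl(1) by simp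
    have dj: "X \<inter> set zl = {}" using c(2) zl(1) by blast
    have sz: "fst ` set zl \<subseteq> sorts BL" using c(3) zl(1) by simp
    have i: "fm_in (eq_lang BL M) (y0 # map rv zl) (?\<Xi> xs)"
      by (rule wf_Xi[OF XY(5) sz zl(2) subset_refl \<Phi>(1) f y0])
    have "definable_over (eq_lang BL M) (eq_struct M) (set ?d) (Imag xs ys E) {Inr ?K}"
      unfolding definable_over_def
    proof (intro exI conjI)
      show "fst y0 = Imag xs ys E" by (rule y0)
      show "fm_in (eq_lang BL M) (y0 # map rv zl) (?\<Xi> xs)" by (rule i)
      show "length (map (Inl \<circ> w0) zl) = length (map rv zl)" by simp
      show "set (zip (map fst (map rv zl)) (map (Inl \<circ> w0) zl)) \<subseteq> set ?d"
        by (auto simp: zip_map_map zip_same_conv_map)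
      show "{Inr ?K} = {a \<in> univ (eq_struct M) (Imag xs ys E). holds (eq_struct M) (y0 # map rv zl) (?\<Xi> xs) (a # map (Inl \<circ> w0) zl)}"
        (is "_ = ?D")
      proof -
        have h: "holds (eq_struct M) (y0 # map rv zl) (?\<Xi> xs) (Inr K # map (Inl \<circ> w0) zl) \<longleftrightarrow>
          (\<exists>v. gdB v \<and> (\<forall>r\<in>set zl. v r = w0 r) \<and> eqrel M xs ys E `` {map v xs} = K \<and> sat M v \<Phi>)" for K
        proof -
          let ?V = "\<lambda>t :: ('s bsort, ('s, 'f, 'r) bfun, unit) eq_sort var. case fst t of Real s \<Rightarrow> Inl (w0 (s, snd t)) | _ \<Rightarrow> Inr K"
          have V: "?V y0 = Inr K" "?V (rv r) = Inl (w0 r)" for r by (simp_all add: y0_def rv_def)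
          then have m: "map ?V (y0 # map rv zl) = Inr K # map (Inl \<circ> w0) zl" by simp
          have "fv (?\<Xi> xs) \<subseteq> set (y0 # map rv zl)" using i unfolding fm_in_def by blast
          from holds_map[OF this, of "eq_struct M" ?V]
          have "holds (eq_struct M) (y0 # map rv zl) (?\<Xi> xs) (Inr K # map (Inl \<circ> w0) zl) \<longleftrightarrow> sat (eq_struct M) ?V (?\<Xi> xs)"
            unfolding m .
          also have "\<dots> \<longleftrightarrow> (\<exists>v. gdB v \<and> (\<forall>r\<in>set zl. v r = w0 r) \<and> eqrel M xs ys E `` {map v xs} = K \<and> sat M v \<Phi>)"
            by (rule sat_Xi[OF subset_refl dj XY(5) f y0 V c(5)])
          finally show ?thesis .
        qed
        show ?thesis
        proof
          have "holds (eq_struct M) (y0 # map rv zl) (?\<Xi> xs) (Inr ?K # map (Inl \<circ> w0) zl)"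
            unfolding h using c(5) Kw \<Phi>0 by blast
          then show "{Inr ?K} \<subseteq> ?D" using eK by simp
          show "?D \<subseteq> {Inr ?K}"
          proof
            fix a assume a: "a \<in> ?D"
            then have "a \<in> eq_univ M (Imag xs ys E)" by simp
            then obtain K where K: "a = Inr K" by auto
            have "holds (eq_struct M) (y0 # map rv zl) (?\<Xi> xs) (Inr K # map (Inl \<circ> w0) zl)" using a K by blast
            then obtain v where v: "gdB v" "\<forall>r\<in>set zl. v r = w0 r" "eqrel M xs ys E `` {map v xs} = K" "sat M v \<Phi>"
              unfolding h by (elim exE conjE)
            have Av: "AA v" "\<And>p. p \<in> \<Omega> \<Longrightarrow> G p v" using \<Phi>(3) v(1,4) by blast+
            \<comment> \<open>The region of the code is \<open>b1\<close>, so equal codes force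
              equal fibres at every point.\<close>
            have "PE p v w0" if "p \<in> \<Omega>" for p
              by (rule c(8)[OF v(1) Av(2) _ that]) (use v(2) zl(1) that in simp_all)
            then have "sim v w0" by (rule PE_sim[OF v(1) c(5) Av(1) Aw])
            then have "eqrel M xs ys E `` {map v xs} = eqrel M xs ys E `` {map w0 xs}"
              unfolding sim_def by (rule equiv_class_eq[OF equiv])
            then show "a \<in> {Inr ?K}" using K Kw v(3) by simp
          qed
        qed
      qed
    qed
    then show ?thesis using eK d by (simp add: dcl_def elems_def)
  qed
  have d_acl: "(Real (fst z), Inl (w0 z)) \<in> acl_eq BL M {?e}" if z: "z \<in> Z" for z
  proof -
    let ?qs = "xs @ filter (\<lambda>x. x \<noteq> z) zl"
    have f: "fv \<Phi> \<subseteq> set ?qs \<union> set [z]" using \<Phi>(2) zl(1) by auto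
    have dj: "set ?qs \<inter> set [z] = {}" using c(2) z by auto
    have sq: "fst ` set ?qs \<subseteq> sorts BL" using c(3) XY(5) zl(1) by auto
    have sz: "fst z \<in> sorts BL" using c(3) z by blast
    then have sz': "fst ` set [z] \<subseteq> sorts BL" by simp
    have X: "X \<subseteq> set ?qs" by simp
    have i0: "fm_in (eq_lang BL M) (y0 # map rv [z]) (?\<Xi> ?qs)"
      by (rule wf_Xi[OF sq sz' _ X \<Phi>(1) f y0]) simp
    \<comment> \<open>The same formula is now read with the entry of the code as the defined
      variable and the class as the parameter.\<close>
    then have i: "fm_in (eq_lang BL M) (rv z # [y0]) (?\<Xi> ?qs)" unfolding fm_in_def by auto
    let ?A = "{v. gdB v \<and> eqrel M xs ys E `` {map v xs} = ?K \<and> AA v \<and> (\<forall>p\<in>\<Omega>. G p v)}"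
    let ?D = "{a \<in> univ (eq_struct M) (Real (fst z)). holds (eq_struct M) (rv z # [y0]) (?\<Xi> ?qs) (a # [Inr ?K])}"
    have h: "holds (eq_struct M) (rv z # [y0]) (?\<Xi> ?qs) (Inl b # [Inr ?K]) \<longleftrightarrow>
      (\<exists>v. gdB v \<and> (\<forall>r\<in>set [z]. v r = (v0(z := b)) r) \<and> eqrel M xs ys E `` {map v xs} = ?K \<and> sat M v \<Phi>)"
      if b: "b \<in> univ M (fst z)" for b
    proof -
      let ?V = "\<lambda>t :: ('s bsort, ('s, 'f, 'r) bfun, unit) eq_sort var. if t = y0 then Inr ?K else Inl b"
      have V: "?V y0 = Inr ?K" by simp
      have "rv z \<noteq> y0" by (simp add: rv_def y0_def)
      then have V': "?V (rv z) = Inl b" by simp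
      have m: "map ?V (rv z # [y0]) = Inl b # [Inr ?K]" using V V' by simp
      have V'': "?V (rv r) = Inl ((v0(z := b)) r)" if "r \<in> set [z]" for r using that V' by simp
      have g: "gdB (v0(z := b))" by (rule gd_upd[OF v0]) (rule b)
      have "fv (?\<Xi> ?qs) \<subseteq> set (rv z # [y0])" using i unfolding fm_in_def by blast
      from holds_map[OF this, of "eq_struct M" ?V]
      have "holds (eq_struct M) (rv z # [y0]) (?\<Xi> ?qs) (Inl b # [Inr ?K]) \<longleftrightarrow> sat (eq_struct M) ?V (?\<Xi> ?qs)" unfolding m .
      also have "\<dots> \<longleftrightarrow> (\<exists>v. gdB v \<and> (\<forall>r\<in>set [z]. v r = (v0(z := b)) r) \<and> eqrel M xs ys E `` {map v xs} = ?K \<and> sat M v \<Phi>)"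
        by (rule sat_Xi[OF X dj sq f y0 V V'' g])
      finally show ?thesis .
    qed
    \<comment> \<open>The defined set consists of the entries at \<open>z\<close> of codes of tuples
      in the class of \<open>v0\<close>. Such an entry depends on the fibres of the tuple only,
      these depend on \<open>types v0 v\<close> only, and \<open>types v0 v\<close> is a subset of
      the finite set \<open>F\<close>.\<close>
    have D: "?D \<subseteq> (\<lambda>v. Inl (v z)) ` ?A"
    proof
      fix a assume a: "a \<in> ?D"
      then have "a \<in> eq_univ M (Real (fst z))" by simp
      then obtain b where b: "a = Inl b" "b \<in> univ M (fst z)" by auto
      have "holds (eq_struct M) (rv z # [y0]) (?\<Xi> ?qs) (Inl b # [Inr ?K])" using a b(1) by blast
      then obtain v where v: "gdB v" "\<forall>r\<in>set [z]. v r = (v0(z := b)) r" "eqrel M xs ys E `` {map v xs} = ?K" "sat M v \<Phi>"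
        unfolding h[OF b(2)] by (elim exE conjE)
      have "v \<in> ?A" using v(1,3,4) \<Phi>(3) by blast
      moreover have "v z = b" using v(2) by simp
      ultimately show "a \<in> (\<lambda>v. Inl (v z)) ` ?A" unfolding b(1) by blast
    qed
    have "finite ((\<lambda>v. v z) ` ?A)"
    proof (rule finite_image_factor)
      have "types v0 ` ?A \<subseteq> Pow F" using types_F[OF v0] by blast
      then show "finite (types v0 ` ?A)" by (rule finite_subset) (simp add: finF)
      fix v v' assume v: "v \<in> ?A" "v' \<in> ?A" and t: "types v0 v = types v0 v'"
      have "PE p v v'" if "p \<in> \<Omega>" for p
        by (rule types_determine[OF v0 _ _ _ _ _ _ t that]) (use v simK in blast)+
      then show "v z = v' z" by (rule c(9)[rotated 4, OF _ z]) (use v in blast)+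
    qed
    then have "finite (Inl ` (\<lambda>v. v z) ` ?A :: ('m + 'm list set) set)" by (rule finite_imageI)
    then have fin: "finite ?D" using D unfolding image_image by (rule finite_subset[rotated])
    have wz: "w0 z \<in> univ M (fst z)" by (rule gd_in[OF c(5) refl sz])
    have "holds (eq_struct M) (rv z # [y0]) (?\<Xi> ?qs) (Inl (w0 z) # [Inr ?K])"
      unfolding h[OF wz] using c(5) Kw \<Phi>0 by (intro exI[of _ w0]) simp
    then have mem: "Inl (w0 z) \<in> ?D" using wz by simp
    have "definable_over (eq_lang BL M) (eq_struct M) {?e} (Real (fst z)) ?D" unfolding definable_over_def
    proof (intro exI conjI)
      show "fst (rv z :: ('s bsort, ('s, 'f, 'r) bfun, unit) eq_sort var) = Real (fst z)" by simp
      show "fm_in (eq_lang BL M) (rv z # [y0]) (?\<Xi> ?qs)" by (rule i)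
      show "length [Inr ?K] = length [y0]" by simp
      show "set (zip (map fst [y0]) [Inr ?K]) \<subseteq> {?e}" by (simp add: y0)
      show "?D = ?D" ..
    qed
    moreover have "(Real (fst z), Inl (w0 z)) \<in> elems (eq_lang BL M) (eq_struct M)" using sz wz by (simp add: elems_def)
    ultimately show ?thesis unfolding acl_def using fin mem by blast
  qed
  have "set ?d \<subseteq> reals BL M"
  proof
    fix x assume "x \<in> set ?d"
    then obtain z where z: "x = (Real (fst z), Inl (w0 z))" "z \<in> Z" using zl(1) by auto
    have "fst z \<in> sorts BL" using c(3) z(2) by blast
    then show "x \<in> reals BL M" unfolding z(1) reals_def elems_def using gd_in[OF c(5) refl] by simp
  qed
  moreover have "set ?d \<subseteq> acl_eq BL M {?e}" using d_acl zl(1) by auto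
  ultimately show ?thesis using e_dcl by (intro exI[of _ "[?d]"]) simp
qed

end

theorem theorem4p1:
  fixes L :: "('s, 'f, 'r) lang"
    and T :: "('s, 'f, 'r) fm set"
  assumes "\<exists>i :: ('s, 'f, 'r) fm \<Rightarrow> 'u. inj i"
    and "wf_lang L"
    and "theory_in L T"
    and "elim_imaginaries TYPE('u) L T"
    and "\<forall>s \<in> sorts L. sort_has_definable_element TYPE('u) L T s"
  shows "weak_elim_imaginaries TYPE('m) (boole_lang L) (atomless_theory TYPE('u) L T)"
  unfolding weak_elim_imaginaries_def
proof (intro allI impI ballI)
  fix M :: "('s bsort, ('s, 'f, 'r) bfun, unit, 'm) struct" and e
  assume M: "is_model (boole_lang L) (atomless_theory TYPE('u) L T) M" and e: "e \<in> imaginaries (boole_lang L) M"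
  obtain \<iota> :: "('s, 'f, 'r) fm \<Rightarrow> 'u" where \<iota>: "inj \<iota>" using assms(1) ..
  interpret bvmodel "TYPE('u)" L T M using assms(2,3) M by unfold_locales
  obtain \<sigma> c where \<sigma>: "e = (\<sigma>, c)" "\<sigma> \<in> sorts (eq_lang BL M)" "c \<in> eq_univ M \<sigma>"
    using e unfolding imaginaries_def elems_def by auto
  show "\<exists>ds. (\<forall>d\<in>set ds. set d \<subseteq> reals BL M \<and> set d \<subseteq> acl_eq BL M {e}) \<and> e \<in> dcl_eq BL M (\<Union>d\<in>set ds. set d)"
  proof (cases \<sigma>)
    \<comment> \<open>An element of a real sort is its own code.\<close>
    case (Real s)
    have "e \<in> dcl_eq BL M {e}" using e unfolding imaginaries_def by (rule dcl_self)
    moreover have "e \<in> reals BL M" using \<sigma> unfolding Real reals_def elems_def by auto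
    ultimately show ?thesis using dcl_acl[of e "eq_lang BL M" "eq_struct M" "{e}"] by (intro exI[of _ "[[e]]"]) simp
  next
    case (Imag xs ys E)
    have d: "defines_equiv BL M xs ys E" using \<sigma>(2) unfolding Imag by simp
    have xs: "distinct xs" "distinct ys" "fst ` set xs \<subseteq> sorts BL" "fst ` set ys \<subseteq> sorts BL" "map fst xs = map fst ys"
      "set xs \<inter> set ys = {}" "wf_fm BL E" "fv E \<subseteq> set (xs @ ys)"
      using d by (auto simp: defines_equiv_def fm_in_def)
    obtain a where a: "a \<in> tuples M (map fst xs)" "c = Inr (eqrel M xs ys E `` {a})"
      using \<sigma>(3) unfolding Imag by (auto elim: quotientE)
    obtain v :: "'s bsort var \<Rightarrow> 'm" where "gdB v" using gd_ex[of BL "univ M"] univ_ne by blast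
    moreover have "list_all2 (\<lambda>a x. a \<in> univ M (fst x)) a xs" using a(1) unfolding tuples_iff list_all2_map2 .
    ultimately obtain v0 where v0: "gdB v0" "map v0 xs = a" using val_of_list[OF _ xs(1)] by blast
    interpret t: tarski BL "univ M" "sat M" "\<lambda>_. (=)" by (rule tarski_sat[OF is_struct_M])
    from quantifier_elimination[OF xs(7)] obtain C F \<E> where C: "coloured (fv E) C F"
      and \<E>: "\<forall>v. gdB v \<longrightarrow> (sat M v E \<longleftrightarrow> (\<lambda>p. C p v) ` \<Omega> \<in> \<E>)" by (elim exE conjE)
    let ?im = "\<lambda>w. (\<lambda>p. C p (override_on v0 w (set ys))) ` \<Omega>"
    let ?A = "?im ` {w. gdB w} \<inter> \<E>"
    have AF: "?A \<subseteq> Pow F"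
      using colouredD(3)[OF C gd_override[OF v0(1)]] by blast
    then have fA: "finite ?A" using colouredD(1)[OF C] by (meson finite_Pow_iff finite_subset)
    \<comment> \<open>The tuple \<open>a\<close> is copied to \<open>ys\<close>. Reflexivity of
      \<open>E\<close> then shows that at least one set of colours realised over \<open>v0\<close>
      makes \<open>E\<close> true, so that a maximal one exists.\<close>
    obtain w where w: "gdB w" "off (set ys) v0 w" "map w ys = map v0 xs"
      by (rule t.copy_val[OF v0(1,1) xs(2) xs(5)[symmetric] xs(4)])
    have ow: "override_on v0 w (set ys) = w"
    proof
      fix x show "override_on v0 w (set ys) x = w x" using off_apply[OF w(2), of x] by (cases "x \<in> set ys") simp_all
    qed
    have "map w xs = map v0 xs" using w(2) xs(6) by (auto simp: off_def)
    then have m: "map w (xs @ ys) = a @ a" using w(3) v0(2) by simp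
    have "(a, a) \<in> eqrel M xs ys E" using d a(1) by (simp add: defines_equiv_def equiv_def refl_on_def)
    then have "holds M (xs @ ys) E (a @ a)" by (simp add: eqrel_def)
    then have "sat M w E" using holds_map[OF xs(8), of M w] unfolding m by blast
    then have "?im w \<in> \<E>" using \<E> w(1) unfolding ow by blast
    then have "?im w \<in> ?A" using w(1) by (intro IntI imageI) simp_all
    then have "?A \<noteq> {}" by blast
    \<comment> \<open>Maximality is needed only among the colour sets realised over this
      \<open>v0\<close>, and this is what \<open>AA v0\<close> asks for.\<close>
    from finite_has_maximal[OF fA this] obtain s where sm: "s \<in> ?A" "\<forall>t\<in>?A. s \<subseteq> t \<longrightarrow> s = t" by (elim bexE)
    have s\<E>: "s \<in> \<E>" "s \<subseteq> F" using sm(1) AF by blast+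
    note va = v0(2)
    interpret coding "TYPE('u)" L T M xs ys E C F \<E> s \<iota> v0
      using d C \<E> s\<E> \<iota> assms(4,5) v0(1) by unfold_locales blast+
    from IntD1[OF sm(1)] obtain w1 where w1: "s = ?im w1" "w1 \<in> {w. gdB w}" by (rule imageE)
    have "\<not> s \<subset> ?im w" if "gdB w" "?im w \<in> \<E>" for w
    proof -
      have "?im w \<in> ?A" by (intro IntI imageI) (simp_all add: that)
      then show ?thesis using sm(2) by blast
    qed
    then have "AA v0" unfolding AA_def im_def using w1(2) w1(1)[symmetric] by blast
    from weak_code[OF this] show ?thesis unfolding \<sigma>(1) Imag a(2) va .
  qed
qed

end
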